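(* Let $k$ be an algebraically closed field of characteristic $p=2$ and $G=SL_2$ over $k$. For all integers $n\ge 1$ and $m\ge 0$, $$\dim \mathrm{H}^n(G,V(m))\le e^{2\pi(n+1)/\sqrt3}\,2^{n+1}=\frac{C_{n+1}}{(n+1)2^{n+1}}.$$
   Context: Dominant weights of $SL_2$ are identified with $\mathbb N=\{0,1,2,\dots\}$. $V(m)=\mathrm{ind}_B^G(m)^*$ is the Weyl module of highest weight $m$, where $B$ is a Borel subgroup (corresponding to the negative root). $\mathrm{H}^n(G,M)=\mathrm{Ext}^n_G(k,M)$ is rational cohomology. For an integer $n$, $C_n=n\,4^n e^{2\pi n/\sqrt3}$. *)

theory Defs
  imports
    "HOL-Analysis.Analysis"
    "HOL-Library.Function_Algebras"
    "HOL-Library.Infinite_Typeclass"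
    "HOL-Computational_Algebra.Polynomial"
begin

section \<open>Vector spaces of functions\<close>

text \<open>
  All vector spaces below are subspaces of a space \<open>'x \<Rightarrow> 'k\<close> of all functions from some type
  to the field, with pointwise operations. Every vector space having a basis indexed by
  (a subset of) \<open>'x\<close> is isomorphic to such a subspace.
\<close>

definition fscale :: "'k::field \<Rightarrow> ('x \<Rightarrow> 'k) \<Rightarrow> 'x \<Rightarrow> 'k" where
  "fscale c v = (\<lambda>x. c * v x)"

lemma vector_space_fscale: "vector_space (fscale :: 'k::field \<Rightarrow> ('x \<Rightarrow> 'k) \<Rightarrow> 'x \<Rightarrow> 'k)"
  by unfold_locales (auto simp: fscale_def algebra_simps fun_eq_iff)

text \<open>
  The dimension of the quotient \<open>Z / B\<close> of vector spaces \<open>B \<subseteq> Z\<close>, with value \<open>\<infinity>\<close> when infinite: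
  the supremum of the sizes of finite subsets of \<open>Z\<close> that are linearly independent modulo \<open>B\<close>.
\<close>

definition quot_dim :: "('k::field \<Rightarrow> 'v::ab_group_add \<Rightarrow> 'v) \<Rightarrow> 'v set \<Rightarrow> 'v set \<Rightarrow> enat" where
  "quot_dim s Z B =
     (SUP S \<in> {S. finite S \<and> S \<subseteq> Z \<and>
                  (\<forall>a. (\<Sum>v\<in>S. s (a v) v) \<in> B \<longrightarrow> (\<forall>v\<in>S. a v = 0))}. enat (card S))"


section \<open>The group \<open>SL\<^sub>2\<close> and its coordinate ring\<close>

type_synonym 'k mat2 = "'k^2^2"

definition SL2 :: "'k::field mat2 set" where
  "SL2 = {g. det g = 1}"

text \<open>The Borel subgroup corresponding to the negative root.\<close>

definition borel_neg :: "'k::field mat2 set" where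
  "borel_neg = {b \<in> SL2. b $ 1 $ 2 = 0}"

text \<open>
  The character of \<open>borel_neg\<close> given by the weight \<open>m\<close>: on the torus it sends
  \<open>diag(t, 1/t)\<close> to \<open>t ^ m\<close>.
\<close>

definition weight_char :: "nat \<Rightarrow> 'k::field mat2 \<Rightarrow> 'k" where
  "weight_char m b = (b $ 1 $ 1) ^ m"

inductive_set poly_fun :: "('k::field mat2 \<Rightarrow> 'k) set" where
  const: "(\<lambda>_. c) \<in> poly_fun"
| entry: "(\<lambda>g. g $ i $ j) \<in> poly_fun"
| add: "p \<in> poly_fun \<Longrightarrow> q \<in> poly_fun \<Longrightarrow> (\<lambda>g. p g + q g) \<in> poly_fun"
| mult: "p \<in> poly_fun \<Longrightarrow> q \<in> poly_fun \<Longrightarrow> (\<lambda>g. p g * q g) \<in> poly_fun"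

text \<open>
  The coordinate ring \<open>k[SL\<^sub>2]\<close>. Over an algebraically closed field its elements are determined by
  their values on \<open>SL2\<close>; they are extended by \<open>0\<close> to all matrices so as to be unique as functions.
\<close>

definition coord_ring :: "('k::field mat2 \<Rightarrow> 'k) set" where
  "coord_ring = {f. \<exists>p\<in>poly_fun. f = (\<lambda>g. if g \<in> SL2 then p g else 0)}"


section \<open>Rational \<open>SL\<^sub>2\<close>-modules\<close>

record ('k, 'x) gmod =
  carrier :: "('x \<Rightarrow> 'k) set"
  act :: "'k mat2 \<Rightarrow> ('x \<Rightarrow> 'k) \<Rightarrow> 'x \<Rightarrow> 'k"

text \<open>
  The last condition says that \<open>g \<mapsto> act M g v\<close> comes from an element \<open>\<Sum>i. w i \<otimes> f i\<close> of
  \<open>carrier M \<otimes> k[SL\<^sub>2]\<close>, i.e. that the action is given by a comodule structure.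
\<close>

definition rational_module :: "('k::field, 'x) gmod \<Rightarrow> bool" where
  "rational_module M \<longleftrightarrow>
     module.subspace fscale (carrier M) \<and>
     (\<forall>g\<in>SL2. \<forall>v\<in>carrier M. act M g v \<in> carrier M) \<and>
     (\<forall>g\<in>SL2. \<forall>v\<in>carrier M. \<forall>w\<in>carrier M. act M g (v + w) = act M g v + act M g w) \<and>
     (\<forall>g\<in>SL2. \<forall>c. \<forall>v\<in>carrier M. act M g (fscale c v) = fscale c (act M g v)) \<and>
     (\<forall>v\<in>carrier M. act M (mat 1) v = v) \<and>
     (\<forall>g\<in>SL2. \<forall>h\<in>SL2. \<forall>v\<in>carrier M. act M (g ** h) v = act M g (act M h v)) \<and>
     (\<forall>v\<in>carrier M. \<exists>(r::nat) f w.
        (\<forall>i<r. f i \<in> coord_ring \<and> w i \<in> carrier M) \<and>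
        (\<forall>g\<in>SL2. act M g v = (\<Sum>i<r. fscale (f i g) (w i))))"

text \<open>Homomorphisms are extended by \<open>0\<close> outside the carrier of their domain.\<close>

definition HomG :: "('k::field, 'x) gmod \<Rightarrow> ('k, 'y) gmod \<Rightarrow> (('x \<Rightarrow> 'k) \<Rightarrow> 'y \<Rightarrow> 'k) set" where
  "HomG M N = {\<phi>.
     (\<forall>v. v \<notin> carrier M \<longrightarrow> \<phi> v = 0) \<and>
     (\<forall>v\<in>carrier M. \<phi> v \<in> carrier N) \<and>
     (\<forall>v\<in>carrier M. \<forall>w\<in>carrier M. \<phi> (v + w) = \<phi> v + \<phi> w) \<and>
     (\<forall>c. \<forall>v\<in>carrier M. \<phi> (fscale c v) = fscale c (\<phi> v)) \<and>
     (\<forall>g\<in>SL2. \<forall>v\<in>carrier M. \<phi> (act M g v) = act N g (\<phi> v))}"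

definition hom_scale :: "'k::field \<Rightarrow> (('x \<Rightarrow> 'k) \<Rightarrow> 'y \<Rightarrow> 'k) \<Rightarrow> ('x \<Rightarrow> 'k) \<Rightarrow> 'y \<Rightarrow> 'k" where
  "hom_scale c \<phi> = (\<lambda>v. fscale c (\<phi> v))"

text \<open>The trivial one-dimensional module \<open>k\<close>.\<close>

definition trivial_module :: "('k::field, unit) gmod" where
  "trivial_module = \<lparr>carrier = UNIV, act = (\<lambda>_ v. v)\<rparr>"

text \<open>
  The induced module from \<open>borel_neg\<close>: all \<open>f \<in> k[SL\<^sub>2]\<close> with \<open>f (gb) = \<lambda>(b)\<^sup>-\<^sup>1 f g\<close>, on which the
  group acts by left translation.
\<close>

definition ind_module :: "nat \<Rightarrow> ('k::field, 'k mat2) gmod" where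
  "ind_module m =
     \<lparr>carrier = {f \<in> coord_ring.
        \<forall>g\<in>SL2. \<forall>b\<in>borel_neg. f (g ** b) = inverse (weight_char m b) * f g},
      act = (\<lambda>g f x. f (matrix_inv g ** x))\<rparr>"

text \<open>
  The dual module: linear functionals on \<open>carrier M\<close>, extended by \<open>0\<close>, with the contragredient
  action.
\<close>

definition dual_module :: "('k::field, 'x) gmod \<Rightarrow> ('k, 'x \<Rightarrow> 'k) gmod" where
  "dual_module M =
     \<lparr>carrier = {\<xi>. (\<forall>v. v \<notin> carrier M \<longrightarrow> \<xi> v = 0) \<and>
                    (\<forall>v\<in>carrier M. \<forall>w\<in>carrier M. \<xi> (v + w) = \<xi> v + \<xi> w) \<and>
                    (\<forall>c. \<forall>v\<in>carrier M. \<xi> (fscale c v) = c * \<xi> v)},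
      act = (\<lambda>g \<xi> v. if v \<in> carrier M then \<xi> (act M (matrix_inv g) v) else 0)\<rparr>"

definition weyl_module :: "nat \<Rightarrow> ('k::field, 'k mat2 \<Rightarrow> 'k) gmod" where
  "weyl_module m = dual_module (ind_module m)"


section \<open>Ext groups and rational cohomology\<close>

text \<open>
  Injectivity is tested on the rational modules carried by subspaces of \<open>'x \<Rightarrow> 'k\<close>, so the type
  \<open>'x\<close> plays the role of a universe. For every infinite \<open>'x\<close> this agrees with injectivity in the
  category of all rational modules: rational modules are locally finite, so by Baer's criterion
  finite-dimensional test modules suffice.
\<close>

definition injective_module :: "('k::field, 'x) gmod \<Rightarrow> bool" where
  "injective_module I \<longleftrightarrow>
     rational_module I \<and>
     (\<forall>(A :: ('k, 'x) gmod) (B :: ('k, 'x) gmod) \<iota> \<phi>.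
        rational_module A \<longrightarrow> rational_module B \<longrightarrow>
        \<iota> \<in> HomG A B \<longrightarrow> inj_on \<iota> (carrier A) \<longrightarrow> \<phi> \<in> HomG A I \<longrightarrow>
        (\<exists>\<psi>\<in>HomG B I. \<forall>a\<in>carrier A. \<psi> (\<iota> a) = \<phi> a))"

text \<open>Exactness of \<open>0 \<rightarrow> M \<rightarrow> I 0 \<rightarrow> I 1 \<rightarrow> \<dots>\<close> with all \<open>I i\<close> injective.\<close>

definition injective_resolution ::
  "('k::field, 'z) gmod \<Rightarrow> (('z \<Rightarrow> 'k) \<Rightarrow> 'x \<Rightarrow> 'k) \<Rightarrow>
   (nat \<Rightarrow> ('k, 'x) gmod) \<Rightarrow> (nat \<Rightarrow> ('x \<Rightarrow> 'k) \<Rightarrow> 'x \<Rightarrow> 'k) \<Rightarrow> bool" where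
  "injective_resolution M \<epsilon> I d \<longleftrightarrow>
     (\<forall>i. injective_module (I i)) \<and>
     \<epsilon> \<in> HomG M (I 0) \<and> (\<forall>i. d i \<in> HomG (I i) (I (Suc i))) \<and>
     inj_on \<epsilon> (carrier M) \<and>
     \<epsilon> ` carrier M = {v \<in> carrier (I 0). d 0 v = 0} \<and>
     (\<forall>i. d i ` carrier (I i) = {v \<in> carrier (I (Suc i)). d (Suc i) v = 0})"

definition Ext_cocycles ::
  "('k::field, 'y) gmod \<Rightarrow> (nat \<Rightarrow> ('k, 'x) gmod) \<Rightarrow> (nat \<Rightarrow> ('x \<Rightarrow> 'k) \<Rightarrow> 'x \<Rightarrow> 'k) \<Rightarrow> nat \<Rightarrow>
   (('y \<Rightarrow> 'k) \<Rightarrow> 'x \<Rightarrow> 'k) set" where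
  "Ext_cocycles N I d n = {\<phi> \<in> HomG N (I n). d n \<circ> \<phi> = 0}"

fun Ext_coboundaries ::
  "('k::field, 'y) gmod \<Rightarrow> (nat \<Rightarrow> ('k, 'x) gmod) \<Rightarrow> (nat \<Rightarrow> ('x \<Rightarrow> 'k) \<Rightarrow> 'x \<Rightarrow> 'k) \<Rightarrow> nat \<Rightarrow>
   (('y \<Rightarrow> 'k) \<Rightarrow> 'x \<Rightarrow> 'k) set" where
  "Ext_coboundaries N I d 0 = {0}"
| "Ext_coboundaries N I d (Suc n) = (\<lambda>\<psi>. d n \<circ> \<psi>) ` HomG N (I n)"

text \<open>
  \<open>dim Ext\<^sup>n\<^sub>G(N, M)\<close>: the \<open>n\<close>-th cohomology of \<open>Hom\<^sub>G(N, I)\<close> for a chosen injective resolution \<open>I\<close> of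
  \<open>M\<close> in the universe \<open>'x\<close>. Such a resolution exists whenever \<open>M\<close> has countable dimension, since
  the modules \<open>M \<otimes> k[SL\<^sub>2]\<close> then have countable dimension.
\<close>

definition Ext_dim ::
  "'x::infinite itself \<Rightarrow> nat \<Rightarrow> ('k::field, 'y) gmod \<Rightarrow> ('k, 'z) gmod \<Rightarrow> enat" where
  "Ext_dim U n N M =
     (let (I, d) = (SOME (I :: nat \<Rightarrow> ('k, 'x) gmod, d). \<exists>\<epsilon>. injective_resolution M \<epsilon> I d)
      in quot_dim hom_scale (Ext_cocycles N I d n) (Ext_coboundaries N I d n))"

definition H_dim :: "'x::infinite itself \<Rightarrow> nat \<Rightarrow> ('k::field, 'z) gmod \<Rightarrow> enat" where
  "H_dim U n M = Ext_dim U n trivial_module M"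


section \<open>The constants \<open>C\<^sub>n\<close>\<close>

definition C_const :: "int \<Rightarrow> real" where
  "C_const n = of_int n * 4 powi n * exp (2 * pi * of_int n / sqrt 3)"

end

theory Submission
  imports
    Defs
begin

text \<open>
  Let \<open>E\<close> be the natural module and \<open>M\<^sup>(\<^sup>1\<^sup>)\<close> the Frobenius twist. In characteristic two
  \<open>V(2a + 1) = E \<otimes> V(a)\<^sup>(\<^sup>1\<^sup>)\<close>, and \<open>E \<otimes> k[G]\<^sup>(\<^sup>1\<^sup>)\<close> is a direct summand of \<open>k[G]\<close>. Hence
  \<open>E \<otimes> M\<^sup>(\<^sup>1\<^sup>)\<close> has no cohomology and \<open>E \<otimes> E \<otimes> M\<^sup>(\<^sup>1\<^sup>)\<close> has the cohomology of \<open>M\<close>. The Koszul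
  sequence \<open>0 \<rightarrow> V(2a + 2) \<rightarrow> E \<otimes> V(2a + 1) \<rightarrow> V(2a) \<rightarrow> 0\<close> then gives, for the dimensions \<open>h\<close> of
  cohomology,
  \<open>h\<^sup>n(2a + 2) \<le> h\<^sup>n(a) + h\<^sup>n\<^sup>-\<^sup>1(2a)\<close> and \<open>h\<^sup>n(2a + 1) = 0\<close>, starting from \<open>h\<^sup>n(0) = 0\<close> for \<open>n > 0\<close>, which
  follows from the filtration of a weight space of \<open>k[G]\<close> by induced modules. The recursion counts
  partitions into powers of two. Its solution is at most \<open>4\<^sup>n\<^sup>+\<^sup>1\<close>, as one sees by comparison with
  \<open>2\<close> to the minus binary digit sum, and \<open>4 \<le> 2 e\<close> to the power \<open>2 \<pi> / sqrt 3\<close>.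

  Cohomology is computed with invariant polynomial functions on powers of the group. A module is
  acyclic once it is a retract of its coinduced module; this holds for injective modules, so
  injective resolutions give the same dimensions.
\<close>

text \<open>\<open>Ext_dim\<close> takes whatever resolution \<open>SOME\<close> selects in the
  universe \<open>'x\<close>. So the bound is needed for every injective resolution, and one must
  exist there, for otherwise nothing is known about the selected pair. Both points rest on the
  countable dimension of \<open>k[G]\<close>: \<open>k[G] \<otimes> M\<close> still embeds into
  \<open>'x \<Rightarrow> 'k\<close>. Only upper bounds travel through the exact sequences, so
  dimensions are replaced by the predicates \<open>qle\<close> and \<open>coh_le\<close>.

  In place of a spectral sequence for the Frobenius kernel stands an explicit projection. The
  derivations of \<open>k[G]\<close> along the two root subgroups kill squares, so operators built
  from them are linear over the squares, and Cramer's rule with determinant one recovers both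
  coefficients of an element of \<open>E \<otimes> k[G]^(1)\<close>. Twisting the standard
  resolution of \<open>M\<close> and tensoring with \<open>E\<close> thus gives acyclic terms, and
  only invariants remain to be compared. There a polynomial in \<open>t^2\<close> meets an
  expression linear in \<open>t\<close>.

  The weight in the growth estimate comes from a product: the coefficients of
  \<open>(1 - q/4) \<Prod> (1 + q^(2^i)/2)\<close> bound the partitions into powers of two when each
  part is weighted \<open>1/4\<close>.\<close>

interpretation fs: vector_space "fscale :: 'k::field \<Rightarrow> ('x \<Rightarrow> 'k) \<Rightarrow> 'x \<Rightarrow> 'k"
  by (rule vector_space_fscale)

interpretation fsp: vector_space_pair "fscale :: 'k::field \<Rightarrow> ('x \<Rightarrow> 'k) \<Rightarrow> 'x \<Rightarrow> 'k"
    "fscale :: 'k::field \<Rightarrow> ('y \<Rightarrow> 'k) \<Rightarrow> 'y \<Rightarrow> 'k"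
  by unfold_locales

lemma fscale_apply: "fscale c v x = c * v x"
  by (simp add: fscale_def)

text \<open>As default simplification rules, the pointwise laws would also rewrite eta-expanded vectors.\<close>

lemmas pointwise = plus_fun_apply zero_fun_apply minus_apply uminus_apply one_fun_apply
  times_fun_apply fscale_apply

declare pointwise [simp del]

section \<open>Linear maps between subspaces of function spaces\<close>

definition lin_on :: "('x \<Rightarrow> 'k::field) set \<Rightarrow> (('x \<Rightarrow> 'k) \<Rightarrow> 'y \<Rightarrow> 'k) \<Rightarrow> bool" where
  "lin_on X f \<longleftrightarrow> (\<forall>v\<in>X. \<forall>w\<in>X. f (v + w) = f v + f w) \<and>
                (\<forall>c. \<forall>v\<in>X. f (fscale c v) = fscale c (f v))"

lemma lin_onI:
  assumes "\<And>v w. v \<in> X \<Longrightarrow> w \<in> X \<Longrightarrow> f (v + w) = f v + f w"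
    and "\<And>c v. v \<in> X \<Longrightarrow> f (fscale c v) = fscale c (f v)"
  shows "lin_on X f"
  using assms by (simp add: lin_on_def)

lemma lin_on_add: "lin_on X f \<Longrightarrow> v \<in> X \<Longrightarrow> w \<in> X \<Longrightarrow> f (v + w) = f v + f w"
  by (simp add: lin_on_def)

lemma lin_on_scale: "lin_on X f \<Longrightarrow> v \<in> X \<Longrightarrow> f (fscale c v) = fscale c (f v)"
  by (simp add: lin_on_def)

lemma lin_on_zero:
  assumes "lin_on X f" "fs.subspace X" shows "f 0 = 0"
  using lin_on_scale[OF assms(1) fs.subspace_0[OF assms(2)], of 0] by simp

lemma lin_on_diff:
  assumes "lin_on X f" "fs.subspace X" "v \<in> X" "w \<in> X" shows "f (v - w) = f v - f w"
proof -
  have "f (v - w + w) = f (v - w) + f w"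
    using assms by (intro lin_on_add[OF assms(1)] fs.subspace_diff)
  then show ?thesis by (simp add: algebra_simps)
qed

lemma lin_on_sum:
  assumes "lin_on X f" "fs.subspace X" "\<And>i. i \<in> A \<Longrightarrow> v i \<in> X"
  shows "f (sum v A) = (\<Sum>i\<in>A. f (v i))"
  using assms(3)
proof (induction A rule: infinite_finite_induct)
  case (insert x F)
  then show ?case
    using assms by (subst sum.insert) (auto simp: lin_on_add fs.subspace_sum)
qed (simp_all add: lin_on_zero[OF assms(1,2)])

lemma lin_on_mono: "lin_on Y f \<Longrightarrow> X \<subseteq> Y \<Longrightarrow> lin_on X f"
  by (auto intro!: lin_onI simp: lin_on_add lin_on_scale subset_iff)

lemma lin_on_comp: "lin_on X f \<Longrightarrow> lin_on Y g \<Longrightarrow> f ` X \<subseteq> Y \<Longrightarrow> lin_on X (\<lambda>v. g (f v))"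
  by (auto simp: lin_on_def image_subset_iff)

lemma lin_on_subspace_image:
  assumes "lin_on X f" "fs.subspace X" shows "fs.subspace (f ` X)"
proof (rule fs.subspaceI)
  show "0 \<in> f ` X" using lin_on_zero[OF assms] fs.subspace_0[OF assms(2)] by (metis image_eqI)
  show "x + y \<in> f ` X" if "x \<in> f ` X" "y \<in> f ` X" for x y
    using that lin_on_add[OF assms(1)] fs.subspace_add[OF assms(2)] by (metis (no_types, lifting) image_iff)
  show "fscale c x \<in> f ` X" if "x \<in> f ` X" for c x
    using that lin_on_scale[OF assms(1)] fs.subspace_scale[OF assms(2)] by (metis (no_types, lifting) image_iff)
qed

lemma lin_on_subspace_vimage:
  assumes "lin_on X f" "fs.subspace X" "fs.subspace B" shows "fs.subspace {v \<in> X. f v \<in> B}"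
  using assms
  by (intro fs.subspaceI)
     (auto simp: lin_on_add lin_on_scale lin_on_zero fs.subspace_0 fs.subspace_add fs.subspace_scale)

lemma lin_on_the_inv:
  assumes f: "lin_on X f" "fs.subspace X" "inj_on f X"
  shows "lin_on (f ` X) (the_inv_into X f)"
proof (rule lin_onI)
  fix v w assume "v \<in> f ` X" "w \<in> f ` X"
  then obtain a b where ab: "a \<in> X" "b \<in> X" "v = f a" "w = f b" by auto
  then have "v + w = f (a + b)" by (simp add: lin_on_add[OF f(1)])
  then show "the_inv_into X f (v + w) = the_inv_into X f v + the_inv_into X f w"
    using ab by (simp add: the_inv_into_f_f[OF f(3)] fs.subspace_add[OF f(2)])
next
  fix c v assume "v \<in> f ` X"
  then obtain a where ab: "a \<in> X" "v = f a" by auto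
  then have "fscale c v = f (fscale c a)" by (simp add: lin_on_scale[OF f(1)])
  then show "the_inv_into X f (fscale c v) = fscale c (the_inv_into X f v)"
    using ab by (simp add: the_inv_into_f_f[OF f(3)] fs.subspace_scale[OF f(2)])
qed

text \<open>Extension by a basis. The control of the range is part of the claim because the targets
  that occur later are proper subspaces such as \<open>PF n X\<close>.\<close>

lemma lin_on_extend:
  assumes f: "lin_on X f" "fs.subspace X"
  shows "\<exists>F. lin_on UNIV F \<and> (\<forall>v\<in>X. F v = f v) \<and> range F \<subseteq> f ` X"
proof -
  obtain B where B: "B \<subseteq> X" "fs.independent B" "X \<subseteq> fs.span B"
    using fs.maximal_independent_subset by blast
  have sB: "fs.span B = X"
    using B f(2) by (simp add: fs.span_subspace)
  obtain F where F: "Vector_Spaces.linear fscale fscale F" "\<forall>x\<in>B. F x = f x" "range F = fs.span (f ` B)"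
    using fsp.linear_independent_extend_subspace[OF B(2), of f] by blast
  have lin: "F (v + w) = F v + F w" "F (fscale c v) = fscale c (F v)" for v w c
    using F(1) by (auto simp: Vector_Spaces.linear_iff)
  have "v \<in> X \<and> F v = f v" if "v \<in> fs.span B" for v
    using that
  proof (induction rule: fs.span_induct_alt)
    case base
    show ?case using lin_on_zero[OF f] lin(2)[of 0 0] fs.subspace_0[OF f(2)] by simp
  next
    case (step c x y)
    then have "x \<in> X" using B(1) by auto
    then show ?case
      using step F(2)
      by (simp add: lin lin_on_add[OF f(1)] lin_on_scale[OF f(1)] fs.subspace_scale[OF f(2)]
          fs.subspace_add[OF f(2)])
  qed
  moreover have "range F \<subseteq> f ` X"
    unfolding F(3) using B(1) by (intro fs.span_minimal lin_on_subspace_image[OF f] image_mono)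
  ultimately show ?thesis
    using sB lin by (intro exI[of _ F]) (simp add: lin_on_def)
qed

lemma lin_on_projection:
  assumes "fs.subspace (Y :: ('x \<Rightarrow> 'k::field) set)"
  shows "\<exists>p. lin_on UNIV p \<and> (\<forall>v\<in>Y. p v = v) \<and> (\<forall>v. p v \<in> Y)"
proof -
  have "lin_on Y (\<lambda>v. v)" by (simp add: lin_on_def)
  from lin_on_extend[OF this assms] obtain p where
    p: "lin_on UNIV p" "\<forall>v\<in>Y. p v = v" "range p \<subseteq> (\<lambda>v. v) ` Y" by blast
  moreover have "p v \<in> Y" for v using p(3) by blast
  ultimately show ?thesis by blast
qed

text \<open>\<open>qle Z B c\<close> says that \<open>Z / (Z \<inter> B)\<close> has dimension at most \<open>c\<close>.\<close>

definition qle :: "('x \<Rightarrow> 'k::field) set \<Rightarrow> ('x \<Rightarrow> 'k) set \<Rightarrow> nat \<Rightarrow> bool" where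
  "qle Z B c \<longleftrightarrow> (\<exists>T. finite T \<and> card T \<le> c \<and> T \<subseteq> Z \<and> Z \<subseteq> fs.span (T \<union> B))"

section \<open>Calculus of dimension bounds for quotients\<close>

lemma qle_mono: "qle Z B c \<Longrightarrow> B \<subseteq> B' \<Longrightarrow> c \<le> c' \<Longrightarrow> qle Z B' c'"
  unfolding qle_def by (meson fs.span_mono Un_mono order.trans subset_refl)

lemma qle_0: "fs.subspace B \<Longrightarrow> qle Z B 0 \<longleftrightarrow> Z \<subseteq> B"
proof -
  assume "fs.subspace B"
  then have "fs.span B = B" by simp
  then show ?thesis unfolding qle_def le_zero_eq card_eq_0_iff
    by (metis Un_empty_left empty_subsetI finite.emptyI)
qed

lemma qle_trans:
  assumes "qle Z K c" "qle K B d" "K \<subseteq> Z"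
  shows "qle Z B (c + d)"
proof -
  obtain T where T: "finite T" "card T \<le> c" "T \<subseteq> Z" "Z \<subseteq> fs.span (T \<union> K)"
    using assms(1) by (auto simp: qle_def)
  obtain S where S: "finite S" "card S \<le> d" "S \<subseteq> K" "K \<subseteq> fs.span (S \<union> B)"
    using assms(2) by (auto simp: qle_def)
  have "T \<union> K \<subseteq> fs.span (T \<union> S \<union> B)"
    using S(4) fs.span_mono[of "S \<union> B" "T \<union> S \<union> B"] fs.span_superset[of "T \<union> S \<union> B"] by blast
  then have "Z \<subseteq> fs.span (T \<union> S \<union> B)"
    using T(4) fs.span_minimal[of "T \<union> K"] fs.subspace_span by blast
  moreover have "card (T \<union> S) \<le> c + d"
    using card_Un_le[of T S] T(2) S(2) by linarith
  ultimately show ?thesis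
    unfolding qle_def using T S assms(3) by (intro exI[of _ "T \<union> S"]) auto
qed

lemma qle_image:
  assumes q: "qle Z B c" and f: "lin_on Z f" "fs.subspace Z" and B: "B \<subseteq> Z" "f ` B \<subseteq> B'"
    and Z': "Z' = f ` Z"
  shows "qle Z' B' c"
proof -
  obtain T where T: "finite T" "card T \<le> c" "T \<subseteq> Z" "Z \<subseteq> fs.span (T \<union> B)"
    using q by (auto simp: qle_def)
  have "v \<in> Z \<and> f v \<in> fs.span (f ` T \<union> B')" if "v \<in> fs.span (T \<union> B)" for v
    using that
  proof (induction rule: fs.span_induct_alt)
    case base
    show ?case using lin_on_zero[OF f] fs.subspace_0[OF f(2)] by (simp add: fs.span_zero)
  next
    case (step c x y)
    then have x: "x \<in> Z" "f x \<in> fs.span (f ` T \<union> B')" using T(3) B by (auto intro: fs.span_base)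
    then show ?case
      using step by (simp add: lin_on_add[OF f(1)] lin_on_scale[OF f(1)] fs.subspace_scale[OF f(2)]
          fs.subspace_add[OF f(2)] fs.span_add fs.span_scale)
  qed
  then have "Z' \<subseteq> fs.span (f ` T \<union> B')" using T(4) Z' by auto
  then show ?thesis
    unfolding qle_def using T card_image_le[OF T(1), of f] Z'
    by (intro exI[of _ "f ` T"]) auto
qed

text \<open>Elimination with one pivot: a single \<open>z0\<close> whose image leaves
  \<open>B\<close> is enough, since a multiple of it corrects every other element back into the
  preimage of \<open>B\<close>.\<close>

lemma qle_vimage_insert:
  assumes f: "lin_on Z f" "fs.subspace Z" and B: "fs.subspace B"
    and sub: "f ` Z \<subseteq> fs.span (insert t B)"
  shows "qle Z {z \<in> Z. f z \<in> B} 1"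
proof (cases "f ` Z \<subseteq> B")
  case True
  then show ?thesis unfolding qle_def by (intro exI[of _ "{}"]) (auto intro: fs.span_base)
next
  case False
  then obtain z0 where z0: "z0 \<in> Z" "f z0 \<notin> B" by auto
  have ex: "\<exists>k. f z - fscale k t \<in> B" if "z \<in> Z" for z
    using sub that B fs.span_breakdown_eq[of "f z" t B] fs.span_eq_iff[of B]
    by (metis image_subset_iff)
  obtain k0 where k0: "f z0 - fscale k0 t \<in> B" using ex z0 by blast
  have k0n: "k0 \<noteq> 0" using k0 z0 by auto
  have "z \<in> fs.span (insert z0 {z \<in> Z. f z \<in> B})" if z: "z \<in> Z" for z
  proof -
    obtain k where k: "f z - fscale k t \<in> B" using ex z by blast
    let ?c = "k / k0"
    have "f z - fscale k t - fscale ?c (f z0 - fscale k0 t) \<in> B"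
      by (intro fs.subspace_diff[OF B] fs.subspace_scale[OF B] k k0)
    also have "f z - fscale k t - fscale ?c (f z0 - fscale k0 t) = f (z - fscale ?c z0)"
      using z z0 k0n by (simp add: lin_on_diff[OF f] lin_on_scale[OF f(1)] fs.subspace_scale[OF f(2)])
        (simp add: fun_eq_iff pointwise field_simps)
    finally have "z - fscale ?c z0 \<in> {z \<in> Z. f z \<in> B}"
      using z z0 by (simp add: fs.subspace_diff[OF f(2)] fs.subspace_scale[OF f(2)])
    then show ?thesis
      unfolding fs.span_breakdown_eq by (blast intro: fs.span_base)
  qed
  then show ?thesis unfolding qle_def using z0 by (intro exI[of _ "{z0}"]) auto
qed

text \<open>A subspace of \<open>W\<close> modulo \<open>B\<close> has no larger dimension than
  \<open>W\<close> modulo \<open>B\<close>. The generators of \<open>W\<close> need not lie in the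
  image of \<open>f\<close>, so they are removed one at a time, each costing at most one
  dimension.\<close>

lemma qle_vimage:
  assumes f: "lin_on Z f" "fs.subspace Z" and B: "fs.subspace B"
    and q: "qle W B c" and sub: "f ` Z \<subseteq> W"
  shows "qle Z {z \<in> Z. f z \<in> B} c"
proof -
  obtain T where T: "finite T" "card T \<le> c" "W \<subseteq> fs.span (T \<union> B)"
    using q by (auto simp: qle_def)
  have "qle Z {z \<in> Z. f z \<in> B} (card T)"
    if "finite T" "f ` Z \<subseteq> fs.span (T \<union> B)" "lin_on Z f" "fs.subspace Z" for T Z
    using that
  proof (induction T arbitrary: Z rule: finite_induct)
    case empty
    then have "f ` Z \<subseteq> B" using B fs.span_eq_iff[of B] by (metis Un_empty_left)
    then show ?case unfolding qle_def by (intro exI[of _ "{}"]) (auto intro: fs.span_base)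
  next
    case (insert t T)
    let ?K = "{z \<in> Z. f z \<in> fs.span (T \<union> B)}"
    have sK: "fs.subspace ?K" using insert.prems by (intro lin_on_subspace_vimage) auto
    have "fs.span (insert t (T \<union> B)) \<subseteq> fs.span (insert t (fs.span (T \<union> B)))"
      by (intro fs.span_mono) (use fs.span_superset in blast)
    then have "qle Z ?K 1"
      using insert.prems by (intro qle_vimage_insert) auto
    moreover have "qle ?K {z \<in> ?K. f z \<in> B} (card T)"
      using insert.prems sK by (intro insert.IH) (auto intro: lin_on_mono)
    then have "qle ?K {z \<in> Z. f z \<in> B} (card T)"
      by (rule qle_mono) auto
    ultimately have "qle Z {z \<in> Z. f z \<in> B} (1 + card T)"
      by (rule qle_trans) auto
    then show ?case using insert.hyps by simp
  qed
  from this[OF T(1) _ f] sub T(3) have "qle Z {z \<in> Z. f z \<in> B} (card T)" by blast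
  then show ?thesis using T(2) by (rule qle_mono[OF _ order.refl])
qed

text \<open>A family independent modulo \<open>B\<close> gives an injective map from its coefficient space.\<close>

lemma qle_card_bound:
  fixes Z :: "('x \<Rightarrow> 'k::field) set"
  assumes q: "qle Z B c" and B: "fs.subspace B"
    and S: "finite (S :: 'i set)" "\<And>i. i \<in> S \<Longrightarrow> v i \<in> Z"
    and ind: "\<And>a. (\<Sum>i\<in>S. fscale (a i) (v i)) \<in> B \<Longrightarrow> \<forall>i\<in>S. a i = 0"
    and Z: "fs.subspace Z"
  shows "card S \<le> c"
proof -
  let ?A = "{a :: 'i \<Rightarrow> 'k. \<forall>i. i \<notin> S \<longrightarrow> a i = 0}"
  let ?f = "\<lambda>a :: 'i \<Rightarrow> 'k. \<Sum>i\<in>S. fscale (a i) (v i)"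
  have sA: "fs.subspace ?A" by (rule fs.subspaceI) (auto simp: pointwise)
  have f: "lin_on ?A ?f"
    by (rule lin_onI)
       (auto simp: fs.scale_left_distrib sum.distrib fs.scale_sum_right plus_fun_apply fscale_apply)
  have "?f ` ?A \<subseteq> Z" using S Z by (auto intro!: fs.subspace_sum fs.subspace_scale)
  from qle_vimage[OF f sA B q this]
  have "qle ?A {a \<in> ?A. ?f a \<in> B} c" .
  moreover have "{a \<in> ?A. ?f a \<in> B} \<subseteq> {0}" using ind by (auto simp: fun_eq_iff zero_fun_apply) blast
  ultimately have "qle ?A {0} c" by (rule qle_mono) auto
  then obtain T where T: "finite T" "card T \<le> c" "?A \<subseteq> fs.span (T \<union> {0})"
    by (auto simp: qle_def)
  define e where "e = (\<lambda>(i::'i) j. if i = j then 1 else 0 :: 'k)"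
  have inj: "inj_on e S" unfolding e_def by (rule inj_onI) (metis zero_neq_one)
  have expand: "(\<Sum>x\<in>e ` S. fscale (u x) x) i = u (e i)" if "i \<in> S" for u i
  proof -
    have "(\<Sum>x\<in>e ` S. fscale (u x) x) i = (\<Sum>j\<in>S. fscale (u (e j)) (e j)) i"
      by (subst sum.reindex[OF inj]) simp
    also have "\<dots> = (\<Sum>j\<in>S. u (e j) * e j i)"
      by (induction S rule: infinite_finite_induct) (auto simp: pointwise)
    also have "\<dots> = (\<Sum>j\<in>S. if j = i then u (e i) else 0)"
      by (intro sum.cong) (auto simp: e_def)
    also have "\<dots> = u (e i)" using that S(1) by simp
    finally show ?thesis .
  qed
  have "fs.independent (e ` S)"
  proof (rule fs.independent_if_scalars_zero)
    show "finite (e ` S)" using S by simp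
    fix u x assume "(\<Sum>x\<in>e ` S. fscale (u x) x) = 0" "x \<in> e ` S"
    then show "u x = 0" using expand by (metis (no_types, lifting) imageE zero_fun_apply)
  qed
  moreover have "e ` S \<subseteq> fs.span T"
  proof -
    have "e ` S \<subseteq> ?A" by (auto simp: e_def)
    then show ?thesis using T(3) fs.span_insert_0[of T] by simp
  qed
  ultimately have "card (e ` S) \<le> card T" using fs.independent_span_bound[OF T(1)] by blast
  then show ?thesis using T(2) card_image[OF inj] by simp
qed

section \<open>Two by two matrices\<close>

definition mk22 :: "'k \<Rightarrow> 'k \<Rightarrow> 'k \<Rightarrow> 'k \<Rightarrow> 'k mat2" where
  "mk22 a b c d = (\<chi> i j. if i = 1 then (if j = 1 then a else b) else (if j = 1 then c else d))"

lemma mk22_nth [simp]: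
  "mk22 a b c d $ 1 $ 1 = a" "mk22 a b c d $ 1 $ 2 = b"
  "mk22 a b c d $ 2 $ 1 = c" "mk22 a b c d $ 2 $ 2 = d"
  by (simp_all add: mk22_def)

lemma mat2_eq_iff: "(g :: 'k mat2) = h \<longleftrightarrow> g$1$1 = h$1$1 \<and> g$1$2 = h$1$2 \<and> g$2$1 = h$2$1 \<and> g$2$2 = h$2$2"
  by (auto simp: vec_eq_iff forall_2)

lemma mult22_nth [simp]: "((g :: 'k::field mat2) ** h) $ i $ j = g$i$1 * h$1$j + g$i$2 * h$2$j"
  by (simp add: matrix_matrix_mult_def sum_2)

lemma mat1_nth [simp]: "(mat 1 :: 'k::field mat2) $ 1 $ 1 = 1" "(mat 1 :: 'k::field mat2) $ 1 $ 2 = 0"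
  "(mat 1 :: 'k::field mat2) $ 2 $ 1 = 0" "(mat 1 :: 'k::field mat2) $ 2 $ 2 = 1"
  by (simp_all add: mat_def)

definition adj2 :: "'k::field mat2 \<Rightarrow> 'k mat2" where
  "adj2 g = mk22 (g$2$2) (- g$1$2) (- g$2$1) (g$1$1)"

lemma adj2_nth [simp]:
  "adj2 g $ 1 $ 1 = g$2$2" "adj2 g $ 1 $ 2 = - g$1$2" "adj2 g $ 2 $ 1 = - g$2$1" "adj2 g $ 2 $ 2 = g$1$1"
  by (simp_all add: adj2_def)

lemma SL2_iff: "g \<in> SL2 \<longleftrightarrow> g$1$1 * g$2$2 - g$1$2 * g$2$1 = 1"
  by (simp add: SL2_def det_2)

lemma SL2_mult [simp, intro]: "g \<in> SL2 \<Longrightarrow> h \<in> SL2 \<Longrightarrow> g ** h \<in> SL2"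
  unfolding SL2_iff mult22_nth by algebra

lemma SL2_one [simp, intro]: "mat 1 \<in> SL2"
  by (simp add: SL2_iff)

lemma SL2_adj2 [simp]: "adj2 g \<in> SL2 \<longleftrightarrow> g \<in> SL2"
  by (simp add: SL2_iff) algebra

lemma adj2_left [simp]: "g \<in> SL2 \<Longrightarrow> adj2 g ** g = mat 1"
  unfolding SL2_iff mat2_eq_iff by (simp add: algebra_simps)

lemma adj2_right [simp]: "g \<in> SL2 \<Longrightarrow> g ** adj2 g = mat 1"
  unfolding SL2_iff mat2_eq_iff by (simp add: algebra_simps)

lemma adj2_adj2 [simp]: "adj2 (adj2 g) = g"
  by (simp add: mat2_eq_iff)

lemma adj2_mult: "adj2 (g ** h) = adj2 h ** adj2 g"
  by (simp add: mat2_eq_iff algebra_simps)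

lemma adj2_one [simp]: "adj2 (mat 1) = mat 1"
  by (simp add: mat2_eq_iff)

lemma adj2_cancel_left: "g \<in> SL2 \<Longrightarrow> adj2 g ** (g ** h) = h" "g \<in> SL2 \<Longrightarrow> g ** (adj2 g ** h) = h"
  by (simp_all add: matrix_mul_assoc)

lemma SL2_mult_cancel: "g \<in> SL2 \<Longrightarrow> g ** h \<in> SL2 \<longleftrightarrow> h \<in> SL2"
  by (metis SL2_adj2 SL2_mult adj2_cancel_left(1))

lemma matrix_inv_SL2: "g \<in> SL2 \<Longrightarrow> matrix_inv g = adj2 g"
  unfolding matrix_inv_def
proof (rule some_equality)
  fix h assume "g \<in> SL2" "g ** h = mat 1 \<and> h ** g = mat 1"
  then show "h = adj2 g" by (metis adj2_left matrix_mul_assoc matrix_mul_lid matrix_mul_rid)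
qed simp

section \<open>Tuples of group elements and their left translation\<close>

definition tuples :: "nat \<Rightarrow> 'k::field mat2 list set" where
  "tuples n = {l. length l = n \<and> set l \<subseteq> SL2}"

lemma tuples_0 [simp]: "l \<in> tuples 0 \<longleftrightarrow> l = []"
  by (auto simp: tuples_def)

lemma Cons_in_tuples [simp]: "g # l \<in> tuples (Suc n) \<longleftrightarrow> g \<in> SL2 \<and> l \<in> tuples n"
  by (auto simp: tuples_def)

lemma Nil_in_tuples [simp]: "[] \<in> tuples n \<longleftrightarrow> n = 0"
  by (auto simp: tuples_def)

lemma in_tuples_SucE: "l \<in> tuples (Suc n) \<Longrightarrow> (\<And>g l'. l = g # l' \<Longrightarrow> g \<in> SL2 \<Longrightarrow> l' \<in> tuples n \<Longrightarrow> P) \<Longrightarrow> P"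
  by (cases l) (auto simp: tuples_def)

lemma tuples_nth: "l \<in> tuples n \<Longrightarrow> j < n \<Longrightarrow> l ! j \<in> SL2"
  by (auto simp: tuples_def)

abbreviation tr :: "'k::field mat2 \<Rightarrow> 'k mat2 list \<Rightarrow> 'k mat2 list" where
  "tr g \<equiv> map ((**) g)"

lemma tr_in_tuples [simp]: "g \<in> SL2 \<Longrightarrow> tr g l \<in> tuples n \<longleftrightarrow> l \<in> tuples n"
  by (auto simp: tuples_def SL2_mult_cancel)

lemma tr_tr: "tr g (tr h l) = tr (g ** h) l"
  by (simp add: matrix_mul_assoc)

lemma tr_one [simp]: "tr (mat 1) l = l"
  by (induction l) auto

lemma tr_adj2 [simp]: "g \<in> SL2 \<Longrightarrow> tr g (tr (adj2 g) l) = l" "g \<in> SL2 \<Longrightarrow> tr (adj2 g) (tr g l) = l"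
  unfolding tr_tr by simp_all

section \<open>Polynomial functions on powers of the group\<close>

text \<open>The rule \<open>cong\<close> makes membership depend on the values on
  \<open>tuples n\<close> only, so what \<open>hd\<close>, \<open>tl\<close> and \<open>!\<close>
  return on other lists is irrelevant.\<close>

inductive_set LP :: "nat \<Rightarrow> ('k::field mat2 list \<Rightarrow> 'k) set" for n where
  const: "(\<lambda>_. c) \<in> LP n"
| entry: "j < n \<Longrightarrow> (\<lambda>l. l ! j $ i $ k) \<in> LP n"
| add: "p \<in> LP n \<Longrightarrow> q \<in> LP n \<Longrightarrow> (\<lambda>l. p l + q l) \<in> LP n"
| mult: "p \<in> LP n \<Longrightarrow> q \<in> LP n \<Longrightarrow> (\<lambda>l. p l * q l) \<in> LP n"
| cong: "p \<in> LP n \<Longrightarrow> (\<And>l. l \<in> tuples n \<Longrightarrow> q l = p l) \<Longrightarrow> q \<in> LP n"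

lemma LP_minus: "p \<in> LP n \<Longrightarrow> (\<lambda>l. - p l) \<in> LP n"
  using LP.mult[OF LP.const[of "-1"], of p n] by simp

lemma LP_sum: "(\<And>i. i \<in> A \<Longrightarrow> p i \<in> LP n) \<Longrightarrow> (\<lambda>l. \<Sum>i\<in>A. p i l) \<in> LP n"
  by (induction A rule: infinite_finite_induct) (auto intro: LP.intros)

lemma LP_power: "p \<in> LP n \<Longrightarrow> (\<lambda>l. p l ^ m) \<in> LP n"
  by (induction m) (auto intro: LP.intros)

definition poly_map :: "nat \<Rightarrow> ('k::field mat2 list \<Rightarrow> 'k mat2) \<Rightarrow> bool" where
  "poly_map n t \<longleftrightarrow> (\<forall>l\<in>tuples n. t l \<in> SL2) \<and> (\<forall>i j. (\<lambda>l. t l $ i $ j) \<in> LP n)"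

lemma poly_map_SL2: "poly_map n t \<Longrightarrow> l \<in> tuples n \<Longrightarrow> t l \<in> SL2"
  by (simp add: poly_map_def)

lemma poly_map_const: "g \<in> SL2 \<Longrightarrow> poly_map n (\<lambda>_. g)"
  by (simp add: poly_map_def LP.const)

lemma poly_map_nth: "j < n \<Longrightarrow> poly_map n (\<lambda>l. l ! j)"
  by (simp add: poly_map_def LP.entry tuples_nth)

lemma poly_map_cong: "poly_map n t \<Longrightarrow> (\<And>l. l \<in> tuples n \<Longrightarrow> t' l = t l) \<Longrightarrow> poly_map n t'"
  unfolding poly_map_def by (metis (no_types, lifting) LP.cong)

lemma poly_map_mult: "poly_map n s \<Longrightarrow> poly_map n t \<Longrightarrow> poly_map n (\<lambda>l. s l ** t l)"
  unfolding poly_map_def by (auto intro!: LP.add LP.mult)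

lemma poly_map_adj2: "poly_map n t \<Longrightarrow> poly_map n (\<lambda>l. adj2 (t l))"
  unfolding poly_map_def by (auto simp: forall_2 intro: LP_minus)

definition frob :: "'k::field mat2 \<Rightarrow> 'k mat2" where
  "frob g = (\<chi> i j. (g $ i $ j)\<^sup>2)"

lemma frob_nth [simp]: "frob g $ i $ j = (g $ i $ j)\<^sup>2"
  by (simp add: frob_def)

definition poly_subst :: "nat \<Rightarrow> nat \<Rightarrow> ('k::field mat2 list \<Rightarrow> 'k mat2 list) \<Rightarrow> bool" where
  "poly_subst m n s \<longleftrightarrow> (\<forall>l\<in>tuples m. s l \<in> tuples n) \<and> (\<forall>j<n. poly_map m (\<lambda>l. s l ! j))"

lemma LP_subst:
  assumes "p \<in> LP n" "poly_subst m n s"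
  shows "(\<lambda>l. p (s l)) \<in> LP m"
  using assms(1)
proof induction
  case (entry j i k)
  then show ?case using assms(2) by (simp add: poly_subst_def poly_map_def)
next
  case (cong p q)
  then show ?case using assms(2) by (intro LP.cong[OF cong.IH]) (simp add: poly_subst_def)
qed (auto intro: LP.intros)

lemma poly_subst_Nil: "poly_subst m 0 (\<lambda>_. [])"
  by (simp add: poly_subst_def)

lemma poly_subst_Cons:
  "poly_map m t \<Longrightarrow> poly_subst m n s \<Longrightarrow> poly_subst m (Suc n) (\<lambda>l. t l # s l)"
  by (auto simp: poly_subst_def poly_map_SL2 less_Suc_eq_0_disj)

lemma poly_subst_id: "poly_subst m m (\<lambda>l. l)"
  by (simp add: poly_subst_def poly_map_nth)

lemma poly_subst_tl: "poly_subst (Suc m) m tl"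
proof -
  have "poly_map (Suc m) (\<lambda>l. tl l ! j)" if "j < m" for j
    by (rule poly_map_cong[OF poly_map_nth[of "Suc j"]]) (use that in \<open>auto elim!: in_tuples_SucE\<close>)
  then show ?thesis by (auto simp: poly_subst_def elim!: in_tuples_SucE)
qed

lemma poly_map_hd: "poly_map (Suc m) hd"
  by (rule poly_map_cong[OF poly_map_nth[of 0]]) (auto elim!: in_tuples_SucE)

lemma poly_subst_tr:
  assumes "poly_map m t" "poly_subst m n s" shows "poly_subst m n (\<lambda>l. tr (t l) (s l))"
proof -
  have "poly_map m (\<lambda>l. tr (t l) (s l) ! j)" if "j < n" for j
  proof (rule poly_map_cong)
    show "poly_map m (\<lambda>l. t l ** (s l ! j))"
      using assms that by (intro poly_map_mult) (simp_all add: poly_subst_def)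
    show "tr (t l) (s l) ! j = t l ** (s l ! j)" if "l \<in> tuples m" for l
      using assms that \<open>j < n\<close> by (simp add: poly_subst_def tuples_def)
  qed
  then show ?thesis using assms by (auto simp: poly_subst_def poly_map_SL2)
qed

lemma poly_fun_LP:
  assumes "p \<in> poly_fun" "poly_map m t" shows "(\<lambda>l. p (t l)) \<in> LP m"
  using assms(1) by induction (use assms(2) in \<open>auto simp: poly_map_def intro: LP.intros\<close>)

lemma coord_ring_LP:
  assumes "f \<in> coord_ring" "poly_map m t" shows "(\<lambda>l. f (t l)) \<in> LP m"
proof -
  obtain p where p: "p \<in> poly_fun" "f = (\<lambda>g. if g \<in> SL2 then p g else 0)"
    using assms(1) by (auto simp: coord_ring_def)
  show ?thesis by (rule LP.cong[OF poly_fun_LP[OF p(1) assms(2)]]) (simp add: p poly_map_SL2[OF assms(2)])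
qed

lemma LP_coord_ring:
  assumes "p \<in> LP 1" shows "(\<lambda>g. if g \<in> SL2 then p [g] else 0) \<in> coord_ring"
proof -
  from assms have "\<exists>q\<in>poly_fun. \<forall>g\<in>SL2. p [g] = q g"
  proof induction
    case (const c) then show ?case using poly_fun.const by fastforce
  next
    case (entry j i k) then show ?case using poly_fun.entry by fastforce
  next
    case (add p q)
    then obtain p' q' where "p' \<in> poly_fun" "\<forall>g\<in>SL2. p [g] = p' g" "q' \<in> poly_fun" "\<forall>g\<in>SL2. q [g] = q' g"
      by blast
    then show ?case by (intro bexI[OF _ poly_fun.add[of p' q']]) auto
  next
    case (mult p q)
    then obtain p' q' where "p' \<in> poly_fun" "\<forall>g\<in>SL2. p [g] = p' g" "q' \<in> poly_fun" "\<forall>g\<in>SL2. q [g] = q' g"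
      by blast
    then show ?case by (intro bexI[OF _ poly_fun.mult[of p' q']]) auto
  next
    case (cong p q) then show ?case by (metis Cons_in_tuples tuples_0 One_nat_def)
  qed
  then obtain q where "q \<in> poly_fun" "\<forall>g\<in>SL2. p [g] = q g" by blast
  then show ?thesis unfolding coord_ring_def by (intro CollectI bexI[of _ q] ext) auto
qed

lemma coord_ring_off: "f \<in> coord_ring \<Longrightarrow> g \<notin> SL2 \<Longrightarrow> f g = 0"
  by (auto simp: coord_ring_def)

text \<open>\<open>LP (Suc n)\<close> is the tensor product of the coordinate ring and \<open>LP n\<close>.\<close>

inductive_set TP :: "nat \<Rightarrow> ('k::field mat2 list \<Rightarrow> 'k) set" for n where
  gen: "b \<in> coord_ring \<Longrightarrow> p \<in> LP n \<Longrightarrow> (\<lambda>l. b (hd l) * p (tl l)) \<in> TP n"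
| add: "p \<in> TP n \<Longrightarrow> q \<in> TP n \<Longrightarrow> (\<lambda>l. p l + q l) \<in> TP n"

lemma coord_ring_mult: "f \<in> coord_ring \<Longrightarrow> g \<in> coord_ring \<Longrightarrow> (\<lambda>x. f x * g x) \<in> coord_ring"
  unfolding coord_ring_def using poly_fun.mult by fastforce

lemma TP_mult:
  assumes "p \<in> TP n" "q \<in> TP n" shows "(\<lambda>l. p l * q l) \<in> TP n"
  using assms(1)
proof induction
  case (gen b p)
  from assms(2) show ?case
  proof induction
    case (gen b' p')
    show ?case using TP.gen[OF coord_ring_mult[OF \<open>b \<in> coord_ring\<close> gen(1)] LP.mult[OF \<open>p \<in> LP n\<close> gen(2)]]
      by (simp add: mult_ac)
  qed (use TP.add in \<open>auto simp: distrib_left\<close>)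
qed (use TP.add in \<open>auto simp: distrib_right\<close>)

lemma coord_ring_const: "(\<lambda>g. if g \<in> SL2 then c else 0) \<in> coord_ring"
  using LP_coord_ring[OF LP.const[of c]] by simp

lemma coord_ring_entry: "(\<lambda>g. if g \<in> SL2 then g $ i $ j else 0) \<in> coord_ring"
  using LP_coord_ring[OF LP.entry[of 0 1 i j]] by (simp cong: if_cong)

lemma LP_decompose:
  assumes "p \<in> LP (Suc n)" shows "\<exists>q\<in>TP n. \<forall>l\<in>tuples (Suc n). p l = q l"
  using assms
proof induction
  case (const c)
  show ?case
    by (rule bexI[OF _ TP.gen[OF coord_ring_const[of c] LP.const[of 1]]]) (auto elim!: in_tuples_SucE)
next
  case (entry j i k)
  show ?case
  proof (cases j)
    case 0
    show ?thesis
      by (rule bexI[OF _ TP.gen[OF coord_ring_entry[of i k] LP.const[of 1]]]) (auto elim!: in_tuples_SucE simp: 0)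
  next
    case (Suc j')
    show ?thesis
      by (rule bexI[OF _ TP.gen[OF coord_ring_const[of 1] LP.entry[of j' n i k]]])
         (use Suc entry in \<open>auto elim!: in_tuples_SucE\<close>)
  qed
next
  case (add p q)
  then obtain p' q' where "p' \<in> TP n" "q' \<in> TP n" "\<forall>l\<in>tuples (Suc n). p l = p' l" "\<forall>l\<in>tuples (Suc n). q l = q' l"
    by blast
  then show ?case by (intro bexI[OF _ TP.add[of p' n q']]) auto
next
  case (mult p q)
  then obtain p' q' where "p' \<in> TP n" "q' \<in> TP n" "\<forall>l\<in>tuples (Suc n). p l = p' l" "\<forall>l\<in>tuples (Suc n). q l = q' l"
    by blast
  then show ?case by (intro bexI[OF _ TP_mult[of p' n q']]) auto
next
  case (cong p q) then show ?case by metis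
qed

section \<open>Vector-valued polynomial functions\<close>

declare curry_conv [simp del]

lemma poly_map_hd1: "poly_map 1 hd"
  using poly_map_hd[of 0] by simp

lemma curry_add: "curry (f + g) l = curry f l + curry g l"
  by (simp add: fun_eq_iff pointwise curry_conv)

lemma curry_diff: "curry (f - g) l = curry f l - curry g (l :: 'l) " for f g :: "_ \<Rightarrow> 'k::ab_group_add"
  by (simp add: fun_eq_iff pointwise curry_conv)

lemma curry_zero: "curry 0 l = 0"
  by (simp add: fun_eq_iff pointwise curry_conv)

lemma curry_scale: "curry (fscale c f) l = fscale c (curry f l)"
  by (simp add: fun_eq_iff pointwise curry_conv)

lemmas curry_simps = curry_add curry_diff curry_zero curry_scale

lemma curry_eqI: "(\<And>l. curry f l = curry g l) \<Longrightarrow> f = g"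
  by (metis case_prod_curry ext)

text \<open>Vector-valued functions are kept uncurried. They are then scalar functions again, so
  that spaces of them can be carriers of a \<open>gmod\<close>; \<open>curry\<close> recovers the
  value at a tuple.\<close>

definition elt :: "nat \<Rightarrow> ('k::field mat2 list \<Rightarrow> 'k) \<Rightarrow> ('x \<Rightarrow> 'k) \<Rightarrow> 'k mat2 list \<times> 'x \<Rightarrow> 'k" where
  "elt n p w = case_prod (\<lambda>l. if l \<in> tuples n then fscale (p l) w else 0)"

lemma curry_elt: "curry (elt n p w) l = (if l \<in> tuples n then fscale (p l) w else 0)"
  by (simp add: elt_def)

text \<open>\<open>PF n X\<close> consists of the polynomial functions from \<open>n\<close>-tuples of group elements to \<open>X\<close>.\<close>

inductive_set PF :: "nat \<Rightarrow> ('x \<Rightarrow> 'k::field) set \<Rightarrow> ('k mat2 list \<times> 'x \<Rightarrow> 'k) set" for n X where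
  zero: "0 \<in> PF n X"
| gen: "p \<in> LP n \<Longrightarrow> w \<in> X \<Longrightarrow> elt n p w \<in> PF n X"
| add: "f \<in> PF n X \<Longrightarrow> g \<in> PF n X \<Longrightarrow> f + g \<in> PF n X"

lemma PF_scale: "f \<in> PF n X \<Longrightarrow> fscale c f \<in> PF n X"
proof (induction rule: PF.induct)
  case zero then show ?case by (simp add: PF.zero)
next
  case (gen p w)
  have "fscale c (elt n p w) = elt n (\<lambda>l. c * p l) w"
    by (rule curry_eqI) (simp add: curry_scale curry_elt)
  then show ?case using gen by (simp add: PF.gen LP.mult LP.const)
next
  case (add f g) then show ?case by (simp add: fs.scale_right_distrib PF.add)
qed

lemma PF_subspace [simp, intro]: "fs.subspace (PF n X)"
  by (rule fs.subspaceI) (auto intro: PF.intros PF_scale)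

lemma PF_off: "f \<in> PF n X \<Longrightarrow> l \<notin> tuples n \<Longrightarrow> curry f l = 0"
  by (induction rule: PF.induct) (simp_all add: curry_simps curry_elt)

lemma PF_in: "f \<in> PF n X \<Longrightarrow> fs.subspace X \<Longrightarrow> curry f l \<in> X"
  by (induction rule: PF.induct)
     (simp_all add: curry_simps curry_elt fs.subspace_0 fs.subspace_add fs.subspace_scale)

lemma PF_mono: "f \<in> PF n X \<Longrightarrow> X \<subseteq> Y \<Longrightarrow> f \<in> PF n Y"
  by (induction rule: PF.induct) (auto intro: PF.intros)

lemma PF_eqI:
  assumes "f \<in> PF n X" "g \<in> PF n Y" "\<And>l. l \<in> tuples n \<Longrightarrow> curry f l = curry g l"
  shows "f = g"
  using assms PF_off[OF assms(1)] PF_off[OF assms(2)] by (intro curry_eqI) metis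

definition cut :: "nat \<Rightarrow> ('k::field mat2 list \<Rightarrow> 'x \<Rightarrow> 'k) \<Rightarrow> 'k mat2 list \<times> 'x \<Rightarrow> 'k" where
  "cut n F = case_prod (\<lambda>l. if l \<in> tuples n then F l else 0)"

lemma curry_cut: "curry (cut n F) l = (if l \<in> tuples n then F l else 0)"
  by (simp add: cut_def)

lemma cut_cong: "(\<And>l. l \<in> tuples n \<Longrightarrow> F l = G l) \<Longrightarrow> cut n F = cut n G"
  by (rule curry_eqI) (simp add: curry_cut)

lemma cut_curry: "f \<in> PF n X \<Longrightarrow> cut n (curry f) = f"
  using PF_off by (intro curry_eqI) (auto simp: curry_cut)

lemma cut_add: "cut n (\<lambda>l. F l + G l) = cut n F + cut n G"
  by (rule curry_eqI) (simp add: curry_cut curry_simps)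

lemma cut_diff: "cut n (\<lambda>l. F l - G l) = cut n F - cut n G"
  by (rule curry_eqI) (simp add: curry_cut curry_simps)

lemma cut_scale: "cut n (\<lambda>l. fscale c (F l)) = fscale c (cut n F)"
  by (rule curry_eqI) (simp add: curry_cut curry_simps)

lemma cut_zero: "cut n (\<lambda>l. 0) = 0"
  by (rule curry_eqI) (simp add: curry_cut curry_simps)

lemma cut_elt: "p \<in> LP n \<Longrightarrow> w \<in> X \<Longrightarrow> cut n (\<lambda>l. fscale (p l) w) \<in> PF n X"
  using PF.gen[of p n w X] by (simp add: elt_def cut_def)

definition pw :: "(('x \<Rightarrow> 'k::field) \<Rightarrow> 'y \<Rightarrow> 'k) \<Rightarrow> ('k mat2 list \<times> 'x \<Rightarrow> 'k) \<Rightarrow> 'k mat2 list \<times> 'y \<Rightarrow> 'k" where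
  "pw T f = case_prod (\<lambda>l. T (curry f l))"

lemma curry_pw [simp]: "curry (pw T f) l = T (curry f l)"
  by (simp add: pw_def)

lemma PF_pw:
  assumes f: "f \<in> PF n X" and T: "lin_on X T" "fs.subspace X" "T ` X \<subseteq> Y"
  shows "pw T f \<in> PF n Y"
  using f
proof (induction rule: PF.induct)
  case zero
  have "pw T 0 = 0" by (rule curry_eqI) (simp add: curry_simps lin_on_zero[OF T(1,2)])
  then show ?case by (simp add: PF.zero)
next
  case (gen p w)
  have "pw T (elt n p w) = elt n p (T w)"
    by (rule curry_eqI) (use gen in \<open>simp add: curry_elt lin_on_zero[OF T(1,2)] lin_on_scale[OF T(1)]\<close>)
  then show ?case using gen T by (auto intro: PF.gen)
next
  case (add f g)
  have "pw T (f + g) = pw T f + pw T g"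
    by (rule curry_eqI) (use add in \<open>simp add: curry_simps PF_in[OF _ T(2)] lin_on_add[OF T(1)]\<close>)
  then show ?case using add by (simp add: PF.add)
qed

lemma pw_add: "f \<in> PF n X \<Longrightarrow> g \<in> PF n X \<Longrightarrow> lin_on X T \<Longrightarrow> fs.subspace X \<Longrightarrow> pw T (f + g) = pw T f + pw T g"
  by (rule curry_eqI) (simp add: curry_simps PF_in lin_on_add[of X T])

lemma pw_scale: "f \<in> PF n X \<Longrightarrow> lin_on X T \<Longrightarrow> fs.subspace X \<Longrightarrow> pw T (fscale c f) = fscale c (pw T f)"
  by (rule curry_eqI) (simp add: curry_simps PF_in lin_on_scale[of X T])

lemma pw_lin_on: "lin_on X T \<Longrightarrow> fs.subspace X \<Longrightarrow> lin_on (PF n X) (pw T)"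
  by (rule lin_onI) (auto intro: pw_add pw_scale)

text \<open>A function with values in \<open>Y\<close> may have been presented with vectors outside
  \<open>Y\<close>. Applying a linear projection onto \<open>Y\<close> to all of them repairs the
  presentation and leaves the function as it is.\<close>

lemma PF_restrict:
  assumes f: "f \<in> PF n X" and X: "fs.subspace Y" and sub: "\<And>l. l \<in> tuples n \<Longrightarrow> curry f l \<in> Y"
  shows "f \<in> PF n Y"
proof -
  obtain p where p: "lin_on UNIV p" "\<forall>v\<in>Y. p v = v" "\<forall>v. p v \<in> Y"
    using lin_on_projection[OF X] by blast
  have "pw p f \<in> PF n Y"
    using p by (intro PF_pw[OF PF_mono[OF f, of UNIV]]) auto
  moreover have "curry f l \<in> Y" for l
    using sub PF_off[OF f] fs.subspace_0[OF X] by (cases "l \<in> tuples n") auto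
  then have "pw p f = f" using p by (intro curry_eqI) simp
  ultimately show ?thesis by simp
qed

lemma PF_mult:
  assumes f: "f \<in> PF n X" and p: "p \<in> LP n"
  shows "cut n (\<lambda>l. fscale (p l) (curry f l)) \<in> PF n X"
  using f
proof (induction rule: PF.induct)
  case zero then show ?case by (simp add: curry_simps cut_zero PF.zero)
next
  case (gen q w)
  have "cut n (\<lambda>l. fscale (p l) (curry (elt n q w) l)) = cut n (\<lambda>l. fscale (p l * q l) w)"
    by (rule cut_cong) (simp add: curry_elt)
  then show ?case using gen p by (simp add: cut_elt LP.mult)
next
  case (add f g) then show ?case by (simp add: curry_simps fs.scale_right_distrib cut_add PF.add)
qed

lemma PF_subst:
  assumes f: "f \<in> PF n X" and s: "poly_subst m n s"
  shows "cut m (\<lambda>l. curry f (s l)) \<in> PF m X"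
  using f
proof (induction rule: PF.induct)
  case zero then show ?case by (simp add: curry_simps cut_zero PF.zero)
next
  case (gen q w)
  have "cut m (\<lambda>l. curry (elt n q w) (s l)) = cut m (\<lambda>l. fscale (q (s l)) w)"
    by (rule cut_cong) (use s in \<open>simp add: curry_elt poly_subst_def\<close>)
  then show ?case using gen s by (simp add: cut_elt LP_subst)
next
  case (add f g) then show ?case by (simp add: curry_simps cut_add PF.add)
qed

definition cons_elt :: "('k::field mat2 \<Rightarrow> 'k) \<Rightarrow> ('k mat2 list \<times> 'x \<Rightarrow> 'k) \<Rightarrow> 'k mat2 list \<times> 'x \<Rightarrow> 'k" where
  "cons_elt b f = case_prod (\<lambda>l. case l of [] \<Rightarrow> 0 | g # l' \<Rightarrow> fscale (b g) (curry f l'))"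

lemma curry_cons_elt [simp]: "curry (cons_elt b f) (g # l) = fscale (b g) (curry f l)"
  "curry (cons_elt b f) [] = 0"
  by (simp_all add: cons_elt_def)

text \<open>The isomorphism of \<open>k[G^(n+1)] \<otimes> X\<close> with
  \<open>k[G] \<otimes> (k[G^n] \<otimes> X)\<close> in the form of an induction rule. An operator
  in the first variable then has to be computed only on \<open>cons_elt b f\<close>.\<close>

lemma PF_Suc_induct [consumes 1, case_names zero gen add]:
  assumes f: "f \<in> PF (Suc n) X"
    and zero: "P 0"
    and gen: "\<And>b f. b \<in> coord_ring \<Longrightarrow> f \<in> PF n X \<Longrightarrow> P (cons_elt b f)"
    and add: "\<And>f g. f \<in> PF (Suc n) X \<Longrightarrow> g \<in> PF (Suc n) X \<Longrightarrow> P f \<Longrightarrow> P g \<Longrightarrow> P (f + g)"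
  shows "P f"
  using f
proof (induction rule: PF.induct)
  case (gen p w)
  obtain q where q: "q \<in> TP n" "\<forall>l\<in>tuples (Suc n). p l = q l" using LP_decompose[OF gen(1)] by blast
  have "elt (Suc n) q w \<in> PF (Suc n) X \<and> P (elt (Suc n) q w)"
    using q(1)
  proof induction
    case (gen b p)
    have "elt (Suc n) (\<lambda>l. b (hd l) * p (tl l)) w = cons_elt b (elt n p w)"
    proof (rule curry_eqI)
      fix l show "curry (elt (Suc n) (\<lambda>l. b (hd l) * p (tl l)) w) l = curry (cons_elt b (elt n p w)) l"
        using coord_ring_off[OF gen(1)] by (cases l) (auto simp: curry_elt)
    qed
    moreover have "(\<lambda>l. b (hd l) * p (tl l)) \<in> LP (Suc n)"
      using gen by (intro LP.mult coord_ring_LP poly_map_hd LP_subst[OF _ poly_subst_tl])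
    ultimately show ?case
      using gen \<open>w \<in> X\<close> PF.gen[of "\<lambda>l. b (hd l) * p (tl l)" "Suc n" w X] assms(3)[OF gen(1) PF.gen[OF gen(2)]]
      by simp
  next
    case (add p q)
    have "elt (Suc n) (\<lambda>l. p l + q l) w = elt (Suc n) p w + elt (Suc n) q w"
      by (rule curry_eqI) (simp add: curry_elt curry_simps fs.scale_left_distrib)
    then show ?case using add assms(4) by (simp add: PF.add)
  qed
  moreover have "elt (Suc n) q w = elt (Suc n) p w"
    by (rule curry_eqI) (simp add: curry_elt q)
  ultimately show ?case by simp
qed (use zero add in auto)

lemma cons_elt_PF:
  assumes "b \<in> coord_ring" "f \<in> PF n X" shows "cons_elt b f \<in> PF (Suc n) X"
proof -
  have "cut (Suc n) (\<lambda>l. fscale (b (hd l)) (curry (cut (Suc n) (\<lambda>l. curry f (tl l))) l)) \<in> PF (Suc n) X"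
    using assms by (intro PF_mult PF_subst[OF _ poly_subst_tl] coord_ring_LP poly_map_hd)
  also have "cut (Suc n) (\<lambda>l. fscale (b (hd l)) (curry (cut (Suc n) (\<lambda>l. curry f (tl l))) l)) = cons_elt b f"
  proof (rule curry_eqI)
    fix l show "curry (cut (Suc n) (\<lambda>l. fscale (b (hd l)) (curry (cut (Suc n) (\<lambda>l. curry f (tl l))) l))) l =
        curry (cons_elt b f) l"
      using coord_ring_off[OF assms(1)] PF_off[OF assms(2)] by (cases l) (auto simp: curry_cut)
  qed
  finally show ?thesis .
qed

definition slice :: "('k::field mat2 list \<times> 'x \<Rightarrow> 'k) \<Rightarrow> 'k mat2 list \<Rightarrow> 'k mat2 list \<times> 'x \<Rightarrow> 'k" where
  "slice f l = cut 1 (\<lambda>l'. curry f (hd l' # l))"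

lemma curry_slice: "curry (slice f l) [g] = (if g \<in> SL2 then curry f (g # l) else 0)"
  by (simp add: slice_def curry_cut)

lemma slice_add: "slice (f + g) l = slice f l + slice g l"
  by (simp add: slice_def curry_simps cut_add)

lemma slice_cons_elt: "slice (cons_elt b f) l = cut 1 (\<lambda>l'. fscale (b (hd l')) (curry f l))"
  by (simp add: slice_def)

lemma slice_zero: "slice 0 l = 0"
  by (simp add: slice_def curry_simps cut_zero)

lemma slice_PF:
  assumes "f \<in> PF (Suc n) X" "l \<in> tuples n" shows "slice f l \<in> PF 1 X"
  unfolding slice_def
  using assms by (intro PF_subst) (auto simp: poly_subst_def less_Suc_eq_0_disj tuples_nth
      intro!: poly_map_const poly_map_hd[of 0, simplified] elim!: in_tuples_SucE)

text \<open>An arbitrary linear operator in the first variable preserves polynomial dependence on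
  the others: on \<open>b(g) p(l) w\<close> it yields \<open>p(l)\<close> times a fixed
  vector.\<close>

lemma PF_slice_map:
  assumes f: "f \<in> PF (Suc n) X" and X: "fs.subspace X"
    and R: "lin_on (PF 1 X) R" "R ` PF 1 X \<subseteq> Y"
  shows "cut n (\<lambda>l. R (slice f l)) \<in> PF n Y"
  using f
proof (induction rule: PF_Suc_induct)
  case zero
  then show ?case by (simp add: slice_zero lin_on_zero[OF R(1)] cut_zero PF.zero)
next
  case (gen b f)
  have b: "cut 1 (\<lambda>l'. fscale (b (hd l')) w) \<in> PF 1 X" if "w \<in> X" for w
    using that gen(1) poly_map_hd[of 0] by (intro cut_elt coord_ring_LP) auto
  from gen(2) show ?case
  proof (induction rule: PF.induct)
    case zero
    then show ?case by (simp add: slice_cons_elt curry_simps lin_on_zero[OF R(1)] cut_zero PF.zero)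
  next
    case (gen p w)
    have "cut n (\<lambda>l. R (slice (cons_elt b (elt n p w)) l)) =
        cut n (\<lambda>l. fscale (p l) (R (cut 1 (\<lambda>l'. fscale (b (hd l')) w))))"
    proof (rule cut_cong)
      fix l :: "'a mat2 list" assume "l \<in> tuples n"
      then have "slice (cons_elt b (elt n p w)) l = fscale (p l) (cut 1 (\<lambda>l'. fscale (b (hd l')) w))"
        by (simp add: slice_cons_elt curry_elt mult_ac flip: cut_scale)
      then show "R (slice (cons_elt b (elt n p w)) l) = fscale (p l) (R (cut 1 (\<lambda>l'. fscale (b (hd l')) w)))"
        using b gen by (simp add: lin_on_scale[OF R(1)])
    qed
    then show ?case using gen b R(2) by (auto intro!: cut_elt)
  next
    case (add f g)
    have "slice (cons_elt b h) l \<in> PF 1 X" if "h \<in> PF n X" for h l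
      using b[OF PF_in[OF that X]] by (simp add: slice_cons_elt)
    moreover have "cons_elt b (f + g) = cons_elt b f + cons_elt b g"
    proof (rule curry_eqI)
      fix l show "curry (cons_elt b (f + g)) l = curry (cons_elt b f + cons_elt b g) l"
        by (cases l) (simp_all add: curry_simps fs.scale_right_distrib)
    qed
    ultimately show ?case
      using add by (simp add: slice_add lin_on_add[OF R(1)] cut_add PF.add)
  qed
next
  case (add f g)
  have "cut n (\<lambda>l. R (slice (f + g) l)) = cut n (\<lambda>l. R (slice f l) + R (slice g l))"
    using add by (intro cut_cong) (simp only: slice_add lin_on_add[OF R(1)] slice_PF)
  then show ?case using add by (simp add: cut_add PF.add)
qed

text \<open>Together with \<open>PF_unsplit\<close>, this passes between functions of
  \<open>n + 1\<close> variables and functions of one variable with values in functions of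
  \<open>n\<close> variables.\<close>

definition split1 :: "nat \<Rightarrow> ('k::field mat2 list \<times> 'x \<Rightarrow> 'k) \<Rightarrow> 'k mat2 list \<times> 'k mat2 list \<times> 'x \<Rightarrow> 'k" where
  "split1 n f = cut 1 (\<lambda>l'. cut n (\<lambda>l. curry f (hd l' # l)))"

lemma split1_PF:
  assumes "f \<in> PF (Suc n) X" shows "split1 n f \<in> PF 1 (PF n X)"
  using assms
proof (induction rule: PF_Suc_induct)
  case zero then show ?case by (simp add: split1_def curry_simps cut_zero PF.zero)
next
  case (gen b f)
  have "split1 n (cons_elt b f) = cut 1 (\<lambda>l'. fscale (b (hd l')) f)"
    using cut_curry[OF gen(2)] by (simp add: split1_def cut_scale)
  then show ?case using gen by (auto intro!: cut_elt coord_ring_LP poly_map_hd1 simp del: One_nat_def)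
next
  case (add f g) then show ?case by (simp add: split1_def curry_simps cut_add PF.add)
qed

section \<open>Rational modules\<close>

text \<open>Converts membership in \<open>PF 1\<close> into the finite sum that the comodule clause
  of \<open>rational_module\<close> asks for.\<close>

lemma PF1_expand:
  assumes "F \<in> PF 1 X"
  shows "\<exists>(r::nat) f w. (\<forall>i<r. f i \<in> coord_ring \<and> w i \<in> X) \<and>
           (\<forall>g\<in>SL2. curry F [g] = (\<Sum>i<r. fscale (f i g) (w i)))"
proof -
  from assms have "\<exists>ps. set ps \<subseteq> coord_ring \<times> X \<and>
      (\<forall>g\<in>SL2. curry F [g] = (\<Sum>(f, w)\<leftarrow>ps. fscale (f g) w))"
  proof (induction rule: PF.induct)
    case zero
    show ?case by (rule exI[of _ "[]"]) (simp add: curry_simps)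
  next
    case (gen p w)
    show ?case
      by (rule exI[of _ "[(\<lambda>g. if g \<in> SL2 then p [g] else 0, w)]"])
         (use gen LP_coord_ring in \<open>auto simp: curry_elt\<close>)
  next
    case (add f g)
    then obtain ps qs where "set ps \<subseteq> coord_ring \<times> X" "set qs \<subseteq> coord_ring \<times> X"
      "\<forall>x\<in>SL2. curry f [x] = (\<Sum>(f, w)\<leftarrow>ps. fscale (f x) w)"
      "\<forall>x\<in>SL2. curry g [x] = (\<Sum>(f, w)\<leftarrow>qs. fscale (f x) w)" by blast
    then show ?case by (intro exI[of _ "ps @ qs"]) (simp add: curry_simps)
  qed
  then obtain ps where ps: "set ps \<subseteq> coord_ring \<times> X"
    "\<forall>g\<in>SL2. curry F [g] = (\<Sum>(f, w)\<leftarrow>ps. fscale (f g) w)" by blast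
  have "fst (ps ! i) \<in> coord_ring \<and> snd (ps ! i) \<in> X" if "i < length ps" for i
    using ps(1) nth_mem[OF that] by auto
  moreover have "curry F [g] = (\<Sum>i<length ps. fscale (fst (ps ! i) g) (snd (ps ! i)))" if "g \<in> SL2" for g
    using ps(2) that by (simp add: sum_list_sum_nth atLeast0LessThan case_prod_beta)
  ultimately show ?thesis
    by (intro exI[of _ "length ps"] exI[of _ "\<lambda>i. fst (ps ! i)"] exI[of _ "\<lambda>i. snd (ps ! i)"]) blast
qed

text \<open>This is the coaction evaluated at \<open>v\<close>; rationality of a module becomes a
  statement about \<open>PF 1\<close>.\<close>

definition orb :: "('k::field, 'x) gmod \<Rightarrow> ('x \<Rightarrow> 'k) \<Rightarrow> 'k mat2 list \<times> 'x \<Rightarrow> 'k" where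
  "orb M v = cut 1 (\<lambda>l. act M (hd l) v)"

lemma rational_moduleI:
  assumes "fs.subspace (carrier M)"
    and "\<And>g v. g \<in> SL2 \<Longrightarrow> v \<in> carrier M \<Longrightarrow> act M g v \<in> carrier M"
    and "\<And>g. g \<in> SL2 \<Longrightarrow> lin_on (carrier M) (act M g)"
    and "\<And>v. v \<in> carrier M \<Longrightarrow> act M (mat 1) v = v"
    and "\<And>g h v. g \<in> SL2 \<Longrightarrow> h \<in> SL2 \<Longrightarrow> v \<in> carrier M \<Longrightarrow> act M (g ** h) v = act M g (act M h v)"
    and orb: "\<And>v. v \<in> carrier M \<Longrightarrow> orb M v \<in> PF 1 (carrier M)"
  shows "rational_module M"
proof -
  have "\<exists>(r::nat) f w. (\<forall>i<r. f i \<in> coord_ring \<and> w i \<in> carrier M) \<and>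
           (\<forall>g\<in>SL2. act M g v = (\<Sum>i<r. fscale (f i g) (w i)))" if "v \<in> carrier M" for v
    using PF1_expand[OF orb[OF that]] by (simp add: orb_def curry_cut)
  then show ?thesis
    using assms(1-5) by (auto simp: rational_module_def lin_on_def)
qed

context
  fixes M :: "('k::field, 'x) gmod"
  assumes M: "rational_module M"
begin

lemma rm_sub: "fs.subspace (carrier M)"
  using M by (simp add: rational_module_def)

lemma rm_act: "g \<in> SL2 \<Longrightarrow> v \<in> carrier M \<Longrightarrow> act M g v \<in> carrier M"
  using M by (simp add: rational_module_def)

lemma rm_lin: "g \<in> SL2 \<Longrightarrow> lin_on (carrier M) (act M g)"
  using M by (simp add: rational_module_def lin_on_def)

lemma rm_one: "v \<in> carrier M \<Longrightarrow> act M (mat 1) v = v"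
  using M by (simp add: rational_module_def)

lemma rm_mult: "g \<in> SL2 \<Longrightarrow> h \<in> SL2 \<Longrightarrow> v \<in> carrier M \<Longrightarrow> act M (g ** h) v = act M g (act M h v)"
  using M by (simp add: rational_module_def)

lemma rm_zero: "g \<in> SL2 \<Longrightarrow> act M g 0 = 0"
  using lin_on_zero[OF rm_lin rm_sub] .

lemma rm_inv: "g \<in> SL2 \<Longrightarrow> v \<in> carrier M \<Longrightarrow> act M (adj2 g) (act M g v) = v"
    "g \<in> SL2 \<Longrightarrow> v \<in> carrier M \<Longrightarrow> act M g (act M (adj2 g) v) = v"
  using rm_mult[of "adj2 g" g v] rm_mult[of g "adj2 g" v] by (simp_all add: rm_one)

lemma rm_orb: assumes "v \<in> carrier M" shows "orb M v \<in> PF 1 (carrier M)"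
proof -
  from M assms obtain r :: nat and f w where fw: "\<forall>i<r. f i \<in> coord_ring \<and> w i \<in> carrier M"
    "\<forall>g\<in>SL2. act M g v = (\<Sum>i<r. fscale (f i g) (w i))" unfolding rational_module_def by blast
  have "orb M v = cut 1 (\<lambda>l. \<Sum>i<r. fscale (f i (hd l)) (w i))"
    unfolding orb_def by (rule cut_cong) (use fw(2) in \<open>auto elim!: in_tuples_SucE\<close>)
  also have "\<dots> = (\<Sum>i<r. cut 1 (\<lambda>l. fscale (f i (hd l)) (w i)))"
    by (induction r) (simp_all add: cut_zero cut_add del: One_nat_def)
  also have "\<dots> \<in> PF 1 (carrier M)"
    using fw(1) by (intro fs.subspace_sum PF_subspace cut_elt coord_ring_LP poly_map_hd1) auto
  finally show ?thesis .
qed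

text \<open>On a generator \<open>p(l) w\<close> the action of \<open>t(l)\<close> is
  \<open>p(l)\<close> times the coaction of \<open>w\<close> with \<open>t(l)\<close> substituted,
  so polynomiality is inherited from \<open>orb\<close>.\<close>

lemma PF_act:
  assumes f: "f \<in> PF n (carrier M)" and t: "poly_map n t"
  shows "cut n (\<lambda>l. act M (t l) (curry f l)) \<in> PF n (carrier M)"
  using f
proof (induction rule: PF.induct)
  case zero
  have "cut n (\<lambda>l. act M (t l) (curry 0 l)) = 0"
    by (rule curry_eqI) (simp add: curry_cut curry_simps rm_zero poly_map_SL2[OF t])
  then show ?case by (simp add: PF.zero)
next
  case (gen p w)
  let ?o = "cut n (\<lambda>l. curry (orb M w) [t l])"
  have "?o \<in> PF n (carrier M)"
    using rm_orb[OF gen(2)] by (rule PF_subst) (use poly_subst_Cons[OF t poly_subst_Nil] in simp)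
  from PF_mult[OF this gen(1)]
  show ?case
  proof (rule back_subst[of "\<lambda>x. x \<in> _"], intro cut_cong)
    fix l :: "'k mat2 list" assume "l \<in> tuples n"
    then show "fscale (p l) (curry ?o l) = act M (t l) (curry (elt n p w) l)"
      using gen by (simp add: curry_cut curry_elt orb_def poly_map_SL2[OF t] lin_on_scale[OF rm_lin])
  qed
next
  case (add f g)
  have "cut n (\<lambda>l. act M (t l) (curry (f + g) l)) =
      cut n (\<lambda>l. act M (t l) (curry f l) + act M (t l) (curry g l))"
    using add by (intro cut_cong)
      (simp add: curry_simps lin_on_add[OF rm_lin] PF_in[OF _ rm_sub] poly_map_SL2[OF t])
  then show ?case using add by (simp add: cut_add PF.add)
qed

end

text \<open>Compared with \<open>HomG\<close>, values off the carrier are unconstrained, which lets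
  explicit lambda terms and composites qualify directly.\<close>

definition ghom :: "('k::field, 'x) gmod \<Rightarrow> ('k, 'y) gmod \<Rightarrow> (('x \<Rightarrow> 'k) \<Rightarrow> 'y \<Rightarrow> 'k) \<Rightarrow> bool" where
  "ghom M N f \<longleftrightarrow> lin_on (carrier M) f \<and> f ` carrier M \<subseteq> carrier N \<and>
     (\<forall>g\<in>SL2. \<forall>v\<in>carrier M. f (act M g v) = act N g (f v))"

lemma ghom_lin: "ghom M N f \<Longrightarrow> lin_on (carrier M) f"
  and ghom_in: "ghom M N f \<Longrightarrow> v \<in> carrier M \<Longrightarrow> f v \<in> carrier N"
  and ghom_act: "ghom M N f \<Longrightarrow> g \<in> SL2 \<Longrightarrow> v \<in> carrier M \<Longrightarrow> f (act M g v) = act N g (f v)"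
  by (auto simp: ghom_def)

lemma ghomI:
  assumes "lin_on (carrier M) f" "\<And>v. v \<in> carrier M \<Longrightarrow> f v \<in> carrier N"
    "\<And>g v. g \<in> SL2 \<Longrightarrow> v \<in> carrier M \<Longrightarrow> f (act M g v) = act N g (f v)"
  shows "ghom M N f"
  using assms by (auto simp: ghom_def)

lemma ghom_comp: "ghom M N f \<Longrightarrow> ghom N P g \<Longrightarrow> ghom M P (\<lambda>v. g (f v))"
  by (rule ghomI) (auto simp: ghom_in ghom_act lin_on_add[OF ghom_lin] lin_on_scale[OF ghom_lin] intro!: lin_onI)

lemma HomG_ghom: "f \<in> HomG M N \<Longrightarrow> ghom M N f"
  by (auto simp: HomG_def ghom_def lin_on_def)

definition image_mod :: "(('x \<Rightarrow> 'k::field) \<Rightarrow> 'y \<Rightarrow> 'k) \<Rightarrow> ('k, 'x) gmod \<Rightarrow> ('k, 'y) gmod \<Rightarrow> ('k, 'y) gmod" where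
  "image_mod f M N = \<lparr>carrier = f ` carrier M, act = act N\<rparr>"

lemma rational_image_mod:
  assumes M: "rational_module M" and f: "ghom M N f" and N: "rational_module N"
  shows "rational_module (image_mod f M N)"
proof (rule rational_moduleI, unfold image_mod_def gmod.simps)
  show "fs.subspace (f ` carrier M)" by (rule lin_on_subspace_image[OF ghom_lin[OF f] rm_sub[OF M]])
  show "act N g v \<in> f ` carrier M" if "g \<in> SL2" "v \<in> f ` carrier M" for g v
    using that ghom_act[OF f] rm_act[OF M] by (metis (no_types, lifting) image_iff)
  show "lin_on (f ` carrier M) (act N g)" if "g \<in> SL2" for g
    using rm_lin[OF N that] by (rule lin_on_mono) (use ghom_in[OF f] in auto)
  show "act N (mat 1) v = v" if "v \<in> f ` carrier M" for v
    using that ghom_in[OF f] rm_one[OF N] by auto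
  show "act N (g ** h) v = act N g (act N h v)" if "g \<in> SL2" "h \<in> SL2" "v \<in> f ` carrier M" for g h v
    using that ghom_in[OF f] rm_mult[OF N] by auto
  show "orb \<lparr>carrier = f ` carrier M, act = act N\<rparr> v \<in> PF 1 (f ` carrier M)" if v: "v \<in> f ` carrier M" for v
  proof -
    obtain u where u: "u \<in> carrier M" "v = f u" using v by auto
    have "pw f (orb M u) \<in> PF 1 (f ` carrier M)"
      by (rule PF_pw[OF rm_orb[OF M u(1)] ghom_lin[OF f] rm_sub[OF M]]) simp
    moreover have "pw f (orb M u) = orb \<lparr>carrier = f ` carrier M, act = act N\<rparr> v"
      using u ghom_act[OF f _ u(1)] lin_on_zero[OF ghom_lin[OF f] rm_sub[OF M]]
      by (intro curry_eqI) (auto simp: orb_def curry_cut elim!: in_tuples_SucE)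
    ultimately show ?thesis by simp
  qed
qed

section \<open>Homogeneous cochains\<close>

text \<open>The alternating sum over all omissions of one entry: omit the head, or keep it and omit,
  with opposite sign, an entry of the tail.\<close>

fun Dl :: "('g list \<Rightarrow> 'v::ab_group_add) \<Rightarrow> 'g list \<Rightarrow> 'v" where
  "Dl f [] = 0"
| "Dl f (g # l) = f l - Dl (\<lambda>l. f (g # l)) l"

lemma Dl_add: "Dl (\<lambda>l. f l + g l) l = Dl f l + Dl g l"
  by (induction l arbitrary: f g) simp_all

lemma Dl_diff: "Dl (\<lambda>l. f l - g l) l = Dl f l - Dl g l"
  by (induction l arbitrary: f g) simp_all

lemma Dl_zero: "Dl (\<lambda>l. 0) l = 0"
  by (induction l) simp_all

lemma Dl_Dl: "Dl (Dl f) l = 0"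
  by (induction l arbitrary: f) (simp_all add: Dl_diff)

lemma Dl_map: "Dl f (map t l) = Dl (\<lambda>l. f (map t l)) l"
  by (induction l arbitrary: f) simp_all

lemma Dl_cong: "(\<And>l. l \<in> tuples m \<Longrightarrow> f l = g l) \<Longrightarrow> l \<in> tuples (Suc m) \<Longrightarrow> Dl f l = Dl g l"
proof (induction l arbitrary: f g m)
  case (Cons x l)
  show ?case
  proof (cases m)
    case 0
    then show ?thesis using Cons.prems by simp
  next
    case (Suc m')
    have "Dl (\<lambda>l. f (x # l)) l = Dl (\<lambda>l. g (x # l)) l"
      using Cons.prems Suc by (intro Cons.IH) auto
    then show ?thesis using Cons.prems by simp
  qed
qed simp

lemma Dl_in: "fs.subspace X \<Longrightarrow> (\<And>l. f l \<in> X) \<Longrightarrow> Dl f l \<in> X"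
  by (induction l arbitrary: f) (auto intro: fs.subspace_0 fs.subspace_diff)

lemma Dl_lin:
  assumes "lin_on X T" "fs.subspace X"
  shows "(\<And>l. f l \<in> X) \<Longrightarrow> Dl (\<lambda>l. T (f l)) l = T (Dl f l)"
  by (induction l arbitrary: f) (simp_all add: lin_on_zero[OF assms] lin_on_diff[OF assms] Dl_in[OF assms(2)])

lemma Dl_scale: "Dl (\<lambda>l. fscale c (f l)) l = fscale c (Dl f l)"
  by (rule Dl_lin[of UNIV]) (auto intro!: lin_onI simp: fs.scale_right_distrib mult_ac)

text \<open>\<open>dd n\<close> is the differential on functions of \<open>Suc n\<close> group elements.\<close>

definition dd :: "nat \<Rightarrow> ('k::field mat2 list \<times> 'x \<Rightarrow> 'k) \<Rightarrow> 'k mat2 list \<times> 'x \<Rightarrow> 'k" where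
  "dd n f = cut (Suc (Suc n)) (Dl (curry f))"

lemma Dl_curry_add: "Dl (curry (f + g)) l = Dl (curry f) l + Dl (curry g) l"
  using Dl_add[of "curry f" "curry g" l] by (simp add: curry_add[abs_def])

lemma Dl_curry_diff: "Dl (curry (f - g)) l = Dl (curry f) l - Dl (curry g) l"
  for f g :: "'l list \<times> 'x \<Rightarrow> 'k::field"
  using Dl_diff[of "curry f" "curry g" l] by (simp add: curry_diff[abs_def])

lemma Dl_curry_scale: "Dl (curry (fscale c f)) l = fscale c (Dl (curry f) l)"
  using Dl_scale[of c "curry f" l] by (simp add: curry_scale[abs_def])

lemma curry_dd: "curry (dd n f) l = (if l \<in> tuples (Suc (Suc n)) then Dl (curry f) l else 0)"
  by (simp add: dd_def curry_cut)

lemma dd_add: "dd n (f + g) = dd n f + dd n g"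
  by (rule curry_eqI) (simp add: curry_dd curry_simps Dl_curry_add)

lemma dd_diff: "dd n (f - g) = dd n f - dd n g"
  by (rule curry_eqI) (simp add: curry_dd curry_simps Dl_curry_diff)

lemma dd_scale: "dd n (fscale c f) = fscale c (dd n f)"
  by (rule curry_eqI) (simp add: curry_dd curry_simps Dl_curry_scale)

lemma dd_zero: "dd n 0 = 0"
  using dd_diff[of n 0 0] by simp

lemma dd_lin_on: "lin_on X (dd n)"
  by (simp add: lin_on_def dd_add dd_scale)

lemma dd_dd: "dd (Suc n) (dd n f) = 0"
proof (rule curry_eqI)
  fix l :: "'a mat2 list"
  have "Dl (curry (dd n f)) l = Dl (Dl (curry f)) l" if "l \<in> tuples (Suc (Suc (Suc n)))"
    by (rule Dl_cong[OF _ that]) (simp add: curry_dd)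
  then show "curry (dd (Suc n) (dd n f)) l = curry 0 l"
    by (simp add: curry_dd[of "Suc n"] Dl_Dl curry_simps)
qed

text \<open>On \<open>cons_elt b f\<close> the omission of the head is a substitution, and the
  remaining terms are \<open>b\<close> times the same operator in one variable fewer.\<close>

lemma PF_Dl:
  assumes "f \<in> PF m X" shows "cut (Suc m) (Dl (curry f)) \<in> PF (Suc m) X"
  using assms
proof (induction m arbitrary: f)
  case 0
  have "cut 1 (\<lambda>l. curry f []) \<in> PF 1 X"
    by (rule PF_subst[OF 0 poly_subst_Nil])
  also have "cut 1 (\<lambda>l. curry f []) = cut (Suc 0) (Dl (curry f))"
    unfolding One_nat_def by (rule cut_cong) (auto elim!: in_tuples_SucE)
  finally show ?case by simp
next
  case (Suc m)
  from Suc.prems show ?case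
  proof (induction rule: PF_Suc_induct)
    case zero
    show ?case by (simp add: curry_zero[abs_def] Dl_zero[abs_def] cut_zero PF.zero)
  next
    case (gen b f)
    have "cut (Suc (Suc m)) (\<lambda>l. curry (cons_elt b f) (tl l)) - cons_elt b (cut (Suc m) (Dl (curry f)))
        \<in> PF (Suc (Suc m)) X"
      using gen Suc.IH by (intro fs.subspace_diff PF_subspace PF_subst[OF _ poly_subst_tl] cons_elt_PF)
    also have "cut (Suc (Suc m)) (\<lambda>l. curry (cons_elt b f) (tl l)) - cons_elt b (cut (Suc m) (Dl (curry f)))
        = cut (Suc (Suc m)) (Dl (curry (cons_elt b f)))"
    proof (rule curry_eqI)
      fix l
      show "curry (cut (Suc (Suc m)) (\<lambda>l. curry (cons_elt b f) (tl l)) -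
                cons_elt b (cut (Suc m) (Dl (curry f)))) l =
          curry (cut (Suc (Suc m)) (Dl (curry (cons_elt b f)))) l"
        using coord_ring_off[OF gen(1)]
        by (cases l) (auto simp: curry_simps curry_cut Dl_scale)
    qed
    finally show ?case .
  next
    case (add f g)
    have "cut (Suc (Suc m)) (Dl (curry (f + g))) = cut (Suc (Suc m)) (Dl (curry f)) + cut (Suc (Suc m)) (Dl (curry g))"
      by (rule curry_eqI) (simp add: curry_cut curry_simps Dl_curry_add)
    then show ?case using add by (simp add: PF.add)
  qed
qed

lemma dd_PF: "f \<in> PF (Suc n) X \<Longrightarrow> dd n f \<in> PF (Suc (Suc n)) X"
  unfolding dd_def by (rule PF_Dl)

lemma dd_pw:
  assumes "f \<in> PF (Suc n) X" "lin_on X T" "fs.subspace X"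
  shows "dd n (pw T f) = pw T (dd n f)"
  by (rule curry_eqI)
     (use Dl_lin[OF assms(2,3), of "curry f"] PF_in[OF assms(1,3)] lin_on_zero[OF assms(2,3)] in
       \<open>simp add: curry_dd curry_pw[abs_def]\<close>)

text \<open>The cone construction: for a cocycle, inserting a fixed entry in front inverts the
  differential. Exactness of the standard resolution and the homotopy for relatively injective
  modules both come from it.\<close>

lemma Dl_cocycle: "Dl f (g # l) = 0 \<Longrightarrow> Dl (\<lambda>l. f (g # l)) l = f l"
  by simp

text \<open>Homogeneous cochains: degree \<open>n\<close> means \<open>n + 1\<close> group elements,
  and the group enters through equivariance only, so the differential does not mention the
  action.\<close>

definition cochains :: "nat \<Rightarrow> ('k::field, 'x) gmod \<Rightarrow> ('k mat2 list \<times> 'x \<Rightarrow> 'k) set" where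
  "cochains n M = {f \<in> PF (Suc n) (carrier M).
     \<forall>g\<in>SL2. \<forall>l\<in>tuples (Suc n). curry f (tr g l) = act M g (curry f l)}"

definition cocycles :: "nat \<Rightarrow> ('k::field, 'x) gmod \<Rightarrow> ('k mat2 list \<times> 'x \<Rightarrow> 'k) set" where
  "cocycles n M = {f \<in> cochains n M. dd n f = 0}"

fun coboundaries :: "nat \<Rightarrow> ('k::field, 'x) gmod \<Rightarrow> ('k mat2 list \<times> 'x \<Rightarrow> 'k) set" where
  "coboundaries 0 M = {0}"
| "coboundaries (Suc n) M = dd n ` cochains n M"

text \<open>\<open>coh_le n M c\<close> says that \<open>H\<^sup>n(G, M)\<close> has dimension at most \<open>c\<close>.\<close>

definition coh_le :: "nat \<Rightarrow> ('k::field, 'x) gmod \<Rightarrow> nat \<Rightarrow> bool" where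
  "coh_le n M c \<longleftrightarrow> qle (cocycles n M) (coboundaries n M) c"

lemma cochains_PF: "f \<in> cochains n M \<Longrightarrow> f \<in> PF (Suc n) (carrier M)"
  by (simp add: cochains_def)

lemma cochains_act: "f \<in> cochains n M \<Longrightarrow> g \<in> SL2 \<Longrightarrow> l \<in> tuples (Suc n) \<Longrightarrow> curry f (tr g l) = act M g (curry f l)"
  by (simp add: cochains_def)

lemma cocycles_cochains: "f \<in> cocycles n M \<Longrightarrow> f \<in> cochains n M"
  and cocycles_dd: "f \<in> cocycles n M \<Longrightarrow> dd n f = 0"
  by (simp_all add: cocycles_def)

context
  fixes M :: "('k::field, 'x) gmod"
  assumes M: "rational_module M"
begin

lemma cochains_subspace: "fs.subspace (cochains n M)"
proof (rule fs.subspaceI)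
  show "0 \<in> cochains n M"
    by (simp add: cochains_def PF.zero curry_simps rm_zero[OF M])
  show "f + g \<in> cochains n M" if "f \<in> cochains n M" "g \<in> cochains n M" for f g
    using that by (simp add: cochains_def PF.add curry_simps lin_on_add[OF rm_lin[OF M]] PF_in[of _ "Suc n", OF _ rm_sub[OF M]])
  show "fscale c f \<in> cochains n M" if "f \<in> cochains n M" for c f
    using that by (simp add: cochains_def PF_scale curry_simps lin_on_scale[OF rm_lin[OF M]] PF_in[of _ "Suc n", OF _ rm_sub[OF M]])
qed

lemma dd_cochains:
  assumes f: "f \<in> cochains n M" shows "dd n f \<in> cochains (Suc n) M"
proof -
  have "Dl (curry f) (tr g l) = act M g (Dl (curry f) l)" if "g \<in> SL2" "l \<in> tuples (Suc (Suc n))" for g l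
  proof -
    have "Dl (curry f) (tr g l) = Dl (\<lambda>l. curry f (tr g l)) l" by (rule Dl_map)
    also have "\<dots> = Dl (\<lambda>l. act M g (curry f l)) l"
      using that cochains_act[OF f] by (intro Dl_cong) auto
    also have "\<dots> = act M g (Dl (curry f) l)"
      by (intro Dl_lin[OF rm_lin[OF M that(1)] rm_sub[OF M]] PF_in[OF cochains_PF[OF f] rm_sub[OF M]])
    finally show ?thesis .
  qed
  then show ?thesis using dd_PF[OF cochains_PF[OF f]] by (simp add: cochains_def curry_dd)
qed

lemma cocycles_subspace: "fs.subspace (cocycles n M)"
proof -
  have "cocycles n M = {f \<in> cochains n M. dd n f \<in> {0}}" by (auto simp: cocycles_def)
  then show ?thesis
    using lin_on_subspace_vimage[OF dd_lin_on[of "cochains n M" n] cochains_subspace, of "{0}"] by simp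
qed

lemma coboundaries_subspace: "fs.subspace (coboundaries n M)"
  by (cases n) (auto intro!: lin_on_subspace_image[OF dd_lin_on] cochains_subspace)

lemma coboundaries_cocycles: "coboundaries n M \<subseteq> cocycles n M"
  using fs.subspace_0[OF cochains_subspace]
  by (cases n) (auto simp: cocycles_def dd_zero dd_dd dd_cochains)

end

lemma pw_cochains:
  assumes M: "rational_module M" and T: "ghom M N T" and f: "f \<in> cochains n M"
  shows "pw T f \<in> cochains n N" and "dd n (pw T f) = pw T (dd n f)"
proof -
  have PF: "f \<in> PF (Suc n) (carrier M)" using f by (rule cochains_PF)
  have "pw T f \<in> PF (Suc n) (carrier N)"
    using T by (intro PF_pw[OF PF _ rm_sub[OF M]]) (auto simp: ghom_def)
  then show "pw T f \<in> cochains n N"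
    using cochains_act[OF f] PF_in[OF PF rm_sub[OF M]] by (simp add: cochains_def ghom_act[OF T])
  show "dd n (pw T f) = pw T (dd n f)"
    by (rule dd_pw[OF PF ghom_lin[OF T] rm_sub[OF M]])
qed

lemma pw_0: "ghom M N T \<Longrightarrow> rational_module M \<Longrightarrow> pw T 0 = 0"
  by (rule curry_eqI) (simp add: curry_simps lin_on_zero[OF ghom_lin rm_sub])

lemma pw_cocycles:
  assumes M: "rational_module M" and T: "ghom M N T" and f: "f \<in> cocycles n M"
  shows "pw T f \<in> cocycles n N"
  using pw_cochains[OF M T cocycles_cochains[OF f]] cocycles_dd[OF f] pw_0[OF T M] by (simp add: cocycles_def)

lemma pw_coboundaries:
  assumes M: "rational_module M" and T: "ghom M N T" and f: "f \<in> coboundaries n M"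
  shows "pw T f \<in> coboundaries n N"
proof (cases n)
  case (Suc m)
  then obtain h where h: "h \<in> cochains m M" "f = dd m h" using f by auto
  then show ?thesis using pw_cochains[OF M T h(1)] Suc by (metis coboundaries.simps(2) image_eqI)
qed (use f pw_0[OF T M] in auto)

lemma pw_lin_on_cochains:
  assumes "rational_module M" "ghom M N T" shows "lin_on (cochains n M) (pw T)"
  by (rule lin_on_mono[OF pw_lin_on[OF ghom_lin[OF assms(2)] rm_sub[OF assms(1)]]])
     (auto intro: cochains_PF)

text \<open>Invariant cochains are determined by their values on tuples starting with the identity.\<close>

lemma cochain_extend:
  assumes M: "rational_module M" and f: "f \<in> PF n (carrier M)"
  defines "F \<equiv> cut (Suc n) (\<lambda>l. act M (hd l) (curry f (tr (adj2 (hd l)) (tl l))))"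
  shows "F \<in> cochains n M" and "\<And>l. l \<in> tuples n \<Longrightarrow> curry F (mat 1 # l) = curry f l"
proof -
  let ?F = "cut (Suc n) (\<lambda>l. curry f (tr (adj2 (hd l)) (tl l)))"
  have "?F \<in> PF (Suc n) (carrier M)"
    by (intro PF_subst[OF f] poly_subst_tr poly_map_adj2 poly_map_hd poly_subst_tl)
  from PF_act[OF M this poly_map_hd]
  have "F \<in> PF (Suc n) (carrier M)"
    unfolding F_def by (rule back_subst[of "\<lambda>x. x \<in> _"]) (rule cut_cong, simp add: curry_cut)
  moreover have "curry F (tr g l) = act M g (curry F l)" if "g \<in> SL2" "l \<in> tuples (Suc n)" for g l
    using that PF_in[OF f rm_sub[OF M]]
    by (auto elim!: in_tuples_SucE
        simp: F_def curry_cut rm_mult[OF M] adj2_mult matrix_mul_assoc[symmetric] adj2_cancel_left comp_def)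
  ultimately show "F \<in> cochains n M" by (simp add: cochains_def)
  show "curry F (mat 1 # l) = curry f l" if "l \<in> tuples n" for l
    using that PF_in[OF f rm_sub[OF M]] by (simp add: F_def curry_cut rm_one[OF M])
qed

text \<open>Surjectivity survives on cochains because an equivariant function amounts to an
  arbitrary polynomial function of the remaining \<open>n\<close> entries. Such functions are sums
  of \<open>p w\<close>, which lift by lifting \<open>w\<close>, and \<open>cochain_extend\<close>
  restores equivariance.\<close>

lemma cochain_lift:
  assumes M: "rational_module M" and N: "rational_module N" and T: "ghom M N T"
    and surj: "T ` carrier M = carrier N" and f: "f \<in> cochains n N"
  shows "\<exists>h\<in>cochains n M. pw T h = f"
proof -
  have lift: "\<exists>h\<in>PF m (carrier M). pw T h = f" if "f \<in> PF m (carrier N)" for m f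
    using that
  proof (induction rule: PF.induct)
    case zero
    then show ?case using pw_0[OF T M] PF.zero by blast
  next
    case (gen p w)
    then obtain v where v: "v \<in> carrier M" "w = T v" using surj by auto
    have "pw T (elt m p v) = elt m p w"
      by (rule curry_eqI)
         (simp add: v curry_elt lin_on_scale[OF ghom_lin[OF T]] lin_on_zero[OF ghom_lin[OF T] rm_sub[OF M]])
    then show ?case using v gen PF.gen by blast
  next
    case (add f g)
    then obtain f' g' where fg: "f' \<in> PF m (carrier M)" "g' \<in> PF m (carrier M)" "pw T f' = f" "pw T g' = g"
      by blast
    then have "pw T (f' + g') = f + g"
      using pw_add[OF fg(1,2) ghom_lin[OF T] rm_sub[OF M]] by simp
    then show ?case using fg PF.add by blast
  qed
  have id: "poly_subst n (Suc n) (\<lambda>l. mat 1 # l)"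
    by (intro poly_subst_Cons poly_map_const poly_subst_id SL2_one)
  obtain h where h: "h \<in> PF n (carrier M)" "pw T h = cut n (\<lambda>l. curry f (mat 1 # l))"
    using lift[OF PF_subst[OF cochains_PF[OF f] id]] by blast
  let ?H = "cut (Suc n) (\<lambda>l. act M (hd l) (curry h (tr (adj2 (hd l)) (tl l))))"
  have H: "?H \<in> cochains n M" by (rule cochain_extend[OF M h(1)])
  have hv: "T (curry h l) = curry f (mat 1 # l)" if "l \<in> tuples n" for l
    using arg_cong[OF h(2), of "\<lambda>F. curry F l"] that by (simp add: curry_cut)
  have "pw T ?H = f"
  proof (rule PF_eqI)
    show "pw T ?H \<in> PF (Suc n) (carrier N)" "f \<in> PF (Suc n) (carrier N)"
      using pw_cochains(1)[OF M T H] f by (auto intro: cochains_PF)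
    fix l :: "'a mat2 list" assume "l \<in> tuples (Suc n)"
    then obtain g l' where l: "l = g # l'" "g \<in> SL2" "l' \<in> tuples n" by (auto elim: in_tuples_SucE)
    have "T (act M g (curry h (tr (adj2 g) l'))) = act N g (curry f (mat 1 # tr (adj2 g) l'))"
      using l PF_in[OF h(1) rm_sub[OF M]] by (simp add: ghom_act[OF T] hv)
    also have "\<dots> = curry f (tr g (mat 1 # tr (adj2 g) l'))"
      using l by (intro cochains_act[OF f, symmetric]) auto
    also have "tr g (mat 1 # tr (adj2 g) l') = l" using l tr_adj2(1)[of g l'] by simp
    finally show "curry (pw T ?H) l = curry f l" using l by (simp add: curry_cut)
  qed
  then show ?thesis using H by blast
qed

lemma coh_le_mono: "coh_le n M c \<Longrightarrow> c \<le> d \<Longrightarrow> coh_le n M d"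
  unfolding coh_le_def by (rule qle_mono) auto

lemma coh_retract:
  assumes X: "rational_module X" and Y: "rational_module Y"
    and i: "ghom X Y i" and p: "ghom Y X p" and pi: "\<And>v. v \<in> carrier X \<Longrightarrow> p (i v) = v"
    and Yc: "coh_le n Y c"
  shows "coh_le n X c"
proof -
  have "qle (cocycles n X) {z \<in> cocycles n X. pw i z \<in> coboundaries n Y} c"
    using Yc pw_cocycles[OF X i] unfolding coh_le_def
    by (intro qle_vimage[OF _ cocycles_subspace[OF X] coboundaries_subspace[OF Y]])
       (auto intro: lin_on_mono[OF pw_lin_on_cochains[OF X i]] simp: cocycles_def)
  then show ?thesis unfolding coh_le_def
  proof (rule qle_mono)
    show "{z \<in> cocycles n X. pw i z \<in> coboundaries n Y} \<subseteq> coboundaries n X"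
    proof safe
      fix z assume z: "z \<in> cocycles n X" "pw i z \<in> coboundaries n Y"
      have "pw p (pw i z) = z"
        using PF_in[OF cochains_PF[OF cocycles_cochains[OF z(1)]] rm_sub[OF X]]
        by (intro curry_eqI) (simp add: pi)
      then show "z \<in> coboundaries n X" using pw_coboundaries[OF Y p z(2)] by simp
    qed
  qed simp
qed

section \<open>Short exact sequences\<close>

locale ses =
  fixes N :: "('k::field, 'x) gmod" and J :: "('k, 'y) gmod" and Q :: "('k, 'z) gmod"
    and e :: "('x \<Rightarrow> 'k) \<Rightarrow> 'y \<Rightarrow> 'k" and p :: "('y \<Rightarrow> 'k) \<Rightarrow> 'z \<Rightarrow> 'k"
  assumes N: "rational_module N" and J: "rational_module J" and Q: "rational_module Q"
    and e: "ghom N J e" and p: "ghom J Q p"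
    and inj: "inj_on e (carrier N)" and exact: "e ` carrier N = {v \<in> carrier J. p v = 0}"
    and surj: "p ` carrier J = carrier Q"
begin

lemma cochain_kernel:
  assumes f: "f \<in> cochains n J" and 0: "pw p f = 0"
  shows "pw (the_inv_into (carrier N) e) f \<in> cochains n N"
    and "pw e (pw (the_inv_into (carrier N) e) f) = f"
proof -
  let ?i = "the_inv_into (carrier N) e"
  note PFf = cochains_PF[OF f]
  have val: "curry f l \<in> e ` carrier N" for l
  proof -
    have "p (curry f l) = 0" using arg_cong[OF 0, of "\<lambda>F. curry F l"] by (simp add: curry_simps)
    then show ?thesis using exact PF_in[OF PFf rm_sub[OF J]] by auto
  qed
  have sub: "fs.subspace (e ` carrier N)"
    by (rule lin_on_subspace_image[OF ghom_lin[OF e] rm_sub[OF N]])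
  have "f \<in> PF (Suc n) (e ` carrier N)" by (rule PF_restrict[OF PFf sub val])
  then have "pw ?i f \<in> PF (Suc n) (carrier N)"
    by (rule PF_pw[OF _ lin_on_the_inv[OF ghom_lin[OF e] rm_sub[OF N] inj] sub])
       (use the_inv_into_into[OF inj _ order.refl] in auto)
  moreover have "?i (curry f (tr g l)) = act N g (?i (curry f l))" if gl: "g \<in> SL2" "l \<in> tuples (Suc n)" for g l
  proof -
    obtain v where v: "v \<in> carrier N" "curry f l = e v" using val by blast
    have "curry f (tr g l) = e (act N g v)"
      using cochains_act[OF f gl] v by (simp add: ghom_act[OF e gl(1)])
    then show ?thesis using v by (simp add: the_inv_into_f_f[OF inj] rm_act[OF N gl(1)])
  qed
  ultimately show "pw ?i f \<in> cochains n N" by (simp add: cochains_def)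
  show "pw e (pw ?i f) = f"
    by (rule curry_eqI) (simp add: f_the_inv_into_f[OF inj val])
qed

lemma pw_e_inv: "f \<in> cochains n N \<Longrightarrow> pw (the_inv_into (carrier N) e) (pw e f) = f"
  using PF_in[OF cochains_PF rm_sub[OF N], of f n]
  by (intro curry_eqI) (simp add: the_inv_into_f_f[OF inj])

lemma pw_p_e: "f \<in> cochains n N \<Longrightarrow> pw p (pw e f) = 0"
  using PF_in[OF cochains_PF rm_sub[OF N], of f n] exact
  by (intro curry_eqI) (auto simp: curry_simps)

text \<open>Cochains of \<open>J\<close> whose image in \<open>Q\<close> is a cocycle. The
  connecting map is defined on this space of lifts, where it is an honest linear map without
  choices.\<close>

definition conn_dom :: "nat \<Rightarrow> ('k mat2 list \<times> 'y \<Rightarrow> 'k) set" where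
  "conn_dom n = {h \<in> cochains n J. pw p (dd n h) = 0}"

definition conn :: "nat \<Rightarrow> ('k mat2 list \<times> 'y \<Rightarrow> 'k) \<Rightarrow> 'k mat2 list \<times> 'x \<Rightarrow> 'k" where
  "conn n h = pw (the_inv_into (carrier N) e) (dd n h)"

text \<open>The kernel of the connecting homomorphism, seen inside the cocycles of \<open>Q\<close>:
  coboundaries together with the classes coming from \<open>J\<close>.\<close>

definition cob_sum :: "nat \<Rightarrow> ('k mat2 list \<times> 'z \<Rightarrow> 'k) set" where
  "cob_sum n = {x + y | x y. x \<in> coboundaries n Q \<and> y \<in> pw p ` cocycles n J}"

lemma pw_p_lin: "lin_on (cochains n J) (pw p)"
  by (rule pw_lin_on_cochains[OF J p])

lemma cob_sum_subspace: "fs.subspace (cob_sum n)"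
  unfolding cob_sum_def
  by (intro fs.subspace_sums coboundaries_subspace[OF Q] lin_on_subspace_image cocycles_subspace[OF J]
      lin_on_mono[OF pw_p_lin]) (auto simp: cocycles_def)

lemma conn_dom_subspace: "fs.subspace (conn_dom n)"
proof -
  have "lin_on (cochains n J) (\<lambda>h. pw p (dd n h))"
    by (rule lin_on_comp[OF dd_lin_on pw_p_lin[of "Suc n"]]) (use dd_cochains[OF J] in blast)
  from lin_on_subspace_vimage[OF this cochains_subspace[OF J] fs.subspace_single_0]
  show ?thesis by (simp add: conn_dom_def)
qed

lemma e_conn: "h \<in> conn_dom n \<Longrightarrow> conn n h \<in> cochains (Suc n) N"
    "h \<in> conn_dom n \<Longrightarrow> pw e (conn n h) = dd n h"
  using cochain_kernel[OF dd_cochains[OF J]] by (auto simp: conn_dom_def conn_def)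

lemma pw_e_inj:
  assumes "f \<in> cochains n N" "g \<in> cochains n N" "pw e f = pw e g" shows "f = g"
  using pw_e_inv[OF assms(1)] pw_e_inv[OF assms(2)] unfolding assms(3) by (rule trans[OF sym])

lemma conn_cocycle: assumes "h \<in> conn_dom n" shows "conn n h \<in> cocycles (Suc n) N"
proof -
  have "pw e (dd (Suc n) (conn n h)) = dd (Suc n) (dd n h)"
    using pw_cochains(2)[OF N e e_conn(1)[OF assms]] e_conn(2)[OF assms] by simp
  also have "\<dots> = pw e 0" by (simp add: dd_dd pw_0[OF e N])
  finally have "dd (Suc n) (conn n h) = 0"
    by (rule pw_e_inj[OF dd_cochains[OF N e_conn(1)[OF assms]] fs.subspace_0[OF cochains_subspace[OF N]]])
  then show ?thesis using e_conn(1)[OF assms] by (simp add: cocycles_def)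
qed

lemma conn_lin: "lin_on (conn_dom n) (conn n)"
proof (rule lin_onI)
  fix v w assume vw: "v \<in> conn_dom n" "w \<in> conn_dom n"
  show "conn n (v + w) = conn n v + conn n w"
  proof (rule pw_e_inj)
    show "conn n (v + w) \<in> cochains (Suc n) N"
      using vw by (intro e_conn fs.subspace_add[OF conn_dom_subspace])
    show "conn n v + conn n w \<in> cochains (Suc n) N"
      using vw by (intro e_conn fs.subspace_add[OF cochains_subspace[OF N]])
    show "pw e (conn n (v + w)) = pw e (conn n v + conn n w)"
      using vw by (simp add: e_conn fs.subspace_add[OF conn_dom_subspace] dd_add
          lin_on_add[OF pw_lin_on_cochains[OF N e], of _ "Suc n"])
  qed
next
  fix c v assume v: "v \<in> conn_dom n"
  show "conn n (fscale c v) = fscale c (conn n v)"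
  proof (rule pw_e_inj)
    show "conn n (fscale c v) \<in> cochains (Suc n) N"
      using v by (intro e_conn fs.subspace_scale[OF conn_dom_subspace])
    show "fscale c (conn n v) \<in> cochains (Suc n) N"
      using v by (intro e_conn fs.subspace_scale[OF cochains_subspace[OF N]])
    show "pw e (conn n (fscale c v)) = pw e (fscale c (conn n v))"
      using v by (simp add: e_conn fs.subspace_scale[OF conn_dom_subspace] dd_scale
          lin_on_scale[OF pw_lin_on_cochains[OF N e], of _ "Suc n"])
  qed
qed

lemma p_conn_dom: "pw p ` conn_dom n = cocycles n Q"
proof
  show "pw p ` conn_dom n \<subseteq> cocycles n Q"
    using pw_cochains[OF J p] by (auto simp: conn_dom_def cocycles_def)
  show "cocycles n Q \<subseteq> pw p ` conn_dom n"
  proof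
    fix z assume z: "z \<in> cocycles n Q"
    then obtain h where h: "h \<in> cochains n J" "pw p h = z"
      using cochain_lift[OF J Q p surj] cocycles_cochains by blast
    then show "z \<in> pw p ` conn_dom n"
      using pw_cochains(2)[OF J p h(1)] cocycles_dd[OF z] by (auto simp: conn_dom_def)
  qed
qed

text \<open>A cochain bounding in \<open>Q\<close> lifts to \<open>J\<close>, so after subtracting a
  coboundary and a cocycle of \<open>J\<close> from \<open>h\<close>, which changes
  \<open>dd n h\<close> in no way, the remainder comes from a cochain of \<open>N\<close>.\<close>

lemma conn_coboundary:
  assumes h: "h \<in> conn_dom n" and "pw p h \<in> cob_sum n"
  shows "conn n h \<in> coboundaries (Suc n) N"
proof -
  obtain x z where xz: "x \<in> coboundaries n Q" "z \<in> cocycles n J" "pw p h = x + pw p z"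
    using assms(2) by (auto simp: cob_sum_def)
  obtain x' where x': "x' \<in> coboundaries n J" "pw p x' = x"
  proof (cases n)
    case 0
    then show ?thesis using xz(1) that pw_0[OF p J] by auto
  next
    case (Suc m)
    then obtain w where w: "w \<in> cochains m Q" "x = dd m w" using xz(1) by auto
    obtain w' where "w' \<in> cochains m J" "pw p w' = w"
      using cochain_lift[OF J Q p surj w(1)] by blast
    then show ?thesis using that[of "dd m w'"] w Suc pw_cochains(2)[OF J p] by auto
  qed
  have x'c: "x' \<in> cocycles n J" using x' coboundaries_cocycles[OF J] by blast
  have hc: "h \<in> cochains n J" using h by (simp add: conn_dom_def)
  let ?y = "h - x' - z"
  have y: "?y \<in> cochains n J"
    by (intro fs.subspace_diff[OF cochains_subspace[OF J]] hc cocycles_cochains[OF x'c] cocycles_cochains[OF xz(2)])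
  have sub: "h - x' \<in> cochains n J"
    by (intro fs.subspace_diff[OF cochains_subspace[OF J]] hc cocycles_cochains[OF x'c])
  have "pw p ?y = pw p h - pw p x' - pw p z"
    using lin_on_diff[OF pw_p_lin cochains_subspace[OF J] sub cocycles_cochains[OF xz(2)]]
      lin_on_diff[OF pw_p_lin cochains_subspace[OF J] hc cocycles_cochains[OF x'c]] by simp
  then have "pw p ?y = 0" using x' xz by simp
  note k = cochain_kernel[OF y this]
  let ?k = "pw (the_inv_into (carrier N) e) ?y"
  have "pw e (dd n ?k) = dd n ?y"
    using pw_cochains(2)[OF N e k(1)] k(2) by simp
  also have "\<dots> = dd n h" using xz x'c by (simp add: dd_diff cocycles_dd)
  also have "\<dots> = pw e (conn n h)" by (rule e_conn(2)[OF h, symmetric])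
  finally have "dd n ?k = conn n h"
    by (rule pw_e_inj[OF dd_cochains[OF N k(1)] e_conn(1)[OF h]])
  then show ?thesis using k(1) by (metis coboundaries.simps(2) image_eqI)
qed

lemma conn_coboundary_conv:
  assumes h: "h \<in> conn_dom n" and "conn n h \<in> coboundaries (Suc n) N"
  shows "pw p h \<in> cob_sum n"
proof -
  obtain y where y: "y \<in> cochains n N" "conn n h = dd n y" using assms(2) by auto
  have hc: "h \<in> cochains n J" using h by (simp add: conn_dom_def)
  have ey: "pw e y \<in> cochains n J" by (rule pw_cochains(1)[OF N e y(1)])
  have "dd n (h - pw e y) = 0"
    using e_conn(2)[OF h] y pw_cochains(2)[OF N e y(1)] by (simp add: dd_diff)
  then have c: "h - pw e y \<in> cocycles n J"
    using fs.subspace_diff[OF cochains_subspace[OF J] hc ey] by (simp add: cocycles_def)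
  have "pw p h = 0 + pw p (h - pw e y)"
    using lin_on_diff[OF pw_p_lin cochains_subspace[OF J] hc ey] pw_p_e[OF y(1)] by simp
  then show ?thesis
    unfolding cob_sum_def using c fs.subspace_0[OF coboundaries_subspace[OF Q]] by blast
qed

text \<open>Classes of \<open>N\<close> split into their image in the cohomology of
  \<open>J\<close>, bounded by \<open>c1\<close>, and the kernel \<open>?K\<close> of that map,
  which is the image of the connecting map.\<close>

lemma les_le:
  assumes J1: "coh_le (Suc n) J c1" and Q1: "qle (cocycles n Q) (cob_sum n) c2"
  shows "coh_le (Suc n) N (c1 + c2)"
proof -
  let ?K = "{z \<in> cocycles (Suc n) N. pw e z \<in> coboundaries (Suc n) J}"
  have "qle (cocycles (Suc n) N) ?K c1"
    using J1 pw_cocycles[OF N e] unfolding coh_le_def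
    by (intro qle_vimage[OF _ cocycles_subspace[OF N] coboundaries_subspace[OF J]])
       (auto intro: lin_on_mono[OF pw_lin_on_cochains[OF N e]] simp: cocycles_def simp del: coboundaries.simps)
  moreover have "qle (conn_dom n) {h \<in> conn_dom n. pw p h \<in> cob_sum n} c2"
    using p_conn_dom
    by (intro qle_vimage[OF _ conn_dom_subspace cob_sum_subspace Q1])
       (auto intro: lin_on_mono[OF pw_p_lin] simp: conn_dom_def)
  then have "qle ?K (coboundaries (Suc n) N) c2"
  proof (rule qle_image[OF _ conn_lin conn_dom_subspace])
    show "{h \<in> conn_dom n. pw p h \<in> cob_sum n} \<subseteq> conn_dom n" by blast
    show "conn n ` {h \<in> conn_dom n. pw p h \<in> cob_sum n} \<subseteq> coboundaries (Suc n) N"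
      using conn_coboundary by blast
    show "?K = conn n ` conn_dom n"
    proof (intro subset_antisym subsetI)
      fix z assume "z \<in> ?K"
      then obtain h where h: "h \<in> cochains n J" "pw e z = dd n h" and z: "z \<in> cocycles (Suc n) N" by auto
      then have "h \<in> conn_dom n" using pw_p_e[OF cocycles_cochains[OF z]] by (simp add: conn_dom_def)
      moreover have "conn n h = z" using h pw_e_inv[OF cocycles_cochains[OF z]] by (simp add: conn_def)
      ultimately show "z \<in> conn n ` conn_dom n" by blast
    next
      fix z assume "z \<in> conn n ` conn_dom n"
      then obtain h where h: "h \<in> conn_dom n" "z = conn n h" by blast
      then show "z \<in> ?K" using conn_cocycle[OF h(1)] e_conn(2)[OF h(1)] by (auto simp: conn_dom_def)
    qed
  qed
  ultimately show ?thesis unfolding coh_le_def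
    by (rule qle_trans) auto
qed

text \<open>Injectivity of the connecting map modulo \<open>cob_sum n\<close>. With
  \<open>les_le\<close> it turns dimension shifting over an acyclic \<open>J\<close> into an
  equivalence.\<close>

lemma les_le_conv:
  assumes N1: "coh_le (Suc n) N c" shows "qle (cocycles n Q) (cob_sum n) c"
proof -
  have "qle (conn_dom n) {h \<in> conn_dom n. conn n h \<in> coboundaries (Suc n) N} c"
    using conn_cocycle
    by (intro qle_vimage[OF conn_lin conn_dom_subspace coboundaries_subspace[OF N] N1[unfolded coh_le_def]]) auto
  then show ?thesis
  proof (rule qle_image[OF _ _ conn_dom_subspace])
    show "lin_on (conn_dom n) (pw p)"
      by (rule lin_on_mono[OF pw_p_lin]) (auto simp: conn_dom_def)
    show "pw p ` {h \<in> conn_dom n. conn n h \<in> coboundaries (Suc n) N} \<subseteq> cob_sum n"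
      using conn_coboundary_conv by blast
    show "cocycles n Q = pw p ` conn_dom n" by (rule p_conn_dom[symmetric])
  qed auto
qed

lemma les_bound:
  assumes "coh_le (Suc n) J c1" "coh_le n Q c2"
  shows "coh_le (Suc n) N (c1 + c2)"
proof (rule les_le[OF assms(1)])
  show "qle (cocycles n Q) (cob_sum n) c2"
    using assms(2) unfolding coh_le_def
  proof (rule qle_mono)
    show "coboundaries n Q \<subseteq> cob_sum n"
    proof
      fix x assume "x \<in> coboundaries n Q"
      moreover have "0 \<in> pw p ` cocycles n J"
        using fs.subspace_0[OF cocycles_subspace[OF J]] pw_0[OF p J] by (metis image_eqI)
      ultimately show "x \<in> cob_sum n" unfolding cob_sum_def by (metis (mono_tags, lifting) CollectI add.right_neutral)
    qed
  qed simp
qed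

end

section \<open>The standard resolution and relative injectivity\<close>

text \<open>The module \<open>k[G^(n+1)] \<otimes> M\<close> with diagonal action; its invariants
  are the cochains of degree \<open>n\<close>.\<close>

definition Std :: "nat \<Rightarrow> ('k::field, 'x) gmod \<Rightarrow> ('k, 'k mat2 list \<times> 'x) gmod" where
  "Std n M = \<lparr>carrier = PF (Suc n) (carrier M),
     act = (\<lambda>g f. case_prod (\<lambda>l. act M g (curry f (tr (adj2 g) l))))\<rparr>"

definition cst :: "('x \<Rightarrow> 'k::field) \<Rightarrow> 'k mat2 list \<times> 'x \<Rightarrow> 'k" where
  "cst v = cut 1 (\<lambda>_. v)"

lemma carrier_Std: "carrier (Std n M) = PF (Suc n) (carrier M)"
  by (simp add: Std_def)

lemma curry_act_Std: "curry (act (Std n M) g f) l = act M g (curry f (tr (adj2 g) l))"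
  by (simp add: Std_def)

lemma curry_cst: "curry (cst v) [g] = (if g \<in> SL2 then v else 0)"
  by (simp add: cst_def curry_cut)

lemma cst_PF: "v \<in> X \<Longrightarrow> cst v \<in> PF 1 X"
  using cut_elt[OF LP.const[of 1], of v X 1] by (simp add: cst_def)

lemma cst_add: "cst (v + w) = cst v + cst w"
  by (simp add: cst_def cut_add)

lemma cst_scale: "cst (fscale c v) = fscale c (cst v)"
  by (simp add: cst_def cut_scale)

lemma lin_on_cst: "lin_on X cst"
  by (simp add: lin_on_def cst_add cst_scale)

lemma act_Std_cut:
  assumes "rational_module M" "g \<in> SL2" "f \<in> PF (Suc n) (carrier M)"
  shows "act (Std n M) g f = cut (Suc n) (\<lambda>l. act M g (curry f (tr (adj2 g) l)))"
  by (rule curry_eqI)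
     (use assms PF_off[OF assms(3)] in \<open>auto simp: curry_act_Std curry_cut rm_zero\<close>)

lemma PF_cut_tr:
  assumes "f \<in> PF n X" "g \<in> SL2" shows "cut n (\<lambda>l. curry f (tr g l)) \<in> PF n X"
  using PF_subst[OF assms(1) poly_subst_tr[OF poly_map_const[OF assms(2)] poly_subst_id]] .

lemma rational_Std:
  assumes M: "rational_module M" shows "rational_module (Std n M)"
proof (rule rational_moduleI, unfold carrier_Std)
  show "fs.subspace (PF (Suc n) (carrier M))" by simp
  show act: "act (Std n M) g f \<in> PF (Suc n) (carrier M)" if "g \<in> SL2" "f \<in> PF (Suc n) (carrier M)" for g f
  proof -
    have "cut (Suc n) (\<lambda>l. curry f (tr (adj2 g) l)) \<in> PF (Suc n) (carrier M)"
      using that by (intro PF_cut_tr) auto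
    from PF_act[OF M this poly_map_const[OF that(1)]]
    show ?thesis unfolding act_Std_cut[OF M that]
      by (rule back_subst[of "\<lambda>x. x \<in> _"]) (rule cut_cong, simp add: curry_cut)
  qed
  show "lin_on (PF (Suc n) (carrier M)) (act (Std n M) g)" if "g \<in> SL2" for g
    by (intro lin_onI curry_eqI)
       (simp_all add: curry_act_Std curry_simps PF_in[of _ "Suc n", OF _ rm_sub[OF M]]
          lin_on_add[OF rm_lin[OF M that]] lin_on_scale[OF rm_lin[OF M that]])
  show "act (Std n M) (mat 1) f = f" if "f \<in> PF (Suc n) (carrier M)" for f
    by (rule curry_eqI) (simp add: curry_act_Std rm_one[OF M] PF_in[OF that rm_sub[OF M]])
  show "act (Std n M) (g ** h) f = act (Std n M) g (act (Std n M) h f)"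
    if "g \<in> SL2" "h \<in> SL2" "f \<in> PF (Suc n) (carrier M)" for g h f
    by (rule curry_eqI)
       (simp add: curry_act_Std rm_mult[OF M that(1,2)] PF_in[OF that(3) rm_sub[OF M]] adj2_mult
          matrix_mul_assoc comp_def)
  show "orb (Std n M) f \<in> PF 1 (PF (Suc n) (carrier M))" if f: "f \<in> PF (Suc n) (carrier M)" for f
  proof -
    have "cut (Suc (Suc n)) (\<lambda>l. curry f (tr (adj2 (hd l)) (tl l))) \<in> PF (Suc (Suc n)) (carrier M)"
      by (intro PF_subst[OF f] poly_subst_tr poly_map_adj2 poly_map_hd poly_subst_tl)
    from split1_PF[OF PF_act[OF M this poly_map_hd]]
    show ?thesis
    proof (rule back_subst[of "\<lambda>x. x \<in> _"], unfold split1_def orb_def, intro cut_cong)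
      fix l' :: "'a mat2 list" assume "l' \<in> tuples 1"
      then obtain g where g: "g \<in> SL2" "l' = [g]" by (auto elim!: in_tuples_SucE)
      show "cut (Suc n) (\<lambda>l. curry (cut (Suc (Suc n)) (\<lambda>l. act M (hd l)
              (curry (cut (Suc (Suc n)) (\<lambda>l. curry f (tr (adj2 (hd l)) (tl l)))) l))) (hd l' # l)) =
            act (Std n M) (hd l') f"
        using act_Std_cut[OF M g(1) f] g by (auto intro!: cut_cong simp: curry_cut)
    qed
  qed
qed

text \<open>The module is an equivariant retract of \<open>k[G] \<otimes> Y\<close> along the
  constant functions. A retraction can be written down explicitly, and it suffices for
  acyclicity.\<close>

definition rel_inj :: "('k::field, 'x) gmod \<Rightarrow> bool" where
  "rel_inj Y \<longleftrightarrow> rational_module Y \<and>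
     (\<exists>r. ghom (Std 0 Y) Y r \<and> (\<forall>v\<in>carrier Y. r (cst v) = v))"

definition acyclic :: "('k::field, 'x) gmod \<Rightarrow> bool" where
  "acyclic Y \<longleftrightarrow> (\<forall>n. coh_le (Suc n) Y 0)"

lemma acyclic_iff: "rational_module Y \<Longrightarrow> acyclic Y \<longleftrightarrow> (\<forall>n. cocycles (Suc n) Y \<subseteq> coboundaries (Suc n) Y)"
  unfolding acyclic_def coh_le_def using qle_0[OF coboundaries_subspace] by blast

text \<open>The retraction \<open>r\<close> integrates out the first variable of a cocycle
  \<open>z\<close> and gives a primitive: by the cocycle identity the differential of the slices of
  \<open>z\<close> at \<open>l\<close> is the constant function with value \<open>z\<close> at
  \<open>l\<close>, which \<open>r\<close> sends back to that value.\<close>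

lemma rel_inj_acyclic:
  assumes "rel_inj Y" shows "acyclic Y"
proof -
  have Y: "rational_module Y" using assms by (simp add: rel_inj_def)
  obtain r where r: "ghom (Std 0 Y) Y r" "\<And>v. v \<in> carrier Y \<Longrightarrow> r (cst v) = v"
    using assms by (auto simp: rel_inj_def)
  have rl: "lin_on (PF 1 (carrier Y)) r" using ghom_lin[OF r(1)] by (simp add: carrier_Std)
  have "z \<in> coboundaries (Suc n) Y" if z: "z \<in> cocycles (Suc n) Y" for n z
  proof -
    note zc = cocycles_cochains[OF z]
    note zPF = cochains_PF[OF zc]
    \<comment> \<open>Needed at every list, since \<open>Dl_lin\<close> requires membership also off
      \<open>tuples\<close>.\<close>
    have slice: "slice z l \<in> PF 1 (carrier Y)" for l
    proof (cases "l \<in> tuples (Suc n)")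
      case True then show ?thesis by (rule slice_PF[OF zPF])
    next
      case False
      then have "slice z l = 0" unfolding slice_def
        using PF_off[OF zPF] by (intro curry_eqI) (auto simp: curry_cut curry_simps elim!: in_tuples_SucE)
      then show ?thesis by (simp add: PF.zero)
    qed
    let ?h = "cut (Suc n) (\<lambda>l. r (slice z l))"
    have "?h \<in> PF (Suc n) (carrier Y)"
      using ghom_in[OF r(1)] by (intro PF_slice_map[OF zPF rm_sub[OF Y] rl]) (auto simp: carrier_Std)
    moreover have "r (slice z (tr g l)) = act Y g (r (slice z l))" if gl: "g \<in> SL2" "l \<in> tuples (Suc n)" for g l
    proof -
      have "slice z (tr g l) = act (Std 0 Y) g (slice z l)"
      proof (rule PF_eqI[of _ 1 "carrier Y" _ "carrier Y"])
        show "slice z (tr g l) \<in> PF 1 (carrier Y)" by (rule slice)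
        show "act (Std 0 Y) g (slice z l) \<in> PF 1 (carrier Y)"
          using rm_act[OF rational_Std[OF Y, of 0] gl(1)] slice by (simp add: carrier_Std)
        fix l' :: "'a mat2 list" assume "l' \<in> tuples 1"
        then obtain x where x: "x \<in> SL2" "l' = [x]" by (auto elim!: in_tuples_SucE)
        have "curry z (x # tr g l) = curry z (tr g ((adj2 g ** x) # l))"
          using gl x by (simp add: adj2_cancel_left)
        also have "\<dots> = act Y g (curry z ((adj2 g ** x) # l))"
          using gl x by (intro cochains_act[OF zc]) auto
        finally show "curry (slice z (tr g l)) l' = curry (act (Std 0 Y) g (slice z l)) l'"
          using x gl by (simp add: curry_act_Std curry_slice)
      qed
      then show ?thesis using slice by (simp add: ghom_act[OF r(1) gl(1)] carrier_Std)
    qed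
    ultimately have h: "?h \<in> cochains n Y" by (simp add: cochains_def curry_cut)
    have "dd n ?h = z"
    proof (rule PF_eqI[OF dd_PF[OF cochains_PF[OF h]] zPF])
      fix l :: "'a mat2 list" assume l: "l \<in> tuples (Suc (Suc n))"
      have "Dl (curry ?h) l = Dl (\<lambda>l. r (slice z l)) l"
        by (rule Dl_cong[OF _ l]) (simp add: curry_cut)
      also have "\<dots> = r (Dl (slice z) l)"
        by (rule Dl_lin[OF rl PF_subspace slice])
      also have "Dl (slice z) l = cst (curry z l)"
      proof (rule PF_eqI)
        show "Dl (slice z) l \<in> PF 1 (carrier Y)" by (rule Dl_in[OF PF_subspace slice])
        show "cst (curry z l) \<in> PF 1 (carrier Y)" by (rule cst_PF[OF PF_in[OF zPF rm_sub[OF Y]]])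
        fix l' :: "'a mat2 list" assume "l' \<in> tuples 1"
        then obtain x where x: "x \<in> SL2" "l' = [x]" by (auto elim!: in_tuples_SucE)
        have "curry (Dl (slice z) l) l' = Dl (\<lambda>l. curry (slice z l) [x]) l"
          unfolding x(2) by (rule Dl_lin[of UNIV "\<lambda>F. curry F [x]", symmetric])
             (auto intro!: lin_onI simp: curry_simps)
        also have "\<dots> = Dl (\<lambda>l. curry z (x # l)) l" using x by (simp add: curry_slice)
        also have "\<dots> = curry z l"
        proof (rule Dl_cocycle)
          have "curry (dd (Suc n) z) (x # l) = 0" using cocycles_dd[OF z] by (simp add: curry_simps)
          then show "Dl (curry z) (x # l) = 0" using l x by (simp add: curry_dd del: Dl.simps)
        qed
        finally show "curry (Dl (slice z) l) l' = curry (cst (curry z l)) l'"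
          using x by (simp add: curry_cst)
      qed
      also have "r (cst (curry z l)) = curry z l"
        by (rule r(2)[OF PF_in[OF zPF rm_sub[OF Y]]])
      finally show "curry (dd n ?h) l = curry z l" using l by (simp add: curry_dd)
    qed
    then show ?thesis using h by (metis coboundaries.simps(2) image_eqI)
  qed
  then show ?thesis using acyclic_iff[OF Y] by blast
qed

section \<open>Cohomology from an acyclic resolution\<close>

definition fixed :: "('k::field, 'x) gmod \<Rightarrow> ('x \<Rightarrow> 'k) set" where
  "fixed M = {v \<in> carrier M. \<forall>g\<in>SL2. act M g v = v}"

lemma fixed_subspace: assumes M: "rational_module M" shows "fs.subspace (fixed M)"
  unfolding fixed_def
  by (rule fs.subspaceI)
     (auto simp: fs.subspace_0 fs.subspace_add fs.subspace_scale rm_sub[OF M] rm_zero[OF M]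
       lin_on_add[OF rm_lin[OF M]] lin_on_scale[OF rm_lin[OF M]])

lemma cocycles_0:
  assumes M: "rational_module M" shows "cocycles 0 M = cst ` fixed M"
proof (intro subset_antisym subsetI)
  fix z assume z: "z \<in> cocycles 0 M"
  note zPF = cochains_PF[OF cocycles_cochains[OF z]]
  let ?v = "curry z [mat 1]"
  have const: "curry z [g] = ?v" if "g \<in> SL2" for g
  proof -
    have "curry (dd 0 z) [mat 1, g] = 0" using cocycles_dd[OF z] by (simp add: curry_simps)
    then show ?thesis using that by (simp add: curry_dd)
  qed
  have "act M g ?v = ?v" if "g \<in> SL2" for g
    using cochains_act[OF cocycles_cochains[OF z] that, of "[mat 1]"] const[of g] that by simp
  then have "?v \<in> fixed M" using PF_in[OF zPF rm_sub[OF M]] by (simp add: fixed_def)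
  moreover have "z = cst ?v"
  proof (rule curry_eqI)
    fix l show "curry z l = curry (cst ?v) l"
    proof (cases "l \<in> tuples (Suc 0)")
      case True
      then obtain g where "g \<in> SL2" "l = [g]" by (auto elim!: in_tuples_SucE)
      then show ?thesis unfolding curry_cst by (metis const curry_cst)
    qed (use PF_off[OF zPF, of l] in \<open>simp add: cst_def curry_cut\<close>)
  qed
  ultimately show "z \<in> cst ` fixed M" by blast
next
  fix z assume "z \<in> cst ` fixed M"
  then obtain v where v: "v \<in> fixed M" "z = cst v" by auto
  then have "z \<in> PF (Suc 0) (carrier M)" using cst_PF[of v "carrier M"] by (simp add: fixed_def)
  moreover have "dd 0 z = 0"
    by (rule curry_eqI) (auto simp: curry_dd v cst_def curry_cut curry_simps elim!: in_tuples_SucE)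
  ultimately show "z \<in> cocycles 0 M" using v
    by (auto simp: cocycles_def cochains_def fixed_def cst_def curry_cut elim!: in_tuples_SucE)
qed

lemma eval_cst: "curry (cst v) [mat 1] = v"
  by (simp add: curry_cst)

lemma qle_cst:
  assumes "fs.subspace Z" "B \<subseteq> Z" shows "qle (cst ` Z) (cst ` B) c \<longleftrightarrow> qle Z B c"
proof
  assume q: "qle (cst ` Z) (cst ` B) c"
  show "qle Z B c"
  proof (rule qle_image[OF q, of "\<lambda>F. curry F [mat 1]"])
    show "fs.subspace (cst ` Z)" by (rule lin_on_subspace_image[OF lin_on_cst assms(1)])
  qed (use assms in \<open>auto simp: image_image eval_cst curry_simps intro!: lin_onI\<close>)
next
  assume q: "qle Z B c"
  show "qle (cst ` Z) (cst ` B) c"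
    by (rule qle_image[OF q lin_on_cst assms(1)]) (use assms in auto)
qed

lemma coh_le_0: assumes M: "rational_module M" shows "coh_le 0 M c \<longleftrightarrow> qle (fixed M) {0} c"
proof -
  have "cst 0 = (0 :: 'a mat2 list \<times> 'b \<Rightarrow> 'a)" by (simp add: cst_def cut_zero)
  then show ?thesis
    using qle_cst[OF fixed_subspace[OF M], of "{0}" c] fs.subspace_0[OF fixed_subspace[OF M]]
    by (simp add: coh_le_def cocycles_0[OF M])
qed

section \<open>Dimension shifting along an acyclic resolution\<close>

locale resolution =
  fixes N :: "('k::field, 'x) gmod" and e :: "('x \<Rightarrow> 'k) \<Rightarrow> 'y \<Rightarrow> 'k"
    and J :: "nat \<Rightarrow> ('k, 'y) gmod" and \<delta> :: "nat \<Rightarrow> ('y \<Rightarrow> 'k) \<Rightarrow> 'y \<Rightarrow> 'k"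
  assumes N: "rational_module N" and J: "rational_module (J i)"
    and e: "ghom N (J 0) e" and \<delta>: "ghom (J i) (J (Suc i)) (\<delta> i)"
    and inj: "inj_on e (carrier N)" and exact0: "e ` carrier N = {v \<in> carrier (J 0). \<delta> 0 v = 0}"
    and exact: "\<delta> i ` carrier (J i) = {v \<in> carrier (J (Suc i)). \<delta> (Suc i) v = 0}"

locale acyclic_resolution = resolution +
  assumes acyclic: "acyclic (J i)"
begin

definition syz :: "nat \<Rightarrow> ('a, 'c) gmod" where
  "syz i = \<lparr>carrier = {v \<in> carrier (J i). \<delta> i v = 0}, act = act (J i)\<rparr>"

lemma syz_image: "syz 0 = image_mod e N (J 0)" "syz (Suc i) = image_mod (\<delta> i) (J i) (J (Suc i))"
  by (simp_all add: syz_def image_mod_def exact0 exact)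

lemma rational_syz: "rational_module (syz i)"
  by (cases i) (simp_all add: syz_image rational_image_mod[OF N e J] rational_image_mod[OF J \<delta> J])

lemma ses_syz: "ses (syz i) (J i) (syz (Suc i)) (\<lambda>v. v) (\<delta> i)"
proof
  show "ghom (syz i) (J i) (\<lambda>v. v)" by (rule ghomI) (auto simp: syz_def lin_on_def)
  show "ghom (J i) (syz (Suc i)) (\<delta> i)"
  proof (rule ghomI)
    show "\<delta> i v \<in> carrier (syz (Suc i))" if "v \<in> carrier (J i)" for v
      using exact[of i] that unfolding syz_def by auto
  qed (simp_all add: syz_def ghom_lin[OF \<delta>] ghom_act[OF \<delta>])
  show "rational_module (syz i)" "rational_module (syz (Suc i))" by (rule rational_syz)+
qed (auto simp: J syz_def exact)

lemma cob_sum_Suc: "ses.cob_sum (J i) (syz (Suc i)) (\<delta> i) (Suc n) = coboundaries (Suc n) (syz (Suc i))"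
proof -
  interpret S: ses "syz i" "J i" "syz (Suc i)" "\<lambda>v. v" "\<delta> i" by (rule ses_syz)
  have "pw (\<delta> i) ` cocycles (Suc n) (J i) \<subseteq> coboundaries (Suc n) (syz (Suc i))"
    using acyclic[of i] acyclic_iff[OF J] pw_coboundaries[OF J S.p] by (meson image_subsetI subsetD)
  moreover have "0 \<in> pw (\<delta> i) ` cocycles (Suc n) (J i)"
    using fs.subspace_0[OF cocycles_subspace[OF J]] pw_0[OF S.p J] by (metis image_eqI)
  ultimately show ?thesis
    unfolding S.cob_sum_def
    using fs.subspace_add[OF coboundaries_subspace[OF rational_syz]]
    by (intro subset_antisym subsetI) (blast, metis (mono_tags, lifting) CollectI add.right_neutral)
qed

lemma coh_syz_shift: "coh_le (Suc (Suc n)) (syz i) c \<longleftrightarrow> coh_le (Suc n) (syz (Suc i)) c"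
proof -
  interpret S: ses "syz i" "J i" "syz (Suc i)" "\<lambda>v. v" "\<delta> i" by (rule ses_syz)
  show ?thesis
    using S.les_le[of "Suc n" 0 c] S.les_le_conv[of "Suc n" c] acyclic[of i]
    by (auto simp: acyclic_def cob_sum_Suc coh_le_def simp del: coboundaries.simps)
qed

text \<open>The bottom of the shift: degree one cohomology of a syzygy is the failure of
  \<open>\<delta> i\<close> to be onto the next syzygy after taking invariants.\<close>

lemma coh_syz_1:
  "coh_le (Suc 0) (syz i) c \<longleftrightarrow> qle {v \<in> fixed (J (Suc i)). \<delta> (Suc i) v = 0} (\<delta> i ` fixed (J i)) c"
proof -
  interpret S: ses "syz i" "J i" "syz (Suc i)" "\<lambda>v. v" "\<delta> i" by (rule ses_syz)
  have fx: "fixed (syz (Suc i)) = {v \<in> fixed (J (Suc i)). \<delta> (Suc i) v = 0}"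
    by (auto simp: fixed_def syz_def)
  have "pw (\<delta> i) (cst v) = cst (\<delta> i v)" for v
    using lin_on_zero[OF ghom_lin[OF \<delta>] rm_sub[OF J]]
    by (intro curry_eqI) (simp add: cst_def curry_cut)
  then have cs: "S.cob_sum 0 = cst ` \<delta> i ` fixed (J i)"
    by (auto simp: S.cob_sum_def cocycles_0[OF J] image_image)
  have "coh_le (Suc 0) (syz i) c \<longleftrightarrow> qle (cocycles 0 (syz (Suc i))) (S.cob_sum 0) c"
    using S.les_le[of 0 0 c] S.les_le_conv[of 0 c] acyclic[of i] by (auto simp: acyclic_def)
  also have "\<dots> \<longleftrightarrow> qle (fixed (syz (Suc i))) (\<delta> i ` fixed (J i)) c"
    unfolding cs cocycles_0[OF rational_syz]
  proof (rule qle_cst[OF fixed_subspace[OF rational_syz]])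
    show "\<delta> i ` fixed (J i) \<subseteq> fixed (syz (Suc i))"
      using ghom_in[OF S.p] by (auto simp: fixed_def simp flip: ghom_act[OF S.p])
  qed
  finally show ?thesis unfolding fx .
qed

lemma coh_syz: "coh_le (Suc n) (syz i) c \<longleftrightarrow>
    qle {v \<in> fixed (J (Suc (i + n))). \<delta> (Suc (i + n)) v = 0} (\<delta> (i + n) ` fixed (J (i + n))) c"
  by (induction n arbitrary: i) (simp_all add: coh_syz_1 coh_syz_shift del: One_nat_def)

text \<open>The left side does not mention the resolution. This is how twisted standard resolutions
  and injective resolutions are compared with the cochain complex.\<close>

lemma coh_le_iff: "coh_le (Suc n) N c \<longleftrightarrow>
    qle {v \<in> fixed (J (Suc n)). \<delta> (Suc n) v = 0} (\<delta> n ` fixed (J n)) c"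
proof -
  let ?i = "the_inv_into (carrier N) e"
  have 1: "ghom N (syz 0) e"
    using ghom_lin[OF e] ghom_act[OF e] exact0 by (intro ghomI) (auto simp: syz_def)
  have 2: "ghom (syz 0) N ?i"
  proof (rule ghomI)
    show "lin_on (carrier (syz 0)) ?i"
      using lin_on_the_inv[OF ghom_lin[OF e] rm_sub[OF N] inj] exact0 by (simp add: syz_def)
    show "?i v \<in> carrier N" if "v \<in> carrier (syz 0)" for v
      using that the_inv_into_into[OF inj _ order.refl, of v] exact0 by (simp add: syz_def)
    show "?i (act (syz 0) g v) = act N g (?i v)" if g: "g \<in> SL2" and "v \<in> carrier (syz 0)" for g v
    proof -
      have "v \<in> e ` carrier N" using that exact0 by (simp add: syz_def)
      then obtain u where u: "u \<in> carrier N" "v = e u" by blast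
      have "act (syz 0) g v = e (act N g u)" using u by (simp add: ghom_act[OF e g] syz_def)
      then show ?thesis using u by (simp add: the_inv_into_f_f[OF inj] rm_act[OF N g])
    qed
  qed
  have "coh_le (Suc n) N c \<longleftrightarrow> coh_le (Suc n) (syz 0) c"
  proof
    assume "coh_le (Suc n) N c"
    then show "coh_le (Suc n) (syz 0) c"
    proof (rule coh_retract[OF rational_syz N 2 1, rotated])
      fix v assume "v \<in> carrier (syz 0)"
      then have "v \<in> e ` carrier N" using exact0 by (simp add: syz_def)
      then show "e (?i v) = v" by (rule f_the_inv_into_f[OF inj])
    qed
  next
    assume "coh_le (Suc n) (syz 0) c"
    then show "coh_le (Suc n) N c"
    proof (rule coh_retract[OF N rational_syz 1 2, rotated])
      fix v assume "v \<in> carrier N"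
      then show "?i (e v) = v" by (rule the_inv_into_f_f[OF inj])
    qed
  qed
  then show ?thesis using coh_syz[of n 0 c] by simp
qed

end

lemma ghom_cst: assumes M: "rational_module M" shows "ghom M (Std 0 M) cst"
proof (rule ghomI[OF lin_on_cst])
  show "cst v \<in> carrier (Std 0 M)" if "v \<in> carrier M" for v
    using cst_PF[OF that] by (simp add: carrier_Std)
  show "cst (act M g v) = act (Std 0 M) g (cst v)" if "g \<in> SL2" "v \<in> carrier M" for g v
    by (rule curry_eqI) (use that in \<open>simp add: curry_act_Std cst_def curry_cut rm_zero[OF M]\<close>)
qed

lemma ghom_dd: assumes M: "rational_module M" shows "ghom (Std n M) (Std (Suc n) M) (dd n)"
proof (rule ghomI[OF dd_lin_on])
  show "dd n v \<in> carrier (Std (Suc n) M)" if "v \<in> carrier (Std n M)" for v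
    using that dd_PF by (auto simp: carrier_Std)
  show "dd n (act (Std n M) g v) = act (Std (Suc n) M) g (dd n v)"
    if g: "g \<in> SL2" and v: "v \<in> carrier (Std n M)" for g v
  proof (rule curry_eqI)
    fix l :: "'a mat2 list"
    have "Dl (curry (act (Std n M) g v)) l = Dl (\<lambda>l. act M g (curry v (tr (adj2 g) l))) l"
      by (simp add: curry_act_Std[abs_def])
    also have "\<dots> = act M g (Dl (\<lambda>l. curry v (tr (adj2 g) l)) l)"
      using v PF_in[OF _ rm_sub[OF M]] by (intro Dl_lin[OF rm_lin[OF M g] rm_sub[OF M]]) (auto simp: carrier_Std)
    also have "\<dots> = act M g (Dl (curry v) (tr (adj2 g) l))" by (simp only: Dl_map)
    finally show "curry (dd n (act (Std n M) g v)) l = curry (act (Std (Suc n) M) g (dd n v)) l"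
      using g by (simp add: curry_dd curry_act_Std rm_zero[OF M])
  qed
qed

text \<open>Inserting the identity in front contracts the complex. This homotopy is not equivariant,
  but exactness concerns the underlying vector spaces only.\<close>

lemma resolution_Std:
  assumes M: "rational_module M" shows "resolution M cst (\<lambda>n. Std n M) dd"
proof
  show "inj_on cst (carrier M)" by (rule inj_onI) (metis eval_cst)
  show "cst ` carrier M = {v \<in> carrier (Std 0 M). dd 0 v = 0}"
  proof (intro subset_antisym subsetI)
    fix z assume "z \<in> cst ` carrier M"
    then obtain v where v: "v \<in> carrier M" "z = cst v" by auto
    have "dd 0 z = 0"
      by (rule curry_eqI) (auto simp: curry_dd v cst_def curry_cut curry_simps elim!: in_tuples_SucE)
    then show "z \<in> {v \<in> carrier (Std 0 M). dd 0 v = 0}" using v ghom_in[OF ghom_cst[OF M]] by simp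
  next
    fix z assume "z \<in> {v \<in> carrier (Std 0 M). dd 0 v = 0}"
    then have z: "z \<in> PF (Suc 0) (carrier M)" "dd 0 z = 0" by (simp_all add: carrier_Std)
    have const: "curry z [g] = curry z [mat 1]" if "g \<in> SL2" for g
    proof -
      have "curry (dd 0 z) [mat 1, g] = 0" using z by (simp add: curry_simps)
      then show ?thesis using that by (simp add: curry_dd)
    qed
    have "z = cst (curry z [mat 1])"
    proof (rule curry_eqI)
      fix l show "curry z l = curry (cst (curry z [mat 1])) l"
      proof (cases "l \<in> tuples (Suc 0)")
        case True
        then obtain g where "g \<in> SL2" "l = [g]" by (auto elim!: in_tuples_SucE)
        then show ?thesis unfolding curry_cst by (metis const curry_cst)
      qed (use PF_off[OF z(1), of l] in \<open>simp add: cst_def curry_cut\<close>)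
    qed
    then show "z \<in> cst ` carrier M" using PF_in[OF z(1) rm_sub[OF M]] by blast
  qed
  show "dd n ` carrier (Std n M) = {v \<in> carrier (Std (Suc n) M). dd (Suc n) v = 0}" for n
  proof (intro subset_antisym subsetI)
    fix z assume "z \<in> dd n ` carrier (Std n M)"
    then show "z \<in> {v \<in> carrier (Std (Suc n) M). dd (Suc n) v = 0}"
      using ghom_in[OF ghom_dd[OF M]] by (auto simp: dd_dd)
  next
    fix z assume "z \<in> {v \<in> carrier (Std (Suc n) M). dd (Suc n) v = 0}"
    then have z: "z \<in> PF (Suc (Suc n)) (carrier M)" "dd (Suc n) z = 0" by (simp_all add: carrier_Std)
    let ?h = "cut (Suc n) (\<lambda>l. curry z (mat 1 # l))"
    have "?h \<in> PF (Suc n) (carrier M)"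
      by (intro PF_subst[OF z(1)] poly_subst_Cons poly_map_const poly_subst_id SL2_one)
    moreover have "dd n ?h = z"
    proof (rule PF_eqI[OF dd_PF[OF calculation] z(1)])
      fix l :: "'a mat2 list" assume l: "l \<in> tuples (Suc (Suc n))"
      have "curry (dd (Suc n) z) (mat 1 # l) = 0" using z by (simp add: curry_simps)
      then have "Dl (\<lambda>l. curry z (mat 1 # l)) l = curry z l"
        using l by (intro Dl_cocycle) (simp add: curry_dd del: Dl.simps)
      moreover have "Dl (curry ?h) l = Dl (\<lambda>l. curry z (mat 1 # l)) l"
        by (rule Dl_cong[OF _ l]) (simp add: curry_cut)
      ultimately show "curry (dd n ?h) l = curry z l" using l by (simp add: curry_dd)
    qed
    ultimately show "z \<in> dd n ` carrier (Std n M)" by (metis carrier_Std image_eqI)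
  qed
qed (use assms in \<open>simp_all add: rational_Std ghom_cst ghom_dd\<close>)

section \<open>Tensoring with the natural module\<close>

text \<open>\<open>E \<otimes> M\<close> in the standard basis of \<open>E\<close>: the index in
  \<open>2\<close> selects the coefficient of a basis vector.\<close>

definition tensE :: "('k::field, 'x) gmod \<Rightarrow> ('k, 2 \<times> 'x) gmod" where
  "tensE M = \<lparr>carrier = {w. \<forall>i. curry w i \<in> carrier M},
     act = (\<lambda>g w. case_prod (\<lambda>i. fscale (g$i$1) (act M g (curry w 1)) + fscale (g$i$2) (act M g (curry w 2))))\<rparr>"

definition tE :: "(('x \<Rightarrow> 'k) \<Rightarrow> 'y \<Rightarrow> 'k) \<Rightarrow> (2 \<times> 'x \<Rightarrow> 'k) \<Rightarrow> 2 \<times> 'y \<Rightarrow> 'k" where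
  "tE T w = case_prod (\<lambda>i. T (curry w i))"

lemma curry_tE [simp]: "curry (tE T w) i = T (curry w i)"
  by (simp add: tE_def)

lemma carrier_tensE: "w \<in> carrier (tensE M) \<longleftrightarrow> (\<forall>i. curry w i \<in> carrier M)"
  by (simp add: tensE_def)

lemma curry_act_tensE: "curry (act (tensE M) g w) i =
    fscale (g$i$1) (act M g (curry w 1)) + fscale (g$i$2) (act M g (curry w 2))"
  by (simp add: tensE_def)

definition inE :: "2 \<Rightarrow> ('x \<Rightarrow> 'k::field) \<Rightarrow> 2 \<times> 'x \<Rightarrow> 'k" where
  "inE i v = case_prod (\<lambda>j. if j = i then v else 0)"

lemma curry_inE: "curry (inE i v) j = (if j = i then v else 0)"
  by (simp add: inE_def)

lemma tensE_subspace: "fs.subspace (carrier M) \<Longrightarrow> fs.subspace (carrier (tensE M))"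
  by (rule fs.subspaceI) (simp_all add: carrier_tensE curry_simps fs.subspace_0 fs.subspace_add fs.subspace_scale)

lemma exhaust_2': "(i::2) = 1 \<or> i = 2"
  using exhaust_2 by blast

lemma rational_tensE:
  assumes M: "rational_module M" shows "rational_module (tensE M)"
proof (rule rational_moduleI)
  show sub: "fs.subspace (carrier (tensE M))" by (rule tensE_subspace[OF rm_sub[OF M]])
  show "act (tensE M) g w \<in> carrier (tensE M)" if "g \<in> SL2" "w \<in> carrier (tensE M)" for g w
    using that by (simp add: carrier_tensE curry_act_tensE fs.subspace_add[OF rm_sub[OF M]]
      fs.subspace_scale[OF rm_sub[OF M]] rm_act[OF M])
  show "lin_on (carrier (tensE M)) (act (tensE M) g)" if "g \<in> SL2" for g
    by (intro lin_onI curry_eqI)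
       (simp_all add: carrier_tensE curry_act_tensE curry_simps lin_on_add[OF rm_lin[OF M that]]
         lin_on_scale[OF rm_lin[OF M that]] fs.scale_right_distrib mult_ac add_ac)
  show "act (tensE M) (mat 1) w = w" if "w \<in> carrier (tensE M)" for w
  proof (rule curry_eqI)
    fix i show "curry (act (tensE M) (mat 1) w) i = curry w i"
      using that exhaust_2'[of i] by (auto simp: curry_act_tensE carrier_tensE rm_one[OF M])
  qed
  show "act (tensE M) (g ** h) w = act (tensE M) g (act (tensE M) h w)"
    if "g \<in> SL2" "h \<in> SL2" "w \<in> carrier (tensE M)" for g h w
  proof (rule curry_eqI)
    fix i
    have w: "curry w j \<in> carrier M" for j using that by (simp add: carrier_tensE)
    have "act M g (fscale c (act M h (curry w 1)) + fscale d (act M h (curry w 2))) =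
        fscale c (act M (g ** h) (curry w 1)) + fscale d (act M (g ** h) (curry w 2))" for c d
      using that(1,2) w by (simp add: lin_on_add[OF rm_lin[OF M]] lin_on_scale[OF rm_lin[OF M]]
        fs.subspace_scale[OF rm_sub[OF M]] rm_act[OF M] rm_mult[OF M])
    then show "curry (act (tensE M) (g ** h) w) i = curry (act (tensE M) g (act (tensE M) h w)) i"
      by (simp add: curry_act_tensE fs.scale_left_distrib fs.scale_right_distrib add_ac)
  qed
  show "orb (tensE M) w \<in> PF 1 (carrier (tensE M))" if w: "w \<in> carrier (tensE M)" for w
  proof -
    let ?f = "\<lambda>i j. pw (inE i) (cut 1 (\<lambda>l. fscale (hd l $ i $ j) (curry (orb M (curry w j)) l)))"
    have f: "?f i j \<in> PF 1 (carrier (tensE M))" for i j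
    proof (rule PF_pw)
      have "(\<lambda>l. hd l $ i $ j) \<in> LP 1" using poly_map_hd1 unfolding poly_map_def by blast
      then show "cut 1 (\<lambda>l. fscale (hd l $ i $ j) (curry (orb M (curry w j)) l)) \<in> PF 1 (carrier M)"
        using w by (intro PF_mult rm_orb[OF M]) (simp_all add: carrier_tensE)
      show "lin_on (carrier M) (inE i)"
        by (intro lin_onI curry_eqI) (auto simp: curry_inE curry_simps)
      show "inE i ` carrier M \<subseteq> carrier (tensE M)"
        by (auto simp: carrier_tensE curry_inE fs.subspace_0[OF rm_sub[OF M]])
    qed (rule rm_sub[OF M])
    have "orb (tensE M) w = ?f 1 1 + ?f 1 2 + ?f 2 1 + ?f 2 2"
    proof (intro curry_eqI)
      fix l i show "curry (curry (orb (tensE M) w) l) i = curry (curry (?f 1 1 + ?f 1 2 + ?f 2 1 + ?f 2 2) l) i"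
        using exhaust_2'[of i] by (auto simp: orb_def curry_cut curry_simps curry_inE curry_act_tensE)
    qed
    then show ?thesis using f by (auto intro!: PF.add simp del: One_nat_def)
  qed
qed

lemma ghom_tE: assumes T: "ghom M N T" and M: "rational_module M" shows "ghom (tensE M) (tensE N) (tE T)"
proof (rule ghomI)
  show "lin_on (carrier (tensE M)) (tE T)"
    by (intro lin_onI curry_eqI)
       (simp_all add: curry_simps carrier_tensE lin_on_add[OF ghom_lin[OF T]] lin_on_scale[OF ghom_lin[OF T]])
  show "tE T v \<in> carrier (tensE N)" if "v \<in> carrier (tensE M)" for v
    using that by (simp add: carrier_tensE ghom_in[OF T])
  show "tE T (act (tensE M) g v) = act (tensE N) g (tE T v)" if "g \<in> SL2" "v \<in> carrier (tensE M)" for g v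
    using that
    by (intro curry_eqI)
       (simp add: curry_act_tensE carrier_tensE lin_on_add[OF ghom_lin[OF T]] lin_on_scale[OF ghom_lin[OF T]]
         ghom_act[OF T] rm_act[OF M] fs.subspace_scale[OF rm_sub[OF M]])
qed

lemma tE_image:
  fixes T :: "('x \<Rightarrow> 'k) \<Rightarrow> 'y \<Rightarrow> 'k"
  assumes "T ` X = Y" shows "tE T ` {w. \<forall>i. curry w i \<in> X} = {w. \<forall>i. curry w i \<in> Y}"
proof (intro subset_antisym subsetI)
  fix w :: "2 \<times> 'y \<Rightarrow> 'k" assume "w \<in> {w. \<forall>i. curry w i \<in> Y}"
  then have "\<forall>i::2. \<exists>v\<in>X. T v = curry w i" using assms by (metis (mono_tags, lifting) CollectD imageE)
  then obtain v where v: "\<And>i::2. v i \<in> X" "\<And>i. T (v i) = curry w i" by metis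
  have "w = tE T (case_prod v)" by (rule curry_eqI) (simp add: v)
  then show "w \<in> tE T ` {w. \<forall>i. curry w i \<in> X}" using v(1) by auto
qed (use assms in auto)

lemma tE_eq_0: "tE T w = 0 \<longleftrightarrow> (\<forall>i. T (curry w i) = 0)"
proof
  assume "tE T w = 0" then show "\<forall>i. T (curry w i) = 0" by (metis curry_tE curry_zero)
next
  assume "\<forall>i. T (curry w i) = 0" then show "tE T w = 0" by (intro curry_eqI) (simp add: curry_simps)
qed

lemma resolution_tensE:
  assumes "resolution N e J \<delta>"
  shows "resolution (tensE N) (tE e) (\<lambda>i. tensE (J i)) (\<lambda>i. tE (\<delta> i))"
proof -
  interpret resolution N e J \<delta> by fact
  show ?thesis
  proof
    show "inj_on (tE e) (carrier (tensE N))"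
    proof (rule inj_onI)
      fix v w assume "v \<in> carrier (tensE N)" "w \<in> carrier (tensE N)" "tE e v = tE e w"
      then show "v = w"
        using inj by (intro curry_eqI) (metis carrier_tensE curry_tE inj_onD)
    qed
    show "tE e ` carrier (tensE N) = {v \<in> carrier (tensE (J 0)). tE (\<delta> 0) v = 0}"
      using tE_image[OF exact0] by (auto simp: tensE_def tE_eq_0)
    show "tE (\<delta> i) ` carrier (tensE (J i)) = {v \<in> carrier (tensE (J (Suc i))). tE (\<delta> (Suc i)) v = 0}" for i
      using tE_image[OF exact[of i]] by (auto simp: tensE_def tE_eq_0)
  qed (simp_all add: rational_tensE N J ghom_tE e \<delta>)
qed

text \<open>Functions with values in \<open>E \<otimes> Y\<close> are pairs of functions with values
  in \<open>Y\<close>, so \<open>r\<close> can be applied in each coordinate; the matrix entries of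
  \<open>g\<close> are scalars and pass through it.\<close>

lemma rel_inj_tensE: assumes "rel_inj Y" shows "rel_inj (tensE Y)"
proof -
  have Y: "rational_module Y" using assms by (simp add: rel_inj_def)
  obtain r where r: "ghom (Std 0 Y) Y r" "\<And>v. v \<in> carrier Y \<Longrightarrow> r (cst v) = v"
    using assms by (auto simp: rel_inj_def)
  let ?p = "\<lambda>i. pw (\<lambda>w. curry w i)"
  have lin: "lin_on (carrier (tensE Y)) (\<lambda>w. curry w i)" for i by (simp add: lin_on_def curry_simps)
  have sub: "fs.subspace (carrier (tensE Y))" by (rule tensE_subspace[OF rm_sub[OF Y]])
  have p: "?p i F \<in> carrier (Std 0 Y)" if "F \<in> carrier (Std 0 (tensE Y))" for F i
    using that unfolding carrier_Std by (rule PF_pw[OF _ lin sub]) (auto simp: carrier_tensE)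
  let ?r = "\<lambda>F. case_prod (\<lambda>i. r (?p i F))"
  have "ghom (Std 0 (tensE Y)) (tensE Y) ?r"
  proof (rule ghomI)
    have pl: "lin_on (carrier (Std 0 (tensE Y))) (?p i)" for i
      unfolding carrier_Std by (rule pw_lin_on[OF lin sub])
    show "lin_on (carrier (Std 0 (tensE Y))) ?r"
    proof (intro lin_onI curry_eqI)
      fix F G i assume "F \<in> carrier (Std 0 (tensE Y))" "G \<in> carrier (Std 0 (tensE Y))"
      then show "curry (?r (F + G)) i = curry (?r F + ?r G) i"
        by (simp only: curry_simps curry_case_prod lin_on_add[OF pl] lin_on_add[OF ghom_lin[OF r(1)]] p)
    next
      fix F c i assume "F \<in> carrier (Std 0 (tensE Y))"
      then show "curry (?r (fscale c F)) i = curry (fscale c (?r F)) i"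
        by (simp only: curry_simps curry_case_prod lin_on_scale[OF pl] lin_on_scale[OF ghom_lin[OF r(1)]] p)
    qed
    show "?r F \<in> carrier (tensE Y)" if "F \<in> carrier (Std 0 (tensE Y))" for F
      using that by (simp add: carrier_tensE ghom_in[OF r(1)] p)
    show "?r (act (Std 0 (tensE Y)) g F) = act (tensE Y) g (?r F)"
      if g: "g \<in> SL2" and F: "F \<in> carrier (Std 0 (tensE Y))" for g F
    proof (rule curry_eqI)
      fix i
      have "?p i (act (Std 0 (tensE Y)) g F) =
          fscale (g$i$1) (act (Std 0 Y) g (?p 1 F)) + fscale (g$i$2) (act (Std 0 Y) g (?p 2 F))"
        by (rule curry_eqI) (simp add: curry_act_Std curry_act_tensE curry_simps)
      then show "curry (?r (act (Std 0 (tensE Y)) g F)) i = curry (act (tensE Y) g (?r F)) i"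
        using rm_act[OF rational_Std[OF Y] g p[OF F]] fs.subspace_scale[OF rm_sub[OF rational_Std[OF Y]]] p[OF F]
        by (simp add: curry_act_tensE lin_on_add[OF ghom_lin[OF r(1)]] lin_on_scale[OF ghom_lin[OF r(1)]]
            ghom_act[OF r(1) g])
    qed
  qed
  moreover have "?r (cst w) = w" if "w \<in> carrier (tensE Y)" for w
  proof (rule curry_eqI)
    fix i
    have "?p i (cst w) = cst (curry w i)"
      by (rule curry_eqI) (simp add: cst_def curry_cut curry_simps)
    then show "curry (?r (cst w)) i = curry w i" using that by (simp add: r(2) carrier_tensE)
  qed
  ultimately show ?thesis using rational_tensE[OF Y] unfolding rel_inj_def by blast
qed

section \<open>Expansion along one-parameter families\<close>

lemma infinite_alg_closed: "infinite (UNIV :: 'k::alg_closed_field set)"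
proof
  assume fin: "finite (UNIV :: 'k set)"
  let ?q = "\<Prod>x\<in>UNIV. [:- x, 1 :: 'k:]"
  have deg: "degree ?q = card (UNIV :: 'k set)"
    by (subst degree_prod_eq_sum_degree) auto
  have "card (UNIV :: 'k set) > 0" using fin by (simp add: card_gt_0_iff)
  then have "degree (?q + 1) > 0" using deg by (subst degree_add_eq_left) auto
  then obtain y where "poly (?q + 1) y = 0" using alg_closed_imp_poly_has_root by blast
  moreover have "poly ?q y = 0" using fin by (auto simp: poly_prod intro!: prod_zero)
  ultimately show False by simp
qed

lemma poly_eqI_nonzero:
  fixes P :: "'k::alg_closed_field poly"
  assumes "\<And>s. s \<noteq> 0 \<Longrightarrow> poly P s = poly Q s" shows "P = Q"
proof (rule ccontr)
  assume "P \<noteq> Q"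
  then have "finite {s. poly (P - Q) s = 0}" by (intro poly_roots_finite) simp
  then have "finite (insert 0 {s. poly (P - Q) s = 0})" by (rule finite.insertI)
  moreover have "insert 0 {s. poly (P - Q) s = 0} = UNIV" using assms by auto
  ultimately show False using infinite_alg_closed by metis
qed

lemma poly_fun_sum: "(\<And>i. i \<in> A \<Longrightarrow> p i \<in> poly_fun) \<Longrightarrow> (\<lambda>g. \<Sum>i\<in>A. p i g) \<in> poly_fun"
  by (induction A rule: infinite_finite_induct) (auto intro: poly_fun.intros)

text \<open>A family is given by Laurent polynomials in the parameter; \<open>e\<close> bounds the pole order at \<open>0\<close>.\<close>

definition curve :: "nat \<Rightarrow> ('k::field \<Rightarrow> 'k mat2) \<Rightarrow> bool" where
  "curve e v \<longleftrightarrow> (\<forall>s. e = 0 \<or> s \<noteq> 0 \<longrightarrow> v s \<in> SL2) \<and>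
     (\<forall>i j. \<exists>w. \<forall>s. e = 0 \<or> s \<noteq> 0 \<longrightarrow> poly w s = s ^ e * v s $ i $ j)"

text \<open>A power of \<open>s\<close> clears the pole uniformly in \<open>g\<close>, and the
  coefficients of the resulting polynomial are again polynomial in \<open>g\<close>. For
  \<open>e = 0\<close> the identity holds at \<open>s = 0\<close> as well, which later gives
  constant terms.\<close>

lemma poly_fun_curve:
  assumes p: "p \<in> poly_fun" and v: "curve e v"
  shows "\<exists>N Q d. (\<forall>g s. e = 0 \<or> s \<noteq> 0 \<longrightarrow> poly (Q g) s = s ^ (e * N) * p (g ** v s)) \<and>
     (\<forall>i. (\<lambda>g. coeff (Q g) i) \<in> poly_fun) \<and> (\<forall>g. degree (Q g) \<le> d)"
  using p
proof induction
  case (const c)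
  show ?case
  proof (rule exI[of _ 0], rule exI[of _ "\<lambda>_. [:c:]"], rule exI[of _ 0], intro conjI allI impI)
    show "(\<lambda>_. coeff [:c:] i) \<in> poly_fun" for i by (rule poly_fun.const)
  qed auto
next
  case (entry i j)
  have "\<forall>k. \<exists>w. \<forall>s. e = 0 \<or> s \<noteq> 0 \<longrightarrow> poly w s = s ^ e * v s $ k $ j"
    using v by (simp add: curve_def)
  from choice[OF this] obtain w where w: "\<And>k s. e = 0 \<or> s \<noteq> 0 \<Longrightarrow> poly (w k) s = s ^ e * v s $ k $ j"
    by blast
  let ?Q = "\<lambda>g :: 'a mat2. smult (g$i$1) (w 1) + smult (g$i$2) (w 2)"
  have "(\<lambda>g. coeff (?Q g) k) \<in> poly_fun" for k
    unfolding coeff_add coeff_smult by (intro poly_fun.add poly_fun.mult poly_fun.entry poly_fun.const)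
  moreover have "degree (?Q g) \<le> max (degree (w 1)) (degree (w 2))" for g
    by (intro degree_add_le) (auto intro: order.trans[OF degree_smult_le])
  moreover have "poly (?Q g) s = s ^ (e * 1) * ((g ** v s) $ i $ j)" if "e = 0 \<or> s \<noteq> 0" for g s
    by (simp add: w[OF that] algebra_simps)
  ultimately show ?case
    by - (rule exI[of _ 1], rule exI[of _ ?Q], rule exI[of _ "max (degree (w 1)) (degree (w 2))"], intro conjI allI impI)
next
  case (add p q)
  from add.IH(1) obtain N Q d where 1: "\<And>g s. e = 0 \<or> s \<noteq> 0 \<Longrightarrow> poly (Q g) s = s ^ (e * N) * p (g ** v s)"
     "\<And>i. (\<lambda>g. coeff (Q g) i) \<in> poly_fun" "\<And>g. degree (Q g) \<le> d" by blast
  from add.IH(2) obtain N' Q' d' where 2: "\<And>g s. e = 0 \<or> s \<noteq> 0 \<Longrightarrow> poly (Q' g) s = s ^ (e * N') * q (g ** v s)"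
     "\<And>i. (\<lambda>g. coeff (Q' g) i) \<in> poly_fun" "\<And>g. degree (Q' g) \<le> d'" by blast
  let ?Q = "\<lambda>g. monom 1 (e * N') * Q g + monom 1 (e * N) * Q' g"
  have shift: "(\<lambda>g. coeff (monom 1 m * R g) k) \<in> poly_fun"
    if "\<And>i. (\<lambda>g. coeff (R g) i) \<in> poly_fun" for m k and R :: "'a mat2 \<Rightarrow> 'a poly"
    using that[of "k - m"] poly_fun.const[of 0] by (cases "k < m") (simp_all add: coeff_monom_mult)
  have "(\<lambda>g. coeff (?Q g) k) \<in> poly_fun" for k
    unfolding coeff_add by (intro poly_fun.add shift 1(2) 2(2))
  moreover have "degree (?Q g) \<le> max (e * N' + d) (e * N + d')" for g
  proof (rule degree_add_le)
    show "degree (monom 1 (e * N') * Q g) \<le> max (e * N' + d) (e * N + d')"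
      using degree_mult_le[of "monom 1 (e * N')" "Q g"] 1(3)[of g] degree_monom_le[of "1::'a" "e * N'"] by linarith
    show "degree (monom 1 (e * N) * Q' g) \<le> max (e * N' + d) (e * N + d')"
      using degree_mult_le[of "monom 1 (e * N)" "Q' g"] 2(3)[of g] degree_monom_le[of "1::'a" "e * N"] by linarith
  qed
  moreover have "poly (?Q g) s = s ^ (e * (N + N')) * (p (g ** v s) + q (g ** v s))" if "e = 0 \<or> s \<noteq> 0" for g s
    by (simp add: 1(1)[OF that] 2(1)[OF that] poly_monom power_add algebra_simps)
  ultimately show ?case
    by - (rule exI[of _ "N + N'"], rule exI[of _ ?Q], rule exI[of _ "max (e * N' + d) (e * N + d')"], intro conjI allI impI)
next
  case (mult p q)
  from mult.IH(1) obtain N Q d where 1: "\<And>g s. e = 0 \<or> s \<noteq> 0 \<Longrightarrow> poly (Q g) s = s ^ (e * N) * p (g ** v s)"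
     "\<And>i. (\<lambda>g. coeff (Q g) i) \<in> poly_fun" "\<And>g. degree (Q g) \<le> d" by blast
  from mult.IH(2) obtain N' Q' d' where 2: "\<And>g s. e = 0 \<or> s \<noteq> 0 \<Longrightarrow> poly (Q' g) s = s ^ (e * N') * q (g ** v s)"
     "\<And>i. (\<lambda>g. coeff (Q' g) i) \<in> poly_fun" "\<And>g. degree (Q' g) \<le> d'" by blast
  have "(\<lambda>g. coeff (Q g * Q' g) k) \<in> poly_fun" for k
    unfolding coeff_mult by (intro poly_fun_sum poly_fun.mult 1 2)
  moreover have "degree (Q g * Q' g) \<le> d + d'" for g
    using degree_mult_le[of "Q g" "Q' g"] 1(3)[of g] 2(3)[of g] by linarith
  moreover have "poly (Q g * Q' g) s = s ^ (e * (N + N')) * (p (g ** v s) * q (g ** v s))" if "e = 0 \<or> s \<noteq> 0" for g s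
    by (simp add: 1(1)[OF that] 2(1)[OF that] power_add algebra_simps)
  ultimately show ?case
    by - (rule exI[of _ "N + N'"], rule exI[of _ "\<lambda>g. Q g * Q' g"], rule exI[of _ "d + d'"], intro conjI allI impI)
qed

lemma coord_ring_curve:
  assumes f: "f \<in> coord_ring" and v: "curve e v"
  shows "\<exists>N Q d. (\<forall>g s. e = 0 \<or> s \<noteq> 0 \<longrightarrow> poly (Q g) s = s ^ (e * N) * f (g ** v s)) \<and>
     (\<forall>i. (\<lambda>g. coeff (Q g) i) \<in> coord_ring) \<and> (\<forall>g. degree (Q g) \<le> d)"
proof -
  obtain p where p: "p \<in> poly_fun" "f = (\<lambda>g. if g \<in> SL2 then p g else 0)"
    using f by (auto simp: coord_ring_def)
  obtain N Q d where Q: "\<And>g s. e = 0 \<or> s \<noteq> 0 \<Longrightarrow> poly (Q g) s = s ^ (e * N) * p (g ** v s)"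
     "\<And>i. (\<lambda>g. coeff (Q g) i) \<in> poly_fun" "\<And>g. degree (Q g) \<le> d"
    using poly_fun_curve[OF p(1) v] by blast
  let ?Q = "\<lambda>g. if g \<in> SL2 then Q g else 0"
  have "(\<lambda>g. coeff (?Q g) i) = (\<lambda>g. if g \<in> SL2 then coeff (Q g) i else 0)" for i by auto
  then have "(\<lambda>g. coeff (?Q g) i) \<in> coord_ring" for i using Q(2)[of i] by (auto simp: coord_ring_def)
  moreover have "poly (?Q g) s = s ^ (e * N) * f (g ** v s)" if s: "e = 0 \<or> s \<noteq> 0" for g s
  proof -
    have vs: "v s \<in> SL2" using v s unfolding curve_def by blast
    have "g ** v s \<in> SL2 \<longleftrightarrow> g \<in> SL2"
    proof
      assume "g ** v s \<in> SL2"
      then have "g ** v s ** adj2 (v s) \<in> SL2" using vs by auto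
      then show "g \<in> SL2" using vs by (simp flip: matrix_mul_assoc)
    qed (use vs in auto)
    then show ?thesis using Q(1)[OF s] by (simp add: p)
  qed
  ultimately show ?thesis using Q(3) by (intro exI[of _ N] exI[of _ ?Q] exI[of _ d]) auto
qed

text \<open>\<open>lc v i f g\<close> is the coefficient of \<open>s ^ i\<close> in the Laurent polynomial \<open>s \<mapsto> f (g ** v s)\<close>.\<close>

definition lc :: "('k::alg_closed_field \<Rightarrow> 'k mat2) \<Rightarrow> nat \<Rightarrow> ('k mat2 \<Rightarrow> 'k) \<Rightarrow> 'k mat2 \<Rightarrow> 'k" where
  "lc v i f g = (THE c. \<exists>N P. (\<forall>s. s \<noteq> 0 \<longrightarrow> poly P s = s ^ N * f (g ** v s)) \<and> c = coeff P (N + i))"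

text \<open>Two representations become equal after cross multiplication by powers of
  \<open>s\<close>, because they agree at infinitely many points. Hence the description by
  \<open>THE\<close> is unambiguous.\<close>

lemma lc_eqI:
  assumes P: "\<And>s. s \<noteq> 0 \<Longrightarrow> poly P s = s ^ N * f (g ** v s)"
  shows "lc v i f g = coeff P (N + i)"
  unfolding lc_def
proof (rule the_equality)
  fix c assume "\<exists>N P. (\<forall>s. s \<noteq> 0 \<longrightarrow> poly P s = s ^ N * f (g ** v s)) \<and> c = coeff P (N + i)"
  then obtain N' P' where P': "\<And>s. s \<noteq> 0 \<Longrightarrow> poly P' s = s ^ N' * f (g ** v s)" "c = coeff P' (N' + i)" by blast
  have "monom 1 N' * P = monom 1 N * P'"
    by (rule poly_eqI_nonzero) (simp add: P P' poly_monom algebra_simps)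
  then have "coeff (monom 1 N' * P) (N + N' + i) = coeff (monom 1 N * P') (N + N' + i)" by simp
  then have "coeff P (N + i) = coeff P' (N' + i)" by (simp add: coeff_monom_mult add_ac)
  then show "c = coeff P (N + i)" using P'(2) by simp
qed (use P in blast)

lemma lc_shift: "lc v i (\<lambda>x. f (h ** x)) g = lc v i f (h ** g)"
  by (simp add: lc_def matrix_mul_assoc)

context
  fixes v :: "'k::alg_closed_field \<Rightarrow> 'k mat2" and e :: nat
  assumes v: "curve e v"
begin

lemma lc_ex:
  assumes "f \<in> coord_ring"
  shows "\<exists>N P. \<forall>s. s \<noteq> 0 \<longrightarrow> poly P s = s ^ N * f (g ** v s)"
  using coord_ring_curve[OF assms v] by blast

lemma lc_coord_ring:
  assumes f: "f \<in> coord_ring" shows "lc v i f \<in> coord_ring"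
proof -
  obtain N Q where Q: "\<And>g s. s \<noteq> 0 \<Longrightarrow> poly (Q g) s = s ^ (e * N) * f (g ** v s)"
     "\<And>i. (\<lambda>g. coeff (Q g) i) \<in> coord_ring"
    using coord_ring_curve[OF f v] by blast
  have "lc v i f = (\<lambda>g. coeff (Q g) (e * N + i))" using lc_eqI[OF Q(1)] by blast
  then show ?thesis using Q(2) by simp
qed

lemma lc_bounded:
  assumes f: "f \<in> coord_ring" shows "\<exists>d. \<forall>i>d. lc v i f = 0"
proof -
  obtain N Q d where Q: "\<And>g s. s \<noteq> 0 \<Longrightarrow> poly (Q g) s = s ^ (e * N) * f (g ** v s)"
     "\<And>g. degree (Q g) \<le> d"
    using coord_ring_curve[OF f v] by blast
  have "lc v i f g = 0" if "i > d" for i g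
  proof -
    have "degree (Q g) < e * N + i" using Q(2)[of g] that by linarith
    then show ?thesis using lc_eqI[where P = "Q g" and N = "e * N" and f = f and g = g and v = v and i = i] Q(1)
      by (simp add: coeff_eq_0)
  qed
  then show ?thesis by (intro exI[of _ d]) (auto simp: fun_eq_iff zero_fun_apply)
qed

lemma lc_add:
  assumes "f \<in> coord_ring" "h \<in> coord_ring" shows "lc v i (f + h) = lc v i f + lc v i h"
proof
  fix g
  obtain N P where P: "\<And>s. s \<noteq> 0 \<Longrightarrow> poly P s = s ^ N * f (g ** v s)" using lc_ex[OF assms(1)] by blast
  obtain N' P' where P': "\<And>s. s \<noteq> 0 \<Longrightarrow> poly P' s = s ^ N' * h (g ** v s)" using lc_ex[OF assms(2)] by blast
  have "lc v i (f + h) g = coeff (monom 1 N' * P + monom 1 N * P') (N + N' + i)"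
    by (rule lc_eqI) (simp add: P P' poly_monom power_add algebra_simps plus_fun_apply)
  also have "\<dots> = coeff P (N + i) + coeff P' (N' + i)"
    by (simp add: coeff_monom_mult add_ac)
  finally show "lc v i (f + h) g = (lc v i f + lc v i h) g"
    using lc_eqI[OF P, of i] lc_eqI[OF P', of i] by (simp add: plus_fun_apply)
qed

lemma lc_scale:
  assumes "f \<in> coord_ring" shows "lc v i (fscale c f) = fscale c (lc v i f)"
proof
  fix g
  obtain N P where P: "\<And>s. s \<noteq> 0 \<Longrightarrow> poly P s = s ^ N * f (g ** v s)" using lc_ex[OF assms(1)] by blast
  have "lc v i (fscale c f) g = coeff (smult c P) (N + i)"
    by (rule lc_eqI) (simp add: P fscale_apply)
  then show "lc v i (fscale c f) g = fscale c (lc v i f) g"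
    using lc_eqI[OF P, of i] by (simp add: fscale_apply)
qed

lemma lc_lin_on: "lin_on coord_ring (lc v i)"
  by (rule lin_onI) (auto intro: lc_add lc_scale)

end

section \<open>Root subgroups and torus as curves in the group\<close>

lemma coord_ring_add: "f \<in> coord_ring \<Longrightarrow> g \<in> coord_ring \<Longrightarrow> f + g \<in> coord_ring"
  unfolding coord_ring_def plus_fun_def using poly_fun.add by fastforce

lemma coord_ring_times: "f \<in> coord_ring \<Longrightarrow> g \<in> coord_ring \<Longrightarrow> f * g \<in> coord_ring"
  using coord_ring_mult by (simp add: times_fun_def)

lemma coord_ring_subspace [simp]: "fs.subspace (coord_ring :: ('k::field mat2 \<Rightarrow> 'k) set)"
proof (rule fs.subspaceI)
  show "0 \<in> (coord_ring :: ('k mat2 \<Rightarrow> 'k) set)" using coord_ring_const[of 0] by (simp add: zero_fun_def)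
  fix c and f :: "'k mat2 \<Rightarrow> 'k" assume f: "f \<in> coord_ring"
  have "(\<lambda>g. (if g \<in> SL2 then c else 0) * f g) = fscale c f"
    using coord_ring_off[OF f] by (auto simp: fun_eq_iff fscale_apply)
  then show "fscale c f \<in> coord_ring" using coord_ring_mult[OF coord_ring_const[of c] f] by simp
qed (rule coord_ring_add)

definition up :: "'k::field \<Rightarrow> 'k mat2" where "up t = mk22 1 t 0 1"
definition lo :: "'k::field \<Rightarrow> 'k mat2" where "lo t = mk22 1 0 t 1"
text \<open>The parameter sits in the lower right corner so that
  \<open>inverse (weight_char m (tor s))\<close> is \<open>s ^ m\<close>, a nonnegative
  power.\<close>

definition tor :: "'k::field \<Rightarrow> 'k mat2" where "tor s = mk22 (inverse s) 0 0 s"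

lemma up_nth [simp]: "up t $ 1 $ 1 = 1" "up t $ 1 $ 2 = t" "up t $ 2 $ 1 = 0" "up t $ 2 $ 2 = 1"
  and lo_nth [simp]: "lo t $ 1 $ 1 = 1" "lo t $ 1 $ 2 = 0" "lo t $ 2 $ 1 = t" "lo t $ 2 $ 2 = 1"
  and tor_nth [simp]: "tor t $ 1 $ 1 = inverse t" "tor t $ 1 $ 2 = 0" "tor t $ 2 $ 1 = 0" "tor t $ 2 $ 2 = t"
  by (simp_all add: up_def lo_def tor_def)

lemma up_SL2 [simp]: "up t \<in> SL2" and lo_SL2 [simp]: "lo t \<in> SL2"
  and tor_SL2: "t \<noteq> 0 \<Longrightarrow> tor t \<in> SL2"
  by (simp_all add: SL2_iff)

lemma all_2_2: "(\<forall>i j. P (i::2) (j::2)) \<longleftrightarrow> P 1 1 \<and> P 1 2 \<and> P 2 1 \<and> P 2 2"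
  by (simp add: forall_2)

lemma curve_up: "curve 0 up"
  unfolding curve_def all_2_2
  by (auto intro: exI[of _ "[:1:]"] exI[of _ "[:0, 1:]"] exI[of _ "[:0:]"])

lemma curve_lo: "curve 0 lo"
  unfolding curve_def all_2_2
  by (auto intro: exI[of _ "[:1:]"] exI[of _ "[:0, 1:]"] exI[of _ "[:0:]"])

lemma curve_tor: "curve 1 tor"
proof -
  have "\<exists>w. \<forall>s. s \<noteq> 0 \<longrightarrow> poly w s = (1::'a)" by (rule exI[of _ "[:1:]"]) simp
  moreover have "\<exists>w. \<forall>s. s \<noteq> 0 \<longrightarrow> poly w s = (s::'a) * s" by (rule exI[of _ "[:0, 0, 1:]"]) simp
  moreover have "\<exists>w. \<forall>s. s \<noteq> 0 \<longrightarrow> poly w s = (0::'a)" by (rule exI[of _ "0"]) simp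
  ultimately show ?thesis unfolding curve_def all_2_2 by (auto simp: tor_SL2)
qed

lemma PF1_curve:
  assumes F: "F \<in> PF 1 X" and v: "curve 0 v"
  shows "\<exists>P. \<forall>s. curry F [v s] x = poly P s"
proof -
  have vS: "v s \<in> SL2" for s using v by (simp add: curve_def)
  from F show ?thesis
  proof (induction rule: PF.induct)
    case zero show ?case by (rule exI[of _ 0]) (simp add: curry_conv pointwise)
  next
    case (gen p w)
    from gen(1) have "\<exists>P. \<forall>s. p [v s] = poly P s"
    proof induction
      case (const c) show ?case by (rule exI[of _ "[:c:]"]) simp
    next
      case (entry j i k)
      have "\<exists>w. \<forall>s. poly w s = v s $ i $ k" using v by (simp add: curve_def)
      then show ?case using entry by (metis less_one nth_Cons_0)
    next
      case (add p q)
      then obtain P Q where "\<forall>s. p [v s] = poly P s" "\<forall>s. q [v s] = poly Q s" by blast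
      then show ?case by (intro exI[of _ "P + Q"]) simp
    next
      case (mult p q)
      then obtain P Q where "\<forall>s. p [v s] = poly P s" "\<forall>s. q [v s] = poly Q s" by blast
      then show ?case by (intro exI[of _ "P * Q"]) simp
    next
      case (cong p q) then show ?case using vS by simp
    qed
    then obtain P where "\<forall>s. p [v s] = poly P s" by blast
    then show ?case by (intro exI[of _ "smult (w x) P"]) (simp add: curry_elt vS fscale_apply)
  next
    case (add f g)
    then obtain P Q where "\<forall>s. curry f [v s] x = poly P s" "\<forall>s. curry g [v s] x = poly Q s" by blast
    then show ?case by (intro exI[of _ "P + Q"]) (simp add: curry_conv pointwise)
  qed
qed

lemma coeff_pcompose_square: "coeff (pcompose P [:0, 0, 1:]) 1 = (0 :: 'k::comm_ring_1)"
  by (cases P) (simp add: pcompose_pCons coeff_pCons split: nat.splits)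

text \<open>Infinitely many \<open>t\<close> turn the equation into one between polynomials, and a
  polynomial in the square of the variable has no linear coefficient.\<close>

lemma square_curve_linear:
  fixes P :: "'k::alg_closed_field poly"
  assumes "\<And>t. poly P (t\<^sup>2) = a - t * b" shows "b = 0"
proof -
  have "pcompose P [:0, 0, 1:] = [:a, - b:]"
    by (rule poly_eqI_nonzero) (simp add: poly_pcompose power2_eq_square flip: assms)
  then show ?thesis using coeff_pcompose_square[of P] by simp
qed

section \<open>Frobenius twists in characteristic two\<close>

locale sl2_char2 =
  fixes ty :: "'k::alg_closed_field itself"
  assumes char2: "CHAR('k) = 2"
begin

lemma two_zero: "(2::'k) = 0"
  using of_nat_CHAR[where 'a = 'k] char2 by simp

lemma minus_eq [simp]: "- x = (x::'k)"
  by (rule uminus_CHAR_2[OF char2])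

lemma diff_eq: "x - y = x + (y::'k)"
  by (metis minus_eq diff_conv_add_uminus)

lemma square_add: "(x + y)\<^sup>2 = x\<^sup>2 + (y::'k)\<^sup>2"
  by (simp add: power2_sum two_zero)

lemma square_inj: "x\<^sup>2 = (y::'k)\<^sup>2 \<Longrightarrow> x = y"
  by (metis minus_eq power2_eq_iff)

lemma frob_mult: "frob (g ** h) = frob g ** frob (h :: 'k mat2)"
  by (simp add: mat2_eq_iff square_add power_mult_distrib)

lemma frob_SL2: "frob g \<in> SL2 \<longleftrightarrow> (g :: 'k mat2) \<in> SL2"
proof -
  have "(g$1$1)\<^sup>2 * (g$2$2)\<^sup>2 - (g$1$2)\<^sup>2 * (g$2$1)\<^sup>2 = (g$1$1 * g$2$2 - g$1$2 * g$2$1)\<^sup>2"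
    by (simp add: diff_eq square_add power_mult_distrib)
  then show ?thesis unfolding SL2_iff frob_nth using square_inj[of _ 1] by (metis one_power2)
qed

lemma frob_one [simp]: "frob (mat 1) = (mat 1 :: 'k mat2)"
  by (simp add: mat2_eq_iff)

lemma frob_adj2: "frob (adj2 g) = adj2 (frob (g :: 'k mat2))"
  by (simp add: mat2_eq_iff)

lemma frob_inj: "frob g = frob h \<Longrightarrow> g = (h :: 'k mat2)"
  using square_inj by (simp add: mat2_eq_iff)

lemma frob_surj: "\<exists>h. frob h = (g :: 'k mat2)"
proof -
  have "\<exists>y. y\<^sup>2 = x" for x :: 'k by (rule nth_root_exists) simp
  then obtain r where r: "\<And>x :: 'k. (r x)\<^sup>2 = x" by metis
  show ?thesis by (rule exI[of _ "mk22 (r (g$1$1)) (r (g$1$2)) (r (g$2$1)) (r (g$2$2))"]) (simp add: mat2_eq_iff r)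
qed

lemma frob_up: "frob (up t) = up ((t :: 'k)\<^sup>2)" and frob_lo: "frob (lo t) = lo (t\<^sup>2)"
  by (simp_all add: mat2_eq_iff)

text \<open>A bijection of matrices that is not a polynomial map. Composing a coordinate function
  with it stays in \<open>coord_ring\<close> once the function is known to lie in the image of
  \<open>fr\<close>.\<close>

definition frobinv :: "'k mat2 \<Rightarrow> 'k mat2" where
  "frobinv g = (SOME h. frob h = g)"

lemma frob_frobinv [simp]: "frob (frobinv g) = g"
  unfolding frobinv_def by (rule someI_ex[OF frob_surj])

lemma frobinv_frob [simp]: "frobinv (frob g) = g"
  by (rule frob_inj) simp

lemma frobinv_SL2 [simp]: "frobinv g \<in> SL2 \<longleftrightarrow> g \<in> SL2"
  using frob_SL2[of "frobinv g"] by simp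

lemma frobinv_mult: "frobinv (g ** h) = frobinv g ** frobinv h"
  by (rule frob_inj) (simp add: frob_mult)

lemma poly_map_frob:
  assumes "poly_map n (t :: 'k mat2 list \<Rightarrow> _)" shows "poly_map n (\<lambda>l. frob (t l))"
  unfolding poly_map_def
proof (intro conjI allI ballI)
  show "frob (t l) \<in> SL2" if "l \<in> tuples n" for l using poly_map_SL2[OF assms that] by (simp add: frob_SL2)
  have "(\<lambda>l. t l $ i $ j) \<in> LP n" for i j using assms by (simp add: poly_map_def)
  then show "(\<lambda>l. frob (t l) $ i $ j) \<in> LP n" for i j
    unfolding frob_nth by (rule LP_power)
qed

section \<open>Twisted modules and the invariants of their products with \<open>E\<close>\<close>

definition twist :: "('k, 'x) gmod \<Rightarrow> ('k, 'x) gmod" where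
  "twist M = \<lparr>carrier = carrier M, act = (\<lambda>g. act M (frob g))\<rparr>"

lemma carrier_twist [simp]: "carrier (twist M) = carrier M"
  and act_twist [simp]: "act (twist M) g = act M (frob g)"
  by (simp_all add: twist_def)

lemma rational_twist:
  assumes M: "rational_module M" shows "rational_module (twist M)"
proof (rule rational_moduleI)
  show "orb (twist M) v \<in> PF 1 (carrier (twist M))" if "v \<in> carrier (twist M)" for v
  proof -
    have s: "poly_subst 1 (Suc 0) (\<lambda>l :: 'k mat2 list. [frob (hd l)])"
      by (rule poly_subst_Cons[OF poly_map_frob[OF poly_map_hd1] poly_subst_Nil])
    have "cut 1 (\<lambda>l. curry (orb M v) [frob (hd l)]) \<in> PF 1 (carrier M)"
      using that by (intro PF_subst[OF rm_orb[OF M] s[folded One_nat_def]]) simp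
    also have "cut 1 (\<lambda>l. curry (orb M v) [frob (hd l)]) = orb (twist M) v"
      unfolding orb_def by (rule cut_cong) (auto simp: curry_cut frob_SL2 elim!: in_tuples_SucE)
    finally show ?thesis by simp
  qed
qed (simp_all add: frob_SL2 rm_sub[OF M] rm_act[OF M] rm_lin[OF M] rm_one[OF M] frob_mult rm_mult[OF M])

lemma ghom_twist: "ghom M N T \<Longrightarrow> ghom (twist M) (twist N) T"
  by (rule ghomI) (auto simp: ghom_lin ghom_in ghom_act frob_SL2)

lemma resolution_twist:
  assumes "resolution N e J \<delta>" shows "resolution (twist N) e (\<lambda>i. twist (J i)) \<delta>"
proof -
  interpret resolution N e J \<delta> by fact
  show ?thesis
    by unfold_locales (simp_all add: rational_twist N J ghom_twist e \<delta> inj exact0 exact)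
qed

lemma fixed_curve_linear:
  fixes M :: "('k, 'x) gmod"
  assumes M: "rational_module M" and v: "v \<in> carrier M" and c: "curve 0 c"
    and eq: "\<And>t. act M (c (t\<^sup>2)) v = v - fscale t w"
  shows "w = 0"
proof
  fix x
  obtain P where P: "\<And>s. curry (orb M v) [c s] x = poly P s"
    using PF1_curve[OF rm_orb[OF M v] c] by blast
  have "c s \<in> SL2" for s using c by (simp add: curve_def)
  then have "poly P s = act M (c s) v x" for s using P[of s] by (simp add: orb_def curry_cut)
  then have "poly P (t\<^sup>2) = v x - t * w x" for t using eq[of t] by (simp add: pointwise)
  from square_curve_linear[OF this] show "w x = 0 x" by (simp add: pointwise)
qed

text \<open>Along \<open>up\<close>, invariance says that translating the first component by
  \<open>up (t^2)\<close> subtracts \<open>t\<close> times the second. The left side is polynomial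
  in \<open>t^2\<close>, so the second component vanishes; \<open>lo\<close> treats the
  first.\<close>

lemma fixed_tensE_twist:
  assumes M: "rational_module M" shows "fixed (tensE (twist M)) = {0}"
proof (intro subset_antisym subsetI)
  fix w assume w: "w \<in> fixed (tensE (twist M))"
  then have wc: "curry w i \<in> carrier M" for i by (simp add: fixed_def carrier_tensE)
  have e: "curry w i = fscale (g$i$1) (act M (frob g) (curry w 1)) + fscale (g$i$2) (act M (frob g) (curry w 2))"
    if "g \<in> SL2" for g i
    using w that curry_act_tensE[of "twist M" g w i] by (simp add: fixed_def)
  have "curry w 2 = 0"
  proof (rule fixed_curve_linear[OF M wc curve_up])
    fix t :: 'k
    have "curry w 2 = act M (up (t\<^sup>2)) (curry w 2)" using e[OF up_SL2, of 2 t] by (simp add: frob_up)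
    moreover have "curry w 1 = act M (up (t\<^sup>2)) (curry w 1) + fscale t (act M (up (t\<^sup>2)) (curry w 2))"
      using e[OF up_SL2, of 1 t] by (simp add: frob_up)
    ultimately show "act M (up (t\<^sup>2)) (curry w 1) = curry w 1 - fscale t (curry w 2)"
      by (metis add_diff_cancel_right')
  qed
  moreover have "curry w 1 = 0"
  proof (rule fixed_curve_linear[OF M wc curve_lo])
    fix t :: 'k
    have "curry w 1 = act M (lo (t\<^sup>2)) (curry w 1)" using e[OF lo_SL2, of 1 t] by (simp add: frob_lo)
    moreover have "curry w 2 = fscale t (act M (lo (t\<^sup>2)) (curry w 1)) + act M (lo (t\<^sup>2)) (curry w 2)"
      using e[OF lo_SL2, of 2 t] by (simp add: frob_lo)
    ultimately show "act M (lo (t\<^sup>2)) (curry w 2) = curry w 2 - fscale t (curry w 1)"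
      by (metis add_diff_cancel_left')
  qed
  ultimately have "curry w i = curry 0 i" for i using exhaust_2'[of i] by (auto simp: curry_simps)
  then show "w \<in> {0}" by (simp add: curry_eqI)
qed (use fs.subspace_0[OF fixed_subspace[OF rational_tensE[OF rational_twist[OF M]]]] in simp)

text \<open>The tensor product with the invariant
  \<open>e_1 \<otimes> e_2 - e_2 \<otimes> e_1\<close> of \<open>E \<otimes> E\<close>, whose sign
  disappears in characteristic two.\<close>

definition coev :: "('x \<Rightarrow> 'k) \<Rightarrow> 2 \<times> 2 \<times> 'x \<Rightarrow> 'k" where
  "coev v = case_prod (\<lambda>i. case_prod (\<lambda>j. if i = j then 0 else v))"

lemma curry_coev: "curry (curry (coev v) i) j = (if i = j then 0 else v)"
  by (simp add: coev_def)

lemma lin_on_coev: "lin_on X coev"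
  by (intro lin_onI curry_eqI) (simp_all add: curry_simps curry_coev)

lemma uminus_vec: "- (v :: 'x \<Rightarrow> 'k) = v"
  by (simp add: fun_eq_iff pointwise)

text \<open>The terms linear in \<open>t\<close> along \<open>up\<close> and \<open>lo\<close> force
  the two diagonal components to vanish and the two others to agree. The surviving component is
  acted on with the determinant as coefficient.\<close>

lemma fixed_tensE_tensE_twist:
  assumes M: "rational_module M" shows "fixed (tensE (tensE (twist M))) = coev ` fixed M"
proof (intro subset_antisym subsetI)
  fix w assume w: "w \<in> fixed (tensE (tensE (twist M)))"
  let ?w = "\<lambda>i j. curry (curry w i) j"
  have wc: "?w i j \<in> carrier M" for i j using w by (simp add: fixed_def carrier_tensE)
  have e: "?w i j =
      fscale (g$i$1) (fscale (g$j$1) (act M (frob g) (?w 1 1)) + fscale (g$j$2) (act M (frob g) (?w 1 2))) +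
      fscale (g$i$2) (fscale (g$j$1) (act M (frob g) (?w 2 1)) + fscale (g$j$2) (act M (frob g) (?w 2 2)))"
    if "g \<in> SL2" for g i j
    using w that arg_cong[OF curry_act_tensE[of "tensE (twist M)" g w i], of "\<lambda>F. curry F j"]
    by (simp add: fixed_def curry_simps curry_act_tensE)
  have U: "act M (up (t\<^sup>2)) (?w 2 2) = ?w 2 2"
     "?w 1 2 = act M (up (t\<^sup>2)) (?w 1 2) + fscale t (act M (up (t\<^sup>2)) (?w 2 2))"
     "?w 2 1 = act M (up (t\<^sup>2)) (?w 2 1) + fscale t (act M (up (t\<^sup>2)) (?w 2 2))"
     "?w 1 1 = act M (up (t\<^sup>2)) (?w 1 1) + fscale t (act M (up (t\<^sup>2)) (?w 1 2)) +
        fscale t (act M (up (t\<^sup>2)) (?w 2 1) + fscale t (act M (up (t\<^sup>2)) (?w 2 2)))" for t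
    using e[OF up_SL2[of t], of 2 2] e[OF up_SL2[of t], of 1 2] e[OF up_SL2[of t], of 2 1] e[OF up_SL2[of t], of 1 1]
    by (simp_all add: frob_up)
  have 22: "?w 2 2 = 0"
  proof (rule fixed_curve_linear[OF M wc curve_up])
    show "act M (up (t\<^sup>2)) (?w 1 2) = ?w 1 2 - fscale t (?w 2 2)" for t
      using U(1,2)[of t] by (metis add_diff_cancel_right')
  qed
  have "?w 1 2 + ?w 2 1 = 0"
  proof (rule fixed_curve_linear[OF M wc curve_up])
    fix t
    have z: "act M (up (t\<^sup>2)) (?w 2 2) = 0" using U(1)[of t] 22 by (rule trans)
    have a: "act M (up (t\<^sup>2)) (?w 1 2) = ?w 1 2" "act M (up (t\<^sup>2)) (?w 2 1) = ?w 2 1"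
      using U(2)[of t, unfolded z fs.scale_zero_right add_0_right, symmetric]
        U(3)[of t, unfolded z fs.scale_zero_right add_0_right, symmetric] .
    have "?w 1 1 = act M (up (t\<^sup>2)) (?w 1 1) + fscale t (?w 1 2 + ?w 2 1)"
      using U(4)[of t] unfolding z a by (simp only: fs.scale_zero_right add_0_right fs.scale_right_distrib add.assoc)
    then show "act M (up (t\<^sup>2)) (?w 1 1) = ?w 1 1 - fscale t (?w 1 2 + ?w 2 1)"
      by (metis add_diff_cancel_right')
  qed
  then have 12: "?w 2 1 = ?w 1 2" by (metis uminus_vec add_eq_0_iff)
  have L: "act M (lo (t\<^sup>2)) (?w 1 1) = ?w 1 1"
     "?w 1 2 = fscale t (act M (lo (t\<^sup>2)) (?w 1 1)) + act M (lo (t\<^sup>2)) (?w 1 2)" for t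
    using e[OF lo_SL2[of t], of 1 1] e[OF lo_SL2[of t], of 1 2] by (simp_all add: frob_lo)
  have 11: "?w 1 1 = 0"
  proof (rule fixed_curve_linear[OF M wc curve_lo])
    show "act M (lo (t\<^sup>2)) (?w 1 2) = ?w 1 2 - fscale t (?w 1 1)" for t
      using L[of t] by (metis add_diff_cancel_left')
  qed
  \<comment> \<open>The equations involve only matrices \<open>frob h\<close>, so \<open>g\<close>
    is written in this form; the coefficient that appears is the determinant of
    \<open>h\<close>.\<close>
  have "act M g (?w 1 2) = ?w 1 2" if g: "g \<in> SL2" for g
  proof -
    let ?h = "frobinv g"
    have h: "?h \<in> SL2" using g by simp
    have h1: "?h$1$1 * ?h$2$2 + ?h$1$2 * ?h$2$1 = 1" using h by (simp add: SL2_iff diff_eq)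
    have "?w 1 2 = fscale (?h$1$1 * ?h$2$2 + ?h$1$2 * ?h$2$1) (act M g (?w 1 2))"
      using e[OF h, of 1 2] 11 22 12 rm_zero[OF M g] by (simp add: fs.scale_left_distrib)
    then show ?thesis unfolding h1 fs.scale_one by (rule sym)
  qed
  then have "?w 1 2 \<in> fixed M" using wc by (simp add: fixed_def)
  moreover have "w = coev (?w 1 2)"
  proof (intro curry_eqI)
    fix i j show "?w i j = curry (curry (coev (?w 1 2)) i) j"
      using exhaust_2'[of i] exhaust_2'[of j] 11 22 12 by (auto simp: curry_coev)
  qed
  ultimately show "w \<in> coev ` fixed M" by blast
next
  fix w assume "w \<in> coev ` fixed M"
  then obtain v where v: "v \<in> carrier M" "\<And>g. g \<in> SL2 \<Longrightarrow> act M g v = v" "w = coev v" by (auto simp: fixed_def)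
  have "act (tensE (tensE (twist M))) g w = w" if g: "g \<in> SL2" for g
  proof (intro curry_eqI)
    fix i j
    have gv: "act M (frob g) v = v" "act M (frob g) 0 = 0" using g v(2) rm_zero[OF M] by (simp_all add: frob_SL2)
    have "curry (curry (act (tensE (tensE (twist M))) g w) i) j = fscale (g$i$1 * g$j$2 + g$i$2 * g$j$1) v"
      by (simp add: curry_act_tensE curry_simps v(3) curry_coev gv fs.scale_left_distrib)
    also have "\<dots> = curry (curry w i) j"
    proof -
      have "g$1$1 * g$2$2 + g$1$2 * g$2$1 = 1" using g by (simp add: SL2_iff diff_eq)
      then show ?thesis
        using exhaust_2'[of i] exhaust_2'[of j] two_zero
        by (auto simp: v(3) curry_coev mult.commute add.commute simp flip: mult_2)
    qed
    finally show "curry (curry (act (tensE (tensE (twist M))) g w) i) j = curry (curry w i) j" .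
  qed
  then show "w \<in> fixed (tensE (tensE (twist M)))"
    using v(1) fs.subspace_0[OF rm_sub[OF M]] by (simp add: fixed_def carrier_tensE v(3) curry_coev)
qed

end

section \<open>The coordinate ring over its subring of squares\<close>

definition ent :: "2 \<Rightarrow> 2 \<Rightarrow> 'k::field mat2 \<Rightarrow> 'k" where
  "ent i j = (\<lambda>g. if g \<in> SL2 then g $ i $ j else 0)"

definition one2 :: "'k::field mat2 \<Rightarrow> 'k" where
  "one2 = (\<lambda>g. if g \<in> SL2 then 1 else 0)"

lemma ent_coord_ring [simp]: "ent i j \<in> coord_ring"
  and one2_coord_ring [simp]: "one2 \<in> coord_ring"
  by (simp_all add: ent_def one2_def coord_ring_entry coord_ring_const)

lemma lc_mult_1:
  assumes v: "curve 0 v" and f: "f \<in> coord_ring" and h: "h \<in> coord_ring" and v0: "v 0 = mat 1"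
  shows "lc v 1 (f * h) = f * lc v 1 h + lc v 1 f * h"
proof
  fix g
  obtain Q where Q: "\<And>s. poly Q s = f (g ** v s)" using coord_ring_curve[OF f v] by auto
  obtain R where R: "\<And>s. poly R s = h (g ** v s)" using coord_ring_curve[OF h v] by auto
  have 0: "coeff Q 0 = f g" "coeff R 0 = h g"
    using Q[of 0] R[of 0] v0 by (simp_all add: poly_0_coeff_0)
  have 1: "lc v 1 f g = coeff Q 1" "lc v 1 h g = coeff R 1" "lc v 1 (f * h) g = coeff (Q * R) 1"
    using lc_eqI[of Q 0 f g v 1] lc_eqI[of R 0 h g v 1] lc_eqI[of "Q * R" 0 "f * h" g v 1]
    by (simp_all add: Q R times_fun_apply)
  show "lc v 1 (f * h) g = (f * lc v 1 h + lc v 1 f * h) g"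
    unfolding plus_fun_apply times_fun_apply 1 by (simp add: coeff_mult 0)
qed

text \<open>The action of the two root vectors of the Lie algebra by right translation: derivations
  that commute with left translation and move one column of the matrix into the other.\<close>

definition D1 :: "('k::alg_closed_field mat2 \<Rightarrow> 'k) \<Rightarrow> 'k mat2 \<Rightarrow> 'k" where "D1 = lc up 1"
definition D2 :: "('k::alg_closed_field mat2 \<Rightarrow> 'k) \<Rightarrow> 'k mat2 \<Rightarrow> 'k" where "D2 = lc lo 1"

lemma up_0: "up 0 = mat 1" and lo_0: "lo 0 = mat 1"
  by (simp_all add: mat2_eq_iff)

lemma D_coord_ring [simp]: "f \<in> coord_ring \<Longrightarrow> D1 f \<in> coord_ring" "f \<in> coord_ring \<Longrightarrow> D2 f \<in> coord_ring"
  unfolding D1_def D2_def by (auto intro: lc_coord_ring curve_up curve_lo)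

lemma D_mult:
  assumes "f \<in> coord_ring" "h \<in> coord_ring"
  shows "D1 (f * h) = f * D1 h + D1 f * h" "D2 (f * h) = f * D2 h + D2 f * h"
  unfolding D1_def D2_def
  by (rule lc_mult_1[OF curve_up assms up_0], rule lc_mult_1[OF curve_lo assms lo_0])

lemma D_add:
  assumes "f \<in> coord_ring" "h \<in> coord_ring"
  shows "D1 (f + h) = D1 f + D1 h" "D2 (f + h) = D2 f + D2 h"
  unfolding D1_def D2_def
  by (rule lc_add[OF curve_up assms], rule lc_add[OF curve_lo assms])

lemma D_scale:
  assumes "f \<in> coord_ring"
  shows "D1 (fscale c f) = fscale c (D1 f)" "D2 (fscale c f) = fscale c (D2 f)"
  unfolding D1_def D2_def
  by (rule lc_scale[OF curve_up assms], rule lc_scale[OF curve_lo assms])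

lemma D_shift:
  "D1 (\<lambda>x. f (h ** x)) = (\<lambda>g. D1 f (h ** g))" "D2 (\<lambda>x. f (h ** x)) = (\<lambda>g. D2 f (h ** g))"
  unfolding D1_def D2_def by (rule ext, rule lc_shift)+

lemma mult_right_SL2: assumes h: "h \<in> SL2" shows "g ** h \<in> SL2 \<longleftrightarrow> g \<in> SL2"
proof
  assume "g ** h \<in> SL2"
  then have "g ** h ** adj2 h \<in> SL2" using h by (rule SL2_mult[OF _ SL2_adj2[THEN iffD2]])
  also have "g ** h ** adj2 h = g" using h by (metis adj2_right matrix_mul_assoc matrix_mul_rid)
  finally show "g \<in> SL2" .
qed (rule SL2_mult[OF _ h])

lemma D_ent [simp]:
  fixes i :: 2
  defines "e \<equiv> ent i :: 2 \<Rightarrow> 'k::alg_closed_field mat2 \<Rightarrow> 'k"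
  shows "D1 (e 2) = e 1" "D1 (e 1) = 0" "D2 (e 1) = e 2" "D2 (e 2) = 0"
  unfolding e_def
proof -
  have m: "g ** up s \<in> SL2 \<longleftrightarrow> g \<in> SL2" "g ** lo s \<in> SL2 \<longleftrightarrow> g \<in> SL2" for g :: "'k mat2" and s
    by (simp_all add: mult_right_SL2)
  have L: "D1 (ent i 2) g = coeff (if g \<in> SL2 then [:g$i$2, g$i$1:] else 0) (0 + 1)"
    "D1 (ent i 1) g = coeff (if g \<in> SL2 then [:g$i$1:] else 0) (0 + 1)"
    "D2 (ent i 1) g = coeff (if g \<in> SL2 then [:g$i$1, g$i$2:] else 0) (0 + 1)"
    "D2 (ent i 2) g = coeff (if g \<in> SL2 then [:g$i$2:] else 0) (0 + 1)" for g :: "'k mat2"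
    unfolding D1_def D2_def by (rule lc_eqI, simp add: ent_def m)+
  show "D1 (ent i 2) = (ent i 1 :: 'k mat2 \<Rightarrow> _)" by (rule ext, subst L) (simp add: ent_def)
  show "D1 (ent i 1) = (0 :: 'k mat2 \<Rightarrow> _)" by (rule ext, subst L) (simp add: zero_fun_apply)
  show "D2 (ent i 1) = (ent i 2 :: 'k mat2 \<Rightarrow> _)" by (rule ext, subst L) (simp add: ent_def)
  show "D2 (ent i 2) = (0 :: 'k mat2 \<Rightarrow> _)" by (rule ext, subst L) (simp add: zero_fun_apply)
qed

lemma D_one2 [simp]: "D1 one2 = (0 :: 'k mat2 \<Rightarrow> 'k)" "D2 one2 = (0 :: 'k::alg_closed_field mat2 \<Rightarrow> 'k)"
proof -
  have m: "g ** up s \<in> SL2 \<longleftrightarrow> g \<in> SL2" "g ** lo s \<in> SL2 \<longleftrightarrow> g \<in> SL2" for g :: "'k mat2" and s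
    by (simp_all add: mult_right_SL2)
  have L: "D1 one2 g = coeff [:one2 g:] (0 + 1)" "D2 one2 g = coeff [:one2 g:] (0 + 1)" for g :: "'k mat2"
    unfolding D1_def D2_def by (rule lc_eqI, simp add: one2_def m)+
  show "D1 one2 = (0 :: 'k mat2 \<Rightarrow> 'k)" "D2 one2 = (0 :: 'k mat2 \<Rightarrow> 'k)"
    by (rule ext, subst L, simp add: zero_fun_apply)+
qed

lemma D_zero [simp]: "D1 0 = (0 :: 'k mat2 \<Rightarrow> 'k)" "D2 0 = (0 :: 'k::alg_closed_field mat2 \<Rightarrow> 'k)"
proof -
  have "(0 :: 'k mat2 \<Rightarrow> 'k) \<in> coord_ring" by (rule fs.subspace_0[OF coord_ring_subspace])
  from D_scale[OF this, of 0] show "D1 0 = (0 :: 'k mat2 \<Rightarrow> 'k)" "D2 0 = (0 :: 'k mat2 \<Rightarrow> 'k)" by simp_all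
qed

text \<open>In characteristic two \<open>D1\<close> squares to zero and \<open>D1 D2 + D2 D1\<close>
  multiplies a monomial by the parity of its degree. So \<open>D1 D2 D1\<close> is \<open>D1\<close>
  on odd degrees and zero on even ones, and \<open>D2 D1 D2 D1\<close> is likewise
  \<open>D2 D1\<close>. The combination with row \<open>j\<close> of the matrix is Cramer's rule,
  see \<open>pj_recover\<close>.\<close>

definition pj :: "2 \<Rightarrow> ('k::alg_closed_field mat2 \<Rightarrow> 'k) \<Rightarrow> 'k mat2 \<Rightarrow> 'k" where
  "pj j f = ent j 1 * D2 (D1 (D2 (D1 f))) - ent j 2 * D1 (D2 (D1 f))"

lemma coord_ring_diff: "f \<in> coord_ring \<Longrightarrow> h \<in> coord_ring \<Longrightarrow> f - h \<in> (coord_ring :: ('k::field mat2 \<Rightarrow> 'k) set)"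
  by (rule fs.subspace_diff[OF coord_ring_subspace])

lemma pj_coord_ring: "f \<in> coord_ring \<Longrightarrow> pj j f \<in> coord_ring"
  by (simp add: pj_def coord_ring_diff coord_ring_times)

lemma pj_add: "f \<in> coord_ring \<Longrightarrow> h \<in> coord_ring \<Longrightarrow> pj j (f + h) = pj j f + pj j h"
  by (simp add: pj_def D_add fun_eq_iff pointwise algebra_simps)

lemma pj_scale: "f \<in> coord_ring \<Longrightarrow> pj j (fscale c f) = fscale c (pj j f)"
  by (simp add: pj_def D_scale fun_eq_iff pointwise algebra_simps)

text \<open>The derivations commute with left translation, so only the row factors
  \<open>ent j 1\<close> and \<open>ent j 2\<close> are transformed: \<open>pj 1\<close> and
  \<open>pj 2\<close> are the two coordinates of a vector of \<open>E\<close>.\<close>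

lemma pj_shift:
  assumes h: "h \<in> SL2"
  shows "pj j (\<lambda>x. f (adj2 h ** x)) g = h$j$1 * pj 1 f (adj2 h ** g) + h$j$2 * pj 2 f (adj2 h ** g)"
proof (cases "g \<in> SL2")
  case True
  define x where "x = adj2 h ** g"
  have g: "g = h ** x" using h by (simp add: x_def adj2_cancel_left)
  have x: "x \<in> SL2" using True h by (simp add: x_def)
  show ?thesis
    unfolding pj_def D_shift pointwise x_def[symmetric]
    using True x by (simp add: ent_def g algebra_simps)
next
  case False
  then have "adj2 h ** g \<notin> SL2" using h by (simp add: SL2_mult_cancel)
  then show ?thesis using False by (simp add: pj_def ent_def pointwise)
qed

context sl2_char2
begin

section \<open>Linearity over the subring of squares\<close>

definition fr :: "('k mat2 \<Rightarrow> 'k) \<Rightarrow> 'k mat2 \<Rightarrow> 'k" where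
  "fr q = (\<lambda>g. q (frob g))"

lemma fr_mult: "fr (p * q) = fr p * fr q" and fr_add: "fr (p + q) = fr p + fr q"
  and fr_zero: "fr 0 = 0"
  by (simp_all add: fr_def fun_eq_iff pointwise)

lemma fr_coord_ring: assumes "q \<in> coord_ring" shows "fr q \<in> coord_ring"
proof -
  have "(\<lambda>l. q (frob (hd l))) \<in> LP 1"
    by (intro coord_ring_LP[OF assms] poly_map_frob poly_map_hd1)
  from LP_coord_ring[OF this] show ?thesis
    using coord_ring_off[OF assms] by (auto simp: fr_def frob_SL2 cong: if_cong elim!: back_subst[of "\<lambda>x. x \<in> _"])
qed

text \<open>After the Frobenius map the curve parameter occurs only as \<open>t^2\<close>, so there
  is no linear term to extract.\<close>

lemma D_fr [simp]: assumes "q \<in> coord_ring" shows "D1 (fr q) = 0" "D2 (fr q) = 0"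
proof -
  have "lc v 1 (fr q) g = 0" if v: "curve 0 v" and sq: "\<And>t. frob (v t) = v (t\<^sup>2)" for v g
  proof -
    obtain Q where Q: "\<And>s. poly Q s = q (frob g ** v s)" using coord_ring_curve[OF assms v] by auto
    have "lc v 1 (fr q) g = coeff (pcompose Q [:0, 0, 1:]) (0 + 1)"
      by (rule lc_eqI) (simp add: poly_pcompose Q fr_def frob_mult sq flip: power2_eq_square)
    then show ?thesis by (simp only: add_0 coeff_pcompose_square)
  qed
  from this[OF curve_up frob_up] this[OF curve_lo frob_lo]
  show "D1 (fr q) = 0" "D2 (fr q) = 0"
    by (auto simp: D1_def D2_def fun_eq_iff zero_fun_apply simp del: One_nat_def)
qed

lemma D_mult_fr:
  assumes "m \<in> coord_ring" "q \<in> coord_ring"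
  shows "D1 (m * fr q) = D1 m * fr q" "D2 (m * fr q) = D2 m * fr q"
  using assms by (simp_all add: D_mult fr_coord_ring)

lemma pj_mult_fr:
  assumes "m \<in> coord_ring" "q \<in> coord_ring" shows "pj j (m * fr q) = pj j m * fr q"
proof -
  have "D1 (D2 (D1 (m * fr q))) = D1 (D2 (D1 m)) * fr q"
    "D2 (D1 (D2 (D1 (m * fr q)))) = D2 (D1 (D2 (D1 m))) * fr q"
    using assms by (simp_all add: D_mult_fr)
  then show ?thesis by (simp add: pj_def fun_eq_iff pointwise algebra_simps)
qed

text \<open>By linearity over the squares only \<open>pj j (ent 2 2)\<close> and
  \<open>pj j (ent 1 2)\<close> matter. They are two by two minors with either a repeated row,
  giving zero, or the determinant.\<close>

lemma pj_recover:
  assumes w: "\<And>i. w i \<in> coord_ring"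
  shows "pj j (ent 2 2 * fr (w 1) - ent 1 2 * fr (w 2)) = fr (w j)"
proof -
  have m: "- f = f" for f :: "'k mat2 \<Rightarrow> 'k" by (simp add: fun_eq_iff pointwise)
  have e: "ent 2 2 * fr (w 1) - ent 1 2 * fr (w 2) = ent 2 2 * fr (w 1) + ent 1 2 * fr (w 2)"
    by (simp add: diff_conv_add_uminus m del: add_uminus_conv_diff)
  have "pj j (ent 2 2 * fr (w 1) + ent 1 2 * fr (w 2)) = pj j (ent 2 2) * fr (w 1) + pj j (ent 1 2) * fr (w 2)"
    using w by (simp add: pj_add pj_mult_fr coord_ring_times fr_coord_ring)
  also have "\<dots> = fr (w j)"
  proof
    fix g
    have p: "pj j (ent 2 2) = ent j 1 * ent 2 2 - ent j 2 * ent 2 1"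
      "pj j (ent 1 2) = ent j 1 * ent 1 2 - ent j 2 * ent 1 1" by (simp_all add: pj_def)
    show "(pj j (ent 2 2) * fr (w 1) + pj j (ent 1 2) * fr (w 2)) g = fr (w j) g"
    proof (cases "g \<in> SL2")
      case True
      then have d: "g$1$1 * g$2$2 + g$1$2 * g$2$1 = 1" by (simp add: SL2_iff diff_eq)
      have z: "x + x = 0" for x :: 'k using two_zero by (simp flip: mult_2)
      show ?thesis
        using exhaust_2'[of j] True d z
        unfolding plus_fun_apply times_fun_apply p minus_apply
        by (auto simp: ent_def diff_eq mult.commute add.commute)
    next
      case False
      then have "fr (w i) g = 0" for i using coord_ring_off[OF fr_coord_ring[OF w]] by blast
      then show ?thesis by (simp add: times_fun_apply plus_fun_apply)
    qed
  qed
  finally show ?thesis unfolding e .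
qed

end

context sl2_char2
begin

lemma numeral_char2: "numeral (num.Bit0 n) = (0::'k)" "numeral (num.Bit1 n) = (1::'k)"
  using two_zero by (simp_all only: numeral_Bit0 numeral_Bit1) (simp_all flip: mult_2)

lemma SL2_det: "g \<in> SL2 \<Longrightarrow> g$1$1 * g$2$2 + g$1$2 * g$2$1 = (1::'k)"
  by (simp add: SL2_iff diff_eq)

lemma fun_eq_SL2:
  assumes "f \<in> coord_ring" "h \<in> (coord_ring :: ('k mat2 \<Rightarrow> 'k) set)" "\<And>g. g \<in> SL2 \<Longrightarrow> f g = h g"
  shows "f = h"
proof
  fix g show "f g = h g"
    using assms coord_ring_off[OF assms(1), of g] coord_ring_off[OF assms(2), of g] by (cases "g \<in> SL2") auto
qed

lemma coord_ring_0 [simp]: "0 \<in> (coord_ring :: ('k mat2 \<Rightarrow> 'k) set)"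
  by (rule fs.subspace_0[OF coord_ring_subspace])

text \<open>The values of \<open>pj\<close> on square-free monomials are squares. After expanding the derivations,
  rewriting \<open>b c\<close> to \<open>1 + a d\<close> brings both sides to normal form.\<close>

lemma pj_monomials:
  assumes g: "(g :: 'k mat2) \<in> SL2"
  shows "pj 1 (one2) g = 0" "pj 2 (one2) g = 0"
    "pj 1 (one2 * ent 2 2) g = 1" "pj 2 (one2 * ent 2 2) g = 0"
    "pj 1 (one2 * ent 2 1) g = 0" "pj 2 (one2 * ent 2 1) g = 0"
    "pj 1 (one2 * ent 2 1 * ent 2 2) g = 0" "pj 2 (one2 * ent 2 1 * ent 2 2) g = 0"
    "pj 1 (one2 * ent 1 2) g = 0" "pj 2 (one2 * ent 1 2) g = 1"
    "pj 1 (one2 * ent 1 2 * ent 2 2) g = 0" "pj 2 (one2 * ent 1 2 * ent 2 2) g = 0"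
    "pj 1 (one2 * ent 1 2 * ent 2 1) g = 0" "pj 2 (one2 * ent 1 2 * ent 2 1) g = 0"
    "pj 1 (one2 * ent 1 2 * ent 2 1 * ent 2 2) g = 1" "pj 2 (one2 * ent 1 2 * ent 2 1 * ent 2 2) g = 0"
    "pj 1 (one2 * ent 1 1) g = 0" "pj 2 (one2 * ent 1 1) g = 0"
    "pj 1 (one2 * ent 1 1 * ent 2 2) g = 0" "pj 2 (one2 * ent 1 1 * ent 2 2) g = 0"
    "pj 1 (one2 * ent 1 1 * ent 2 1) g = 0" "pj 2 (one2 * ent 1 1 * ent 2 1) g = 0"
    "pj 1 (one2 * ent 1 1 * ent 2 1 * ent 2 2) g = 0" "pj 2 (one2 * ent 1 1 * ent 2 1 * ent 2 2) g = g$2$1 * g$2$1"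
    "pj 1 (one2 * ent 1 1 * ent 1 2) g = 0" "pj 2 (one2 * ent 1 1 * ent 1 2) g = 0"
    "pj 1 (one2 * ent 1 1 * ent 1 2 * ent 2 2) g = 0" "pj 2 (one2 * ent 1 1 * ent 1 2 * ent 2 2) g = 1"
    "pj 1 (one2 * ent 1 1 * ent 1 2 * ent 2 1) g = g$1$1 * g$1$1" "pj 2 (one2 * ent 1 1 * ent 1 2 * ent 2 1) g = 0"
    "pj 1 (one2 * ent 1 1 * ent 1 2 * ent 2 1 * ent 2 2) g = 0" "pj 2 (one2 * ent 1 1 * ent 1 2 * ent 2 1 * ent 2 2) g = 0"
proof -
  define a b c d where abcd: "a = g$1$1" "b = g$1$2" "c = g$2$1" "d = g$2$2"
  have zz: "x + x = 0" "x + (x + y) = y" for x y :: 'k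
    using two_zero by (simp_all flip: mult_2 add.assoc)
  have "b * c = 1 + a * d"
  proof -
    have "b * c = (a * d + b * c) + a * d" by (simp add: two_zero)
    then show ?thesis using SL2_det[OF g] by (simp add: abcd)
  qed
  then have bc: "b * c = 1 + a * d" "b * (c * y) = y + a * (d * y)" for y
    by (simp_all add: mult.assoc[symmetric] distrib_right)
  note D = pj_def D_mult D_add D_ent D_one2 D_zero D_coord_ring coord_ring_times coord_ring_add
    ent_coord_ring one2_coord_ring mult_zero_left mult_zero_right add_0_left add_0_right
  note E = pointwise ent_def one2_def g diff_eq numeral_char2
  note F = abcd[symmetric] algebra_simps bc zz
  show "pj 1 (one2) g = 0"
    by ((simp only: D)?, (simp add: E)?, (simp add: F)?)
  show "pj 2 (one2) g = 0"
    by ((simp only: D)?, (simp add: E)?, (simp add: F)?)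
  show "pj 1 (one2 * ent 2 2) g = 1"
    by ((simp only: D)?, (simp add: E)?, (simp add: F)?)
  show "pj 2 (one2 * ent 2 2) g = 0"
    by ((simp only: D)?, (simp add: E)?, (simp add: F)?)
  show "pj 1 (one2 * ent 2 1) g = 0"
    by ((simp only: D)?, (simp add: E)?, (simp add: F)?)
  show "pj 2 (one2 * ent 2 1) g = 0"
    by ((simp only: D)?, (simp add: E)?, (simp add: F)?)
  show "pj 1 (one2 * ent 2 1 * ent 2 2) g = 0"
    by ((simp only: D)?, (simp add: E)?, (simp add: F)?)
  show "pj 2 (one2 * ent 2 1 * ent 2 2) g = 0"
    by ((simp only: D)?, (simp add: E)?, (simp add: F)?)
  show "pj 1 (one2 * ent 1 2) g = 0"
    by ((simp only: D)?, (simp add: E)?, (simp add: F)?)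
  show "pj 2 (one2 * ent 1 2) g = 1"
    by ((simp only: D)?, (simp add: E)?, (simp add: F)?)
  show "pj 1 (one2 * ent 1 2 * ent 2 2) g = 0"
    by ((simp only: D)?, (simp add: E)?, (simp add: F)?)
  show "pj 2 (one2 * ent 1 2 * ent 2 2) g = 0"
    by ((simp only: D)?, (simp add: E)?, (simp add: F)?)
  show "pj 1 (one2 * ent 1 2 * ent 2 1) g = 0"
    by ((simp only: D)?, (simp add: E)?, (simp add: F)?)
  show "pj 2 (one2 * ent 1 2 * ent 2 1) g = 0"
    by ((simp only: D)?, (simp add: E)?, (simp add: F)?)
  show "pj 1 (one2 * ent 1 2 * ent 2 1 * ent 2 2) g = 1"
    by ((simp only: D)?, (simp add: E)?, (simp add: F)?)
  show "pj 2 (one2 * ent 1 2 * ent 2 1 * ent 2 2) g = 0"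
    by ((simp only: D)?, (simp add: E)?, (simp add: F)?)
  show "pj 1 (one2 * ent 1 1) g = 0"
    by ((simp only: D)?, (simp add: E)?, (simp add: F)?)
  show "pj 2 (one2 * ent 1 1) g = 0"
    by ((simp only: D)?, (simp add: E)?, (simp add: F)?)
  show "pj 1 (one2 * ent 1 1 * ent 2 2) g = 0"
    by ((simp only: D)?, (simp add: E)?, (simp add: F)?)
  show "pj 2 (one2 * ent 1 1 * ent 2 2) g = 0"
    by ((simp only: D)?, (simp add: E)?, (simp add: F)?)
  show "pj 1 (one2 * ent 1 1 * ent 2 1) g = 0"
    by ((simp only: D)?, (simp add: E)?, (simp add: F)?)
  show "pj 2 (one2 * ent 1 1 * ent 2 1) g = 0"
    by ((simp only: D)?, (simp add: E)?, (simp add: F)?)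
  show "pj 1 (one2 * ent 1 1 * ent 2 1 * ent 2 2) g = 0"
    by ((simp only: D)?, (simp add: E)?, (simp add: F)?)
  show "pj 2 (one2 * ent 1 1 * ent 2 1 * ent 2 2) g = g$2$1 * g$2$1"
    by ((simp only: D)?, (simp add: E)?, (simp add: F)?)
  show "pj 1 (one2 * ent 1 1 * ent 1 2) g = 0"
    by ((simp only: D)?, (simp add: E)?, (simp add: F)?)
  show "pj 2 (one2 * ent 1 1 * ent 1 2) g = 0"
    by ((simp only: D)?, (simp add: E)?, (simp add: F)?)
  show "pj 1 (one2 * ent 1 1 * ent 1 2 * ent 2 2) g = 0"
    by ((simp only: D)?, (simp add: E)?, (simp add: F)?)
  show "pj 2 (one2 * ent 1 1 * ent 1 2 * ent 2 2) g = 1"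
    by ((simp only: D)?, (simp add: E)?, (simp add: F)?)
  show "pj 1 (one2 * ent 1 1 * ent 1 2 * ent 2 1) g = g$1$1 * g$1$1"
    by ((simp only: D)?, (simp add: E)?, (simp add: F)?)
  show "pj 2 (one2 * ent 1 1 * ent 1 2 * ent 2 1) g = 0"
    by ((simp only: D)?, (simp add: E)?, (simp add: F)?)
  show "pj 1 (one2 * ent 1 1 * ent 1 2 * ent 2 1 * ent 2 2) g = 0"
    by ((simp only: D)?, (simp add: E)?, (simp add: F)?)
  show "pj 2 (one2 * ent 1 1 * ent 1 2 * ent 2 1 * ent 2 2) g = 0"
    by ((simp only: D)?, (simp add: E)?, (simp add: F)?)
qed

section \<open>Generation of the coordinate ring by sixteen monomials over the squares\<close>

definition mon :: "nat \<Rightarrow> nat \<Rightarrow> nat \<Rightarrow> nat \<Rightarrow> 'k mat2 \<Rightarrow> 'k" where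
  "mon i j k l = (\<lambda>g. if g \<in> SL2 then (g$1$1) ^ i * (g$1$2) ^ j * (g$2$1) ^ k * (g$2$2) ^ l else 0)"

lemma mon_square_free:
  shows "mon 0 0 0 0 = one2"
    "mon 0 0 0 (Suc 0) = one2 * ent 2 2"
    "mon 0 0 (Suc 0) 0 = one2 * ent 2 1"
    "mon 0 0 (Suc 0) (Suc 0) = one2 * ent 2 1 * ent 2 2"
    "mon 0 (Suc 0) 0 0 = one2 * ent 1 2"
    "mon 0 (Suc 0) 0 (Suc 0) = one2 * ent 1 2 * ent 2 2"
    "mon 0 (Suc 0) (Suc 0) 0 = one2 * ent 1 2 * ent 2 1"
    "mon 0 (Suc 0) (Suc 0) (Suc 0) = one2 * ent 1 2 * ent 2 1 * ent 2 2"
    "mon (Suc 0) 0 0 0 = one2 * ent 1 1"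
    "mon (Suc 0) 0 0 (Suc 0) = one2 * ent 1 1 * ent 2 2"
    "mon (Suc 0) 0 (Suc 0) 0 = one2 * ent 1 1 * ent 2 1"
    "mon (Suc 0) 0 (Suc 0) (Suc 0) = one2 * ent 1 1 * ent 2 1 * ent 2 2"
    "mon (Suc 0) (Suc 0) 0 0 = one2 * ent 1 1 * ent 1 2"
    "mon (Suc 0) (Suc 0) 0 (Suc 0) = one2 * ent 1 1 * ent 1 2 * ent 2 2"
    "mon (Suc 0) (Suc 0) (Suc 0) 0 = one2 * ent 1 1 * ent 1 2 * ent 2 1"
    "mon (Suc 0) (Suc 0) (Suc 0) (Suc 0) = one2 * ent 1 1 * ent 1 2 * ent 2 1 * ent 2 2"
  by (rule ext, simp add: mon_def pointwise ent_def one2_def)+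

lemma mon_coord_ring [simp]: "mon i j k l \<in> coord_ring"
proof -
  have p: "(\<lambda>g :: 'k mat2. (g $ i $ j) ^ n) \<in> poly_fun" for i j n
    by (induction n) (auto intro: poly_fun.intros)
  have "(\<lambda>g :: 'k mat2. (g$1$1) ^ i * (g$1$2) ^ j * (g$2$1) ^ k * (g$2$2) ^ l) \<in> poly_fun"
    by (intro poly_fun.mult p)
  from bexI[OF refl this] show ?thesis unfolding coord_ring_def mon_def by (rule CollectI)
qed

lemma fr_values:
  assumes "g \<in> SL2"
  shows "fr 0 g = 0" "fr one2 g = 1" "fr (ent i j) g = g$i$j * g$i$j"
  using assms by (simp_all add: fr_def pointwise one2_def ent_def frob_SL2 power2_eq_square)

text \<open>The four candidates for \<open>q\<close> are read off the table in
  \<open>pj_monomials\<close>: its values are \<open>0\<close>, \<open>1\<close> and the squares of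
  the entries of the first column.\<close>

lemma pj_square_free:
  assumes "i < 2" "j < 2" "k < 2" "l < 2"
  shows "\<exists>q\<in>coord_ring. pj m (mon i j k l) = fr q"
proof -
  have b: "n = 0 \<or> n = Suc 0" if "n < 2" for n :: nat using that by auto
  have "\<exists>q\<in>{0, one2, ent 1 1, ent 2 1}. \<forall>g\<in>SL2. pj m (mon i j k l) g = fr q g"
    using b[OF assms(1)] b[OF assms(2)] b[OF assms(3)] b[OF assms(4)] exhaust_2'[of m]
    by (elim disjE) (simp_all add: mon_square_free pj_monomials fr_values)
  then obtain q where q: "q \<in> {0, one2, ent 1 1, ent 2 1}" "\<forall>g\<in>SL2. pj m (mon i j k l) g = fr q g" by blast
  then have "q \<in> coord_ring" by auto
  moreover have "pj m (mon i j k l) = fr q"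
    using q(2) calculation by (intro fun_eq_SL2 pj_coord_ring fr_coord_ring) auto
  ultimately show ?thesis by blast
qed

text \<open>The span of the sixteen square-free monomials over the squares. Since it turns out to be
  all of \<open>coord_ring\<close>, a claim linear over the squares has to be checked on these
  monomials only.\<close>

inductive_set MF :: "('k mat2 \<Rightarrow> 'k) set" where
  gen: "i < 2 \<Longrightarrow> j < 2 \<Longrightarrow> k < 2 \<Longrightarrow> l < 2 \<Longrightarrow> q \<in> coord_ring \<Longrightarrow> mon i j k l * fr q \<in> MF"
| add: "f \<in> MF \<Longrightarrow> h \<in> MF \<Longrightarrow> f + h \<in> MF"

lemma MF_gen:
  assumes "q \<in> coord_ring" shows "mon i j k l * fr q \<in> MF"
proof -
  have p: "x ^ n = x ^ (n mod 2) * (x\<^sup>2) ^ (n div 2)" for x :: 'k and n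
    by (simp flip: power_mult power_add)
  have "mon i j k l * fr q = mon (i mod 2) (j mod 2) (k mod 2) (l mod 2) *
      fr (mon (i div 2) (j div 2) (k div 2) (l div 2) * q)"
  proof
    fix g show "(mon i j k l * fr q) g = (mon (i mod 2) (j mod 2) (k mod 2) (l mod 2) *
      fr (mon (i div 2) (j div 2) (k div 2) (l div 2) * q)) g"
      using p[of "g$1$1" i] p[of "g$1$2" j] p[of "g$2$1" k] p[of "g$2$2" l]
      by (simp add: mon_def fr_def times_fun_apply frob_SL2)
  qed
  then show ?thesis using assms by (simp add: MF.gen coord_ring_times)
qed

lemma MF_times:
  assumes "f \<in> MF" "h \<in> MF" shows "f * h \<in> MF"
  using assms(1)
proof induction
  case (gen i j k l q)
  note q = gen(5)
  from assms(2) show ?case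
  proof induction
    case (gen i' j' k' l' q')
    have "mon i j k l * fr q * (mon i' j' k' l' * fr q') = mon (i + i') (j + j') (k + k') (l + l') * fr (q * q')"
      by (rule ext) (simp add: mon_def fr_def times_fun_apply power_add)
    then show ?case using MF_gen[OF coord_ring_times[OF q gen(5)]] by simp
  qed (simp add: distrib_left MF.add)
qed (simp add: distrib_right MF.add)

lemma coord_ring_MF: "f \<in> coord_ring \<Longrightarrow> f \<in> MF"
proof -
  assume "f \<in> coord_ring"
  then obtain p where p: "p \<in> poly_fun" "f = (\<lambda>g. if g \<in> SL2 then p g else 0)"
    by (auto simp: coord_ring_def)
  have e: "(\<lambda>g :: 'k mat2. if g \<in> SL2 then g $ i $ j else 0) \<in> MF" for i j
  proof -
    have "\<exists>a b c d. ent i j = mon a b c d * fr one2"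
    proof -
      have "ent 1 1 = mon 1 0 0 0 * fr one2" "ent 1 2 = mon 0 1 0 0 * fr one2"
        "ent 2 1 = mon 0 0 1 0 * fr one2" "ent 2 2 = mon 0 0 0 1 * fr one2"
        by (rule ext, simp add: mon_def ent_def fr_def one2_def times_fun_apply frob_SL2)+
      then show ?thesis using exhaust_2'[of i] exhaust_2'[of j] by auto
    qed
    then have "ent i j \<in> MF" using MF_gen[OF one2_coord_ring] by auto
    then show ?thesis by (simp add: ent_def)
  qed
  from p(1) have "(\<lambda>g. if g \<in> SL2 then p g else 0) \<in> MF"
  proof induction
    case (const c)
    have "(\<lambda>g. if g \<in> SL2 then c else 0) = mon 0 0 0 0 * fr (\<lambda>g. if g \<in> SL2 then c else 0)"
      by (rule ext) (simp add: mon_def fr_def times_fun_apply frob_SL2)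
    then show ?case using MF_gen[OF coord_ring_const[of c], of 0 0 0 0] by simp
  next
    case (entry i j) show ?case by (rule e)
  next
    case (add p q)
    have "(\<lambda>g. if g \<in> SL2 then p g + q g else 0) = (\<lambda>g. if g \<in> SL2 then p g else 0) + (\<lambda>g. if g \<in> SL2 then q g else 0)"
      by (rule ext) (simp add: plus_fun_apply)
    then show ?case using MF.add[OF add.IH] by simp
  next
    case (mult p q)
    have "(\<lambda>g. if g \<in> SL2 then p g * q g else 0) = (\<lambda>g. if g \<in> SL2 then p g else 0) * (\<lambda>g. if g \<in> SL2 then q g else 0)"
      by (rule ext) (simp add: times_fun_apply)
    then show ?case using MF_times[OF mult.IH] by simp
  qed
  then show "f \<in> MF" using p(2) by simp
qed

lemma pj_range:
  assumes "f \<in> coord_ring" shows "\<exists>q\<in>coord_ring. pj m f = fr q"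
proof -
  from coord_ring_MF[OF assms] have "f \<in> coord_ring \<and> (\<exists>q\<in>coord_ring. pj m f = fr q)"
  proof induction
    case (gen i j k l q)
    obtain r where r: "r \<in> coord_ring" "pj m (mon i j k l) = fr r" using pj_square_free[OF gen(1-4)] by blast
    then have "pj m (mon i j k l * fr q) = fr (r * q)" using gen by (simp add: pj_mult_fr fr_mult)
    then show ?case using gen r by (auto intro!: coord_ring_times fr_coord_ring)
  next
    case (add f h)
    then obtain q r where "q \<in> coord_ring" "pj m f = fr q" "r \<in> coord_ring" "pj m h = fr r" by blast
    moreover from this have "pj m (f + h) = fr (q + r)" using add by (simp add: pj_add fr_add)
    ultimately show ?case using add coord_ring_add by blast
  qed
  then show ?thesis ..
qed

text \<open>The projection of the coordinate ring onto the direct summand \<open>E \<otimes> k[SL\<^sub>2]\<^sup>(\<^sup>1\<^sup>)\<close>.\<close>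

definition prj :: "2 \<Rightarrow> ('k mat2 \<Rightarrow> 'k) \<Rightarrow> 'k mat2 \<Rightarrow> 'k" where
  "prj j f = (\<lambda>g. pj j f (frobinv g))"

text \<open>This is where \<open>pj_range\<close> enters: \<open>pj j f\<close> is
  \<open>fr q\<close> for a coordinate function \<open>q\<close>, and undoing the Frobenius map
  leaves \<open>q\<close>.\<close>

lemma prj_coord_ring: assumes "f \<in> coord_ring" shows "prj j f \<in> coord_ring"
proof -
  obtain q where "q \<in> coord_ring" "pj j f = fr q" using pj_range[OF assms] by blast
  then show ?thesis by (simp add: prj_def fr_def)
qed

lemma prj_add: "f \<in> coord_ring \<Longrightarrow> h \<in> coord_ring \<Longrightarrow> prj j (f + h) = prj j f + prj j h"
  and prj_scale: "f \<in> coord_ring \<Longrightarrow> prj j (fscale c f) = fscale c (prj j f)"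
  by (simp_all add: prj_def pj_add pj_scale fun_eq_iff pointwise)

lemma prj_shift:
  assumes "h \<in> SL2"
  shows "prj j (\<lambda>x. f (adj2 h ** x)) g =
    h$j$1 * prj 1 f (adj2 (frob h) ** g) + h$j$2 * prj 2 f (adj2 (frob h) ** g)"
proof -
  have "frobinv (adj2 (frob h) ** g) = adj2 h ** frobinv g"
    by (simp add: frobinv_mult flip: frob_adj2)
  then show ?thesis by (simp add: prj_def pj_shift[OF assms])
qed

lemma prj_recover:
  assumes "\<And>i. w i \<in> coord_ring"
  shows "prj j (ent 2 2 * fr (w 1) - ent 1 2 * fr (w 2)) = w j"
proof -
  have "pj j (ent 2 2 * fr (w 1) - ent 1 2 * fr (w 2)) = fr (w j)" by (rule pj_recover[OF assms])
  from fun_cong[OF this] show ?thesis by (intro ext) (simp add: prj_def, simp add: fr_def)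
qed

end

section \<open>The projection applied to vector-valued functions\<close>

lemma PF_coord_ring:
  fixes H :: "'k::field mat2 list \<times> 'x \<Rightarrow> 'k"
  assumes "H \<in> PF (Suc n) X" shows "(\<lambda>g. curry H (g # l) x) \<in> coord_ring"
  using assms
proof (induction rule: PF_Suc_induct)
  case zero
  have "(\<lambda>g. curry (0 :: 'k mat2 list \<times> 'x \<Rightarrow> 'k) (g # l) x) = 0" by (rule ext) (simp add: curry_conv pointwise)
  then show ?case using fs.subspace_0[OF coord_ring_subspace] by metis
next
  case (gen b f)
  have "(\<lambda>g. curry (cons_elt b f) (g # l) x) = fscale (curry f l x) b"
    by (simp add: fun_eq_iff fscale_apply mult.commute)
  then show ?case using fs.subspace_scale[OF coord_ring_subspace gen(1)] by simp
next
  case (add f g)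
  have "(\<lambda>h. curry (f + g) (h # l) x) = (\<lambda>h. curry f (h # l) x) + (\<lambda>h. curry g (h # l) x)"
    by (simp add: fun_eq_iff curry_conv pointwise)
  then show ?case using coord_ring_add[OF add(3,4)] by metis
qed

lemma PF_unsplit:
  assumes "F \<in> PF 1 (PF m X)" shows "cut (Suc m) (\<lambda>l. curry (curry F [hd l]) (tl l)) \<in> PF (Suc m) X"
  using assms
proof (induction rule: PF.induct)
  case zero
  show ?case by (simp add: curry_simps cut_zero PF.zero)
next
  case (gen p w)
  let ?b = "\<lambda>g. if g \<in> SL2 then p [g] else 0"
  have "cut (Suc m) (\<lambda>l. curry (curry (elt 1 p w) [hd l]) (tl l)) = cons_elt ?b w"
  proof (rule curry_eqI)
    fix l show "curry (cut (Suc m) (\<lambda>l. curry (curry (elt 1 p w) [hd l]) (tl l))) l = curry (cons_elt ?b w) l"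
      using PF_off[OF gen(2)] by (cases l) (auto simp: curry_cut curry_elt curry_simps)
  qed
  then show ?case using cons_elt_PF[OF LP_coord_ring[OF gen(1)] gen(2)] by simp
next
  case (add f g)
  then show ?case by (simp add: curry_simps cut_add PF.add)
qed

context sl2_char2
begin

lemma prj_zero: "prj j 0 = 0"
  using prj_scale[of 0 j 0] by simp

definition prjv :: "2 \<Rightarrow> ('k mat2 list \<times> 'x \<Rightarrow> 'k) \<Rightarrow> 'k mat2 list \<times> 'x \<Rightarrow> 'k" where
  "prjv j H = case_prod (\<lambda>l. case l of [] \<Rightarrow> 0 | y # l' \<Rightarrow> (\<lambda>x. prj j (\<lambda>g. curry H (g # l') x) y))"

lemma curry_prjv [simp]: "curry (prjv j H) (y # l) = (\<lambda>x. prj j (\<lambda>g. curry H (g # l) x) y)"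
    "curry (prjv j H) [] = 0"
  by (simp_all add: prjv_def)

lemma prjv_zero: "prjv j 0 = (0 :: 'k mat2 list \<times> 'x \<Rightarrow> 'k)"
proof (rule curry_eqI)
  fix l show "curry (prjv j 0) l = curry (0 :: 'k mat2 list \<times> 'x \<Rightarrow> 'k) l"
  proof (cases l)
    case (Cons y l')
    have e: "(\<lambda>g. curry (0 :: 'k mat2 list \<times> 'x \<Rightarrow> 'k) (g # l') x) = 0" for x
      by (rule ext) (simp add: curry_conv pointwise)
    show ?thesis unfolding Cons curry_prjv e prj_zero by (rule ext) (simp only: curry_zero zero_fun_apply)
  qed (simp add: curry_zero)
qed

lemma prjv_cons_elt:
  assumes "b \<in> coord_ring" shows "prjv j (cons_elt b f) = cons_elt (prj j b) f"
proof (rule curry_eqI)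
  fix l show "curry (prjv j (cons_elt b f)) l = curry (cons_elt (prj j b) f) l"
  proof (cases l)
    case (Cons y l')
    have e: "(\<lambda>g. curry (cons_elt b f) (g # l') x) = fscale (curry f l' x) b" for x
      by (simp add: fun_eq_iff fscale_apply mult.commute)
    show ?thesis
      unfolding Cons curry_prjv e prj_scale[OF assms]
      by (rule ext) (simp only: curry_cons_elt fscale_apply mult.commute)
  qed simp
qed

lemma prjv_add:
  assumes "f \<in> PF (Suc n) X" "g \<in> PF (Suc n) X" shows "prjv j (f + g) = prjv j f + prjv j g"
proof (rule curry_eqI)
  fix l show "curry (prjv j (f + g)) l = curry (prjv j f + prjv j g) l"
  proof (cases l)
    case (Cons y l')
    have e: "(\<lambda>h. curry (f + g) (h # l') x) = (\<lambda>h. curry f (h # l') x) + (\<lambda>h. curry g (h # l') x)" for x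
      by (simp add: fun_eq_iff curry_conv pointwise)
    show ?thesis
      unfolding Cons curry_prjv e prj_add[OF PF_coord_ring[OF assms(1)] PF_coord_ring[OF assms(2)]]
      by (rule ext) (simp only: curry_prjv curry_add plus_fun_apply)
  qed (simp add: curry_simps)
qed

lemma prjv_scale:
  assumes "f \<in> PF (Suc n) X" shows "prjv j (fscale c f) = fscale c (prjv j f)"
proof (rule curry_eqI)
  fix l show "curry (prjv j (fscale c f)) l = curry (fscale c (prjv j f)) l"
  proof (cases l)
    case (Cons y l')
    have e: "(\<lambda>h. curry (fscale c f) (h # l') x) = fscale c (\<lambda>h. curry f (h # l') x)" for x
      by (simp add: fun_eq_iff curry_conv pointwise)
    show ?thesis
      unfolding Cons curry_prjv e prj_scale[OF PF_coord_ring[OF assms]]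
      by (rule ext) (simp only: curry_prjv curry_scale fscale_apply)
  qed (simp add: curry_simps)
qed

lemma prjv_PF: "H \<in> PF (Suc n) X \<Longrightarrow> prjv j H \<in> PF (Suc n) X"
proof (induction rule: PF_Suc_induct)
  case zero then show ?case by (simp add: prjv_zero PF.zero)
next
  case (gen b f) then show ?case by (simp add: prjv_cons_elt cons_elt_PF prj_coord_ring)
next
  case (add f g) then show ?case by (simp add: prjv_add[of _ n X] PF.add)
qed

text \<open>The linear map \<open>T\<close> stands for the action of \<open>frob h\<close> on the
  values. It must be carried through the projection because the action on \<open>Std n M\<close>
  translates arguments and moves values at once.\<close>

lemma prjv_shift:
  assumes H: "H \<in> PF (Suc n) X" and T: "lin_on X T" "fs.subspace X" and h: "h \<in> SL2"
  shows "prj j (\<lambda>g. T (curry H (adj2 h ** g # l)) x) y =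
    h$j$1 * T (curry (prjv 1 H) (adj2 (frob h) ** y # l)) x + h$j$2 * T (curry (prjv 2 H) (adj2 (frob h) ** y # l)) x"
  using H
proof (induction rule: PF_Suc_induct)
  case zero
  have e: "(\<lambda>g. T (curry 0 (adj2 h ** g # l)) x) = 0"
    by (simp add: fun_eq_iff curry_zero lin_on_zero[OF T] zero_fun_apply)
  have p: "T (curry (prjv i 0) k) x = 0" for i k
    by (simp only: prjv_zero curry_zero lin_on_zero[OF T] zero_fun_apply)
  show ?case unfolding e prj_zero p by (simp add: zero_fun_apply)
next
  case (gen b f)
  have f: "curry f l \<in> X" by (rule PF_in[OF gen(2) T(2)])
  have b: "(\<lambda>g. b (adj2 h ** g)) \<in> coord_ring"
  proof -
    have "(\<lambda>l. b (adj2 h ** hd l)) \<in> LP 1"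
      using h by (intro coord_ring_LP[OF gen(1)] poly_map_mult poly_map_const poly_map_hd1) simp
    from LP_coord_ring[OF this] have "(\<lambda>g. if g \<in> SL2 then b (adj2 h ** g) else 0) \<in> coord_ring"
      by (simp cong: if_cong)
    moreover have "(\<lambda>g. if g \<in> SL2 then b (adj2 h ** g) else 0) = (\<lambda>g. b (adj2 h ** g))"
      using coord_ring_off[OF gen(1)] h by (auto simp: fun_eq_iff SL2_mult_cancel)
    ultimately show ?thesis by simp
  qed
  have e: "(\<lambda>g. T (curry (cons_elt b f) (adj2 h ** g # l)) x) = fscale (T (curry f l) x) (\<lambda>g. b (adj2 h ** g))"
    using f by (simp add: fun_eq_iff fscale_apply lin_on_scale[OF T(1)] mult.commute)
  have 1: "prj j (\<lambda>g. T (curry (cons_elt b f) (adj2 h ** g # l)) x) y =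
      T (curry f l) x * (h$j$1 * prj 1 b (adj2 (frob h) ** y) + h$j$2 * prj 2 b (adj2 (frob h) ** y))"
    by (simp only: e prj_scale[OF b] fscale_apply[of _ "prj j _"] prj_shift[OF h])
  have 2: "T (curry (prjv i (cons_elt b f)) (k # l)) x = prj i b k * T (curry f l) x" for i k
    by (simp only: prjv_cons_elt[OF gen(1)] curry_cons_elt lin_on_scale[OF T(1) f] fscale_apply[of _ "T _"])
  show ?case unfolding 1 2 by (simp add: algebra_simps)
next
  case (add f g)
  have c: "(\<lambda>u. T (curry F (adj2 h ** u # l)) x) \<in> coord_ring" if F: "F \<in> PF (Suc n) X" for F
  proof -
    have "cut (Suc n) (\<lambda>l. curry F (adj2 h ** hd l # tl l)) \<in> PF (Suc n) X"
      using h by (intro PF_subst[OF F] poly_subst_Cons poly_map_mult poly_map_const poly_map_hd poly_subst_tl) simp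
    from PF_coord_ring[OF PF_pw[OF this T order.refl], of l x]
    have "(\<lambda>u. curry (pw T (cut (Suc n) (\<lambda>l. curry F (adj2 h ** hd l # tl l)))) (u # l) x) \<in> coord_ring" .
    moreover have "curry (pw T (cut (Suc n) (\<lambda>l. curry F (adj2 h ** hd l # tl l)))) (u # l) x =
        T (curry F (adj2 h ** u # l)) x" for u
      using PF_off[OF F, of "adj2 h ** u # l"] h by (auto simp: curry_cut SL2_mult_cancel)
    ultimately show ?thesis by simp
  qed
  have v: "curry F k \<in> X" if "F \<in> PF (Suc n) X" for F k by (rule PF_in[OF that T(2)])
  have e: "(\<lambda>u. T (curry (f + g) (adj2 h ** u # l)) x) =
      (\<lambda>u. T (curry f (adj2 h ** u # l)) x) + (\<lambda>u. T (curry g (adj2 h ** u # l)) x)"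
    using v[OF add(1)] v[OF add(2)] by (simp add: fun_eq_iff curry_add lin_on_add[OF T(1)] plus_fun_apply)
  have e': "T (curry (prjv i (f + g)) k) x = T (curry (prjv i f) k) x + T (curry (prjv i g) k) x" for i k
    using v[OF prjv_PF[OF add(1)]] v[OF prjv_PF[OF add(2)]]
    by (simp add: prjv_add[OF add(1,2)] curry_add lin_on_add[OF T(1)] plus_fun_apply)
  have "prj j (\<lambda>u. T (curry (f + g) (adj2 h ** u # l)) x) y =
      prj j (\<lambda>u. T (curry f (adj2 h ** u # l)) x) y + prj j (\<lambda>u. T (curry g (adj2 h ** u # l)) x) y"
    by (simp only: e prj_add[OF c[OF add(1)] c[OF add(2)]] plus_fun_apply[of "prj j _"])
  then show ?case unfolding add(3,4) e' by (simp add: algebra_simps)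
qed

text \<open>Pairing with the first row of the inverse matrix.\<close>

definition rowp :: "nat \<Rightarrow> ('k mat2 list \<times> 2 \<times> 'k mat2 list \<times> 'x \<Rightarrow> 'k) \<Rightarrow> 'k mat2 list \<times> 'x \<Rightarrow> 'k" where
  "rowp n F = cut (Suc n) (\<lambda>l.
     fscale (hd l $ 2 $ 2) (curry (curry (curry F [hd l]) 1) (frob (hd l) # tl l)) -
     fscale (hd l $ 1 $ 2) (curry (curry (curry F [hd l]) 2) (frob (hd l) # tl l)))"

lemma rowp_off: "l \<notin> tuples (Suc n) \<Longrightarrow> curry (rowp n F) l = 0"
  by (simp add: rowp_def curry_cut)

lemma rowp_PF:
  assumes X: "fs.subspace X" and F: "F \<in> PF 1 {w. \<forall>i. curry w i \<in> PF (Suc n) X}"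
  shows "rowp n F \<in> PF (Suc n) X"
proof -
  let ?W = "{w :: 2 \<times> _ \<Rightarrow> 'k. \<forall>i. curry w i \<in> PF (Suc n) X}"
  have sW: "fs.subspace ?W"
    by (rule fs.subspaceI) (auto simp: curry_simps PF.zero PF.add PF_scale)
  let ?G = "\<lambda>i. cut (Suc n) (\<lambda>l. curry (curry (curry F [hd l]) i) (frob (hd l) # tl l))"
  have G: "?G i \<in> PF (Suc n) X" for i
  proof -
    have "pw (\<lambda>w. curry w i) F \<in> PF 1 (PF (Suc n) X)"
      by (rule PF_pw[OF F _ sW]) (auto simp: lin_on_def curry_simps)
    from PF_subst[OF PF_unsplit[OF this], of "Suc n" "\<lambda>l. hd l # frob (hd l) # tl l"]
    have "cut (Suc n) (\<lambda>l. curry (cut (Suc (Suc n)) (\<lambda>l. curry (curry (pw (\<lambda>w. curry w i) F) [hd l]) (tl l)))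
       (hd l # frob (hd l) # tl l)) \<in> PF (Suc n) X"
      by (simp add: poly_subst_Cons poly_map_hd poly_map_frob poly_subst_tl)
    then show ?thesis
      by (rule back_subst[of "\<lambda>x. x \<in> _"])
         (rule cut_cong, auto simp: curry_cut frob_SL2 elim!: in_tuples_SucE)
  qed
  have LP: "(\<lambda>l. hd l $ i $ j) \<in> LP (Suc n)" for i j
    using poly_map_hd unfolding poly_map_def by blast
  have "rowp n F = cut (Suc n) (\<lambda>l. fscale (hd l $ 2 $ 2) (curry (?G 1) l)) -
     cut (Suc n) (\<lambda>l. fscale (hd l $ 1 $ 2) (curry (?G 2) l))"
    unfolding rowp_def cut_diff[symmetric] by (rule cut_cong) (simp add: curry_cut)
  then show ?thesis
    using PF_mult[OF G LP] by (auto intro!: fs.subspace_diff[OF PF_subspace])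
qed

text \<open>The retraction first multiplies: \<open>rowp\<close> embeds the \<open>E\<close> factor
  by the second column of the matrix, evaluates the first variable of \<open>Std\<close> at
  \<open>frob g\<close>, and so lands in functions of \<open>g\<close> alone. Then
  \<open>prjv\<close> projects back to both coordinates. On constants this composite is the identity
  by \<open>prj_recover\<close>.\<close>

lemma rel_inj_tensE_twist_Std:
  assumes M: "rational_module (M :: ('k, 'x) gmod)" shows "rel_inj (tensE (twist (Std n M)))"
proof -
  let ?Y = "tensE (twist (Std n M))"
  let ?X = "carrier M"
  note X = rm_sub[OF M]
  have Y: "rational_module ?Y" by (intro rational_tensE rational_twist rational_Std M)
  have cY: "carrier ?Y = {w. \<forall>i. curry w i \<in> PF (Suc n) ?X}"
    by (auto simp: carrier_tensE carrier_Std)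
  have rp: "rowp n F \<in> PF (Suc n) ?X" if "F \<in> carrier (Std 0 ?Y)" for F
    using that by (intro rowp_PF[OF X]) (simp add: carrier_Std cY)
  let ?r = "\<lambda>F. case_prod (\<lambda>j. prjv j (rowp n F))"
  have "ghom (Std 0 ?Y) ?Y ?r"
  proof (rule ghomI)
    have a: "rowp n (F + G) = rowp n F + rowp n G" for F G :: "'k mat2 list \<times> 2 \<times> 'k mat2 list \<times> 'x \<Rightarrow> 'k"
      unfolding rowp_def cut_add[symmetric]
      by (rule cut_cong) (simp add: curry_simps fs.scale_right_distrib)
    have s: "rowp n (fscale c F) = fscale c (rowp n F)" for c and F :: "'k mat2 list \<times> 2 \<times> 'k mat2 list \<times> 'x \<Rightarrow> 'k"
      unfolding rowp_def cut_scale[symmetric]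
      by (rule cut_cong) (simp add: curry_simps fs.scale_right_diff_distrib mult.commute)
    show "lin_on (carrier (Std 0 ?Y)) ?r"
      by (intro lin_onI curry_eqI)
         (simp_all only: a s curry_case_prod curry_add curry_scale prjv_add[OF rp rp] prjv_scale[OF rp])
    show "?r F \<in> carrier ?Y" if "F \<in> carrier (Std 0 ?Y)" for F
      using prjv_PF[OF rp[OF that]] by (simp add: cY)
    show "?r (act (Std 0 ?Y) h F) = act ?Y h (?r F)" if h: "h \<in> SL2" and F: "F \<in> carrier (Std 0 ?Y)" for h F
    proof (intro curry_eqI)
      fix j l
      let ?T = "act M (frob h)"
      have T: "lin_on ?X ?T" using h by (intro rm_lin[OF M]) (simp add: frob_SL2)
      have T0: "?T 0 = 0" by (rule lin_on_zero[OF T X])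
      have rhs: "curry (curry (act ?Y h (?r F)) j) l =
          fscale (h$j$1) (?T (curry (prjv 1 (rowp n F)) (tr (adj2 (frob h)) l))) +
          fscale (h$j$2) (?T (curry (prjv 2 (rowp n F)) (tr (adj2 (frob h)) l)))"
        by (simp add: curry_act_tensE curry_simps curry_act_Std)
      show "curry (curry (?r (act (Std 0 ?Y) h F)) j) l = curry (curry (act ?Y h (?r F)) j) l"
      proof (cases l)
        case Nil
        then show ?thesis unfolding rhs by (simp add: T0)
      next
        case (Cons y l')
        let ?l = "tr (adj2 (frob h)) l'"
        have step: "curry (rowp n (act (Std 0 ?Y) h F)) (g # l') = ?T (curry (rowp n F) (adj2 h ** g # ?l))" for g
        proof (cases "g # l' \<in> tuples (Suc n)")
          case True
          then have g: "g \<in> SL2" "l' \<in> tuples n" by auto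
          have in': "adj2 h ** g \<in> SL2" "?l \<in> tuples n" using g h by (simp_all add: frob_SL2)
          let ?w = "\<lambda>i. curry (curry (curry F [adj2 h ** g]) i) (frob (adj2 h ** g) # ?l)"
          have w: "?w i \<in> ?X" for i
          proof -
            have "curry F [adj2 h ** g] \<in> carrier ?Y"
              using F rm_sub[OF Y] by (intro PF_in) (auto simp: carrier_Std)
            then show ?thesis using PF_in[of _ "Suc n", OF _ X] by (simp add: cY)
          qed
          have "curry (curry (curry (act (Std 0 ?Y) h F) [g]) i) (frob g # l') =
              fscale (h$i$1) (?T (?w 1)) + fscale (h$i$2) (?T (?w 2))" for i
            by (simp add: curry_act_Std curry_act_tensE curry_simps frob_mult frob_adj2)
          then have "curry (rowp n (act (Std 0 ?Y) h F)) (g # l') =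
              fscale (g$2$2) (fscale (h$1$1) (?T (?w 1)) + fscale (h$1$2) (?T (?w 2))) -
              fscale (g$1$2) (fscale (h$2$1) (?T (?w 1)) + fscale (h$2$2) (?T (?w 2)))"
            using g by (simp add: rowp_def curry_cut)
          \<comment> \<open>Collecting the coefficients of \<open>?w 1\<close> and
            \<open>?w 2\<close> produces the second column of \<open>adj2 h ** g\<close>, so
            \<open>rowp\<close> is equivariant.\<close>
          also have "\<dots> = fscale ((adj2 h ** g) $ 2 $ 2) (?T (?w 1)) - fscale ((adj2 h ** g) $ 1 $ 2) (?T (?w 2))"
            by (simp add: fun_eq_iff pointwise algebra_simps two_zero)
          also have "\<dots> = ?T (fscale ((adj2 h ** g) $ 2 $ 2) (?w 1) - fscale ((adj2 h ** g) $ 1 $ 2) (?w 2))"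
            using w by (simp only: lin_on_diff[OF T X] lin_on_scale[OF T] fs.subspace_scale[OF X])
          also have "fscale ((adj2 h ** g) $ 2 $ 2) (?w 1) - fscale ((adj2 h ** g) $ 1 $ 2) (?w 2) =
              curry (rowp n F) (adj2 h ** g # ?l)"
            using in' by (simp add: rowp_def curry_cut)
          finally show ?thesis .
        next
          case False
          then have "adj2 h ** g # ?l \<notin> tuples (Suc n)" using h by (auto simp: SL2_mult_cancel frob_SL2)
          then have "curry (rowp n F) (adj2 h ** g # ?l) = 0" by (rule rowp_off)
          then show ?thesis by (simp only: rowp_off[OF False] T0)
        qed
        have "curry (curry (?r (act (Std 0 ?Y) h F)) j) l x = curry (curry (act ?Y h (?r F)) j) l x" for x
        proof -
          have "curry (curry (?r (act (Std 0 ?Y) h F)) j) l x =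
              prj j (\<lambda>g. ?T (curry (rowp n F) (adj2 h ** g # ?l)) x) y"
            by (simp only: Cons curry_case_prod curry_prjv step)
          also have "\<dots> = h$j$1 * ?T (curry (prjv 1 (rowp n F)) (adj2 (frob h) ** y # ?l)) x +
              h$j$2 * ?T (curry (prjv 2 (rowp n F)) (adj2 (frob h) ** y # ?l)) x"
            by (rule prjv_shift[OF rp[OF F] T X h])
          also have "\<dots> = curry (curry (act ?Y h (?r F)) j) l x"
            unfolding rhs by (simp only: Cons list.map plus_fun_apply fscale_apply)
          finally show ?thesis .
        qed
        then show ?thesis by (rule ext)
      qed
    qed
  qed
  moreover have "?r (cst w) = w" if w: "w \<in> carrier ?Y" for w
  proof (intro curry_eqI)
    fix j l
    have wP: "curry w i \<in> PF (Suc n) ?X" for i using w by (simp add: cY)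
    show "curry (curry (?r (cst w)) j) l = curry (curry w j) l"
    proof (cases l)
      case Nil
      then show ?thesis using PF_off[OF wP, of "[]"] by simp
    next
      case (Cons y l')
      show ?thesis
      proof
        fix x
        let ?W = "\<lambda>i g. curry (curry w i) (g # l') x"
        have W: "?W i \<in> coord_ring" for i by (rule PF_coord_ring[OF wP])
        have "(\<lambda>g. curry (rowp n (cst w)) (g # l') x) = ent 2 2 * fr (?W 1) - ent 1 2 * fr (?W 2)"
        proof
          fix g
          show "curry (rowp n (cst w)) (g # l') x = (ent 2 2 * fr (?W 1) - ent 1 2 * fr (?W 2)) g"
          proof (cases "g # l' \<in> tuples (Suc n)")
            case True
            then show ?thesis
              by (simp add: rowp_def curry_cut curry_cst minus_apply times_fun_apply fscale_apply ent_def)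
                (simp add: fr_def)
          next
            case False
            then have "frob g # l' \<notin> tuples (Suc n)" by (auto simp: frob_SL2)
            then have "?W i (frob g) = 0" for i using PF_off[OF wP] by (simp add: zero_fun_apply)
            then show ?thesis using False
              by (simp add: rowp_off[OF False] minus_apply times_fun_apply zero_fun_apply) (simp add: fr_def)
          qed
        qed
        then have "curry (curry (?r (cst w)) j) l x = prj j (ent 2 2 * fr (?W 1) - ent 1 2 * fr (?W 2)) y"
          by (simp only: Cons curry_case_prod curry_prjv)
        also have "\<dots> = ?W j y" using fun_cong[OF prj_recover[of ?W j, OF W], of y] .
        finally show "curry (curry (?r (cst w)) j) l x = curry (curry w j) l x" by (simp add: Cons)
      qed
    qed
  qed
  ultimately show ?thesis using Y unfolding rel_inj_def by blast
qed

text \<open>Twisting and tensoring keep the standard resolution exact and make its terms acyclic,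
  and the invariants of every term vanish.\<close>

theorem coh_tensE_twist:
  assumes M: "rational_module M" shows "coh_le n (tensE (twist M)) 0"
proof (cases n)
  case 0
  have r: "rational_module (tensE (twist M))" by (intro rational_tensE rational_twist M)
  show ?thesis unfolding 0 coh_le_0[OF r] fixed_tensE_twist[OF M] by (simp add: qle_0)
next
  case (Suc m)
  interpret R: resolution "tensE (twist M)" "tE cst" "\<lambda>i. tensE (twist (Std i M))" "\<lambda>i. tE (dd i)"
    by (intro resolution_tensE resolution_twist resolution_Std M)
  interpret R: acyclic_resolution "tensE (twist M)" "tE cst" "\<lambda>i. tensE (twist (Std i M))" "\<lambda>i. tE (dd i)"
    by unfold_locales (intro rel_inj_acyclic rel_inj_tensE_twist_Std M)
  have z: "tE (dd m) 0 = 0" by (simp add: tE_eq_0 curry_zero dd_zero)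
  have "tE (dd (Suc m)) 0 = 0" by (simp add: tE_eq_0 curry_zero dd_zero)
  then show ?thesis
    unfolding Suc R.coh_le_iff fixed_tensE_twist[OF rational_Std[OF M]] by (auto simp: z qle_0)
qed

lemma fixed_Std: assumes M: "rational_module (M :: ('k, 'x) gmod)" shows "fixed (Std n M) = cochains n M"
proof -
  have "(\<forall>g\<in>SL2. act (Std n M) g f = f) \<longleftrightarrow> (\<forall>g\<in>SL2. \<forall>l\<in>tuples (Suc n). curry f (tr g l) = act M g (curry f l))"
    if f: "f \<in> PF (Suc n) (carrier M)" for f
  proof (intro iffI ballI)
    fix g :: "'k mat2" and l :: "'k mat2 list"
    assume a: "\<forall>g\<in>SL2. act (Std n M) g f = f" "g \<in> SL2" "l \<in> tuples (Suc n)"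
    then have "curry (act (Std n M) g f) (tr g l) = curry f (tr g l)" by simp
    then show "curry f (tr g l) = act M g (curry f l)"
      unfolding curry_act_Std tr_adj2(2)[OF a(2)] by (rule sym)
  next
    fix g :: "'k mat2" assume a: "\<forall>g\<in>SL2. \<forall>l\<in>tuples (Suc n). curry f (tr g l) = act M g (curry f l)" "g \<in> SL2"
    have *: "act M g (curry f (tr (adj2 g) l)) = curry f (tr g (tr (adj2 g) l))" if "l \<in> tuples (Suc n)" for l
      using a(2) that by (intro a(1)[rule_format, OF a(2), symmetric]) simp
    show "act (Std n M) g f = f"
      by (rule PF_eqI[OF _ f])
        (use rm_act[OF rational_Std[OF M] a(2)] f a(2) * in
          \<open>auto simp: carrier_Std curry_act_Std simp del: map_map\<close>)
  qed
  then show ?thesis unfolding fixed_def cochains_def carrier_Std by blast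
qed

text \<open>Through \<open>coev\<close>, the complex of invariants of the twisted resolution is the
  cochain complex of \<open>M\<close> itself.\<close>

theorem coh_tensE_tensE_twist:
  assumes M: "rational_module M" and c: "coh_le n M c"
  shows "coh_le n (tensE (tensE (twist M))) c"
proof (cases n)
  case 0
  have r: "rational_module (tensE (tensE (twist M)))" by (intro rational_tensE rational_twist M)
  have "qle (fixed M) {0} c" using c unfolding 0 coh_le_0[OF M] .
  then have "qle (coev ` fixed M) {0} c"
    by (rule qle_image[OF _ lin_on_coev fixed_subspace[OF M]])
       (use fs.subspace_0[OF fixed_subspace[OF M]] lin_on_zero[OF lin_on_coev[of UNIV]] in auto)
  then show ?thesis unfolding 0 coh_le_0[OF r] fixed_tensE_tensE_twist[OF M] .
next
  case (Suc m)
  let ?J = "\<lambda>i. tensE (tensE (twist (Std i M)))"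
  interpret R: resolution "tensE (tensE (twist M))" "tE (tE cst)" ?J "\<lambda>i. tE (tE (dd i))"
    by (intro resolution_tensE resolution_twist resolution_Std M)
  interpret R: acyclic_resolution "tensE (tensE (twist M))" "tE (tE cst)" ?J "\<lambda>i. tE (tE (dd i))"
    by unfold_locales (intro rel_inj_acyclic rel_inj_tensE rel_inj_tensE_twist_Std M)
  have fx: "fixed (?J i) = coev ` cochains i M" for i
    by (simp add: fixed_tensE_tensE_twist[OF rational_Std[OF M]] fixed_Std[OF M])
  have t: "tE (tE (dd i)) (coev f) = coev (dd i f)" for i f
    by (intro curry_eqI) (simp add: curry_coev dd_zero)
  have inj: "coev f = 0 \<longleftrightarrow> f = 0" for f :: "'k mat2 list \<times> 'a \<Rightarrow> 'k"
  proof
    assume "coev f = 0"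
    then have "curry (curry (coev f) 1) 2 = 0" by (simp add: curry_zero)
    then show "f = 0" by (simp add: curry_coev)
  qed (simp add: lin_on_zero[OF lin_on_coev[of UNIV]])
  have 1: "{v \<in> fixed (?J (Suc m)). tE (tE (dd (Suc m))) v = 0} = coev ` cocycles (Suc m) M"
    unfolding fx by (auto simp: t inj cocycles_def)
  have 2: "tE (tE (dd m)) ` fixed (?J m) = coev ` coboundaries (Suc m) M"
    unfolding fx by (auto simp: image_image t)
  have "qle (coev ` cocycles (Suc m) M) (coev ` coboundaries (Suc m) M) c"
    using c unfolding Suc coh_le_def
    by (rule qle_image[OF _ lin_on_coev cocycles_subspace[OF M] coboundaries_cocycles[OF M]]) auto
  then show ?thesis unfolding Suc R.coh_le_iff 1 2 .
qed

end

section \<open>Weyl modules in coordinates\<close>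

text \<open>\<open>hp g m i\<close> is the polynomial \<open>(a x + b y)\<^sup>i (c x + d y)\<^sup>m\<^sup>-\<^sup>i\<close> with \<open>y = 1\<close>.\<close>

definition hp :: "'k::field mat2 \<Rightarrow> nat \<Rightarrow> nat \<Rightarrow> 'k poly" where
  "hp g m i = [:g$1$2, g$1$1:] ^ i * [:g$2$2, g$2$1:] ^ (m - i)"

text \<open>A vector of \<open>Weyl m\<close> is a linear functional on binary forms of degree
  \<open>m\<close>, with \<open>v j\<close> its value at \<open>x^j y^(m-j)\<close>; forms are
  written with \<open>y = 1\<close>.\<close>

definition ev :: "nat \<Rightarrow> (nat \<Rightarrow> 'k::field) \<Rightarrow> 'k poly \<Rightarrow> 'k" where
  "ev m v P = (\<Sum>j\<le>m. v j * coeff P j)"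

definition Weyl :: "nat \<Rightarrow> ('k::field, nat) gmod" where
  "Weyl m = \<lparr>carrier = {v. \<forall>i>m. v i = 0}, act = (\<lambda>g v i. if i \<le> m then ev m v (hp g m i) else 0)\<rparr>"

lemma carrier_Weyl: "v \<in> carrier (Weyl m) \<longleftrightarrow> (\<forall>i>m. v i = 0)"
  and act_Weyl: "act (Weyl m) g v i = (if i \<le> m then ev m v (hp g m i) else 0)"
  by (simp_all add: Weyl_def)

lemma degree_linear_power: "degree ([:b, a:] ^ n) \<le> n"
  by (rule order.trans[OF degree_power_le]) (auto simp: degree_pCons_eq_if)

lemma degree_hp: "i \<le> m \<Longrightarrow> degree (hp g m i) \<le> m"
  unfolding hp_def
  by (rule order.trans[OF degree_mult_le])
     (use degree_linear_power[of "g$1$2" "g$1$1" i] degree_linear_power[of "g$2$2" "g$2$1" "m - i"] in linarith)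

lemma hp_Suc_left: "hp g (Suc m) (Suc i) = [:g$1$2, g$1$1:] * hp g m i"
  by (simp add: hp_def mult_ac del: mult_pCons_left)

lemma hp_Suc_right: "i \<le> m \<Longrightarrow> hp g (Suc m) i = [:g$2$2, g$2$1:] * hp g m i"
  by (simp add: hp_def Suc_diff_le mult_ac del: mult_pCons_left)

lemma ev_add: "ev m v (P + Q) = ev m v P + ev m v Q"
  by (simp add: ev_def distrib_left sum.distrib)

lemma ev_smult: "ev m v (smult c P) = c * ev m v P"
  by (simp add: ev_def sum_distrib_left mult_ac)

lemma ev_sum: "ev m v (\<Sum>i\<in>A. P i) = (\<Sum>i\<in>A. ev m v (P i))"
  by (induction A rule: infinite_finite_induct) (simp_all add: ev_add, simp_all add: ev_def)

lemma ev_vec_add: "ev m (\<lambda>j. v j + w j) P = ev m v P + ev m w P"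
  by (simp add: ev_def distrib_right sum.distrib)

lemma ev_vec_scale: "ev m (\<lambda>j. c * v j) P = c * ev m v P"
  by (simp add: ev_def sum_distrib_left mult_ac)

lemma ev_vec_diff: "ev m (\<lambda>j. v j - w j) P = ev m v P - ev m w P"
  by (simp add: ev_def left_diff_distrib sum_subtractf)

lemma ev_pCons: "ev (Suc m) v (pCons c P) = v 0 * c + ev m (\<lambda>j. v (Suc j)) P"
  unfolding ev_def by (subst sum.atMost_Suc_shift) simp

lemma ev_Suc: "degree P \<le> m \<Longrightarrow> ev (Suc m) v P = ev m v P"
  by (simp add: ev_def coeff_eq_0)

lemma ev_cong: "(\<And>j. j \<le> m \<Longrightarrow> v j = w j) \<Longrightarrow> ev m v P = ev m w P"
  by (simp add: ev_def)

text \<open>Substitution of \<open>A\<close> and \<open>B\<close> for the two variables of a form.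
  The degree \<open>m\<close> is a separate argument because setting \<open>y = 1\<close> may lower
  the degree of the polynomial.\<close>

definition homog :: "'k::field poly \<Rightarrow> 'k poly \<Rightarrow> nat \<Rightarrow> 'k poly \<Rightarrow> 'k poly" where
  "homog A B m P = (\<Sum>j\<le>m. smult (coeff P j) (A ^ j * B ^ (m - j)))"

lemma homog_pCons: "homog A B (Suc m) (pCons c P) = smult c (B ^ Suc m) + A * homog A B m P"
  unfolding homog_def by (subst sum.atMost_Suc_shift) (simp add: sum_distrib_left mult_ac)

lemma homog_Suc: "degree P \<le> m \<Longrightarrow> homog A B (Suc m) P = B * homog A B m P"
  by (auto simp: homog_def coeff_eq_0 sum_distrib_left Suc_diff_le mult_ac intro!: sum.cong)

lemma homog_add: "homog A B m (P + Q) = homog A B m P + homog A B m Q"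
  by (simp add: homog_def smult_add_left sum.distrib)

lemma homog_smult: "homog A B m (smult c P) = smult c (homog A B m P)"
proof -
  have "homog A B m (smult c P) = (\<Sum>j\<le>m. [:c:] * smult (coeff P j) (A ^ j * B ^ (m - j)))"
    by (simp add: homog_def mult.commute)
  also have "\<dots> = [:c:] * homog A B m P" unfolding homog_def sum_distrib_left ..
  finally show ?thesis by simp
qed

lemma homog_linear_mult:
  assumes "degree P \<le> m"
  shows "homog A B (Suc m) ([:b, a:] * P) = (smult a A + smult b B) * homog A B m P"
proof -
  have "[:b, a:] * P = smult b P + pCons 0 (smult a P)"
    by (simp add: mult_pCons_left)
  then show ?thesis
    using assms by (simp add: homog_add homog_smult homog_pCons homog_Suc algebra_simps)
qed

lemma homog_hp:
  assumes "i \<le> m"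
  shows "homog A B m (hp g m i) =
    (smult (g$1$1) A + smult (g$1$2) B) ^ i * (smult (g$2$1) A + smult (g$2$2) B) ^ (m - i)"
  using assms
proof (induction m arbitrary: i)
  case 0
  then show ?case by (simp add: homog_def hp_def)
next
  case (Suc m)
  show ?case
  proof (cases i)
    case 0
    have "hp g (Suc m) 0 = [:g$2$2, g$2$1:] * hp g m 0" by (rule hp_Suc_right) simp
    then show ?thesis
      using Suc.IH[of 0] degree_hp[of 0 m g] by (simp add: 0 homog_linear_mult del: mult_pCons_left)
  next
    case i: (Suc i')
    then have i': "i' \<le> m" using Suc.prems by simp
    show ?thesis
      unfolding i hp_Suc_left homog_linear_mult[OF degree_hp[OF i']] Suc.IH[OF i'] by (simp add: mult_ac)
  qed
qed

text \<open>The rows of \<open>g ** h\<close> are combinations of the rows of \<open>h\<close>, so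
  the form for the product arises by substituting the linear forms of \<open>h\<close> into the form
  for \<open>g\<close>.\<close>

lemma hp_mult:
  assumes "i \<le> m" shows "hp (g ** h) m i = homog [:h$1$2, h$1$1:] [:h$2$2, h$2$1:] m (hp g m i)"
  unfolding homog_hp[OF assms] unfolding hp_def by (simp add: add_ac)

lemma LP_coeff_mult:
  assumes "\<And>j. (\<lambda>l. coeff (P l) j) \<in> LP n" "\<And>j. (\<lambda>l. coeff (Q l) j) \<in> LP n"
  shows "(\<lambda>l. coeff (P l * Q l) j) \<in> LP n"
  unfolding coeff_mult by (intro LP_sum LP.mult assms)

lemma LP_coeff_hp:
  assumes "poly_map n t" shows "(\<lambda>l. coeff (hp (t l) m i) j) \<in> LP n"
proof -
  have e: "(\<lambda>l. t l $ i $ j) \<in> LP n" for i j using assms by (simp add: poly_map_def)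
  have lin: "(\<lambda>l. coeff [:t l $ a $ b, t l $ c $ d:] j) \<in> LP n" for a b c d j
  proof (cases j)
    case (Suc k)
    then show ?thesis by (cases k) (simp_all add: e LP.const)
  qed (simp add: e)
  have pow: "(\<lambda>l. coeff ([:t l $ a $ b, t l $ c $ d:] ^ k) j) \<in> LP n" for a b c d k j
  proof (induction k arbitrary: j)
    case 0 show ?case by (simp add: LP.const)
  next
    case (Suc k) show ?case unfolding power_Suc by (rule LP_coeff_mult[OF lin Suc])
  qed
  show ?thesis unfolding hp_def by (rule LP_coeff_mult[OF pow pow])
qed

lemma rational_Weyl: "rational_module (Weyl m :: ('k::field, nat) gmod)"
proof (rule rational_moduleI)
  show sub: "fs.subspace (carrier (Weyl m :: ('k, nat) gmod))"
    by (rule fs.subspaceI) (auto simp: carrier_Weyl pointwise)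
  show "act (Weyl m) g v \<in> carrier (Weyl m)" for g and v :: "nat \<Rightarrow> 'k"
    by (simp add: carrier_Weyl act_Weyl)
  show "lin_on (carrier (Weyl m)) (act (Weyl m) g)" for g :: "'k mat2"
    by (intro lin_onI ext)
       (simp_all add: act_Weyl plus_fun_def ev_vec_add, simp_all add: fscale_def act_Weyl ev_vec_scale)
  show "act (Weyl m) (mat 1) v = v" if v: "v \<in> carrier (Weyl m)" for v :: "nat \<Rightarrow> 'k"
  proof
    fix i show "act (Weyl m) (mat 1) v i = v i"
    proof (cases "i \<le> m")
      case True
      have "hp (mat 1) m i = monom (1::'k) i" by (simp add: hp_def monom_altdef pCons_one)
      then show ?thesis using True by (simp add: act_Weyl ev_def if_distrib cong: if_cong)
    qed (use v in \<open>simp add: act_Weyl carrier_Weyl\<close>)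
  qed
  show "act (Weyl m) (g ** h) v = act (Weyl m) g (act (Weyl m) h v)" for g h and v :: "nat \<Rightarrow> 'k"
  proof
    fix i show "act (Weyl m) (g ** h) v i = act (Weyl m) g (act (Weyl m) h v) i"
    proof (cases "i \<le> m")
      case True
      have "ev m v (hp (g ** h) m i) = (\<Sum>j\<le>m. coeff (hp g m i) j * ev m v (hp h m j))"
        unfolding hp_mult[OF True] homog_def ev_sum ev_smult by (simp add: hp_def)
      also have "\<dots> = ev m (act (Weyl m) h v) (hp g m i)"
        unfolding ev_def[of m "act (Weyl m) h v"] by (intro sum.cong) (simp_all add: act_Weyl mult.commute)
      finally show ?thesis using True by (simp add: act_Weyl)
    qed (simp add: act_Weyl)
  qed
  show "orb (Weyl m) v \<in> PF 1 (carrier (Weyl m))" for v :: "nat \<Rightarrow> 'k"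
  proof -
    let ?e = "\<lambda>i j. if j = i then 1 else 0 :: 'k"
    have "orb (Weyl m) v = (\<Sum>i\<le>m. cut 1 (\<lambda>l. fscale (ev m v (hp (hd l) m i)) (?e i)))"
    proof -
      have "(\<Sum>i\<in>A. cut 1 (\<lambda>l. fscale (ev m v (hp (hd l) m i)) (?e i))) =
          cut 1 (\<lambda>l. \<Sum>i\<in>A. fscale (ev m v (hp (hd l) m i)) (?e i))" if "finite A" for A
        using that by (induction A) (simp_all add: cut_zero cut_add del: One_nat_def)
      moreover have "(\<Sum>i\<le>m. fscale (ev m v (hp g m i)) (?e i)) = act (Weyl m) g v" for g
      proof
        fix j
        have *: "(\<Sum>i\<in>A. fscale (ev m v (hp g m i)) (?e i)) j = (if j \<in> A then ev m v (hp g m j) else 0)"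
          if "finite A" for A using that by (induction A) (auto simp: pointwise)
        show "(\<Sum>i\<le>m. fscale (ev m v (hp g m i)) (?e i)) j = act (Weyl m) g v j"
          by (subst *) (simp_all add: act_Weyl)
      qed
      ultimately show ?thesis by (simp add: orb_def)
    qed
    also have "\<dots> \<in> PF 1 (carrier (Weyl m))"
    proof (intro fs.subspace_sum PF_subspace cut_elt)
      show "(\<lambda>l. ev m v (hp (hd l) m i)) \<in> LP 1" for i
        unfolding ev_def by (intro LP_sum LP.mult LP.const LP_coeff_hp poly_map_hd1)
    qed (auto simp: carrier_Weyl)
    finally show ?thesis .
  qed
qed

text \<open>The Koszul sequence \<open>0 \<rightarrow> V(m + 2) \<rightarrow> E \<otimes> V(m + 1) \<rightarrow> V(m) \<rightarrow> 0\<close>.\<close>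

definition Weyl_in :: "nat \<Rightarrow> (nat \<Rightarrow> 'k::field) \<Rightarrow> 2 \<times> nat \<Rightarrow> 'k" where
  "Weyl_in m v = case_prod (\<lambda>e i. if i \<le> Suc m then v (if e = 1 then Suc i else i) else 0)"

text \<open>Dual to \<open>f \<mapsto> x \<otimes> y f - y \<otimes> x f\<close>, just as
  \<open>Weyl_in\<close> is dual to multiplication of a form by \<open>x\<close> or
  \<open>y\<close>.\<close>

definition Weyl_out :: "nat \<Rightarrow> (2 \<times> nat \<Rightarrow> 'k::field) \<Rightarrow> nat \<Rightarrow> 'k" where
  "Weyl_out m w i = (if i \<le> m then w (1, i) - w (2, Suc i) else 0)"

lemma curry_Weyl_in:
  "curry (Weyl_in m v) e = (\<lambda>i. if i \<le> Suc m then v (if e = 1 then Suc i else i) else 0)"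
  by (simp add: Weyl_in_def)

lemma ev_linear: "ev (Suc m) v ([:b, a:] * P) = b * ev (Suc m) v P + a * ev m (\<lambda>j. v (Suc j)) P"
proof -
  have "[:b, a:] * P = smult b P + smult a (pCons 0 P)" by (simp add: mult_pCons_left)
  then show ?thesis by (simp only: ev_add ev_smult ev_pCons) simp
qed

lemma ses_Weyl:
  "ses (Weyl (Suc (Suc m)) :: ('k::field, nat) gmod) (tensE (Weyl (Suc m))) (Weyl m) (Weyl_in m) (Weyl_out m)"
proof
  show "rational_module (Weyl (Suc (Suc m)) :: ('k, nat) gmod)" "rational_module (Weyl m :: ('k, nat) gmod)"
    "rational_module (tensE (Weyl (Suc m)) :: ('k, 2 \<times> nat) gmod)"
    by (intro rational_Weyl rational_tensE)+
  show "ghom (Weyl (Suc (Suc m))) (tensE (Weyl (Suc m))) (Weyl_in m :: (nat \<Rightarrow> 'k) \<Rightarrow> _)"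
  proof (rule ghomI)
    show "lin_on (carrier (Weyl (Suc (Suc m)))) (Weyl_in m :: (nat \<Rightarrow> 'k) \<Rightarrow> _)"
      by (intro lin_onI) (auto simp: Weyl_in_def fun_eq_iff pointwise)
    show "Weyl_in m v \<in> carrier (tensE (Weyl (Suc m)))" for v :: "nat \<Rightarrow> 'k"
      by (simp add: carrier_tensE carrier_Weyl curry_Weyl_in)
    show "Weyl_in m (act (Weyl (Suc (Suc m))) g v) = act (tensE (Weyl (Suc m))) g (Weyl_in m v)"
      for g and v :: "nat \<Rightarrow> 'k"
    proof (intro curry_eqI ext)
      fix e :: 2 and i
      show "curry (Weyl_in m (act (Weyl (Suc (Suc m))) g v)) e i =
        curry (act (tensE (Weyl (Suc m))) g (Weyl_in m v)) e i"
      proof (cases "i \<le> Suc m")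
        case True
        let ?P = "hp g (Suc m) i"
        have dP: "degree ?P \<le> Suc m" by (rule degree_hp[OF True])
        have h: "hp g (Suc (Suc m)) (if e = 1 then Suc i else i) = [:g$e$2, g$e$1:] * ?P"
          using exhaust_2'[of e] True by (auto simp: hp_Suc_left hp_Suc_right simp del: mult_pCons_left)
        have "curry (Weyl_in m (act (Weyl (Suc (Suc m))) g v)) e i =
            ev (Suc (Suc m)) v (hp g (Suc (Suc m)) (if e = 1 then Suc i else i))"
          using True by (simp add: curry_Weyl_in act_Weyl)
        also have "\<dots> = g$e$2 * ev (Suc m) v ?P + g$e$1 * ev (Suc m) (\<lambda>j. v (Suc j)) ?P"
          unfolding h ev_linear ev_Suc[OF dP] ..
        also have "ev (Suc m) v ?P = ev (Suc m) (curry (Weyl_in m v) 2) ?P"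
          by (rule ev_cong) (simp add: curry_Weyl_in)
        also have "ev (Suc m) (\<lambda>j. v (Suc j)) ?P = ev (Suc m) (curry (Weyl_in m v) 1) ?P"
          by (rule ev_cong) (simp add: curry_Weyl_in)
        also have "g$e$2 * ev (Suc m) (curry (Weyl_in m v) 2) ?P + g$e$1 * ev (Suc m) (curry (Weyl_in m v) 1) ?P =
            curry (act (tensE (Weyl (Suc m))) g (Weyl_in m v)) e i"
          by (simp add: curry_act_tensE pointwise act_Weyl True)
        finally show ?thesis .
      qed (simp add: curry_Weyl_in curry_act_tensE pointwise act_Weyl)
    qed
  qed
  show "ghom (tensE (Weyl (Suc m))) (Weyl m) (Weyl_out m :: (2 \<times> nat \<Rightarrow> 'k) \<Rightarrow> _)"
  proof (rule ghomI)
    show "lin_on (carrier (tensE (Weyl (Suc m)))) (Weyl_out m :: (2 \<times> nat \<Rightarrow> 'k) \<Rightarrow> _)"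
      by (intro lin_onI) (auto simp: Weyl_out_def fun_eq_iff pointwise algebra_simps)
    show "Weyl_out m w \<in> carrier (Weyl m)" for w :: "2 \<times> nat \<Rightarrow> 'k"
      by (simp add: carrier_Weyl Weyl_out_def)
    show "Weyl_out m (act (tensE (Weyl (Suc m))) g w) = act (Weyl m) g (Weyl_out m w)"
      if g: "g \<in> SL2" for g and w :: "2 \<times> nat \<Rightarrow> 'k"
    proof
      fix i
      show "Weyl_out m (act (tensE (Weyl (Suc m))) g w) i = act (Weyl m) g (Weyl_out m w) i"
      proof (cases "i \<le> m")
        case True
        let ?Q = "hp g m i"
        let ?x = "curry w 1" and ?y = "curry w 2"
        have dQ: "degree ?Q \<le> m" by (rule degree_hp[OF True])
        have det: "g$1$1 * g$2$2 - g$1$2 * g$2$1 = 1" using g by (simp add: SL2_iff)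
        have "Weyl_out m (act (tensE (Weyl (Suc m))) g w) i =
            (g$1$1 * ev (Suc m) ?x (hp g (Suc m) i) + g$1$2 * ev (Suc m) ?y (hp g (Suc m) i)) -
            (g$2$1 * ev (Suc m) ?x (hp g (Suc m) (Suc i)) + g$2$2 * ev (Suc m) ?y (hp g (Suc m) (Suc i)))"
        proof -
          have c: "act (tensE (Weyl (Suc m))) g w (e, k) =
              g$e$1 * act (Weyl (Suc m)) g ?x k + g$e$2 * act (Weyl (Suc m)) g ?y k" for e k
            using fun_cong[OF curry_act_tensE[of "Weyl (Suc m)" g w e], of k] by (simp add: curry_conv pointwise)
          show ?thesis using True by (simp add: Weyl_out_def c act_Weyl)
        qed
        \<comment> \<open>The mixed terms cancel in pairs and what is left carries the determinant
          as a common factor.\<close>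
        also have "\<dots> = (g$1$1 * g$2$2 - g$1$2 * g$2$1) * (ev m ?x ?Q - ev m (\<lambda>j. ?y (Suc j)) ?Q)"
          unfolding hp_Suc_left hp_Suc_right[OF True] ev_linear ev_Suc[OF dQ] by (simp add: algebra_simps)
        also have "\<dots> = ev m (\<lambda>j. ?x j - ?y (Suc j)) ?Q" by (simp add: det ev_vec_diff)
        also have "\<dots> = ev m (Weyl_out m w) ?Q"
          by (rule ev_cong) (simp add: Weyl_out_def curry_conv)
        finally show ?thesis using True by (simp add: act_Weyl)
      qed (simp add: Weyl_out_def act_Weyl)
    qed
  qed
  have val: "Weyl_in m v (1, i) = (if i \<le> Suc m then v (Suc i) else 0)"
    "Weyl_in m v (2, i) = (if i \<le> Suc m then v i else 0)" for v :: "nat \<Rightarrow> 'k" and i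
    by (simp_all add: Weyl_in_def)
  show "inj_on (Weyl_in m) (carrier (Weyl (Suc (Suc m)) :: ('k, nat) gmod))"
  proof (rule inj_onI, rule ext)
    fix v w :: "nat \<Rightarrow> 'k" and i
    assume c: "v \<in> carrier (Weyl (Suc (Suc m)))" "w \<in> carrier (Weyl (Suc (Suc m)))" and e: "Weyl_in m v = Weyl_in m w"
    consider "i \<le> Suc m" | "i = Suc (Suc m)" | "i > Suc (Suc m)" by linarith
    then show "v i = w i"
    proof cases
      case 1 then show ?thesis using fun_cong[OF e, of "(2, i)"] by (simp add: val)
    next
      case 2 then show ?thesis using fun_cong[OF e, of "(1, Suc m)"] by (simp add: val)
    next
      case 3 then show ?thesis using c by (simp add: carrier_Weyl)
    qed
  qed
  show "Weyl_in m ` carrier (Weyl (Suc (Suc m))) =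
      {w \<in> carrier (tensE (Weyl (Suc m))). Weyl_out m w = (0 :: nat \<Rightarrow> 'k)}"
  proof (intro subset_antisym subsetI)
    fix w :: "2 \<times> nat \<Rightarrow> 'k" assume "w \<in> Weyl_in m ` carrier (Weyl (Suc (Suc m)))"
    then show "w \<in> {w \<in> carrier (tensE (Weyl (Suc m))). Weyl_out m w = (0 :: nat \<Rightarrow> 'k)}"
      by (auto simp: carrier_tensE carrier_Weyl curry_Weyl_in Weyl_out_def val fun_eq_iff zero_fun_apply)
  next
    fix w :: "2 \<times> nat \<Rightarrow> 'k" assume "w \<in> {w \<in> carrier (tensE (Weyl (Suc m))). Weyl_out m w = (0 :: nat \<Rightarrow> 'k)}"
    then have w: "\<And>e i. i > Suc m \<Longrightarrow> w (e, i) = 0" and o: "Weyl_out m w = 0"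
      by (auto simp: carrier_tensE carrier_Weyl curry_conv)
    have o': "w (1, i) = w (2, Suc i)" if "i \<le> m" for i
      using fun_cong[OF o, of i] that by (simp add: Weyl_out_def zero_fun_apply)
    \<comment> \<open>Entry \<open>0\<close> is visible only in the copy with index \<open>2\<close>
      and the last entry only in the copy with index \<open>1\<close>; on the overlap the two
      readings agree by the kernel condition.\<close>
    define v where "v = (\<lambda>i. case i of 0 \<Rightarrow> w (2, 0) | Suc j \<Rightarrow> w (1, j))"
    have "v \<in> carrier (Weyl (Suc (Suc m)))" using w by (auto simp: carrier_Weyl v_def split: nat.splits)
    moreover have "Weyl_in m v = w"
    proof (intro curry_eqI ext)
      fix e i
      have "v i = w (2, i)" if "i \<le> Suc m" using that o' by (cases i) (auto simp: v_def)
      then show "curry (Weyl_in m v) e i = curry w e i"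
        using w[of i e] exhaust_2'[of e] by (auto simp: curry_Weyl_in curry_conv v_def not_le)
    qed
    ultimately show "w \<in> Weyl_in m ` carrier (Weyl (Suc (Suc m)))" by blast
  qed
  show "Weyl_out m ` carrier (tensE (Weyl (Suc m))) = carrier (Weyl m :: ('k, nat) gmod)"
  proof (intro subset_antisym subsetI)
    fix v :: "nat \<Rightarrow> 'k" assume v: "v \<in> carrier (Weyl m)"
    let ?w = "case_prod (\<lambda>e i. if e = (1::2) then v i else 0)"
    have "?w \<in> carrier (tensE (Weyl (Suc m)))" using v by (auto simp: carrier_tensE carrier_Weyl)
    moreover have "Weyl_out m ?w = v" using v by (auto simp: fun_eq_iff Weyl_out_def carrier_Weyl)
    ultimately show "v \<in> Weyl_out m ` carrier (tensE (Weyl (Suc m)))" by (metis image_eqI)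
  qed (auto simp: carrier_Weyl Weyl_out_def)
qed

lemma (in ses) les_bound_0: assumes "coh_le 0 J c" shows "coh_le 0 N c"
proof -
  have "qle (fixed N) {z \<in> fixed N. e z \<in> {0}} c"
  proof (rule qle_vimage[OF _ fixed_subspace[OF N] fs.subspace_single_0])
    show "lin_on (fixed N) e" by (rule lin_on_mono[OF ghom_lin[OF e]]) (auto simp: fixed_def)
    show "qle (fixed J) {0} c" using assms by (simp add: coh_le_0[OF J])
    show "e ` fixed N \<subseteq> fixed J"
      using ghom_in[OF e] by (auto simp: fixed_def simp flip: ghom_act[OF e])
  qed
  moreover have "{z \<in> fixed N. e z \<in> {0}} \<subseteq> {0}"
    using inj_onD[OF inj, of _ 0] lin_on_zero[OF ghom_lin[OF e] rm_sub[OF N]] fs.subspace_0[OF rm_sub[OF N]]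
    by (auto simp: fixed_def)
  ultimately show ?thesis unfolding coh_le_0[OF N] by (rule qle_mono) simp
qed

lemma pcompose_square_pCons: "pcompose (pCons (c::'k::field) P) [:0, 0, 1:] = pCons c (pCons 0 (pcompose P [:0, 0, 1:]))"
  by (simp add: pcompose_pCons)

text \<open>\<open>P(x^2)\<close> meets the entries of \<open>v\<close> at even positions only, and
  \<open>x P(x^2)\<close> those at odd positions.\<close>

lemma ev_pcompose_square:
  assumes "degree P \<le> a"
  shows "ev (Suc (2 * a)) v (pcompose P [:0, 0, 1:]) = ev a (\<lambda>j. v (2 * j)) P"
    and "ev (Suc (2 * a)) v (pCons 0 (pcompose P [:0, 0, 1:])) = ev a (\<lambda>j. v (Suc (2 * j))) P"
proof -
  have "ev (Suc (2 * a)) v (pcompose P [:0, 0, 1:]) = ev a (\<lambda>j. v (2 * j)) P" if "degree P \<le> a" for v a P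
    using that
  proof (induction a arbitrary: P v)
    case 0
    then obtain c where "P = [:c:]" using degree_eq_zeroE by blast
    then show ?case by (simp add: ev_def)
  next
    case (Suc a)
    obtain c Q where P: "P = pCons c Q" by (cases P)
    have "degree Q \<le> a" using Suc.prems P by (simp add: degree_pCons_eq_if split: if_splits)
    note IH = Suc.IH[OF this]
    show ?case
      using IH[of "\<lambda>j. v (Suc (Suc j))"] unfolding P pcompose_square_pCons by (simp add: ev_pCons)
  qed
  note 1 = this
  show "ev (Suc (2 * a)) v (pcompose P [:0, 0, 1:]) = ev a (\<lambda>j. v (2 * j)) P" by (rule 1[OF assms])
  have "degree (pcompose P [:0, 0, 1:]) \<le> 2 * a"
    by (rule order.trans[OF degree_pcompose_le]) (use assms in simp)
  then have "ev (Suc (2 * a)) v (pCons 0 (pcompose P [:0, 0, 1:])) =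
      ev (Suc (2 * a)) (\<lambda>j. v (Suc j)) (pcompose P [:0, 0, 1:])"
    by (simp add: ev_pCons ev_Suc)
  then show "ev (Suc (2 * a)) v (pCons 0 (pcompose P [:0, 0, 1:])) = ev a (\<lambda>j. v (Suc (2 * j))) P"
    using 1[OF assms, of "\<lambda>j. v (Suc j)"] by simp
qed

section \<open>Odd Weyl modules as \<open>E\<close> times a twist, and the resulting
  recursion\<close>

context sl2_char2
begin

text \<open>Dual to writing a form of odd degree as \<open>x P(x^2, y^2) + y Q(x^2, y^2)\<close>,
  which is unique. Copy \<open>1\<close> keeps the odd positions and copy \<open>2\<close> the even
  ones.\<close>

definition Weyl_odd :: "nat \<Rightarrow> (nat \<Rightarrow> 'k) \<Rightarrow> 2 \<times> nat \<Rightarrow> 'k" where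
  "Weyl_odd a v = case_prod (\<lambda>e i. if i \<le> a then v (if e = 1 then Suc (2 * i) else 2 * i) else 0)"

definition Weyl_odd_inv :: "nat \<Rightarrow> (2 \<times> nat \<Rightarrow> 'k) \<Rightarrow> nat \<Rightarrow> 'k" where
  "Weyl_odd_inv a w j = (if j \<le> Suc (2 * a) then w (if odd j then 1 else 2, j div 2) else 0)"

lemma curry_Weyl_odd:
  "curry (Weyl_odd a v) e = (\<lambda>i. if i \<le> a then v (if e = 1 then Suc (2 * i) else 2 * i) else 0)"
  by (simp add: Weyl_odd_def)

lemma linear_square: "[:b, a :: 'k:]\<^sup>2 = pcompose [:b\<^sup>2, a\<^sup>2:] [:0, 0, 1:]"
  by (simp add: power2_eq_square pcompose_pCons two_zero flip: mult_2)

lemma pcompose_power: "pcompose (p ^ n) q = pcompose p q ^ n" for p q :: "'k poly"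
  by (induction n) (simp_all add: pcompose_mult pcompose_1)

text \<open>Squaring a linear form is additive in characteristic two, so all factors but one pair up
  into linear forms of \<open>frob g\<close> evaluated at \<open>x^2\<close>.\<close>

lemma hp_square:
  fixes g :: "'k mat2"
  assumes "i \<le> a"
  shows "hp g (Suc (2 * a)) (if e = 1 then Suc (2 * i) else 2 * i) =
    [:g$e$2, g$e$1:] * pcompose (hp (frob g) a i) [:0, 0, 1:]"
proof -
  have "Suc (2 * a) - 2 * i = Suc (2 * (a - i))" "2 * a - 2 * i = 2 * (a - i)" using assms by simp_all
  moreover have "pcompose (hp (frob g) a i) [:0, 0, 1:] = [:g$1$2, g$1$1:] ^ (2 * i) * [:g$2$2, g$2$1:] ^ (2 * (a - i))"
    unfolding hp_def pcompose_mult pcompose_power power_mult linear_square by simp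
  ultimately show ?thesis
    using exhaust_2'[of e] by (auto simp: hp_def mult_ac simp del: mult_pCons_left)
qed

lemma ghom_Weyl_odd: "ghom (Weyl (Suc (2 * a))) (tensE (twist (Weyl a))) (Weyl_odd a)"
proof (rule ghomI)
  show "lin_on (carrier (Weyl (Suc (2 * a)))) (Weyl_odd a)"
    by (intro lin_onI) (auto simp: Weyl_odd_def fun_eq_iff pointwise)
  show "Weyl_odd a v \<in> carrier (tensE (twist (Weyl a)))" for v
    by (simp add: carrier_tensE carrier_Weyl curry_Weyl_odd)
  show "Weyl_odd a (act (Weyl (Suc (2 * a))) g v) = act (tensE (twist (Weyl a))) g (Weyl_odd a v)" for g v
  proof (intro curry_eqI ext)
    fix e :: 2 and i
    show "curry (Weyl_odd a (act (Weyl (Suc (2 * a))) g v)) e i =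
        curry (act (tensE (twist (Weyl a))) g (Weyl_odd a v)) e i"
    proof (cases "i \<le> a")
      case True
      let ?P = "hp (frob g) a i"
      have dP: "degree ?P \<le> a" by (rule degree_hp[OF True])
      have "curry (Weyl_odd a (act (Weyl (Suc (2 * a))) g v)) e i =
          ev (Suc (2 * a)) v ([:g$e$2, g$e$1:] * pcompose ?P [:0, 0, 1:])"
        using True by (simp add: curry_Weyl_odd act_Weyl hp_square[OF True, symmetric] del: mult_pCons_left)
      also have "[:g$e$2, g$e$1:] * pcompose ?P [:0, 0, 1:] =
          smult (g$e$2) (pcompose ?P [:0, 0, 1:]) + smult (g$e$1) (pCons 0 (pcompose ?P [:0, 0, 1:]))"
        by simp
      also have "ev (Suc (2 * a)) v \<dots> = g$e$2 * ev a (\<lambda>j. v (2 * j)) ?P + g$e$1 * ev a (\<lambda>j. v (Suc (2 * j))) ?P"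
        unfolding ev_add ev_smult ev_pcompose_square[OF dP] ..
      also have "ev a (\<lambda>j. v (2 * j)) ?P = ev a (curry (Weyl_odd a v) 2) ?P"
        by (rule ev_cong) (simp add: curry_Weyl_odd)
      also have "ev a (\<lambda>j. v (Suc (2 * j))) ?P = ev a (curry (Weyl_odd a v) 1) ?P"
        by (rule ev_cong) (simp add: curry_Weyl_odd)
      also have "g$e$2 * ev a (curry (Weyl_odd a v) 2) ?P + g$e$1 * ev a (curry (Weyl_odd a v) 1) ?P =
          curry (act (tensE (twist (Weyl a))) g (Weyl_odd a v)) e i"
        by (simp add: curry_act_tensE pointwise act_Weyl True)
      finally show ?thesis .
    qed (simp add: curry_Weyl_odd curry_act_tensE pointwise act_Weyl)
  qed
qed

lemma Weyl_odd_inverse: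
  "w \<in> carrier (tensE (twist (Weyl a))) \<Longrightarrow> Weyl_odd a (Weyl_odd_inv a w) = w"
  "v \<in> carrier (Weyl (Suc (2 * a))) \<Longrightarrow> Weyl_odd_inv a (Weyl_odd a v) = v"
proof -
  assume w: "w \<in> carrier (tensE (twist (Weyl a)))"
  show "Weyl_odd a (Weyl_odd_inv a w) = w"
  proof (intro curry_eqI ext)
    fix e i show "curry (Weyl_odd a (Weyl_odd_inv a w)) e i = curry w e i"
      using exhaust_2'[of e] w by (auto simp: curry_Weyl_odd Weyl_odd_inv_def curry_conv carrier_tensE carrier_Weyl)
  qed
next
  assume v: "v \<in> carrier (Weyl (Suc (2 * a)))"
  show "Weyl_odd_inv a (Weyl_odd a v) = v"
  proof
    fix j show "Weyl_odd_inv a (Weyl_odd a v) j = v j"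
      using v by (auto simp: Weyl_odd_inv_def Weyl_odd_def carrier_Weyl not_le)
  qed
qed

lemma ghom_Weyl_odd_inv: "ghom (tensE (twist (Weyl a))) (Weyl (Suc (2 * a))) (Weyl_odd_inv a)"
proof (rule ghomI)
  show "lin_on (carrier (tensE (twist (Weyl a)))) (Weyl_odd_inv a)"
    by (intro lin_onI) (auto simp: Weyl_odd_inv_def fun_eq_iff pointwise)
  show in': "Weyl_odd_inv a w \<in> carrier (Weyl (Suc (2 * a)))" for w
    by (simp add: carrier_Weyl Weyl_odd_inv_def)
  show "Weyl_odd_inv a (act (tensE (twist (Weyl a))) g w) = act (Weyl (Suc (2 * a))) g (Weyl_odd_inv a w)"
    if g: "g \<in> SL2" and w: "w \<in> carrier (tensE (twist (Weyl a)))" for g w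
  proof -
    have "act (tensE (twist (Weyl a))) g w = Weyl_odd a (act (Weyl (Suc (2 * a))) g (Weyl_odd_inv a w))"
      using ghom_act[OF ghom_Weyl_odd g in'] Weyl_odd_inverse(1)[OF w] by simp
    then show ?thesis using Weyl_odd_inverse(2)[OF rm_act[OF rational_Weyl g in']] by simp
  qed
qed

lemma coh_Weyl_odd: "coh_le n (Weyl (Suc (2 * a)) :: ('k, nat) gmod) 0"
  by (rule coh_retract[OF rational_Weyl rational_tensE[OF rational_twist[OF rational_Weyl]]
      ghom_Weyl_odd ghom_Weyl_odd_inv Weyl_odd_inverse(2) coh_tensE_twist[OF rational_Weyl]])

lemma coh_tensE_Weyl_odd:
  assumes "coh_le n (Weyl a :: ('k, nat) gmod) c"
  shows "coh_le n (tensE (Weyl (Suc (2 * a))) :: ('k, 2 \<times> nat) gmod) c"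
proof (rule coh_retract[OF _ _ ghom_tE[OF ghom_Weyl_odd rational_Weyl] ghom_tE[OF ghom_Weyl_odd_inv]])
  show "coh_le n (tensE (tensE (twist (Weyl a)))) c"
    by (rule coh_tensE_tensE_twist[OF rational_Weyl assms])
  show "tE (Weyl_odd_inv a) (tE (Weyl_odd a) v) = v" if "v \<in> carrier (tensE (Weyl (Suc (2 * a))))" for v
    using that by (intro curry_eqI) (simp add: Weyl_odd_inverse(2) carrier_tensE)
qed (intro rational_tensE rational_twist rational_Weyl)+

text \<open>The middle term of the Koszul sequence is
  \<open>E \<otimes> E \<otimes> V(a)^(1)\<close>, which contributes the cohomology of
  \<open>V(a)\<close>.\<close>

lemma coh_Weyl_even:
  assumes "coh_le (Suc n) (Weyl a :: ('k, nat) gmod) c" "coh_le n (Weyl (2 * a) :: ('k, nat) gmod) d"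
  shows "coh_le (Suc n) (Weyl (2 * a + 2) :: ('k, nat) gmod) (c + d)"
  using ses.les_bound[OF ses_Weyl coh_tensE_Weyl_odd[OF assms(1)] assms(2)] by simp

lemma coh_Weyl_even_0:
  assumes "coh_le 0 (Weyl a :: ('k, nat) gmod) c"
  shows "coh_le 0 (Weyl (2 * a + 2) :: ('k, nat) gmod) c"
  using ses.les_bound_0[OF ses_Weyl coh_tensE_Weyl_odd[OF assms]] by simp

end

section \<open>Vanishing for induced modules\<close>

text \<open>A weight space of the torus acting by right translation. It is a direct summand of
  \<open>k[G]\<close>, with projection \<open>lc tor m\<close>, and inherits vanishing from
  there.\<close>

definition wt :: "nat \<Rightarrow> ('k::field mat2 \<Rightarrow> 'k) set" where
  "wt m = {f \<in> coord_ring. \<forall>s g. s \<noteq> 0 \<longrightarrow> g \<in> SL2 \<longrightarrow> f (g ** tor s) = s ^ m * f g}"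

text \<open>Weight functions that have degree at most \<open>i\<close> along right translation by \<open>lo\<close>.\<close>

definition wlo :: "nat \<Rightarrow> nat \<Rightarrow> ('k::alg_closed_field mat2 \<Rightarrow> 'k) set" where
  "wlo m i = {f \<in> wt m. \<forall>j>i. lc lo j f = 0}"

lemma wt_coord_ring: "f \<in> wt m \<Longrightarrow> f \<in> coord_ring"
  and wt_tor: "f \<in> wt m \<Longrightarrow> s \<noteq> 0 \<Longrightarrow> g \<in> SL2 \<Longrightarrow> f (g ** tor s) = s ^ m * f g"
  by (simp_all add: wt_def)

lemma wlo_wt: "f \<in> wlo m i \<Longrightarrow> f \<in> wt m"
  by (simp add: wlo_def)

lemma lo_poly:
  fixes f :: "'k::alg_closed_field mat2 \<Rightarrow> 'k"
  assumes "f \<in> coord_ring"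
  obtains Q where "\<And>g t. f (g ** lo t) = poly (Q g) t" "\<And>g j. lc lo j f g = coeff (Q g) j"
proof -
  obtain N Q where Q: "\<And>g s. poly (Q g) s = s ^ (0 * N) * f (g ** lo s)"
    using coord_ring_curve[OF assms curve_lo] by blast
  show ?thesis
  proof (rule that[of Q])
    show "f (g ** lo t) = poly (Q g) t" for g t by (simp add: Q)
    show "lc lo j f g = coeff (Q g) j" for g j
      using lc_eqI[where P = "Q g" and N = 0 and f = f and g = g and v = lo and i = j] Q by simp
  qed
qed

lemma lo_lo: "lo s ** lo t = lo (s + t)" and tor_tor: "tor s ** tor t = tor (s * t)"
  and tor_lo: "s \<noteq> 0 \<Longrightarrow> tor s ** lo t = lo (s * s * t) ** tor s"
  by (simp_all add: mat2_eq_iff)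

lemma wlo_0_lo:
  assumes f: "f \<in> wlo m 0" shows "f (g ** lo t) = f g"
proof -
  obtain Q where Q: "\<And>g t. f (g ** lo t) = poly (Q g) t" "\<And>g j. lc lo j f g = coeff (Q g) j"
    using lo_poly[OF wt_coord_ring[OF wlo_wt[OF f]]] by blast
  have "coeff (Q g) j = 0" if "j > 0" for j
    using f that fun_cong[of "lc lo j f" 0 g] Q(2)[of j g] by (auto simp: wlo_def pointwise)
  then have "degree (Q g) = 0" by (metis leading_coeff_0_iff degree_0 neq0_conv)
  then obtain c where "Q g = [:c:]" using degree_eq_zeroE by blast
  then show ?thesis using Q(1)[of g t] Q(1)[of g 0] by (simp add: lo_0)
qed

lemma wlo_0I:
  assumes f: "f \<in> wt m" and inv: "\<And>g t. g \<in> SL2 \<Longrightarrow> f (g ** lo t) = f g"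
  shows "f \<in> wlo m 0"
proof -
  have "lc lo j f = 0" if "j > 0" for j
  proof
    fix g
    show "lc lo j f g = 0 g"
    proof (cases "g \<in> SL2")
      case True
      have "lc lo j f g = coeff [:f g:] (0 + j)"
        by (rule lc_eqI) (simp add: inv[OF True])
      then show ?thesis using that by (simp add: pointwise coeff_pCons split: nat.splits)
    next
      case False
      then show ?thesis
        using coord_ring_off[OF lc_coord_ring[OF curve_lo wt_coord_ring[OF f]]] by (simp add: pointwise)
    qed
  qed
  then show ?thesis using f by (simp add: wlo_def)
qed

lemma wt_subspace [simp]: "fs.subspace (wt m)"
  by (rule fs.subspaceI)
     (auto simp: wt_def pointwise algebra_simps
       fs.subspace_0[OF coord_ring_subspace] coord_ring_add fs.subspace_scale[OF coord_ring_subspace])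

lemma wlo_subspace [simp]: "fs.subspace (wlo m i)"
proof -
  have l: "lin_on (wt m) (lc lo j)" for j
    by (rule lin_on_mono[OF lc_lin_on[OF curve_lo]]) (auto simp: wt_def)
  have "fs.subspace {f \<in> wt m. lc lo j f \<in> {0}}" for j
    by (rule lin_on_subspace_vimage[OF l wt_subspace fs.subspace_single_0])
  then show ?thesis
    by (auto simp: wlo_def fs.subspace_def)
qed

lemma wlo_mono: "i \<le> j \<Longrightarrow> wlo m i \<subseteq> wlo m j"
  by (auto simp: wlo_def)

lemma wlo_bounded: assumes "f \<in> wt m" shows "\<exists>i. f \<in> wlo m i"
  using lc_bounded[OF curve_lo wt_coord_ring[OF assms]] assms by (auto simp: wlo_def)

lemma lc_tor_wt:
  assumes f: "f \<in> coord_ring" shows "lc tor m f \<in> wt m"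
proof -
  have "lc tor m f (g ** tor s) = s ^ m * lc tor m f g" if s: "s \<noteq> 0" for s g
  proof -
    obtain N P where P: "\<And>t. t \<noteq> 0 \<Longrightarrow> poly P t = t ^ N * f (g ** tor t)"
      using lc_ex[OF curve_tor f] by blast
    have "lc tor m f (g ** tor s) = coeff (smult (inverse s ^ N) (pcompose P [:0, s:])) (N + m)"
    proof (rule lc_eqI)
      fix t :: 'a assume t: "t \<noteq> 0"
      have "poly (smult (inverse s ^ N) (pcompose P [:0, s:])) t = inverse s ^ N * poly P (s * t)"
        by (simp add: poly_pcompose mult.commute)
      also have "\<dots> = t ^ N * f (g ** tor (s * t))"
        using s t by (simp add: P power_mult_distrib field_simps)
      finally show "poly (smult (inverse s ^ N) (pcompose P [:0, s:])) t = t ^ N * f (g ** tor s ** tor t)"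
        by (simp add: tor_tor flip: matrix_mul_assoc)
    qed
    also have "\<dots> = s ^ m * coeff P (N + m)"
      using s by (simp add: coeff_pcompose_linear power_add field_simps)
    finally show ?thesis using lc_eqI[OF P, of m] by simp
  qed
  then show ?thesis using lc_coord_ring[OF curve_tor f] by (simp add: wt_def)
qed

lemma lc_tor_id:
  assumes f: "f \<in> wt m" shows "lc tor m f = f"
proof
  fix g
  show "lc tor m f g = f g"
  proof (cases "g \<in> SL2")
    case True
    have "lc tor m f g = coeff (monom (f g) m) (0 + m)"
      by (rule lc_eqI) (simp add: wt_tor[OF f _ True] poly_monom)
    then show ?thesis by simp
  next
    case False
    then show ?thesis
      using coord_ring_off[OF lc_coord_ring[OF curve_tor wt_coord_ring[OF f]]]
        coord_ring_off[OF wt_coord_ring[OF f]] by metis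
  qed
qed

text \<open>Moving \<open>tor s\<close> past \<open>lo t\<close> scales \<open>t\<close> by
  \<open>s^2\<close>, so the coefficient of \<open>t^i\<close> gains weight \<open>2 i\<close>. As
  the leading coefficient it does not change when \<open>t\<close> is shifted, hence it is invariant
  under \<open>lo\<close>.\<close>

lemma lc_lo_wlo:
  assumes f: "f \<in> wlo m i" shows "lc lo i f \<in> wlo (m + 2 * i) 0"
proof -
  note fc = wt_coord_ring[OF wlo_wt[OF f]]
  obtain Q where Q: "\<And>g t. f (g ** lo t) = poly (Q g) t" "\<And>g j. lc lo j f g = coeff (Q g) j"
    using lo_poly[OF fc] by blast
  have "coeff (Q g) j = 0" if "j > i" for g j
    using f that fun_cong[of "lc lo j f" 0 g] Q(2)[of j g] by (auto simp: wlo_def pointwise)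
  then have dQ: "degree (Q g) \<le> i" for g by (meson degree_le)
  show ?thesis
  proof (rule wlo_0I)
    have "lc lo i f (g ** tor s) = s ^ (m + 2 * i) * lc lo i f g" if s: "s \<noteq> 0" and g: "g \<in> SL2" for s g
    proof -
      have "lc lo i f (g ** tor s) = coeff (smult (s ^ m) (pcompose (Q g) [:0, s * s:])) (0 + i)"
      proof (rule lc_eqI)
        fix t :: 'a
        have "f (g ** tor s ** lo t) = f (g ** lo (s * s * t) ** tor s)"
          by (simp add: tor_lo[OF s] flip: matrix_mul_assoc)
        also have "\<dots> = s ^ m * poly (Q g) (s * s * t)"
          using s g by (simp add: wt_tor[OF wlo_wt[OF f]] Q)
        finally show "poly (smult (s ^ m) (pcompose (Q g) [:0, s * s:])) t = t ^ 0 * f (g ** tor s ** lo t)"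
          by (simp add: poly_pcompose mult_ac)
      qed
      then show ?thesis
        by (simp add: coeff_pcompose_linear Q power_add power_mult mult_ac power2_eq_square power_mult_distrib)
    qed
    then show "lc lo i f \<in> wt (m + 2 * i)" using lc_coord_ring[OF curve_lo fc] by (simp add: wt_def)
    show "lc lo i f (g ** lo t) = lc lo i f g" for g t
    proof -
      have "Q (g ** lo t) = pcompose (Q g) [:t, 1:]"
        by (rule poly_eqI_nonzero) (simp add: poly_pcompose lo_lo flip: Q(1) matrix_mul_assoc)
      moreover have "coeff (pcompose P [:t, 1:]) n = coeff P n" if "degree P \<le> n" for n and P :: "'a poly"
        using that
      proof (induction n arbitrary: P)
        case 0
        then obtain c where "P = [:c:]" using degree_eq_zeroE by blast
        then show ?case by simp
      next
        case (Suc n)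
        obtain c P' where P: "P = pCons c P'" by (cases P)
        have d: "degree P' \<le> n" using Suc.prems P by (simp add: degree_pCons_eq_if split: if_splits)
        have "degree (pcompose P' [:t, 1:]) \<le> n"
          by (rule order.trans[OF degree_pcompose_le]) (use d in simp)
        then show ?case using Suc.IH[OF d] by (simp add: P pcompose_pCons coeff_eq_0)
      qed
      ultimately show ?thesis using dQ by (simp add: Q(2))
    qed
  qed
qed

subsection \<open>Highest weight functions\<close>

definition mon4 :: "nat \<Rightarrow> nat \<Rightarrow> nat \<Rightarrow> nat \<Rightarrow> 'k::field mat2 \<Rightarrow> 'k" where
  "mon4 p q r s g = (if g \<in> SL2 then g$1$1 ^ p * g$2$1 ^ q * g$1$2 ^ r * g$2$2 ^ s else 0)"

lemma mon4_coord_ring: "mon4 p q r s \<in> coord_ring"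
proof -
  have "(\<lambda>l. (l ! 0)$1$1 ^ p * (l ! 0)$2$1 ^ q * (l ! 0)$1$2 ^ r * (l ! 0)$2$2 ^ s) \<in> LP 1"
    by (intro LP.mult LP_power LP.entry) simp_all
  from LP_coord_ring[OF this] show ?thesis by (simp add: mon4_def[abs_def] cong: if_cong)
qed

lemma mon4_wt:
  assumes "r + s = m + (p + q)" shows "(mon4 p q r s :: 'k::field mat2 \<Rightarrow> 'k) \<in> wt m"
proof -
  have "mon4 p q r s (g ** tor t) = t ^ m * mon4 p q r s g" if "t \<noteq> 0" "g \<in> SL2" for t and g :: "'k mat2"
  proof -
    have "inverse t ^ p * inverse t ^ q * t ^ r * t ^ s = inverse t ^ (p + q) * t ^ (r + s)"
      by (simp add: power_add mult_ac)
    also have "\<dots> = t ^ m * (inverse t * t) ^ (p + q)"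
      unfolding assms power_add power_mult_distrib by (simp add: mult_ac)
    also have "\<dots> = t ^ m" using that by simp
    finally show ?thesis
      using that by (simp add: mon4_def tor_SL2 power_mult_distrib mult_ac)
  qed
  then show ?thesis unfolding wt_def by (intro CollectI conjI allI impI mon4_coord_ring)
qed

lemma coeff_linear_mult: "degree P \<le> n \<Longrightarrow> coeff ([:a, b:] * P) (Suc n) = b * coeff P n" for b :: "'k::comm_ring_1"
  by (simp add: coeff_eq_0)

lemma degree_linear_mult: "degree P \<le> n \<Longrightarrow> degree ([:a, b:] * P) \<le> Suc n" for b :: "'k::field"
  by (rule order.trans[OF degree_mult_le]) (auto simp: degree_pCons_eq_if)

lemma linear_power_mult:
  fixes b :: "'k::field"
  assumes "degree P \<le> n"
  shows "degree ([:a, b:] ^ k * P) \<le> k + n \<and> coeff ([:a, b:] ^ k * P) (k + n) = b ^ k * coeff P n"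
proof (induction k)
  case (Suc k)
  then show ?case
    using degree_linear_mult[of "[:a, b:] ^ k * P" "k + n" a b] coeff_linear_mult[of "[:a, b:] ^ k * P" "k + n" a b]
    by (simp add: mult.assoc del: mult_pCons_left)
qed (use assms in simp)

text \<open>Right translation by \<open>lo t\<close> adds \<open>t\<close> times the second column
  to the first. The leading coefficient therefore exchanges each first column entry for its
  neighbour.\<close>

lemma mon4_lo:
  assumes "r + s = m + (p + q)"
  shows "(mon4 p q r s :: 'k::alg_closed_field mat2 \<Rightarrow> 'k) \<in> wlo m (p + q)" and "lc lo (p + q) (mon4 p q r s) = (mon4 0 0 (p + r) (q + s) :: 'k mat2 \<Rightarrow> 'k)"
proof -
  let ?P = "\<lambda>g :: 'k mat2. if g \<in> SL2 then
      [:g$1$1, g$1$2:] ^ p * ([:g$2$1, g$2$2:] ^ q * [:g$1$2 ^ r * g$2$2 ^ s:]) else 0"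
  have lc: "lc lo j (mon4 p q r s) g = coeff (?P g) j" for j and g :: "'k mat2"
  proof -
    have "lc lo j (mon4 p q r s) g = coeff (?P g) (0 + j)"
      by (rule lc_eqI) (auto simp: mon4_def poly_power SL2_iff algebra_simps)
    then show ?thesis by simp
  qed
  have d: "degree (?P g) \<le> p + q \<and> coeff (?P g) (p + q) = mon4 0 0 (p + r) (q + s) g" for g :: "'k mat2"
    using linear_power_mult[of "[:g$2$1, g$2$2:] ^ q * [:g$1$2 ^ r * g$2$2 ^ s:]" q "g$1$1" "g$1$2" p]
      linear_power_mult[of "[:g$1$2 ^ r * g$2$2 ^ s:]" 0 "g$2$1" "g$2$2" q]
    by (auto simp: mon4_def power_add mult_ac simp del: mult_pCons_left mult_pCons_right)
  show "lc lo (p + q) (mon4 p q r s) = (mon4 0 0 (p + r) (q + s) :: 'k mat2 \<Rightarrow> 'k)"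
    by (rule ext) (simp only: lc d)
  have "lc lo j (mon4 p q r s :: 'k mat2 \<Rightarrow> 'k) = 0" if "j > p + q" for j
  proof
    fix g :: "'k mat2" show "lc lo j (mon4 p q r s) g = 0 g"
      unfolding lc zero_fun_apply by (rule coeff_eq_0) (use d[of g] that in linarith)
  qed
  then show "(mon4 p q r s :: 'k mat2 \<Rightarrow> 'k) \<in> wlo m (p + q)" using mon4_wt[OF assms] unfolding wlo_def
    by (intro CollectI conjI allI impI)
qed

lemma poly_le_altdef: "degree p \<le> m \<Longrightarrow> poly p x = (\<Sum>i\<le>m. coeff p i * x ^ i)"
  for p :: "'k::field poly"
  unfolding poly_altdef by (rule sum.mono_neutral_left) (auto simp: coeff_eq_0)

text \<open>Sections over the projective line: \<open>f\<close> is determined by its restriction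
  \<open>P\<close> to \<open>up t\<close>. On the other chart \<open>h s\<close> it becomes
  \<open>s^m P(1/s)\<close>, and this being polynomial forces \<open>P\<close> to have degree at
  most \<open>m\<close>.\<close>

lemma wlo_0_expand:
  fixes f :: "'k::alg_closed_field mat2 \<Rightarrow> 'k"
  assumes f: "f \<in> wlo m 0"
  shows "\<exists>c. f = (\<Sum>i\<le>m. fscale (c i) (mon4 0 0 i (m - i))) \<and>
    (\<forall>t. f (up t) = (\<Sum>i\<le>m. c i * t ^ i))"
proof -
  note fc = wt_coord_ring[OF wlo_wt[OF f]]
  note tor = wt_tor[OF wlo_wt[OF f]] and lo = wlo_0_lo[OF f]
  define h where "h = (\<lambda>s::'k. mk22 0 1 (-1) s)"
  have h: "curve 0 h"
    unfolding curve_def all_2_2 h_def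
    by (auto simp: SL2_iff intro: exI[of _ "[:1:]"] exI[of _ "[:0, 1:]"] exI[of _ "[:0:]"] exI[of _ "[:-1:]"])
  have hS: "h s \<in> SL2" for s by (simp add: h_def SL2_iff)
  obtain Q :: "'k poly" where Q: "\<And>s. poly Q s = f (h s)"
  proof -
    obtain N Q where "\<And>g s. poly (Q g) s = s ^ (0 * N) * f (g ** h s)"
      using coord_ring_curve[OF fc h] by blast
    then show ?thesis using that[of "Q (mat 1)"] by simp
  qed
  obtain P :: "'k poly" where P: "\<And>s. poly P s = f (up s)"
  proof -
    obtain N Q where "\<And>g s. poly (Q g) s = s ^ (0 * N) * f (g ** up s)"
      using coord_ring_curve[OF fc curve_up] by blast
    then show ?thesis using that[of "Q (mat 1)"] by simp
  qed
  let ?D = "degree P"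
  have QP: "poly Q s = s ^ m * poly P (inverse s)" if s: "s \<noteq> 0" for s
  proof -
    have "h s = up (inverse s) ** tor s ** lo (- inverse s)"
      using s by (simp add: h_def mat2_eq_iff)
    then show ?thesis using tor[OF s up_SL2] by (simp add: Q P lo)
  qed
  have "monom 1 ?D * Q = monom 1 m * reflect_poly P"
  proof (rule poly_eqI_nonzero)
    fix s :: 'k assume s: "s \<noteq> 0"
    have "poly (reflect_poly P) s = s ^ ?D * poly P (inverse s)"
      using s by (simp add: poly_reflect_poly_nz)
    then show "poly (monom 1 ?D * Q) s = poly (monom 1 m * reflect_poly P) s"
      by (simp add: poly_monom QP[OF s] mult_ac)
  qed
  \<comment> \<open>If \<open>?D\<close> exceeded \<open>m\<close>, the left side would have
    coefficient zero there, while the right side has the leading coefficient of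
    \<open>P\<close>.\<close>
  from arg_cong[OF this, of "\<lambda>R. coeff R m"] have dP: "?D \<le> m"
    by (auto simp: coeff_monom_mult coeff_reflect_poly split: if_splits)
  let ?c = "coeff P"
  have "Q = (\<Sum>i\<le>m. monom (?c i) (m - i))"
  proof (rule poly_eqI_nonzero)
    fix s :: 'k assume s: "s \<noteq> 0"
    have "s ^ m * (?c i * inverse s ^ i) = ?c i * s ^ (m - i)" if "i \<le> m" for i
      using s power_add[of s "m - i" i] that by (simp add: field_simps)
    then have "(\<Sum>i\<le>m. s ^ m * (?c i * inverse s ^ i)) = (\<Sum>i\<le>m. ?c i * s ^ (m - i))" by (intro sum.cong) simp_all
    then show "poly Q s = poly (\<Sum>i\<le>m. monom (?c i) (m - i)) s"
      unfolding QP[OF s] poly_le_altdef[OF dP] sum_distrib_left poly_sum poly_monom .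
  qed
  then have fh: "f (h s) = (\<Sum>i\<le>m. ?c i * s ^ (m - i))" for s
    by (simp add: poly_sum poly_monom flip: Q)
  have fu: "f (up t) = (\<Sum>i\<le>m. ?c i * t ^ i)" for t
    using poly_le_altdef[OF dP, of t] by (simp add: P)
  have "f g = (\<Sum>i\<le>m. fscale (?c i) (mon4 0 0 i (m - i))) g" for g
  proof (cases "g \<in> SL2")
    case True
    then have det: "g$1$1 * g$2$2 = 1 + g$1$2 * g$2$1" by (simp add: SL2_iff algebra_simps)
    have R: "(\<Sum>i\<le>m. fscale (?c i) (mon4 0 0 i (m - i))) g = (\<Sum>i\<le>m. ?c i * (g$1$2 ^ i * g$2$2 ^ (m - i)))"
    proof -
      have "(\<Sum>i\<in>A. fscale (?c i) (mon4 0 0 i (m - i))) g = (\<Sum>i\<in>A. ?c i * (g$1$2 ^ i * g$2$2 ^ (m - i)))"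
        if "finite A" for A using that by (induction A) (simp_all add: pointwise mon4_def True)
      then show ?thesis by simp
    qed
    show ?thesis
    proof (cases "g$1$2 = 0")
      case True
      then have d: "g$2$2 \<noteq> 0" using det by auto
      have a: "g$1$1 = inverse (g$2$2)" using det True d by (simp add: field_simps)
      have "g = up 0 ** tor (g$2$2) ** lo (g$2$1 / g$2$2)"
        using d True a by (simp add: mat2_eq_iff)
      then have "f g = g$2$2 ^ m * f (up 0)" using tor[OF d up_SL2, of 0] lo by metis
      then show ?thesis unfolding R fu True
        by (simp add: if_distrib[of "\<lambda>x. _ * x"] power_0_left sum.atMost_shift mult.commute)
    next
      case False
      let ?b = "g$1$2"
      have "g = h (g$2$2 / ?b) ** tor ?b ** lo (g$1$1 / ?b)"
        using det False by (simp add: mat2_eq_iff h_def field_simps)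
      then have "f g = ?b ^ m * f (h (g$2$2 / ?b))" using tor[OF False hS] lo by metis
      also have "\<dots> = (\<Sum>i\<le>m. ?c i * (?b ^ i * g$2$2 ^ (m - i)))"
        unfolding fh sum_distrib_left
      proof (intro sum.cong)
        fix i assume "i \<in> {..m}"
        then show "?b ^ m * (?c i * (g$2$2 / ?b) ^ (m - i)) = ?c i * (?b ^ i * g$2$2 ^ (m - i))"
          using False power_add[of ?b i "m - i"] by (simp add: power_divide)
      qed simp
      finally show ?thesis unfolding R .
    qed
  next
    case False
    have "(\<Sum>i\<le>m. fscale (?c i) (mon4 0 0 i (m - i))) \<in> coord_ring"
      by (intro fs.subspace_sum coord_ring_subspace fs.subspace_scale mon4_coord_ring)
    from coord_ring_off[OF this False] coord_ring_off[OF fc False] show ?thesis by simp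
  qed
  then show ?thesis using fu by blast
qed

text \<open>A basis function of weight \<open>m + 2 i\<close> is a product of that many second
  column entries. Replacing \<open>i\<close> of them by their first column neighbours gives a lift;
  as many as possible come from the first row, the rest from the second.\<close>

lemma lc_lo_surj:
  assumes h: "h \<in> wlo (m + 2 * i) 0" shows "\<exists>f\<in>wlo m i. lc lo i f = (h :: 'k::alg_closed_field mat2 \<Rightarrow> 'k)"
proof -
  let ?\<mu> = "m + 2 * i"
  obtain c where c: "h = (\<Sum>j\<le>?\<mu>. fscale (c j) (mon4 0 0 j (?\<mu> - j)))" using wlo_0_expand[OF h] by blast
  define T :: "nat \<Rightarrow> 'k mat2 \<Rightarrow> 'k" where
    "T j = mon4 (min i j) (i - min i j) (j - min i j) (?\<mu> - j - (i - min i j))" for j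
  have T: "T j \<in> wlo m i \<and> lc lo i (T j) = mon4 0 0 j (?\<mu> - j)" if "j \<le> ?\<mu>" for j
  proof -
    have e: "min i j + (i - min i j) = i" "min i j + (j - min i j) = j" by auto
    have e': "i - min i j + (?\<mu> - j - (i - min i j)) = ?\<mu> - j" using that by (simp add: min_def)
    have "j - min i j + (?\<mu> - j - (i - min i j)) = m + (min i j + (i - min i j))" using that by (simp add: min_def)
    from mon4_lo[OF this] show ?thesis unfolding e e' T_def by blast
  qed
  have sub: "wlo m i \<subseteq> coord_ring" using wlo_wt wt_coord_ring by blast
  have "(\<Sum>j\<le>?\<mu>. fscale (c j) (T j)) \<in> wlo m i"
    by (intro fs.subspace_sum fs.subspace_scale wlo_subspace) (use T in simp)
  moreover have "lc lo i (\<Sum>j\<le>?\<mu>. fscale (c j) (T j)) = (\<Sum>j\<le>?\<mu>. lc lo i (fscale (c j) (T j)))"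
    by (rule lin_on_sum[OF lin_on_mono[OF lc_lin_on[OF curve_lo] sub] wlo_subspace])
       (use T in \<open>auto intro: fs.subspace_scale wlo_subspace\<close>)
  moreover have "\<dots> = h"
    unfolding c
  proof (rule sum.cong)
    fix j assume "j \<in> {..?\<mu>}"
    then have "T j \<in> wlo m i" and e: "lc lo i (T j) = mon4 0 0 j (?\<mu> - j)" using T by simp_all
    then have "T j \<in> coord_ring" using sub by blast
    then show "lc lo i (fscale (c j) (T j)) = fscale (c j) (mon4 0 0 j (?\<mu> - j))"
      unfolding e[symmetric] by (rule lc_scale[OF curve_lo])
  qed simp
  ultimately show ?thesis by metis
qed

section \<open>Submodules of the coordinate ring under left translation\<close>

definition ltr :: "('k::field mat2 \<Rightarrow> 'k) set \<Rightarrow> ('k, 'k mat2) gmod" where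
  "ltr X = \<lparr>carrier = X, act = (\<lambda>g f x. f (adj2 g ** x))\<rparr>"

lemma carrier_ltr [simp]: "carrier (ltr X) = X"
  and act_ltr: "act (ltr X) g f = (\<lambda>x. f (adj2 g ** x))"
  by (simp_all add: ltr_def)

lemma coord_ring_translate: "f \<in> coord_ring \<Longrightarrow> g \<in> SL2 \<Longrightarrow> (\<lambda>x. f (g ** x)) \<in> coord_ring"
proof -
  assume f: "f \<in> coord_ring" and g: "g \<in> SL2"
  have "(\<lambda>l. f (g ** hd l)) \<in> LP 1"
    by (rule coord_ring_LP[OF f]) (intro poly_map_mult poly_map_const g poly_map_hd1)
  from LP_coord_ring[OF this] have "(\<lambda>x. if x \<in> SL2 then f (g ** x) else 0) \<in> coord_ring"
    by (simp cong: if_cong)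
  moreover have "(\<lambda>x. if x \<in> SL2 then f (g ** x) else 0) = (\<lambda>x. f (g ** x))"
    using coord_ring_off[OF f] SL2_mult_cancel[OF g] by (auto simp: fun_eq_iff)
  ultimately show ?thesis by simp
qed

text \<open>The function \<open>f(g^-1 x)\<close> is polynomial in the pair \<open>(g, x)\<close>,
  and \<open>LP_decompose\<close> separates the two variables; this is the comultiplication.\<close>

lemma orb_ltr_coord_ring:
  fixes f :: "'k::field mat2 \<Rightarrow> 'k"
  assumes f: "f \<in> coord_ring" shows "orb (ltr coord_ring) f \<in> PF 1 coord_ring"
proof -
  have "(\<lambda>l. f (adj2 (l ! 0) ** (l ! 1))) \<in> LP 2"
    by (rule coord_ring_LP[OF f]) (intro poly_map_mult poly_map_adj2 poly_map_nth; simp)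
  then obtain q where q: "q \<in> TP 1" "\<And>l. l \<in> tuples 2 \<Longrightarrow> f (adj2 (l ! 0) ** (l ! 1)) = q l"
    using LP_decompose[of "\<lambda>l. f (adj2 (l ! 0) ** (l ! 1))" 1] by (auto simp: numeral_2_eq_2)
  have "cut 1 (\<lambda>l x. if x \<in> SL2 then q (hd l # [x]) else 0) \<in> PF 1 coord_ring" if "q \<in> TP 1" for q
    using that
  proof induction
    case (gen b p)
    let ?p = "\<lambda>x. if x \<in> SL2 then p [x] else 0"
    have "(\<lambda>l x. if x \<in> SL2 then b (hd (hd l # [x])) * p (tl (hd l # [x])) else 0) =
        (\<lambda>l. fscale (b (hd l)) ?p)"
      by (auto simp: fun_eq_iff fscale_apply)
    then show ?case
      using cut_elt[OF coord_ring_LP[OF gen(1) poly_map_hd1] LP_coord_ring[OF gen(2)]] by simp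
  next
    case (add p q)
    have "(\<lambda>l x. if x \<in> SL2 then p (hd l # [x]) + q (hd l # [x]) else 0) =
      (\<lambda>l. (\<lambda>x. if x \<in> SL2 then p (hd l # [x]) else 0) + (\<lambda>x. if x \<in> SL2 then q (hd l # [x]) else 0))"
      by (auto simp: fun_eq_iff pointwise)
    then show ?case using PF.add[OF add.IH] by (simp add: cut_add)
  qed
  note * = this[OF q(1)]
  have "orb (ltr coord_ring) f = cut 1 (\<lambda>l x. if x \<in> SL2 then q (hd l # [x]) else 0)"
    unfolding orb_def
  proof (rule cut_cong)
    fix l :: "'k mat2 list" assume "l \<in> tuples 1"
    then obtain g where l: "l = [g]" and g: "g \<in> SL2" by (auto simp: One_nat_def elim!: in_tuples_SucE)
    show "act (ltr coord_ring) (hd l) f = (\<lambda>x. if x \<in> SL2 then q (hd l # [x]) else 0)"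
    proof
      fix x
      show "act (ltr coord_ring) (hd l) f x = (if x \<in> SL2 then q (hd l # [x]) else 0)"
        using q(2)[of "[g, x]"] g coord_ring_off[OF f] SL2_mult_cancel[of "adj2 g" x]
        by (auto simp: l act_ltr numeral_2_eq_2)
    qed
  qed
  then show ?thesis using * by simp
qed

lemma rational_ltr:
  fixes X :: "('k::field mat2 \<Rightarrow> 'k) set"
  assumes X: "fs.subspace X" "X \<subseteq> coord_ring"
    and inv: "\<And>f g. f \<in> X \<Longrightarrow> g \<in> SL2 \<Longrightarrow> (\<lambda>x. f (g ** x)) \<in> X"
  shows "rational_module (ltr X)"
proof (rule rational_moduleI)
  show "orb (ltr X) f \<in> PF 1 (carrier (ltr X))" if f: "f \<in> carrier (ltr X)" for f
  proof (rule PF_restrict)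
    have "orb (ltr X) f = orb (ltr coord_ring) f" by (simp add: orb_def act_ltr)
    then show "orb (ltr X) f \<in> PF 1 coord_ring" using orb_ltr_coord_ring f X(2) by auto
    show "curry (orb (ltr X) f) l \<in> carrier (ltr X)" if l: "l \<in> tuples 1" for l
    proof -
      obtain g where "l = [g]" "g \<in> SL2" using l by (auto simp: One_nat_def elim!: in_tuples_SucE)
      then show ?thesis using inv[of f "adj2 g"] f by (simp add: orb_def curry_cut act_ltr)
    qed
  qed (simp add: X)
  show "lin_on (carrier (ltr X)) (act (ltr X) g)" for g
    by (rule lin_onI) (simp_all add: act_ltr fun_eq_iff pointwise)
  show "act (ltr X) (mat 1) f = f" for f :: "'k mat2 \<Rightarrow> 'k" by (simp add: act_ltr)
  show "act (ltr X) (g ** h) f = act (ltr X) g (act (ltr X) h f)" for g h and f :: "'k mat2 \<Rightarrow> 'k"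
    by (simp add: act_ltr adj2_mult matrix_mul_assoc)
qed (use X inv in \<open>simp_all add: act_ltr\<close>)

lemma rational_coord_ring: "rational_module (ltr coord_ring)"
  by (rule rational_ltr) (simp_all add: coord_ring_translate)

lemma wt_translate: "f \<in> wt m \<Longrightarrow> g \<in> SL2 \<Longrightarrow> (\<lambda>x. f (g ** x)) \<in> wt m"
  unfolding wt_def by (auto simp: coord_ring_translate matrix_mul_assoc)

lemma wlo_translate: "f \<in> wlo m i \<Longrightarrow> g \<in> SL2 \<Longrightarrow> (\<lambda>x. f (g ** x)) \<in> wlo m i"
  unfolding wlo_def by (auto simp: wt_translate fun_eq_iff lc_shift zero_fun_apply)

lemma wlo_coord_ring: "wlo m i \<subseteq> coord_ring"
  using wlo_wt wt_coord_ring by blast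

lemma rational_wlo: "rational_module (ltr (wlo m i))"
  by (rule rational_ltr) (simp_all add: wlo_translate wlo_coord_ring)

text \<open>Evaluation on the diagonal retracts the coinduced module onto the coordinate ring.\<close>

lemma rel_inj_coord_ring: "rel_inj (ltr (coord_ring :: ('k::field mat2 \<Rightarrow> 'k) set))"
proof -
  let ?A = "ltr (coord_ring :: ('k mat2 \<Rightarrow> 'k) set)"
  define r :: "('k mat2 list \<times> 'k mat2 \<Rightarrow> 'k) \<Rightarrow> 'k mat2 \<Rightarrow> 'k" where
    "r F = (\<lambda>x. F ([x], x))" for F
  have "ghom (Std 0 ?A) ?A r"
  proof (rule ghomI)
    show "lin_on (carrier (Std 0 ?A)) r"
      by (rule lin_onI) (simp_all add: r_def fun_eq_iff pointwise)
    show "r F \<in> carrier ?A" if "F \<in> carrier (Std 0 ?A)" for F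
    proof -
      have "F \<in> PF 1 coord_ring" using that by (simp add: carrier_Std)
      then have "r F \<in> coord_ring"
      proof induction
        case zero
        have "r 0 = 0" by (simp add: r_def fun_eq_iff pointwise)
        then show ?case using fs.subspace_0[OF coord_ring_subspace] by metis
      next
        case (gen p w)
        have "r (elt 1 p w) = (\<lambda>x. (if x \<in> SL2 then p [x] else 0) * w x)"
        proof
          fix x
          show "r (elt 1 p w) x = (if x \<in> SL2 then p [x] else 0) * w x"
            using fun_cong[OF curry_elt[of 1 p w "[x]"], of x] by (simp add: r_def curry_conv pointwise One_nat_def)
        qed
        then show ?case using coord_ring_mult[OF LP_coord_ring[OF gen(1)] gen(2)] by simp
      next
        case (add F G)
        have "r (F + G) = r F + r G" by (simp add: r_def fun_eq_iff pointwise)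
        then show ?case using coord_ring_add[OF add.IH] by simp
      qed
      then show ?thesis by simp
    qed
    show "r (act (Std 0 ?A) g F) = act ?A g (r F)" for g F
    proof
      fix x
      show "r (act (Std 0 ?A) g F) x = act ?A g (r F) x"
        using fun_cong[OF curry_act_Std[of 0 ?A g F "[x]"], of x]
        by (simp add: r_def curry_conv act_ltr)
    qed
  qed
  moreover have "r (cst v) = v" if v: "v \<in> carrier ?A" for v
  proof
    fix x show "r (cst v) x = v x"
      using fun_cong[OF curry_cst[of v x], of x] coord_ring_off[of v x] v
      by (auto simp: r_def curry_conv pointwise split: if_splits)
  qed
  ultimately show ?thesis unfolding rel_inj_def using rational_coord_ring by blast
qed

lemma ghom_lc_tor: "ghom (ltr coord_ring) (ltr (wt m)) (lc tor m)"
  by (rule ghomI) (auto simp: lc_lin_on[OF curve_tor] lc_tor_wt act_ltr lc_shift fun_eq_iff)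

lemma ses_wlo: "ses (ltr (wlo m i)) (ltr (wlo m (Suc i))) (ltr (wlo (m + 2 * Suc i) 0)) (\<lambda>v. v) (lc lo (Suc i))"
proof
  show "rational_module (ltr (wlo m i))" "rational_module (ltr (wlo m (Suc i)))"
    "rational_module (ltr (wlo (m + 2 * Suc i) 0))" by (rule rational_wlo)+
  show "ghom (ltr (wlo m i)) (ltr (wlo m (Suc i))) (\<lambda>v. v)"
    by (rule ghomI) (use wlo_mono[of i "Suc i" m] in \<open>auto simp: act_ltr lin_on_def\<close>)
  show "ghom (ltr (wlo m (Suc i))) (ltr (wlo (m + 2 * Suc i) 0)) (lc lo (Suc i))"
  proof (rule ghomI)
    show "lin_on (carrier (ltr (wlo m (Suc i)))) (lc lo (Suc i))"
      using lin_on_mono[OF lc_lin_on[OF curve_lo] wlo_coord_ring] by simp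
    show "lc lo (Suc i) v \<in> carrier (ltr (wlo (m + 2 * Suc i) 0))" if "v \<in> carrier (ltr (wlo m (Suc i)))" for v
      using lc_lo_wlo[of v m "Suc i"] that by simp
  qed (simp add: act_ltr lc_shift fun_eq_iff)
  show "(\<lambda>v. v) ` carrier (ltr (wlo m i)) = {v \<in> carrier (ltr (wlo m (Suc i))). lc lo (Suc i) v = 0}"
    unfolding wlo_def carrier_ltr image_ident
    by (auto simp: less_Suc_eq_le le_Suc_eq dest: Suc_lessI)
  show "lc lo (Suc i) ` carrier (ltr (wlo m (Suc i))) = carrier (ltr (wlo (m + 2 * Suc i) 0))"
    using lc_lo_surj[of _ m "Suc i"] lc_lo_wlo[of _ m "Suc i"] by auto
qed simp

lemma fixed_wlo_0: assumes "m > 0" shows "fixed (ltr (wlo m 0)) = {0 :: 'k::alg_closed_field mat2 \<Rightarrow> 'k}"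
proof (intro subset_antisym subsetI)
  fix f :: "'k mat2 \<Rightarrow> 'k" assume f: "f \<in> fixed (ltr (wlo m 0))"
  then have fw: "f \<in> wt m" and act: "\<And>g x. g \<in> SL2 \<Longrightarrow> f (adj2 g ** x) = f x"
    using wlo_wt by (auto simp: fixed_def act_ltr fun_eq_iff)
  have const: "f x = f (mat 1)" if "x \<in> SL2" for x using act[of x x] that by simp
  have "monom (f (mat 1)) m = [:f (mat 1):]"
  proof (rule poly_eqI_nonzero)
    fix s :: 'k assume s: "s \<noteq> 0"
    then show "poly (monom (f (mat 1)) m) s = poly [:f (mat 1):] s"
      using wt_tor[OF fw s, of "mat 1"] const[OF tor_SL2[OF s]] by (simp add: poly_monom mult.commute)
  qed
  from arg_cong[OF this, of "\<lambda>p. coeff p 0"] have "f (mat 1) = 0" using assms by simp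
  then have "f x = 0" for x using const[of x] coord_ring_off[OF wt_coord_ring[OF fw], of x] by (cases "x \<in> SL2") auto
  then show "f \<in> {0}" by (auto simp: fun_eq_iff zero_fun_apply)
next
  fix f :: "'k mat2 \<Rightarrow> 'k" assume f: "f \<in> {0}"
  have "act (ltr (wlo m 0)) g 0 = (0 :: 'k mat2 \<Rightarrow> 'k)" for g
    by (rule ext) (simp add: act_ltr zero_fun_apply)
  with f show "f \<in> fixed (ltr (wlo m 0))"
    by (simp add: fixed_def fs.subspace_0)
qed

lemma cochains_mono:
  assumes "X \<subseteq> Y" shows "cochains n (ltr X) \<subseteq> cochains n (ltr Y)"
  using PF_mono[OF _ assms] by (auto simp: cochains_def act_ltr)

lemma cochains_restrict:
  assumes "f \<in> cochains n (ltr Y)" "f \<in> PF (Suc n) X" shows "f \<in> cochains n (ltr X)"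
  using assms by (simp add: cochains_def act_ltr)

text \<open>A polynomial function involves finitely many vectors, so the exhaustive filtration is
  reached at a finite stage.\<close>

lemma PF_wlo: assumes "f \<in> PF n (wt m)" shows "\<exists>i. f \<in> PF n (wlo m i)"
  using assms
proof induction
  case (gen p w)
  then show ?case using wlo_bounded[of w m] PF.gen[of p n w] by blast
next
  case (add f g)
  then obtain i j where "f \<in> PF n (wlo m i)" "g \<in> PF n (wlo m j)" by blast
  then have "f \<in> PF n (wlo m (max i j))" "g \<in> PF n (wlo m (max i j))"
    by (auto elim!: PF_mono intro!: wlo_mono)
  then show ?case using PF.add by blast
qed (blast intro: PF.zero)

text \<open>A cocycle in positive degree bounds in \<open>k[G]\<close>, and projecting the primitive
  to weight \<open>m\<close> puts it into some \<open>wlo m i\<close>. The stage is then lowered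
  step by step: the image of the primitive in the top quotient, an induced module of higher weight,
  is a cocycle of lower degree and bounds by induction.\<close>

lemma cocycles_wlo_0:
  assumes "m > 0 \<or> n > 0"
  shows "cocycles n (ltr (wlo m 0)) \<subseteq> coboundaries n (ltr (wlo m 0 :: ('k::alg_closed_field mat2 \<Rightarrow> 'k) set))"
  using assms
proof (induction n arbitrary: m)
  case 0
  have "cst 0 = (0 :: 'k mat2 list \<times> 'k mat2 \<Rightarrow> 'k)" by (simp add: cst_def cut_zero)
  then show ?case using 0 by (simp add: cocycles_0[OF rational_wlo] fixed_wlo_0)
next
  case (Suc n)
  show ?case
  proof
    fix z assume z: "z \<in> cocycles (Suc n) (ltr (wlo m 0 :: ('k mat2 \<Rightarrow> 'k) set))"
    note zP = cochains_PF[OF cocycles_cochains[OF z]]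
    have "z \<in> cocycles (Suc n) (ltr coord_ring)"
      using z cochains_mono[OF wlo_coord_ring] by (auto simp: cocycles_def)
    then obtain h where h: "h \<in> cochains n (ltr coord_ring)" "z = dd n h"
      using rel_inj_acyclic[OF rel_inj_coord_ring] acyclic_iff[OF rational_coord_ring] by auto
    let ?h = "pw (lc tor m) h"
    have hw: "?h \<in> cochains n (ltr (wt m))" and "dd n ?h = pw (lc tor m) z"
      using pw_cochains[OF rational_coord_ring ghom_lc_tor h(1)] h(2) by auto
    moreover have "pw (lc tor m) z = z"
    proof (rule curry_eqI)
      fix l
      have "curry z l \<in> wlo m 0" using PF_in[OF zP rm_sub[OF rational_wlo]] by simp
      then show "curry (pw (lc tor m) z) l = curry z l" by (simp add: lc_tor_id[OF wlo_wt])
    qed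
    ultimately have dh: "dd n ?h = z" by simp
    obtain i where "?h \<in> PF (Suc n) (wlo m i)" using PF_wlo[OF cochains_PF[OF hw, simplified]] by blast
    then have "?h \<in> cochains n (ltr (wlo m i))" by (rule cochains_restrict[OF hw])
    then have "z \<in> coboundaries (Suc n) (ltr (wlo m i))" using dh by auto
    then show "z \<in> coboundaries (Suc n) (ltr (wlo m 0))"
    proof (induction i)
      case (Suc i)
      interpret S: ses "ltr (wlo m i)" "ltr (wlo m (Suc i))" "ltr (wlo (m + 2 * Suc i) 0)"
        "\<lambda>v. v" "lc lo (Suc i)" by (rule ses_wlo)
      have id: "pw (\<lambda>v. v) f = f" for f :: "'k mat2 list \<times> 'k mat2 \<Rightarrow> 'k"
        by (rule curry_eqI) simp
      have zi: "z \<in> cochains (Suc n) (ltr (wlo m i))"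
        using z cochains_mono[OF wlo_mono[of 0 i]] by (auto simp: cocycles_def)
      obtain y where y: "y \<in> cochains n (ltr (wlo m (Suc i)))" "z = dd n y" using Suc.prems by auto
      have yd: "y \<in> S.conn_dom n"
        using y S.pw_p_e[OF zi] unfolding S.conn_dom_def id by simp
      have "pw (lc lo (Suc i)) y \<in> cocycles n (ltr (wlo (m + 2 * Suc i) 0))"
        using S.p_conn_dom yd by blast
      then have "pw (lc lo (Suc i)) y \<in> coboundaries n (ltr (wlo (m + 2 * Suc i) 0))"
        using \<open>\<And>m. 0 < m \<or> 0 < n \<Longrightarrow> _\<close> [of "m + 2 * Suc i"] by auto
      moreover have "pw (lc lo (Suc i)) 0 \<in> pw (lc lo (Suc i)) ` cocycles n (ltr (wlo m (Suc i)))"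
        by (rule imageI, rule fs.subspace_0[OF cocycles_subspace[OF rational_wlo]])
      ultimately have "pw (lc lo (Suc i)) y + pw (lc lo (Suc i)) 0 \<in> S.cob_sum n"
        unfolding S.cob_sum_def by blast
      then have "pw (lc lo (Suc i)) y \<in> S.cob_sum n"
        unfolding pw_0[OF S.p S.J] by simp
      then have "S.conn n y \<in> coboundaries (Suc n) (ltr (wlo m i))" by (rule S.conn_coboundary[OF yd])
      moreover have "S.conn n y = z"
        using S.e_conn(2)[OF yd] y(2) by (simp add: id)
      ultimately show ?case using Suc.IH by simp
    qed
  qed
qed

text \<open>The trivial module appears here both as \<open>Weyl 0\<close> and as the constants
  \<open>wlo 0 0\<close>, to which the vanishing applies.\<close>

lemma coh_Weyl_0_Suc: "coh_le (Suc n) (Weyl 0 :: ('k::alg_closed_field, nat) gmod) 0"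
proof (rule coh_retract[OF rational_Weyl rational_wlo[of 0 0]])
  have act0: "act (Weyl 0) g v = v" if "v \<in> carrier (Weyl 0)" for g and v :: "nat \<Rightarrow> 'k"
    using that by (auto simp: act_Weyl carrier_Weyl hp_def ev_def fun_eq_iff)
  show "coh_le (Suc n) (ltr (wlo 0 0 :: ('k mat2 \<Rightarrow> 'k) set)) 0"
    unfolding coh_le_def qle_0[OF coboundaries_subspace[OF rational_wlo]] by (rule cocycles_wlo_0) simp
  let ?i = "\<lambda>v g. if g \<in> SL2 then v 0 else (0 :: 'k)"
  let ?p = "\<lambda>f j. if j = 0 then f (mat 1) else (0 :: 'k)"
  show "ghom (Weyl 0) (ltr (wlo 0 0)) (?i :: (nat \<Rightarrow> 'k) \<Rightarrow> _)"
  proof (rule ghomI)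
    show "lin_on (carrier (Weyl 0)) (?i :: (nat \<Rightarrow> 'k) \<Rightarrow> _)"
      by (rule lin_onI) (auto simp: fun_eq_iff pointwise)
    show "?i v \<in> carrier (ltr (wlo 0 0))" for v :: "nat \<Rightarrow> 'k"
      by (simp, rule wlo_0I) (auto simp: wt_def coord_ring_const tor_SL2)
    show "?i (act (Weyl 0) g v) = act (ltr (wlo 0 0)) g (?i v)" if "g \<in> SL2" "v \<in> carrier (Weyl 0)" for g and v :: "nat \<Rightarrow> 'k"
      using that by (auto simp: act0 act_ltr fun_eq_iff SL2_mult_cancel)
  qed
  show "ghom (ltr (wlo 0 0)) (Weyl 0) ?p"
  proof (rule ghomI)
    show "lin_on (carrier (ltr (wlo 0 0))) ?p"
      by (rule lin_onI) (auto simp: fun_eq_iff pointwise)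
    show p: "?p v \<in> carrier (Weyl 0)" for v by (simp add: carrier_Weyl)
    show "?p (act (ltr (wlo 0 0)) g f) = act (Weyl 0) g (?p f)" if g: "g \<in> SL2" and f: "f \<in> carrier (ltr (wlo 0 0))" for g f
    proof -
      obtain c where "f = fscale c (mon4 0 0 0 0)" using wlo_0_expand[of f 0] f by auto
      then show ?thesis unfolding act0[OF p] using g by (simp add: act_ltr fun_eq_iff fscale_apply mon4_def)
    qed
  qed
  show "?p (?i v) = v" if "v \<in> carrier (Weyl 0)" for v :: "nat \<Rightarrow> 'k"
    using that by (auto simp: carrier_Weyl fun_eq_iff)
qed

lemma coh_Weyl_0: "coh_le 0 (Weyl 0 :: ('k::alg_closed_field, nat) gmod) 1"
  unfolding coh_le_0[OF rational_Weyl] qle_def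
proof (intro exI conjI)
  let ?e = "\<lambda>i. if i = 0 then 1 else 0 :: 'k"
  show "{?e} \<subseteq> fixed (Weyl 0)" by (auto simp: fixed_def act_Weyl carrier_Weyl hp_def ev_def fun_eq_iff)
  show "fixed (Weyl 0) \<subseteq> fs.span ({?e} \<union> {0})"
  proof
    fix v :: "nat \<Rightarrow> 'k" assume "v \<in> fixed (Weyl 0)"
    then have "v = fscale (v 0) ?e" by (auto simp: fixed_def carrier_Weyl fun_eq_iff fscale_apply)
    then show "v \<in> fs.span ({?e} \<union> {0})" by (metis UnI1 fs.span_base fs.span_scale insertI1)
  qed
qed auto

section \<open>The growth bound\<close>

text \<open>The number of partitions of \<open>N\<close> into exactly \<open>k\<close> powers of
  two: either some part is \<open>1\<close> and is removed, or all parts are even and are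
  halved.\<close>

function hb :: "nat \<Rightarrow> nat \<Rightarrow> nat" where
  "hb 0 N = (if N = 0 then 1 else 0)"
| "hb (Suc k) 0 = 0"
| "hb (Suc k) (Suc N) = hb k N + (if odd N then hb (Suc k) (Suc N div 2) else 0)"
  by pat_completeness auto
termination by (relation "Wellfounded.measure (\<lambda>(k, N). k + N)") (auto elim: oddE)

text \<open>\<open>half_bits N\<close> is \<open>2\<close> to the minus number of binary digits \<open>1\<close> of \<open>N\<close>.\<close>

fun half_bits :: "nat \<Rightarrow> real" where
  "half_bits N = (if N = 0 then 1 else if even N then half_bits (N div 2) else half_bits (N div 2) / 2)"

declare half_bits.simps [simp del]

lemma half_bits_0: "half_bits 0 = 1"
  by (simp add: half_bits.simps)

lemma half_bits_even: "half_bits (2 * M) = half_bits M"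
  by (cases "M = 0") (simp_all add: half_bits.simps[of "2 * M"])

lemma half_bits_odd: "half_bits (Suc (2 * M)) = half_bits M / 2"
  by (simp add: half_bits.simps[of "Suc (2 * M)"])

text \<open>The coefficient of \<open>q^N\<close> in
  \<open>(1 - q/4) \<Prod> (1 + q^(2^i)/2)\<close>; the product alone has the coefficients
  \<open>half_bits N\<close>.\<close>

definition hbw :: "nat \<Rightarrow> real" where
  "hbw N = (if N = 0 then 1 else half_bits N - half_bits (N - 1) / 4)"

lemma half_bits_bounds: "0 < half_bits N \<and> half_bits N \<le> 1"
proof (induction N rule: less_induct)
  case (less N)
  show ?case
  proof (cases "N = 0")
    case False
    then have "N div 2 < N" by simp
    from less[OF this] False show ?thesis by (simp add: half_bits.simps[of N])
  qed (simp add: half_bits_0)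
qed

lemma hbw_odd: "hbw (Suc (2 * M)) = half_bits M / 4"
  by (simp add: hbw_def half_bits_odd half_bits_even)

lemma hbw_even: "hbw (2 * Suc M) = half_bits (Suc M) - half_bits M / 8"
proof -
  have "half_bits (2 * Suc M) = half_bits (Suc M)" by (rule half_bits_even)
  then show ?thesis by (simp add: hbw_def half_bits_odd)
qed

lemma hbw_nonneg: "0 \<le> hbw N"
proof (induction N rule: less_induct)
  case (less N)
  consider "N = 0" | M where "N = Suc (2 * M)" | M where "N = 2 * Suc M"
    by (metis oddE evenE Suc_eq_plus1 not0_implies_Suc mult_0_right)
  then show ?case
  proof cases
    case (3 M)
    then show ?thesis using less[of "Suc M"] half_bits_bounds[of M] hbw_even[of M] by (simp add: hbw_def[of "Suc M"])
  qed (use half_bits_bounds in \<open>auto simp: hbw_def[of 0] hbw_odd less_imp_le\<close>)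
qed

lemma hbw_le_half_bits: "hbw N \<le> half_bits N"
  using half_bits_bounds[of "N - 1"] by (simp add: hbw_def half_bits_0)

text \<open>With weight \<open>1/4\<close> per part, \<open>hbw\<close> satisfies the recursion of
  \<open>hb\<close> with an inequality in place of equality.\<close>

lemma hb_bound: "real (hb k N) \<le> 4 ^ k * hbw N"
proof (induction k N rule: hb.induct)
  case (1 N)
  show ?case using hbw_nonneg[of N] by (simp add: hbw_def[of 0])
next
  case (2 k)
  show ?case by (simp add: hbw_def)
next
  case (3 k N)
  show ?case
  proof (cases "odd N")
    case False
    then obtain M where M: "N = 2 * M" by (auto elim: evenE)
    have "real (hb (Suc k) (Suc N)) \<le> 4 ^ k * hbw N" using 3(1) False by simp
    also have "\<dots> \<le> 4 ^ k * half_bits M"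
      using hbw_le_half_bits[of N] by (simp add: M half_bits_even)
    finally show ?thesis by (simp add: M hbw_odd)
  next
    case True
    then obtain M where M: "N = Suc (2 * M)" by (auto elim: oddE)
    have "real (hb (Suc k) (Suc N)) \<le> 4 ^ k * hbw (Suc (2 * M)) + 4 ^ Suc k * hbw (Suc M)"
      using 3(1) 3(2)[OF True] True by (simp add: M)
    also have "\<dots> = 4 ^ k * (4 * half_bits (Suc M) - 3 / 4 * half_bits M)"
      unfolding hbw_odd by (simp add: hbw_def algebra_simps)
    \<comment> \<open>By \<open>hbw_even\<close> the right side subtracts only half of
      \<open>half_bits M\<close>, the left side three quarters of it.\<close>
    also have "\<dots> \<le> 4 ^ k * (4 * hbw (2 * Suc M))"
      using half_bits_bounds[of M] unfolding hbw_even by (intro mult_left_mono) simp_all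
    finally show ?thesis by (simp add: M)
  qed
qed

lemma hb_le: "hb k N \<le> 4 ^ k"
proof -
  have "real (hb k N) \<le> 4 ^ k * 1"
    using hb_bound[of k N] hbw_le_half_bits[of N] half_bits_bounds[of N]
    by (meson mult_left_mono order.trans zero_le_numeral zero_le_power)
  then show ?thesis by (metis mult_1_right of_nat_le_iff of_nat_numeral of_nat_power)
qed

context sl2_char2
begin

text \<open>Both arguments are shifted by one: \<open>V(2 N)\<close> in degree \<open>n\<close>
  corresponds to \<open>n + 1\<close> parts with sum \<open>N + 1\<close>. The vanishing for odd
  weights matches the missing halving term for an odd sum.\<close>

lemma coh_Weyl_even_hb: "coh_le n (Weyl (2 * N) :: ('k, nat) gmod) (hb (Suc n) (Suc N))"
proof (induction n arbitrary: N)
  case 0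
  show ?case
  proof (induction N rule: less_induct)
    case (less N)
    show ?case
    proof (cases N)
      case 0 then show ?thesis using coh_Weyl_0[where 'k = 'k] by simp
    next
      case (Suc a)
      have e: "2 * N = 2 * a + 2" using Suc by simp
      show ?thesis
      proof (cases "odd a")
        case True
        then obtain b where b: "a = Suc (2 * b)" by (auto elim: oddE)
        show ?thesis unfolding e b by (rule coh_le_mono[OF coh_Weyl_even_0[OF coh_Weyl_odd]]) simp
      next
        case False
        then obtain b where b: "a = 2 * b" by (auto elim: evenE)
        have "coh_le 0 (Weyl a :: ('k, nat) gmod) (hb (Suc 0) (Suc b))"
          unfolding b by (rule less) (use Suc b in simp)
        then show ?thesis
          unfolding e by (rule coh_le_mono[OF coh_Weyl_even_0]) (use Suc b in simp)
      qed
    qed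
  qed
next
  case IH: (Suc n)
  show ?case
  proof (induction N rule: less_induct)
    case (less N)
    show ?case
    proof (cases N)
      case 0 then show ?thesis using coh_Weyl_0_Suc[where 'k = 'k] by simp
    next
      case (Suc a)
      have e: "2 * N = 2 * a + 2" using Suc by simp
      show ?thesis
      proof (cases "odd a")
        case True
        then obtain b where b: "a = Suc (2 * b)" by (auto elim: oddE)
        have "coh_le (Suc n) (Weyl a :: ('k, nat) gmod) 0" unfolding b by (rule coh_Weyl_odd)
        from coh_Weyl_even[OF this IH] show ?thesis
          unfolding e by (rule coh_le_mono) (use Suc in simp)
      next
        case False
        then obtain b where b: "a = 2 * b" by (auto elim: evenE)
        have "coh_le (Suc n) (Weyl a :: ('k, nat) gmod) (hb (Suc (Suc n)) (Suc b))"
          unfolding b by (rule less) (use Suc b in simp)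
        from coh_Weyl_even[OF this IH] show ?thesis
          unfolding e by (rule coh_le_mono) (use Suc b in simp)
      qed
    qed
  qed
qed

lemma coh_Weyl_le: "coh_le n (Weyl m :: ('k, nat) gmod) (4 ^ (n + 1))"
proof (cases "even m")
  case True
  then obtain N where "m = 2 * N" by (auto elim: evenE)
  then show ?thesis using coh_le_mono[OF coh_Weyl_even_hb hb_le, of n N] by simp
next
  case False
  then obtain a where "m = Suc (2 * a)" by (auto elim: oddE)
  then show ?thesis using coh_le_mono[OF coh_Weyl_odd[of n a], of "4 ^ (n + 1)"] by simp
qed

end

section \<open>Duals of induced modules\<close>

lemma borel_neg_iff: "b \<in> borel_neg \<longleftrightarrow> b$1$2 = 0 \<and> b$1$1 * b$2$2 = 1"
  by (auto simp: borel_neg_def SL2_iff)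

text \<open>Every element of the Borel subgroup is a product of some \<open>tor s\<close> and some
  \<open>lo t\<close>, so equivariance splits into a weight condition and invariance under
  \<open>lo\<close>.\<close>

lemma carrier_ind_module: "carrier (ind_module m) = (wlo m 0 :: ('k::alg_closed_field mat2 \<Rightarrow> 'k) set)"
proof (intro subset_antisym subsetI)
  fix f :: "'k mat2 \<Rightarrow> 'k" assume "f \<in> carrier (ind_module m)"
  then have fc: "f \<in> coord_ring"
    and f: "\<And>g b. g \<in> SL2 \<Longrightarrow> b \<in> borel_neg \<Longrightarrow> f (g ** b) = inverse (b$1$1 ^ m) * f g"
    by (auto simp: ind_module_def weight_char_def)
  show "f \<in> wlo m 0"
  proof (rule wlo_0I)
    show "f \<in> wt m" using fc f[of _ "tor s" for s] by (auto simp: wt_def borel_neg_iff power_inverse)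
    show "f (g ** lo t) = f g" if "g \<in> SL2" for g t using f[OF that, of "lo t"] by (simp add: borel_neg_iff)
  qed
next
  fix f :: "'k mat2 \<Rightarrow> 'k" assume f: "f \<in> wlo m 0"
  have "f (g ** b) = inverse (b$1$1 ^ m) * f g" if g: "g \<in> SL2" and b: "b \<in> borel_neg" for g b
  proof -
    from b have d: "b$2$2 \<noteq> 0" and a: "b$1$1 = inverse (b$2$2)" and z: "b$1$2 = 0"
      by (auto simp: borel_neg_iff inverse_eq_divide eq_divide_eq)
    have "b = tor (b$2$2) ** lo (b$2$1 / b$2$2)" using d a z by (simp add: mat2_eq_iff)
    then have "f (g ** b) = f (g ** tor (b$2$2))" using wlo_0_lo[OF f] by (metis matrix_mul_assoc)
    then show ?thesis using wt_tor[OF wlo_wt[OF f] d g] by (simp add: a power_inverse)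
  qed
  then show "f \<in> carrier (ind_module m)"
    using wt_coord_ring[OF wlo_wt[OF f]] by (auto simp: ind_module_def weight_char_def)
qed

section \<open>The isomorphism of \<open>weyl_module m\<close> with \<open>Weyl m\<close>\<close>

definition hmon :: "nat \<Rightarrow> nat \<Rightarrow> 'k::field mat2 \<Rightarrow> 'k" where
  "hmon m i = mon4 0 0 i (m - i)"

definition to_Weyl :: "nat \<Rightarrow> (('k::field mat2 \<Rightarrow> 'k) \<Rightarrow> 'k) \<Rightarrow> nat \<Rightarrow> 'k" where
  "to_Weyl m \<xi> i = (if i \<le> m then \<xi> (hmon m i) else 0)"

text \<open>Along \<open>up t\<close> the function \<open>hmon m i\<close> restricts to
  \<open>t^i\<close>, so the coefficients of \<open>f\<close> in this basis are
  \<open>lc up i f (mat 1)\<close>.\<close>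

definition of_Weyl :: "nat \<Rightarrow> (nat \<Rightarrow> 'k::alg_closed_field) \<Rightarrow> ('k mat2 \<Rightarrow> 'k) \<Rightarrow> 'k" where
  "of_Weyl m v f = (if f \<in> wlo m 0 then \<Sum>i\<le>m. v i * lc up i f (mat 1) else 0)"

lemma hmon_wlo: "i \<le> m \<Longrightarrow> hmon m i \<in> wlo m 0"
  using mon4_lo(1)[of i "m - i" m 0 0] by (simp add: hmon_def)

lemma hmon_translate:
  assumes "i \<le> m" "g \<in> SL2"
  shows "(\<lambda>x. hmon m i (g ** x)) = (\<Sum>j\<le>m. fscale (coeff (hp g m i) j) (hmon m j) :: 'k::field mat2 \<Rightarrow> 'k)"
proof
  fix x :: "'k mat2"
  have s: "(\<Sum>j\<in>A. fscale (c j) (hmon m j)) x = (\<Sum>j\<in>A. c j * hmon m j x)" if "finite A" for A and c :: "nat \<Rightarrow> 'k"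
    using that by (induction A) (simp_all add: pointwise)
  show "hmon m i (g ** x) = (\<Sum>j\<le>m. fscale (coeff (hp g m i) j) (hmon m j)) x"
  proof (cases "x \<in> SL2")
    case True
    have "poly (homog [:x$1$2:] [:x$2$2:] m (hp g m i)) 0 = hmon m i (g ** x)"
      unfolding homog_hp[OF assms(1)] using True assms(2) by (simp add: hmon_def mon4_def poly_power)
    then have "hmon m i (g ** x) = (\<Sum>j\<le>m. coeff (hp g m i) j * hmon m j x)"
      using True by (simp add: homog_def poly_sum poly_power hmon_def mon4_def)
    then show ?thesis unfolding s[OF finite_atMost] .
  next
    case False
    then show ?thesis
      unfolding s[OF finite_atMost] using SL2_mult_cancel[OF assms(2)] by (simp add: hmon_def mon4_def)
  qed
qed

lemma lc_up_hmon: "i \<le> m \<Longrightarrow> lc up j (hmon m i) (mat 1) = (if j = i then 1 else 0)"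
proof -
  assume "i \<le> m"
  have "lc up j (hmon m i) (mat 1) = coeff (monom (1::'a) i) (0 + j)"
    by (rule lc_eqI) (simp add: poly_monom hmon_def mon4_def)
  then show ?thesis by simp
qed

lemma wlo_0_hmon:
  fixes f :: "'k::alg_closed_field mat2 \<Rightarrow> 'k"
  assumes "f \<in> wlo m 0" shows "f = (\<Sum>i\<le>m. fscale (lc up i f (mat 1)) (hmon m i))"
proof -
  obtain c where c: "f = (\<Sum>i\<le>m. fscale (c i) (hmon m i))" "\<And>t. f (up t) = (\<Sum>i\<le>m. c i * t ^ i)"
    using wlo_0_expand[OF assms] unfolding hmon_def by blast
  have "lc up i f (mat 1) = c i" if "i \<le> m" for i
  proof -
    have "lc up i f (mat 1) = coeff (\<Sum>j\<le>m. monom (c j) j) (0 + i)"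
      by (rule lc_eqI) (simp add: c(2) poly_sum poly_monom)
    then show ?thesis using that by (simp add: coeff_sum)
  qed
  then have "(\<Sum>i\<le>m. fscale (lc up i f (mat 1)) (hmon m i)) = (\<Sum>i\<le>m. fscale (c i) (hmon m i))" by simp
  then show ?thesis using c(1) by simp
qed

lemma carrier_weyl_module:
  "\<xi> \<in> carrier (weyl_module m :: ('k::alg_closed_field, 'k mat2 \<Rightarrow> 'k) gmod) \<longleftrightarrow>
    (\<forall>f. f \<notin> wlo m 0 \<longrightarrow> \<xi> f = 0) \<and> (\<forall>f\<in>wlo m 0. \<forall>h\<in>wlo m 0. \<xi> (f + h) = \<xi> f + \<xi> h) \<and>
    (\<forall>c. \<forall>f\<in>wlo m 0. \<xi> (fscale c f) = c * \<xi> f)"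
  by (simp add: weyl_module_def dual_module_def carrier_ind_module)

text \<open>Dualising and left translation each invert \<open>g\<close>, and the two inversions
  cancel.\<close>

lemma act_weyl_module:
  assumes "g \<in> SL2"
  shows "act (weyl_module m) g \<xi> f = (if f \<in> wlo m 0 then \<xi> (\<lambda>x. f (g ** x)) else 0)"
  using matrix_inv_SL2[OF assms] matrix_inv_SL2[of "adj2 g"] assms
  by (simp add: weyl_module_def dual_module_def carrier_ind_module) (simp add: ind_module_def)

lemma weyl_module_sum:
  assumes \<xi>: "\<xi> \<in> carrier (weyl_module m)" and f: "\<And>i. i \<in> A \<Longrightarrow> f i \<in> wlo m 0"
  shows "\<xi> (\<Sum>i\<in>A. fscale (c i) (f i)) = (\<Sum>i\<in>A. c i * \<xi> (f i))"
proof -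
  have 0: "\<xi> 0 = 0"
  proof -
    have "\<xi> (fscale 0 0) = 0 * \<xi> 0"
      using \<xi> fs.subspace_0[OF wlo_subspace[of m 0]] unfolding carrier_weyl_module by blast
    then show ?thesis by simp
  qed
  have "(\<Sum>i\<in>A. fscale (c i) (f i)) \<in> wlo m 0 \<and> \<xi> (\<Sum>i\<in>A. fscale (c i) (f i)) = (\<Sum>i\<in>A. c i * \<xi> (f i))"
    using f
  proof (induction A rule: infinite_finite_induct)
    case (insert i A)
    then show ?case
      using \<xi> by (simp add: carrier_weyl_module fs.subspace_add fs.subspace_scale)
  qed (use 0 in \<open>simp_all add: fs.subspace_0\<close>)
  then show ?thesis by simp
qed

lemma of_Weyl_in: "of_Weyl m v \<in> carrier (weyl_module m)"
  unfolding carrier_weyl_module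
proof (intro conjI ballI allI impI)
  fix f h :: "'a mat2 \<Rightarrow> 'a" assume fh: "f \<in> wlo m 0" "h \<in> wlo m 0"
  then have "f \<in> coord_ring" "h \<in> coord_ring" using wlo_coord_ring by blast+
  then show "of_Weyl m v (f + h) = of_Weyl m v f + of_Weyl m v h"
    using fh by (simp add: of_Weyl_def fs.subspace_add lc_add[OF curve_up] pointwise distrib_left sum.distrib)
next
  fix c and f :: "'a mat2 \<Rightarrow> 'a" assume f: "f \<in> wlo m 0"
  then have "f \<in> coord_ring" using wlo_coord_ring by blast
  then show "of_Weyl m v (fscale c f) = c * of_Weyl m v f"
    using f by (simp add: of_Weyl_def fs.subspace_scale lc_scale[OF curve_up] pointwise sum_distrib_left mult_ac)
qed (simp add: of_Weyl_def)

lemma to_of_Weyl: "v \<in> carrier (Weyl m) \<Longrightarrow> to_Weyl m (of_Weyl m v) = v"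
proof
  fix i assume "v \<in> carrier (Weyl m)"
  then show "to_Weyl m (of_Weyl m v) i = v i"
    by (auto simp: to_Weyl_def of_Weyl_def hmon_wlo lc_up_hmon carrier_Weyl if_distrib cong: if_cong)
qed

lemma of_to_Weyl:
  assumes \<xi>: "\<xi> \<in> carrier (weyl_module m)" shows "of_Weyl m (to_Weyl m \<xi>) = \<xi>"
proof
  fix f
  show "of_Weyl m (to_Weyl m \<xi>) f = \<xi> f"
  proof (cases "f \<in> wlo m 0")
    case True
    have "\<xi> f = (\<Sum>i\<le>m. lc up i f (mat 1) * \<xi> (hmon m i))"
      by (subst wlo_0_hmon[OF True], rule weyl_module_sum[OF \<xi>]) (simp add: hmon_wlo)
    then show ?thesis using True by (simp add: of_Weyl_def to_Weyl_def mult.commute)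
  qed (use \<xi> in \<open>simp add: carrier_weyl_module of_Weyl_def\<close>)
qed

lemma ghom_to_Weyl: "ghom (weyl_module m :: ('k::alg_closed_field, 'k mat2 \<Rightarrow> 'k) gmod) (Weyl m) (to_Weyl m)"
proof (rule ghomI)
  let ?V = "weyl_module m :: ('k, 'k mat2 \<Rightarrow> 'k) gmod"
  show "lin_on (carrier ?V) (to_Weyl m)"
    by (rule lin_onI) (simp_all add: to_Weyl_def fun_eq_iff pointwise)
  show "to_Weyl m \<xi> \<in> carrier (Weyl m)" for \<xi> :: "('k mat2 \<Rightarrow> 'k) \<Rightarrow> 'k"
    by (simp add: carrier_Weyl to_Weyl_def)
  show "to_Weyl m (act ?V g \<xi>) = act (Weyl m) g (to_Weyl m \<xi>)" if g: "g \<in> SL2" and \<xi>: "\<xi> \<in> carrier ?V" for g \<xi>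
  proof
    fix i
    show "to_Weyl m (act ?V g \<xi>) i = act (Weyl m) g (to_Weyl m \<xi>) i"
    proof (cases "i \<le> m")
      case True
      have "to_Weyl m (act ?V g \<xi>) i = \<xi> (\<lambda>x. hmon m i (g ** x))"
        using True by (simp add: to_Weyl_def act_weyl_module[OF g] hmon_wlo)
      also have "\<dots> = (\<Sum>j\<le>m. coeff (hp g m i) j * \<xi> (hmon m j))"
        unfolding hmon_translate[OF True g] by (rule weyl_module_sum[OF \<xi>]) (simp add: hmon_wlo)
      finally show ?thesis using True by (simp add: act_Weyl ev_def to_Weyl_def mult.commute)
    qed (simp add: to_Weyl_def act_Weyl)
  qed
qed

lemma act_weyl_module_in:
  fixes g :: "'k::alg_closed_field mat2"
  assumes g: "g \<in> SL2" and \<xi>: "\<xi> \<in> carrier (weyl_module m)"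
  shows "act (weyl_module m) g \<xi> \<in> carrier (weyl_module m)"
proof -
  have "(\<lambda>x. (f + h) (g ** x)) = (\<lambda>x. f (g ** x)) + (\<lambda>x. h (g ** x))"
    "(\<lambda>x. fscale c f (g ** x)) = fscale c (\<lambda>x. f (g ** x))" for f h :: "'k mat2 \<Rightarrow> 'k" and c
    by (simp_all add: fun_eq_iff pointwise)
  then show ?thesis
    using \<xi> g unfolding carrier_weyl_module
    by (simp add: act_weyl_module[OF g] fs.subspace_add fs.subspace_scale wlo_translate)
qed

lemma ghom_of_Weyl: "ghom (Weyl m) (weyl_module m :: ('k::alg_closed_field, 'k mat2 \<Rightarrow> 'k) gmod) (of_Weyl m)"
proof (rule ghomI)
  let ?V = "weyl_module m :: ('k, 'k mat2 \<Rightarrow> 'k) gmod"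
  show "lin_on (carrier (Weyl m)) (of_Weyl m :: _ \<Rightarrow> ('k mat2 \<Rightarrow> 'k) \<Rightarrow> 'k)"
    by (rule lin_onI) (simp_all add: of_Weyl_def fun_eq_iff pointwise distrib_right sum.distrib sum_distrib_left mult_ac)
  show "of_Weyl m v \<in> carrier ?V" for v by (rule of_Weyl_in)
  show "of_Weyl m (act (Weyl m) g v) = act ?V g (of_Weyl m v)" if g: "g \<in> SL2" and v: "v \<in> carrier (Weyl m)" for g v
  proof -
    have "to_Weyl m (act ?V g (of_Weyl m v)) = act (Weyl m) g v"
      using ghom_act[OF ghom_to_Weyl g of_Weyl_in] to_of_Weyl[OF v] by simp
    then show ?thesis using of_to_Weyl[OF act_weyl_module_in[OF g of_Weyl_in]] by metis
  qed
qed

section \<open>Injective modules\<close>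

text \<open>Maps into \<open>Std n M\<close> correspond to linear maps into \<open>PF n (carrier M)\<close>: evaluate at tuples
  starting with the identity.\<close>

lemma Std_extend:
  fixes M :: "('k::field, 'z) gmod"
  assumes A: "rational_module A" and B: "rational_module B" and M: "rational_module M"
    and i: "ghom A B i" "inj_on i (carrier A)" and f: "ghom A (Std n M) f"
  shows "\<exists>h. ghom B (Std n M) h \<and> (\<forall>a\<in>carrier A. h (i a) = f a)"
proof -
  define f0 where "f0 a = cut n (\<lambda>l. curry (f a) (mat 1 # l))" for a
  have fP: "f a \<in> PF (Suc n) (carrier M)" if "a \<in> carrier A" for a
    using ghom_in[OF f that] by (simp add: carrier_Std)
  have f0P: "f0 a \<in> PF n (carrier M)" if "a \<in> carrier A" for a
    unfolding f0_def by (intro PF_subst[OF fP[OF that]] poly_subst_Cons poly_map_const poly_subst_id SL2_one)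
  have f0l: "lin_on (carrier A) f0"
    by (rule lin_onI)
       (simp_all add: f0_def lin_on_add[OF ghom_lin[OF f]] lin_on_scale[OF ghom_lin[OF f]] curry_simps cut_add cut_scale)
  let ?j = "the_inv_into (carrier A) i"
  have j: "?j (i a) = a" if "a \<in> carrier A" for a by (rule the_inv_into_f_f[OF i(2) that])
  have "lin_on (i ` carrier A) (\<lambda>b. f0 (?j b))"
    by (rule lin_on_comp[OF lin_on_the_inv[OF ghom_lin[OF i(1)] rm_sub[OF A] i(2)] f0l]) (auto simp: j)
  from lin_on_extend[OF this lin_on_subspace_image[OF ghom_lin[OF i(1)] rm_sub[OF A]]]
  obtain F where F: "lin_on UNIV F" "\<forall>v\<in>i ` carrier A. F v = f0 (?j v)"
    and FP: "range F \<subseteq> (\<lambda>b. f0 (?j b)) ` i ` carrier A" by blast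
  have FPF: "F b \<in> PF n (carrier M)" for b using FP f0P by (auto simp: subset_iff image_iff j) (metis j)
  have Fi: "F (i a) = f0 a" if "a \<in> carrier A" for a using F(2) that by (simp add: j)
  \<comment> \<open>Frobenius reciprocity: the linear extension \<open>F\<close> gives the value at
    tuples starting with the identity, and equivariance dictates the others by moving the first
    entry \<open>hd l\<close> to the identity.\<close>
  define h where "h b = cut (Suc n) (\<lambda>l. act M (hd l) (curry (F (act B (adj2 (hd l)) b)) (tr (adj2 (hd l)) (tl l))))" for b
  have hin: "curry (F b) l \<in> carrier M" for b l by (rule PF_in[OF FPF rm_sub[OF M]])
  have hP: "h b \<in> PF (Suc n) (carrier M)" if b: "b \<in> carrier B" for b
  proof -
    have 1: "pw F (orb B b) \<in> PF 1 (PF n (carrier M))"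
      by (rule PF_pw[OF rm_orb[OF B b] lin_on_mono[OF F(1)] rm_sub[OF B]]) (use FPF in auto)
    let ?s = "\<lambda>l. adj2 (hd l) # tr (adj2 (hd l)) (tl l)"
    have s: "poly_subst (Suc n) (Suc n) ?s"
      by (intro poly_subst_Cons poly_subst_tr poly_map_adj2 poly_map_hd poly_subst_tl)
    have "h b = cut (Suc n) (\<lambda>l. act M (hd l) (curry (cut (Suc n) (\<lambda>l.
        curry (cut (Suc n) (\<lambda>l. curry (curry (pw F (orb B b)) [hd l]) (tl l))) (?s l))) l))"
      unfolding h_def
      by (rule cut_cong) (auto elim!: in_tuples_SucE simp: curry_cut orb_def)
    also have "\<dots> \<in> PF (Suc n) (carrier M)"
      by (rule PF_act[OF M PF_subst[OF PF_unsplit[OF 1] s] poly_map_hd])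
    finally show ?thesis .
  qed
  have "ghom B (Std n M) h"
  proof (rule ghomI)
    show "lin_on (carrier B) h"
    proof (rule lin_onI)
      show "h (v + w) = h v + h w" if "v \<in> carrier B" "w \<in> carrier B" for v w
        unfolding h_def cut_add[symmetric]
        by (rule cut_cong) (use that hin in \<open>auto elim!: in_tuples_SucE simp: lin_on_add[OF rm_lin[OF B]]
          lin_on_add[OF F(1)] curry_simps lin_on_add[OF rm_lin[OF M]]\<close>)
      show "h (fscale c v) = fscale c (h v)" if "v \<in> carrier B" for c v
        unfolding h_def cut_scale[symmetric]
        by (rule cut_cong) (use that hin in \<open>auto elim!: in_tuples_SucE simp: lin_on_scale[OF rm_lin[OF B]]
          lin_on_scale[OF F(1)] curry_simps lin_on_scale[OF rm_lin[OF M]]\<close>)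
    qed
    show "h b \<in> carrier (Std n M)" if "b \<in> carrier B" for b using hP[OF that] by (simp add: carrier_Std)
    show "h (act B g b) = act (Std n M) g (h b)" if g: "g \<in> SL2" and b: "b \<in> carrier B" for g b
      unfolding act_Std_cut[OF M g hP[OF b]]
      unfolding h_def
    proof (rule cut_cong)
      fix l :: "'k mat2 list" assume "l \<in> tuples (Suc n)"
      then obtain x l' where l: "l = x # l'" "x \<in> SL2" "l' \<in> tuples n" by (auto elim!: in_tuples_SucE)
      have e: "tr (adj2 x ** g) (tr (adj2 g) l') = tr (adj2 x) l'"
        unfolding tr_tr using g by (simp add: matrix_mul_assoc[symmetric])
      show "act M (hd l) (curry (F (act B (adj2 (hd l)) (act B g b))) (tr (adj2 (hd l)) (tl l))) =
        act M g (curry (cut (Suc n) (\<lambda>l. act M (hd l) (curry (F (act B (adj2 (hd l)) b)) (tr (adj2 (hd l)) (tl l)))))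
          (tr (adj2 g) l))"
        using l g b hin e
        by (simp add: curry_cut adj2_mult rm_mult[OF B, symmetric] rm_mult[OF M, symmetric] matrix_mul_assoc del: map_map)
    qed
  qed
  moreover have "h (i a) = f a" if a: "a \<in> carrier A" for a
  proof (rule PF_eqI[OF hP[OF ghom_in[OF i(1) a]] fP[OF a]])
    fix l :: "'k mat2 list" assume "l \<in> tuples (Suc n)"
    then obtain x l' where l: "l = x # l'" "x \<in> SL2" "l' \<in> tuples n" by (auto elim!: in_tuples_SucE)
    have x': "adj2 x \<in> SL2" using l by simp
    have "curry (h (i a)) l = act M x (curry (F (i (act A (adj2 x) a))) (tr (adj2 x) l'))"
      using l by (simp add: h_def curry_cut ghom_act[OF i(1) x' a])
    also have "\<dots> = act M x (curry (f (act A (adj2 x) a)) (mat 1 # tr (adj2 x) l'))"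
      using l x' by (simp add: Fi[OF rm_act[OF A x' a]] f0_def curry_cut)
    also have "\<dots> = act M x (act M (adj2 x) (curry (f a) (x # l')))"
      using l by (simp add: ghom_act[OF f x' a] curry_act_Std del: map_map)
    finally show "curry (h (i a)) l = curry (f a) l"
      using l rm_inv(2)[OF M l(2) PF_in[OF fP[OF a] rm_sub[OF M]]] by simp
  qed
  ultimately show ?thesis by blast
qed

subsection \<open>Countability of the coordinate ring\<close>

definition mon4s :: "('k::field mat2 \<Rightarrow> 'k) set" where
  "mon4s = range (\<lambda>(p, q, r, s). mon4 p q r s)"

lemma mon4_mon4s: "mon4 p q r s \<in> fs.span mon4s"
  by (rule fs.span_base) (auto simp: mon4s_def intro: image_eqI[of _ _ "(p, q, r, s)"])

lemma mon4_mult: "mon4 p q r s * mon4 p' q' r' s' = mon4 (p + p') (q + q') (r + r') (s + s')"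
  by (simp add: fun_eq_iff times_fun_apply mon4_def power_add mult_ac)

lemma span_mon4s_mult:
  assumes "a \<in> fs.span mon4s" "b \<in> fs.span mon4s" shows "a * b \<in> fs.span mon4s"
proof -
  have 1: "mon4 p q r s * b \<in> fs.span mon4s" for p q r s
    using assms(2)
  proof (induction rule: fs.span_induct_alt)
    case (step c x y)
    obtain p' q' r' s' where "x = mon4 p' q' r' s'" using step(1) by (auto simp: mon4s_def)
    moreover have "mon4 p q r s * (fscale c x + y) = fscale c (mon4 p q r s * x) + mon4 p q r s * y"
      by (simp add: fun_eq_iff pointwise algebra_simps)
    ultimately show ?case using step(2) by (simp add: mon4_mult mon4_mon4s fs.span_add fs.span_scale)
  qed (simp add: fs.span_zero)
  show ?thesis
    using assms(1)
  proof (induction rule: fs.span_induct_alt)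
    case (step c x y)
    obtain p q r s where "x = mon4 p q r s" using step(1) by (auto simp: mon4s_def)
    moreover have "(fscale c x + y) * b = fscale c (x * b) + y * b"
      by (simp add: fun_eq_iff pointwise algebra_simps)
    ultimately show ?case using step(2) 1 by (simp add: fs.span_add fs.span_scale)
  qed (simp add: fs.span_zero)
qed

lemma coord_ring_span: "coord_ring \<subseteq> fs.span mon4s"
proof -
  have "(\<lambda>g. if g \<in> SL2 then p g else 0) \<in> fs.span mon4s" if "p \<in> poly_fun" for p :: "'a mat2 \<Rightarrow> 'a"
    using that
  proof induction
    case (const c)
    have "(\<lambda>g. if g \<in> SL2 then c else 0) = fscale c (mon4 0 0 0 0)" by (auto simp: fscale_apply mon4_def)
    then show ?case by (simp add: fs.span_scale mon4_mon4s)
  next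
    case (entry i j)
    have "(\<lambda>g. if g \<in> SL2 then g $ i $ j else 0) =
        (mon4 (if i = 1 \<and> j = 1 then 1 else 0) (if i = 2 \<and> j = 1 then 1 else 0)
          (if i = 1 \<and> j = 2 then 1 else 0) (if i = 2 \<and> j = 2 then 1 else 0) :: 'a mat2 \<Rightarrow> 'a)"
      using exhaust_2[of i] exhaust_2[of j] by (auto simp: mon4_def fun_eq_iff)
    then show ?case by (simp only: mon4_mon4s)
  next
    case (add p q)
    have "(\<lambda>g. if g \<in> SL2 then p g + q g else 0) =
        (\<lambda>g. if g \<in> SL2 then p g else 0) + (\<lambda>g. if g \<in> SL2 then q g else 0)" by (auto simp: pointwise)
    then show ?case using fs.span_add[OF add.IH] by simp
  next
    case (mult p q)
    have "(\<lambda>g. if g \<in> SL2 then p g * q g else 0) =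
        (\<lambda>g. if g \<in> SL2 then p g else 0) * (\<lambda>g. if g \<in> SL2 then q g else 0)" by (auto simp: pointwise)
    then show ?case using span_mon4s_mult[OF mult.IH] by simp
  qed
  then show ?thesis by (auto simp: coord_ring_def)
qed

text \<open>A basis chosen among the monomials is countable, so the coordinates of a function can be
  listed along the natural numbers.\<close>

lemma coord_ring_coordinates:
  "\<exists>\<rho> :: ('k::field mat2 \<Rightarrow> 'k) \<Rightarrow> nat \<Rightarrow> 'k. lin_on coord_ring \<rho> \<and> inj_on \<rho> coord_ring"
proof -
  obtain B :: "('k mat2 \<Rightarrow> 'k) set" where B: "B \<subseteq> mon4s" "fs.independent B" "mon4s \<subseteq> fs.span B"
    using fs.maximal_independent_subset by blast
  have cB: "countable B" by (rule countable_subset[OF B(1)]) (simp add: mon4s_def)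
  have sp: "coord_ring \<subseteq> fs.span B"
    using coord_ring_span fs.span_minimal[OF B(3) fs.subspace_span] by blast
  define \<rho> where "\<rho> f n = fs.representation B f (from_nat_into B n)" for f n
  have "lin_on coord_ring \<rho>"
    by (rule lin_onI)
       (use sp in \<open>auto simp: \<rho>_def fun_eq_iff pointwise fs.representation_add[OF B(2)] fs.representation_scale[OF B(2)] subset_iff\<close>)
  moreover have "inj_on \<rho> coord_ring"
  proof (rule inj_onI)
    fix f g assume fg: "f \<in> coord_ring" "g \<in> coord_ring" and e: "\<rho> f = \<rho> g"
    have "fs.representation B f b = fs.representation B g b" for b
    proof (cases "b \<in> B")
      case True
      then obtain n where "b = from_nat_into B n" by (metis cB from_nat_into_surj)
      then show ?thesis using fun_cong[OF e, of n] by (simp add: \<rho>_def)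
    qed (metis fs.representation_ne_zero)
    then have "fs.representation B f = fs.representation B g" by blast
    then show "f = g"
      using fs.sum_nonzero_representation_eq[OF B(2), of f] fs.sum_nonzero_representation_eq[OF B(2), of g] sp fg by auto
  qed
  ultimately show ?thesis by blast
qed

text \<open>An element of \<open>k[G] \<otimes> X\<close> has coordinates indexed by
  \<open>nat\<close> times \<open>'x\<close>. For infinite \<open>'x\<close> this index set is
  equinumerous with \<open>'x\<close>, so the universe is not left.\<close>

lemma PF1_embed:
  fixes X :: "('x::infinite \<Rightarrow> 'k::field) set"
  shows "\<exists>E :: _ \<Rightarrow> 'x \<Rightarrow> 'k. lin_on (PF 1 X) E \<and> inj_on E (PF 1 X)"
proof -
  obtain \<rho> :: "('k mat2 \<Rightarrow> 'k) \<Rightarrow> nat \<Rightarrow> 'k" where \<rho>: "lin_on coord_ring \<rho>" "inj_on \<rho> coord_ring"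
    using coord_ring_coordinates by blast
  obtain j0 where "bij_betw j0 ((UNIV :: nat set) \<times> (UNIV :: 'x set)) (UNIV :: 'x set)"
    using iffD2[OF card_of_ordIso conjunct2[OF card_of_Times_infinite[OF infinite_UNIV UNIV_not_empty
      iffD1[OF infinite_iff_card_of_nat infinite_UNIV]]]] by blast
  then have j0: "inj j0" by (simp add: bij_betw_def)
  define j where "j = inv j0"
  have j: "j (j0 p) = p" for p by (simp add: j_def inv_f_f[OF j0])
  define E :: "('k mat2 list \<times> 'x \<Rightarrow> 'k) \<Rightarrow> 'x \<Rightarrow> 'k" where
    "E F z = \<rho> (\<lambda>g. curry F [g] (snd (j z))) (fst (j z))" for F z
  have c: "(\<lambda>g. curry F [g] x) \<in> coord_ring" if "F \<in> PF 1 X" for F x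
    using PF_coord_ring[of F 0 X "[]"] that by simp
  have "lin_on (PF 1 X) E"
  proof (rule lin_onI)
    fix F G assume "F \<in> PF 1 X" "G \<in> PF 1 X"
    note cF = c[OF this(1)] and cG = c[OF this(2)]
    have "(\<lambda>g. curry (F + G) [g] x) = (\<lambda>g. curry F [g] x) + (\<lambda>g. curry G [g] x)" for x
      by (simp add: fun_eq_iff curry_conv pointwise)
    then show "E (F + G) = E F + E G"
      unfolding E_def by (intro ext) (simp add: lin_on_add[OF \<rho>(1) cF cG] plus_fun_apply)
  next
    fix a F assume "F \<in> PF 1 X"
    note cF = c[OF this]
    have "(\<lambda>g. curry (fscale a F) [g] x) = fscale a (\<lambda>g. curry F [g] x)" for x
      by (simp add: fun_eq_iff curry_conv pointwise)
    then show "E (fscale a F) = fscale a (E F)"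
      unfolding E_def by (intro ext) (simp add: lin_on_scale[OF \<rho>(1) cF] fscale_apply)
  qed
  moreover have "inj_on E (PF 1 X)"
  proof (rule inj_onI)
    fix F G assume FG: "F \<in> PF 1 X" "G \<in> PF 1 X" and e: "E F = E G"
    have "(\<lambda>g. curry F [g] x) = (\<lambda>g. curry G [g] x)" for x
    proof (rule inj_onD[OF \<rho>(2) _ c[OF FG(1)] c[OF FG(2)]], rule ext)
      fix i
      show "\<rho> (\<lambda>g. curry F [g] x) i = \<rho> (\<lambda>g. curry G [g] x) i"
        using fun_cong[OF e, of "j0 (i, x)"] by (simp add: E_def j)
    qed
    then have eq: "curry F [g] x = curry G [g] x" for g x by meson
    show "F = G"
    proof (rule PF_eqI[OF FG])
      fix l :: "'k mat2 list" assume "l \<in> tuples 1"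
      then obtain g where "l = [g]" by (auto simp: One_nat_def elim!: in_tuples_SucE)
      then show "curry F l = curry G l" using eq by blast
    qed
  qed
  ultimately show ?thesis by blast
qed

text \<open>One factor \<open>k[G]\<close> is absorbed at a time: embed the values by the previous
  stage, then apply \<open>PF1_embed\<close> to the first variable.\<close>

lemma PF_embed:
  fixes X :: "('y \<Rightarrow> 'k::field) set" and T :: "('y \<Rightarrow> 'k) \<Rightarrow> 'x::infinite \<Rightarrow> 'k"
  assumes X: "fs.subspace X" and T: "lin_on X T" "inj_on T X"
  shows "\<exists>E :: _ \<Rightarrow> 'x \<Rightarrow> 'k. lin_on (PF n X) E \<and> inj_on E (PF n X)"
proof (induction n)
  case 0
  have "lin_on (PF 0 X) (\<lambda>f. T (curry f []))"
    by (rule lin_onI) (auto simp: curry_simps lin_on_add[OF T(1)] lin_on_scale[OF T(1)] PF_in[OF _ X])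
  moreover have "inj_on (\<lambda>f. T (curry f [])) (PF 0 X)"
  proof (rule inj_onI)
    fix f g assume "f \<in> PF 0 X" "g \<in> PF 0 X" "T (curry f []) = T (curry g [])"
    then show "f = g" using inj_onD[OF T(2)] PF_in[OF _ X] by (intro PF_eqI[of f 0 X g X]) auto
  qed
  ultimately show ?case by blast
next
  case (Suc n)
  then obtain E :: "_ \<Rightarrow> 'x \<Rightarrow> 'k" where E: "lin_on (PF n X) E" "inj_on E (PF n X)" by blast
  obtain E1 :: "_ \<Rightarrow> 'x \<Rightarrow> 'k" where E1: "lin_on (PF 1 (E ` PF n X)) E1" "inj_on E1 (PF 1 (E ` PF n X))"
    using PF1_embed by blast
  have s: "pw E (split1 n f) \<in> PF 1 (E ` PF n X)" if "f \<in> PF (Suc n) X" for f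
    by (rule PF_pw[OF split1_PF[OF that] E(1) PF_subspace]) simp
  have "lin_on (PF (Suc n) X) (\<lambda>f. E1 (pw E (split1 n f)))"
  proof (rule lin_onI)
    fix f g assume fg: "f \<in> PF (Suc n) X" "g \<in> PF (Suc n) X"
    have "split1 n (f + g) = split1 n f + split1 n g" by (simp add: split1_def curry_simps cut_add)
    then show "E1 (pw E (split1 n (f + g))) = E1 (pw E (split1 n f)) + E1 (pw E (split1 n g))"
      using lin_on_add[OF E1(1) s s, OF fg] pw_add[OF split1_PF split1_PF E(1) PF_subspace, OF fg] by simp
  next
    fix c f assume f: "f \<in> PF (Suc n) X"
    have "split1 n (fscale c f) = fscale c (split1 n f)" by (simp add: split1_def curry_simps cut_scale)
    then show "E1 (pw E (split1 n (fscale c f))) = fscale c (E1 (pw E (split1 n f)))"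
      using lin_on_scale[OF E1(1) s, OF f] pw_scale[OF split1_PF E(1) PF_subspace, OF f] by simp
  qed
  moreover have "inj_on (\<lambda>f. E1 (pw E (split1 n f))) (PF (Suc n) X)"
  proof (rule inj_onI)
    fix f g assume fg: "f \<in> PF (Suc n) X" "g \<in> PF (Suc n) X"
      and "E1 (pw E (split1 n f)) = E1 (pw E (split1 n g))"
    then have e: "pw E (split1 n f) = pw E (split1 n g)" using inj_onD[OF E1(2)] s by blast
    show "f = g"
    proof (rule PF_eqI[OF fg])
      fix l :: "'k mat2 list" assume "l \<in> tuples (Suc n)"
      then obtain x l' where l: "l = x # l'" "x \<in> SL2" "l' \<in> tuples n" by (auto elim!: in_tuples_SucE)
      have "E (curry (split1 n f) [x]) = E (curry (split1 n g) [x])" using e by (metis curry_pw)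
      then have "curry (split1 n f) [x] = curry (split1 n g) [x]"
        by (rule inj_onD[OF E(2)]) (auto intro: PF_in[OF split1_PF[OF fg(1)]] PF_in[OF split1_PF[OF fg(2)]])
      then have "curry (curry (split1 n f) [x]) l' = curry (curry (split1 n g) [x]) l'" by simp
      then show "curry f l = curry g l" using l by (simp add: split1_def curry_cut)
    qed
  qed
  ultimately show ?case by blast
qed

lemma to_Weyl_image: "to_Weyl m ` carrier (weyl_module m) = (carrier (Weyl m) :: (nat \<Rightarrow> 'k::alg_closed_field) set)"
proof (intro subset_antisym image_subsetI subsetI)
  fix v :: "nat \<Rightarrow> 'k" assume v: "v \<in> carrier (Weyl m)"
  have "to_Weyl m (of_Weyl m v) \<in> to_Weyl m ` carrier (weyl_module m)" by (rule imageI[OF of_Weyl_in])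
  then show "v \<in> to_Weyl m ` carrier (weyl_module m)" unfolding to_of_Weyl[OF v] .
qed (rule ghom_in[OF ghom_to_Weyl])

lemma of_Weyl_image:
  "of_Weyl m ` carrier (Weyl m) = carrier (weyl_module m :: ('k::alg_closed_field, 'k mat2 \<Rightarrow> 'k) gmod)"
proof (intro subset_antisym image_subsetI subsetI)
  fix x :: "('k mat2 \<Rightarrow> 'k) \<Rightarrow> 'k" assume x: "x \<in> carrier (weyl_module m)"
  have "of_Weyl m (to_Weyl m x) \<in> of_Weyl m ` carrier (Weyl m)" by (rule imageI[OF ghom_in[OF ghom_to_Weyl x]])
  then show "x \<in> of_Weyl m ` carrier (Weyl m)" unfolding of_to_Weyl[OF x] .
qed (rule of_Weyl_in)

section \<open>Transport of modules and resolutions into the universe \<open>'x\<close>\<close>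

definition transp :: "(('y \<Rightarrow> 'k::field) \<Rightarrow> 'x \<Rightarrow> 'k) \<Rightarrow> ('k, 'y) gmod \<Rightarrow> ('k, 'x) gmod" where
  "transp T M = \<lparr>carrier = T ` carrier M, act = (\<lambda>g v. T (act M g (the_inv_into (carrier M) T v)))\<rparr>"

context
  fixes T :: "('y \<Rightarrow> 'k::field) \<Rightarrow> 'x \<Rightarrow> 'k" and M :: "('k, 'y) gmod"
  assumes M: "rational_module M" and T: "lin_on (carrier M) T" "inj_on T (carrier M)"
begin

lemma carrier_transp: "carrier (transp T M) = T ` carrier M"
  by (simp add: transp_def)

lemma act_transp: "v \<in> carrier M \<Longrightarrow> act (transp T M) g (T v) = T (act M g v)"
  by (simp add: transp_def the_inv_into_f_f[OF T(2)])

lemma ghom_transp: "ghom M (transp T M) T"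
  by (rule ghomI[OF T(1)]) (simp_all add: carrier_transp act_transp)

lemma ghom_transp_inv: "ghom (transp T M) M (the_inv_into (carrier M) T)"
proof (rule ghomI)
  show "lin_on (carrier (transp T M)) (the_inv_into (carrier M) T)"
    unfolding carrier_transp by (rule lin_on_the_inv[OF T(1) rm_sub[OF M] T(2)])
qed (auto simp: carrier_transp act_transp the_inv_into_f_f[OF T(2)] rm_act[OF M])

lemma rational_transp: "rational_module (transp T M)"
proof (rule rational_moduleI, unfold carrier_transp)
  show "fs.subspace (T ` carrier M)" by (rule lin_on_subspace_image[OF T(1) rm_sub[OF M]])
  show "lin_on (T ` carrier M) (act (transp T M) g)" if g: "g \<in> SL2" for g
  proof -
    have "lin_on (T ` carrier M) (\<lambda>v. act M g (the_inv_into (carrier M) T v))"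
      by (rule lin_on_comp[OF lin_on_the_inv[OF T(1) rm_sub[OF M] T(2)] rm_lin[OF M g]])
         (auto simp: the_inv_into_f_f[OF T(2)])
    moreover have "(\<lambda>v. act M g (the_inv_into (carrier M) T v)) ` T ` carrier M \<subseteq> carrier M"
      using g by (auto simp: the_inv_into_f_f[OF T(2)] rm_act[OF M])
    ultimately show ?thesis
      using lin_on_comp[OF _ T(1)] by (simp add: transp_def)
  qed
  show "orb (transp T M) v \<in> PF 1 (T ` carrier M)" if v: "v \<in> T ` carrier M" for v
  proof -
    obtain u where u: "v = T u" "u \<in> carrier M" using v by blast
    have "orb (transp T M) v = pw T (orb M u)"
    proof (rule curry_eqI)
      fix l show "curry (orb (transp T M) v) l = curry (pw T (orb M u)) l"
        using lin_on_zero[OF T(1) rm_sub[OF M]] u by (simp add: orb_def curry_cut act_transp)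
    qed
    then show ?thesis using PF_pw[OF rm_orb[OF M u(2)] T(1) rm_sub[OF M] order.refl] by simp
  qed
qed (auto simp: act_transp rm_act[OF M] rm_one[OF M] rm_mult[OF M])

end

text \<open>Supplies the value zero off the carrier, which is what separates \<open>HomG\<close>
  from \<open>ghom\<close>.\<close>

definition restrict0 :: "('k::field, 'x) gmod \<Rightarrow> (('x \<Rightarrow> 'k) \<Rightarrow> 'y \<Rightarrow> 'k) \<Rightarrow> ('x \<Rightarrow> 'k) \<Rightarrow> 'y \<Rightarrow> 'k" where
  "restrict0 M f v = (if v \<in> carrier M then f v else 0)"

lemma restrict0_HomG:
  assumes f: "ghom M N f" and M: "fs.subspace (carrier M)" "\<And>g v. g \<in> SL2 \<Longrightarrow> v \<in> carrier M \<Longrightarrow> act M g v \<in> carrier M"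
  shows "restrict0 M f \<in> HomG M N"
  unfolding HomG_def restrict0_def
  using ghom_in[OF f] ghom_act[OF f] lin_on_add[OF ghom_lin[OF f]] lin_on_scale[OF ghom_lin[OF f]] M
  by (auto simp: fs.subspace_add fs.subspace_scale)

lemma injective_transp_Std:
  fixes T :: "_ \<Rightarrow> 'x \<Rightarrow> 'k::field"
  assumes M: "rational_module M"
    and T: "lin_on (carrier (Std n M)) T" "inj_on T (carrier (Std n M))"
  shows "injective_module (transp T (Std n M))"
  unfolding injective_module_def
proof (intro conjI allI impI)
  note S = rational_Std[OF M, of n]
  show "rational_module (transp T (Std n M))" by (rule rational_transp[OF S T])
  fix A B :: "('k, 'x) gmod" and i f
  assume A: "rational_module A" and B: "rational_module B" and i: "i \<in> HomG A B" "inj_on i (carrier A)"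
    and f: "f \<in> HomG A (transp T (Std n M))"
  let ?j = "the_inv_into (carrier (Std n M)) T"
  have "ghom A (Std n M) (\<lambda>a. ?j (f a))"
    by (rule ghom_comp[OF HomG_ghom[OF f] ghom_transp_inv[OF S T]])
  from Std_extend[OF A B M HomG_ghom[OF i(1)] i(2) this]
  obtain h where h: "ghom B (Std n M) h" "\<And>a. a \<in> carrier A \<Longrightarrow> h (i a) = ?j (f a)" by blast
  have "restrict0 B (\<lambda>b. T (h b)) \<in> HomG B (transp T (Std n M))"
    by (intro restrict0_HomG ghom_comp[OF h(1) ghom_transp[OF S T]] rm_sub[OF B] rm_act[OF B])
  moreover have "restrict0 B (\<lambda>b. T (h b)) (i a) = f a" if a: "a \<in> carrier A" for a
  proof -
    have "f a \<in> T ` carrier (Std n M)"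
      using ghom_in[OF HomG_ghom[OF f] a] by (simp add: carrier_transp[OF S T])
    then show ?thesis
      using ghom_in[OF HomG_ghom[OF i(1)] a] f_the_inv_into_f[OF T(2)] h(2)[OF a] by (simp add: restrict0_def)
  qed
  ultimately show "\<exists>p\<in>HomG B (transp T (Std n M)). \<forall>a\<in>carrier A. p (i a) = f a" by blast
qed

text \<open>The coordinate ring has countable dimension, so functions with values in \<open>I\<close> still embed
  in \<open>'x \<Rightarrow> 'k\<close> and injectivity splits \<open>I \<rightarrow> k[G] \<otimes> I\<close>.\<close>

lemma injective_rel_inj:
  fixes I :: "('k::field, 'x::infinite) gmod"
  assumes "injective_module I" shows "rel_inj I"
proof -
  have I: "rational_module I" using assms by (simp add: injective_module_def)
  note S = rational_Std[OF I, of 0]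
  obtain T :: "_ \<Rightarrow> 'x \<Rightarrow> 'k" where "lin_on (PF 1 (carrier I)) T" "inj_on T (PF 1 (carrier I))"
    using PF1_embed by blast
  then have T: "lin_on (carrier (Std 0 I)) T" "inj_on T (carrier (Std 0 I))" by (simp_all add: carrier_Std)
  note B = rational_transp[OF S T]
  let ?i = "\<lambda>v. T (cst v)"
  have gi: "ghom I (transp T (Std 0 I)) ?i" by (rule ghom_comp[OF ghom_cst[OF I] ghom_transp[OF S T]])
  have i: "restrict0 I ?i \<in> HomG I (transp T (Std 0 I))"
    by (intro restrict0_HomG gi rm_sub[OF I] rm_act[OF I])
  have cin: "cst v \<in> carrier (Std 0 I)" if "v \<in> carrier I" for v by (rule ghom_in[OF ghom_cst[OF I] that])
  have ii: "inj_on (restrict0 I ?i) (carrier I)"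
  proof (rule inj_onI)
    fix v w assume vw: "v \<in> carrier I" "w \<in> carrier I" and "restrict0 I ?i v = restrict0 I ?i w"
    then have "cst v = cst w" using inj_onD[OF T(2)] cin by (simp add: restrict0_def)
    then show "v = w" by (metis eval_cst)
  qed
  have "ghom I I (\<lambda>v. v)" by (rule ghomI) (simp_all add: lin_on_def)
  then have id: "restrict0 I (\<lambda>v. v) \<in> HomG I I" by (intro restrict0_HomG rm_sub[OF I] rm_act[OF I])
  obtain p where p: "p \<in> HomG (transp T (Std 0 I)) I"
    "\<forall>a\<in>carrier I. p (restrict0 I ?i a) = restrict0 I (\<lambda>v. v) a"
    using assms I B i ii id unfolding injective_module_def by blast
  have "ghom (Std 0 I) I (\<lambda>v. p (T v))" by (rule ghom_comp[OF ghom_transp[OF S T] HomG_ghom[OF p(1)]])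
  moreover have "\<forall>v\<in>carrier I. p (T (cst v)) = v" using p(2) by (simp add: restrict0_def)
  ultimately show ?thesis using I by (auto simp: rel_inj_def)
qed

lemma resolution_transp:
  assumes "resolution N e J \<delta>"
    and T: "\<And>i. lin_on (carrier (J i)) (T i)" "\<And>i. inj_on (T i) (carrier (J i))"
  shows "resolution N (\<lambda>v. T 0 (e v)) (\<lambda>i. transp (T i) (J i))
    (\<lambda>i v. T (Suc i) (\<delta> i (the_inv_into (carrier (J i)) (T i) v)))"
proof -
  interpret resolution N e J \<delta> by (rule assms)
  have inv: "the_inv_into (carrier (J i)) (T i) (T i v) = v" if "v \<in> carrier (J i)" for i v
    by (rule the_inv_into_f_f[OF T(2) that])
  note ct = carrier_transp[OF J T]
  have ein: "e v \<in> carrier (J 0)" if "v \<in> carrier N" for v by (rule ghom_in[OF e that])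
  have din: "\<delta> i v \<in> carrier (J (Suc i))" if "v \<in> carrier (J i)" for i v by (rule ghom_in[OF \<delta> that])
  have T0: "T i v = 0 \<longleftrightarrow> v = 0" if "v \<in> carrier (J i)" for i v
    using inj_onD[OF T(2)[of i] _ that fs.subspace_0[OF rm_sub[OF J]]] lin_on_zero[OF T(1)[of i] rm_sub[OF J]] by auto
  have ker: "{v \<in> T i ` carrier (J i). T (Suc i) (\<delta> i (the_inv_into (carrier (J i)) (T i) v)) = 0} =
      T i ` {v \<in> carrier (J i). \<delta> i v = 0}" for i
    by (auto simp: inv T0 din lin_on_zero[OF T(1) rm_sub[OF J]])
  show ?thesis
  proof
    show "rational_module N" by (rule N)
    show "rational_module (transp (T i) (J i))" for i by (rule rational_transp[OF J T])
    show "ghom N (transp (T 0) (J 0)) (\<lambda>v. T 0 (e v))" by (rule ghom_comp[OF e ghom_transp[OF J T]])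
    show "ghom (transp (T i) (J i)) (transp (T (Suc i)) (J (Suc i)))
        (\<lambda>v. T (Suc i) (\<delta> i (the_inv_into (carrier (J i)) (T i) v)))" for i
      by (rule ghom_comp[OF ghom_comp[OF ghom_transp_inv[OF J T] \<delta>] ghom_transp[OF J T]])
    show "inj_on (\<lambda>v. T 0 (e v)) (carrier N)"
      by (rule inj_onI) (metis ein inj inj_onD T(2))
    show "(\<lambda>v. T 0 (e v)) ` carrier N =
        {v \<in> carrier (transp (T 0) (J 0)). T (Suc 0) (\<delta> 0 (the_inv_into (carrier (J 0)) (T 0) v)) = 0}"
      unfolding ct ker exact0[symmetric] by (simp add: image_image)
    show "(\<lambda>v. T (Suc i) (\<delta> i (the_inv_into (carrier (J i)) (T i) v))) ` carrier (transp (T i) (J i)) =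
        {v \<in> carrier (transp (T (Suc i)) (J (Suc i))).
          T (Suc (Suc i)) (\<delta> (Suc i) (the_inv_into (carrier (J (Suc i))) (T (Suc i)) v)) = 0}" for i
      unfolding ct ker exact[symmetric] by (simp add: image_image inv cong: image_cong)
  qed
qed

text \<open>Guarantees that the choice in \<open>Ext_dim\<close> meets its specification. The
  standard resolution of \<open>Weyl m\<close> is moved term by term into
  \<open>'x \<Rightarrow> 'k\<close>, where \<open>Std_extend\<close> makes it injective.\<close>

lemma injective_resolution_exists:
  "\<exists>(I :: nat \<Rightarrow> ('k::alg_closed_field, 'x::infinite) gmod) d \<epsilon>.
    injective_resolution (weyl_module m :: ('k, 'k mat2 \<Rightarrow> 'k) gmod) \<epsilon> I d"
proof -
  let ?W = "Weyl m :: ('k, nat) gmod" and ?V = "weyl_module m :: ('k, 'k mat2 \<Rightarrow> 'k) gmod"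
  note W = rational_Weyl[of m, where 'k = 'k]
  obtain j0 :: "nat \<Rightarrow> 'x" where j0: "inj j0" using infinite_countable_subset[OF infinite_UNIV] by auto
  define S :: "(nat \<Rightarrow> 'k) \<Rightarrow> 'x \<Rightarrow> 'k" where "S v x = (if x \<in> range j0 then v (inv j0 x) else 0)" for v x
  have S: "lin_on (carrier ?W) S" "inj_on S (carrier ?W)"
  proof -
    show "lin_on (carrier ?W) S" by (rule lin_onI) (auto simp: S_def fun_eq_iff pointwise)
    show "inj_on S (carrier ?W)"
    proof (rule inj_onI, rule ext)
      fix v w i assume "S v = S w"
      from fun_cong[OF this, of "j0 i"] show "v i = w i" by (simp add: S_def inv_f_f[OF j0])
    qed
  qed
  have "\<forall>n. \<exists>E :: _ \<Rightarrow> 'x \<Rightarrow> 'k. lin_on (PF (Suc n) (carrier ?W)) E \<and> inj_on E (PF (Suc n) (carrier ?W))"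
    using PF_embed[OF rm_sub[OF W] S] by blast
  then obtain T :: "nat \<Rightarrow> _ \<Rightarrow> 'x \<Rightarrow> 'k" where
    "\<And>n. lin_on (PF (Suc n) (carrier ?W)) (T n)" "\<And>n. inj_on (T n) (PF (Suc n) (carrier ?W))"
    by metis
  then have T: "lin_on (carrier (Std n ?W)) (T n)" "inj_on (T n) (carrier (Std n ?W))" for n
    by (simp_all add: carrier_Std)
  define I where "I n = transp (T n) (Std n ?W)" for n
  define e where "e v = T 0 (cst v)" for v
  define \<delta> where "\<delta> n v = T (Suc n) (dd n (the_inv_into (carrier (Std n ?W)) (T n) v))" for n v
  interpret R: resolution ?W e I \<delta>
    using resolution_transp[OF resolution_Std[OF W] T]
    unfolding I_def[abs_def] e_def[abs_def] \<delta>_def[abs_def] .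
  have c: "restrict0 (I i) (\<delta> i) v = \<delta> i v" if "v \<in> carrier (I i)" for i v using that by (simp add: restrict0_def)
  have Vsub: "fs.subspace (carrier ?V)"
    unfolding of_Weyl_image[symmetric]
    by (rule lin_on_subspace_image[OF ghom_lin[OF ghom_of_Weyl] rm_sub[OF W]])
  have "injective_resolution ?V (restrict0 ?V (\<lambda>v. e (to_Weyl m v))) I (\<lambda>i. restrict0 (I i) (\<delta> i))"
    unfolding injective_resolution_def
  proof (intro conjI allI)
    show "injective_module (I i)" for i unfolding I_def by (rule injective_transp_Std[OF W T])
    show "restrict0 ?V (\<lambda>v. e (to_Weyl m v)) \<in> HomG ?V (I 0)"
      by (intro restrict0_HomG ghom_comp[OF ghom_to_Weyl R.e] Vsub act_weyl_module_in)
    show "restrict0 (I i) (\<delta> i) \<in> HomG (I i) (I (Suc i))" for i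
      by (intro restrict0_HomG R.\<delta> rm_sub[OF R.J] rm_act[OF R.J])
    show "inj_on (restrict0 ?V (\<lambda>v. e (to_Weyl m v))) (carrier ?V)"
    proof (rule inj_onI)
      fix v w assume vw: "v \<in> carrier ?V" "w \<in> carrier ?V"
        "restrict0 ?V (\<lambda>v. e (to_Weyl m v)) v = restrict0 ?V (\<lambda>v. e (to_Weyl m v)) w"
      then have "e (to_Weyl m v) = e (to_Weyl m w)" by (simp add: restrict0_def)
      then have "to_Weyl m v = to_Weyl m w"
        by (rule inj_onD[OF R.inj _ ghom_in[OF ghom_to_Weyl vw(1)] ghom_in[OF ghom_to_Weyl vw(2)]])
      from arg_cong[OF this, of "of_Weyl m"] show "v = w" by (simp only: of_to_Weyl vw(1,2))
    qed
    have "restrict0 ?V (\<lambda>v. e (to_Weyl m v)) ` carrier ?V = e ` to_Weyl m ` carrier ?V"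
      by (simp add: restrict0_def image_image cong: image_cong)
    then show "restrict0 ?V (\<lambda>v. e (to_Weyl m v)) ` carrier ?V = {v \<in> carrier (I 0). restrict0 (I 0) (\<delta> 0) v = 0}"
      unfolding to_Weyl_image R.exact0 using c by auto
    have "restrict0 (I i) (\<delta> i) ` carrier (I i) = \<delta> i ` carrier (I i)" for i
      using c by (rule image_cong[OF refl])
    then show "restrict0 (I i) (\<delta> i) ` carrier (I i) =
        {v \<in> carrier (I (Suc i)). restrict0 (I (Suc i)) (\<delta> (Suc i)) v = 0}" for i
      unfolding R.exact using c by auto
  qed
  then show ?thesis by blast
qed

text \<open>Injectivity within the universe already yields relative injectivity and hence
  acyclicity, so the given resolution may be any one.\<close>

lemma injective_resolution_Weyl:
  fixes I :: "nat \<Rightarrow> ('k::alg_closed_field, 'x::infinite) gmod"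
  assumes r: "injective_resolution (weyl_module m :: ('k, 'k mat2 \<Rightarrow> 'k) gmod) \<epsilon> I d"
  shows "acyclic_resolution (Weyl m) (\<lambda>v. \<epsilon> (of_Weyl m v)) I d"
proof -
  let ?W = "Weyl m :: ('k, nat) gmod" and ?V = "weyl_module m :: ('k, 'k mat2 \<Rightarrow> 'k) gmod"
  have I: "rel_inj (I i)" for i
    using r by (auto simp: injective_resolution_def intro: injective_rel_inj)
  show ?thesis
  proof
    show "rational_module ?W" by (rule rational_Weyl)
    show "rational_module (I i)" for i using I by (simp add: rel_inj_def)
    show "acyclic (I i)" for i by (rule rel_inj_acyclic[OF I])
    show "ghom ?W (I 0) (\<lambda>v. \<epsilon> (of_Weyl m v))"
      using r by (intro ghom_comp[OF ghom_of_Weyl] HomG_ghom) (simp add: injective_resolution_def)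
    show "ghom (I i) (I (Suc i)) (d i)" for i
      using r by (intro HomG_ghom) (simp add: injective_resolution_def)
    show "inj_on (\<lambda>v. \<epsilon> (of_Weyl m v)) (carrier ?W)"
    proof (rule inj_onI)
      fix v w assume vw: "v \<in> carrier ?W" "w \<in> carrier ?W" "\<epsilon> (of_Weyl m v) = \<epsilon> (of_Weyl m w)"
      have "inj_on \<epsilon> (carrier ?V)" using r by (simp add: injective_resolution_def)
      then have "of_Weyl m v = (of_Weyl m w :: ('k mat2 \<Rightarrow> 'k) \<Rightarrow> 'k)"
        by (rule inj_onD[OF _ vw(3) of_Weyl_in of_Weyl_in])
      from arg_cong[OF this, of "to_Weyl m"] show "v = w" by (simp only: to_of_Weyl vw(1,2))
    qed
    have "(\<lambda>v. \<epsilon> (of_Weyl m v)) ` carrier ?W = \<epsilon> ` carrier ?V" unfolding of_Weyl_image[symmetric] image_image ..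
    then show "(\<lambda>v. \<epsilon> (of_Weyl m v)) ` carrier ?W = {v \<in> carrier (I 0). d 0 v = 0}"
      using r by (simp add: injective_resolution_def)
    show "d i ` carrier (I i) = {v \<in> carrier (I (Suc i)). d (Suc i) v = 0}" for i
      using r by (simp add: injective_resolution_def)
  qed
qed

section \<open>Cohomology from injective resolutions\<close>

lemma sum_fun_apply: "(\<Sum>i\<in>A. f i) x = (\<Sum>i\<in>A. f i x)" for f :: "'i \<Rightarrow> 'a \<Rightarrow> 'b::comm_monoid_add"
  by (induction A rule: infinite_finite_induct) (simp_all add: pointwise)

text \<open>Evaluation at \<open>1\<close> identifies homomorphisms from the trivial module with
  invariants.\<close>

lemma fixed_trivial:
  "\<phi> \<in> HomG trivial_module M \<Longrightarrow> \<phi> w = fscale (w ()) (\<phi> 1)"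
  "\<phi> \<in> HomG trivial_module M \<Longrightarrow> \<phi> 1 \<in> fixed M"
proof -
  assume \<phi>: "\<phi> \<in> HomG trivial_module M"
  have "w = fscale (w ()) 1" by (rule ext) (simp add: pointwise)
  moreover have "\<phi> (fscale (w ()) 1) = fscale (w ()) (\<phi> 1)" using \<phi> by (simp add: HomG_def trivial_module_def)
  ultimately show "\<phi> w = fscale (w ()) (\<phi> 1)" by simp
  have "\<forall>g\<in>SL2. \<phi> 1 = act M g (\<phi> 1)" "\<phi> 1 \<in> carrier M"
    using \<phi> by (simp_all add: HomG_def trivial_module_def)
  then show "\<phi> 1 \<in> fixed M" by (simp add: fixed_def)
qed

lemma HomG_trivial:
  assumes M: "rational_module M" and u: "u \<in> fixed M"
  shows "(\<lambda>w. fscale (w ()) u) \<in> HomG trivial_module M"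
  using u lin_on_scale[OF rm_lin[OF M]] rm_sub[OF M]
  by (auto simp: HomG_def trivial_module_def fixed_def fs.subspace_scale pointwise fs.scale_left_distrib)

text \<open>Evaluation at \<open>1\<close> sends a set of cocycles independent modulo coboundaries
  to a family of invariants independent modulo \<open>?B\<close>, because a primitive of a relation
  between the values defines a primitive homomorphism.\<close>

lemma (in acyclic_resolution) quot_dim_le:
  assumes c: "coh_le (Suc n) N c"
  shows "quot_dim hom_scale (Ext_cocycles trivial_module J \<delta> (Suc n)) (Ext_coboundaries trivial_module J \<delta> (Suc n)) \<le> enat c"
  unfolding quot_dim_def
proof (rule SUP_least, clarify)
  fix S assume S: "finite S" "S \<subseteq> Ext_cocycles trivial_module J \<delta> (Suc n)"
    and ind: "\<forall>a. (\<Sum>v\<in>S. hom_scale (a v) v) \<in> Ext_coboundaries trivial_module J \<delta> (Suc n) \<longrightarrow> (\<forall>v\<in>S. a v = 0)"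
  let ?Z = "{v \<in> fixed (J (Suc n)). \<delta> (Suc n) v = 0}" and ?B = "\<delta> n ` fixed (J n)"
  have fl: "lin_on (fixed (J i)) (\<delta> i)" for i
    by (rule lin_on_mono[OF ghom_lin[OF \<delta>]]) (auto simp: fixed_def)
  have "card S \<le> c"
  proof (rule qle_card_bound[where v = "\<lambda>\<phi>. \<phi> 1"])
    show "qle ?Z ?B c" using c by (simp add: coh_le_iff)
    show "fs.subspace ?B" by (rule lin_on_subspace_image[OF fl fixed_subspace[OF J]])
    show "fs.subspace ?Z"
      using lin_on_subspace_vimage[OF fl fixed_subspace[OF J] fs.subspace_single_0, of "Suc n"] by simp
    show "finite S" by (rule S)
    show "\<phi> 1 \<in> ?Z" if "\<phi> \<in> S" for \<phi>
    proof -
      have \<phi>: "\<phi> \<in> HomG trivial_module (J (Suc n))" "\<delta> (Suc n) \<circ> \<phi> = 0"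
        using S(2) that by (auto simp: Ext_cocycles_def)
      show ?thesis using fixed_trivial(2)[OF \<phi>(1)] fun_cong[OF \<phi>(2), of 1] by (simp add: zero_fun_apply)
    qed
    fix a assume "(\<Sum>\<phi>\<in>S. fscale (a \<phi>) (\<phi> 1)) \<in> ?B"
    then obtain u where u: "u \<in> fixed (J n)" "(\<Sum>\<phi>\<in>S. fscale (a \<phi>) (\<phi> 1)) = \<delta> n u" by blast
    have "(\<Sum>\<phi>\<in>S. hom_scale (a \<phi>) \<phi>) w = (\<delta> n \<circ> (\<lambda>w. fscale (w ()) u)) w" for w
    proof -
      have "(\<Sum>\<phi>\<in>S. hom_scale (a \<phi>) \<phi>) w = (\<Sum>\<phi>\<in>S. fscale (w ()) (fscale (a \<phi>) (\<phi> 1)))"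
      proof (subst sum_fun_apply, rule sum.cong)
        fix \<phi> assume "\<phi> \<in> S"
        then have "\<phi> w = fscale (w ()) (\<phi> 1)" using S(2) by (intro fixed_trivial(1)) (auto simp: Ext_cocycles_def)
        then show "hom_scale (a \<phi>) \<phi> w = fscale (w ()) (fscale (a \<phi>) (\<phi> 1))"
          by (simp add: hom_scale_def mult.commute)
      qed simp
      also have "\<dots> = fscale (w ()) (\<delta> n u)" unfolding u(2)[symmetric] by (simp add: fs.scale_sum_right)
      also have "\<dots> = \<delta> n (fscale (w ()) u)" by (rule lin_on_scale[OF fl u(1), symmetric])
      finally show ?thesis by simp
    qed
    then have "(\<Sum>\<phi>\<in>S. hom_scale (a \<phi>) \<phi>) = \<delta> n \<circ> (\<lambda>w. fscale (w ()) u)" by (rule ext)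
    also have "\<dots> \<in> Ext_coboundaries trivial_module J \<delta> (Suc n)"
      using HomG_trivial[OF J u(1)] by auto
    finally show "\<forall>\<phi>\<in>S. a \<phi> = 0" using ind by blast
  qed
  then show "enat (card S) \<le> enat c" by simp
qed

lemma H_dim_le:
  assumes "coh_le (Suc n) (Weyl m :: ('k::alg_closed_field, nat) gmod) c"
  shows "H_dim TYPE('x::infinite) (Suc n) (weyl_module m :: ('k, 'k mat2 \<Rightarrow> 'k) gmod) \<le> enat c"
proof -
  let ?P = "\<lambda>(I :: nat \<Rightarrow> ('k, 'x) gmod, d). \<exists>\<epsilon>. injective_resolution (weyl_module m :: ('k, 'k mat2 \<Rightarrow> 'k) gmod) \<epsilon> I d"
  obtain I d where Id: "(SOME p. ?P p) = (I, d)" by (cases "SOME p. ?P p")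
  have "\<exists>p. ?P p" using injective_resolution_exists[of m] by auto
  from someI_ex[OF this] obtain \<epsilon> where "injective_resolution (weyl_module m :: ('k, 'k mat2 \<Rightarrow> 'k) gmod) \<epsilon> I d"
    unfolding Id by auto
  from acyclic_resolution.quot_dim_le[OF injective_resolution_Weyl[OF this] assms]
  show ?thesis unfolding H_dim_def Ext_dim_def Id by simp
qed

text \<open>A crude estimate: the exponent is at least one, and
  \<open>1 + x \<le> exp x\<close>.\<close>

lemma four_le_exp: "4 \<le> 2 * exp (2 * pi / sqrt 3)"
proof -
  have "sqrt 3 \<le> 2" by (rule real_le_lsqrt) simp_all
  then have "1 \<le> 2 * pi / sqrt 3" using pi_gt3 by (simp add: field_simps)
  then have "2 \<le> exp (2 * pi / sqrt 3)" using exp_ge_add_one_self[of "2 * pi / sqrt 3"] by linarith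
  then show ?thesis by simp
qed

theorem theorem4p5:
  fixes n m :: nat
  assumes "CHAR('k::alg_closed_field) = 2"
    and "n \<ge> 1"
  shows "ereal_of_enat (H_dim TYPE('x::infinite) n (weyl_module m :: ('k, 'k mat2 \<Rightarrow> 'k) gmod))
           \<le> ereal (exp (2 * pi * (real n + 1) / sqrt 3) * 2 ^ (n + 1)) \<and>
         exp (2 * pi * (real n + 1) / sqrt 3) * 2 ^ (n + 1)
           = C_const (int n + 1) / ((real n + 1) * 2 ^ (n + 1))"
proof
  interpret sl2_char2 "TYPE('k)" by unfold_locales (rule assms(1))
  have e: "exp (2 * pi * (real n + 1) / sqrt 3) = exp (2 * pi / sqrt 3) ^ (n + 1)"
    unfolding exp_of_nat_mult[symmetric] by (rule arg_cong[where f = exp]) simp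
  obtain k where k: "n = Suc k" using assms(2) by (cases n) auto
  have "H_dim TYPE('x) n (weyl_module m :: ('k, 'k mat2 \<Rightarrow> 'k) gmod) \<le> enat (4 ^ (n + 1))"
    unfolding k by (rule H_dim_le[OF coh_Weyl_le])
  then have "ereal_of_enat (H_dim TYPE('x) n (weyl_module m :: ('k, 'k mat2 \<Rightarrow> 'k) gmod)) \<le> ereal_of_enat (enat (4 ^ (n + 1)))"
    by (simp only: ereal_of_enat_le_iff)
  also have "\<dots> = ereal (4 ^ (n + 1))" by simp
  also have "\<dots> \<le> ereal ((2 * exp (2 * pi / sqrt 3)) ^ (n + 1))"
    unfolding ereal_less_eq(3) by (rule power_mono[OF four_le_exp]) simp
  also have "(2 * exp (2 * pi / sqrt 3)) ^ (n + 1) = exp (2 * pi * (real n + 1) / sqrt 3) * 2 ^ (n + 1)"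
    unfolding e by (simp add: power_mult_distrib mult.commute)
  finally show "ereal_of_enat (H_dim TYPE('x) n (weyl_module m :: ('k, 'k mat2 \<Rightarrow> 'k) gmod))
      \<le> ereal (exp (2 * pi * (real n + 1) / sqrt 3) * 2 ^ (n + 1))" .
  have "(4::real) powi (int n + 1) = 4 ^ (n + 1)" by (metis Suc_eq_plus1 of_nat_Suc power_int_of_nat add.commute)
  also have "\<dots> = 2 ^ (n + 1) * 2 ^ (n + 1)" by (simp flip: power_mult_distrib)
  finally have C: "C_const (int n + 1) = (real n + 1) * (2 ^ (n + 1) * 2 ^ (n + 1)) * exp (2 * pi * (real n + 1) / sqrt 3)"
    by (simp add: C_const_def)
  \<comment> \<open>Applied with \<open>a = n + 1\<close> and \<open>b = 2^(n+1)\<close>, so that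
    \<open>b * b\<close> is the factor \<open>4^(n+1)\<close> of the constant.\<close>
  have "E * b = a * (b * b) * E / (a * b)" if "a \<noteq> 0" "b \<noteq> 0" for a b E :: real
    using that by simp
  then show "exp (2 * pi * (real n + 1) / sqrt 3) * 2 ^ (n + 1) = C_const (int n + 1) / ((real n + 1) * 2 ^ (n + 1))"
    unfolding C by simp
qed

end
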